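(* Let $R$ be a commutative Noetherian ring and let $X \in D(R)$ be a finite chain complex. Then for every integer $k$, the chain complex $\Sigma^k H_k X$ is $X$-cellular.
   Context: $D(R)$ is the (unbounded) derived category of $R$-modules with its triangulated structure and suspension functor $\Sigma$; homological grading is used, so $H_i(\Sigma X)=H_{i-1}(X)$. An $R$-module is regarded as a chain complex concentrated in degree $0$. A chain complex $X$ is finite if the $R$-module $\bigoplus_{i\in\mathbf{Z}} H_i X$ is finitely generated. A non-empty class $\mathcal{C}$ of objects of $D(R)$ is cellular if it is closed under arbitrary direct sums and under cones: for every exact triangle $X\to Y\to Z\to \Sigma X$ with $X,Y\in\mathcal{C}$, also $Z\in\mathcal{C}$. $\mathcal{C}(X)$ denotes the smallest cellular class containing $X$; a complex $Y$ is called $X$-cellular, written $Y\gg X$, if $Y\in\mathcal{C}(X)$. *)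

theory Defs
  imports "HOL-Algebra.Module" "HOL-Algebra.AbelCoset" "HOL-Algebra.Ring_Divisibility"
begin

section \<open>Modules\<close>

text \<open>
  Modules are those of \<^theory>\<open>HOL-Algebra.Module\<close>. The record fields \<open>mult\<close> and \<open>one\<close> that a
  module inherits from the ring record play no role and are left \<open>undefined\<close>.
\<close>

definition mod_hom :: "('r, 's) ring_scheme \<Rightarrow> ('r, 'm) module \<Rightarrow> ('r, 'n) module \<Rightarrow> ('m \<Rightarrow> 'n) set"
  where "mod_hom R M N =
    {h \<in> carrier M \<rightarrow> carrier N.
      (\<forall>x\<in>carrier M. \<forall>y\<in>carrier M. h (x \<oplus>\<^bsub>M\<^esub> y) = h x \<oplus>\<^bsub>N\<^esub> h y) \<and>
      (\<forall>r\<in>carrier R. \<forall>x\<in>carrier M. h (r \<odot>\<^bsub>M\<^esub> x) = r \<odot>\<^bsub>N\<^esub> h x)}"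

definition fin_gen_mod :: "('r, 's) ring_scheme \<Rightarrow> ('r, 'm) module \<Rightarrow> bool"
  where "fin_gen_mod R M \<longleftrightarrow>
    (\<exists>A. finite A \<and> A \<subseteq> carrier M \<and>
      (\<forall>x\<in>carrier M. \<exists>c\<in>A \<rightarrow> carrier R. x = (\<Oplus>\<^bsub>M\<^esub>a\<in>A. c a \<odot>\<^bsub>M\<^esub> a)))"

definition submod :: "('r, 'm) module \<Rightarrow> 'm set \<Rightarrow> ('r, 'm) module"
  where "submod M N = M\<lparr>carrier := N\<rparr>"

definition quot_mod :: "('r, 'm) module \<Rightarrow> 'm set \<Rightarrow> ('r, 'm set) module"
  where "quot_mod M N =
    \<lparr>carrier = a_rcosets\<^bsub>M\<^esub> N, mult = undefined, one = undefined,
     zero = N, add = (\<lambda>A B. A <+>\<^bsub>M\<^esub> B),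
     smult = (\<lambda>r A. \<Union>x\<in>A. N +>\<^bsub>M\<^esub> (r \<odot>\<^bsub>M\<^esub> x))\<rparr>"

definition dsum_mod :: "'i set \<Rightarrow> ('i \<Rightarrow> ('r, 'm) module) \<Rightarrow> ('r, 'i \<Rightarrow> 'm) module"
  where "dsum_mod I M =
    \<lparr>carrier = {x \<in> \<Pi>\<^sub>E i\<in>I. carrier (M i). finite {i \<in> I. x i \<noteq> \<zero>\<^bsub>M i\<^esub>}},
     mult = undefined, one = undefined,
     zero = (\<lambda>i\<in>I. \<zero>\<^bsub>M i\<^esub>), add = (\<lambda>x y. \<lambda>i\<in>I. x i \<oplus>\<^bsub>M i\<^esub> y i),
     smult = (\<lambda>r x. \<lambda>i\<in>I. r \<odot>\<^bsub>M i\<^esub> x i)\<rparr>"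

definition prod_mod :: "('r, 'm) module \<Rightarrow> ('r, 'n) module \<Rightarrow> ('r, 'm \<times> 'n) module"
  where "prod_mod M N =
    \<lparr>carrier = carrier M \<times> carrier N, mult = undefined, one = undefined,
     zero = (\<zero>\<^bsub>M\<^esub>, \<zero>\<^bsub>N\<^esub>),
     add = (\<lambda>(x, y) (x', y'). (x \<oplus>\<^bsub>M\<^esub> x', y \<oplus>\<^bsub>N\<^esub> y')),
     smult = (\<lambda>r (x, y). (r \<odot>\<^bsub>M\<^esub> x, r \<odot>\<^bsub>N\<^esub> y))\<rparr>"


section \<open>Chain complexes\<close>

text \<open>Homological grading: \<open>Diff X n\<close> goes from \<open>Obj X n\<close> to \<open>Obj X (n - 1)\<close>.\<close>

record ('r, 'm) cx =
  Obj :: "int \<Rightarrow> ('r, 'm) module"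
  Diff :: "int \<Rightarrow> 'm \<Rightarrow> 'm"

definition chain_cx :: "('r, 's) ring_scheme \<Rightarrow> ('r, 'm) cx \<Rightarrow> bool"
  where "chain_cx R X \<longleftrightarrow>
    (\<forall>n. module R (Obj X n) \<and> Diff X n \<in> mod_hom R (Obj X n) (Obj X (n - 1)) \<and>
      (\<forall>x\<in>carrier (Obj X n). Diff X (n - 1) (Diff X n x) = \<zero>\<^bsub>Obj X (n - 2)\<^esub>))"

definition chain_map ::
    "('r, 's) ring_scheme \<Rightarrow> ('r, 'm) cx \<Rightarrow> ('r, 'n) cx \<Rightarrow> (int \<Rightarrow> 'm \<Rightarrow> 'n) \<Rightarrow> bool"
  where "chain_map R X Y f \<longleftrightarrow>
    chain_cx R X \<and> chain_cx R Y \<and>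
    (\<forall>n. f n \<in> mod_hom R (Obj X n) (Obj Y n) \<and>
      (\<forall>x\<in>carrier (Obj X n). f (n - 1) (Diff X n x) = Diff Y n (f n x)))"

definition chain_iso ::
    "('r, 's) ring_scheme \<Rightarrow> ('r, 'm) cx \<Rightarrow> ('r, 'n) cx \<Rightarrow> (int \<Rightarrow> 'm \<Rightarrow> 'n) \<Rightarrow> bool"
  where "chain_iso R X Y f \<longleftrightarrow>
    chain_map R X Y f \<and> (\<forall>n. bij_betw (f n) (carrier (Obj X n)) (carrier (Obj Y n)))"

definition cycles :: "('r, 'm) cx \<Rightarrow> int \<Rightarrow> 'm set"
  where "cycles X n = {x \<in> carrier (Obj X n). Diff X n x = \<zero>\<^bsub>Obj X (n - 1)\<^esub>}"

definition boundaries :: "('r, 'm) cx \<Rightarrow> int \<Rightarrow> 'm set"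
  where "boundaries X n = Diff X (n + 1) ` carrier (Obj X (n + 1))"

definition homology :: "int \<Rightarrow> ('r, 'm) cx \<Rightarrow> ('r, 'm set) module"
  where "homology n X = quot_mod (submod (Obj X n) (cycles X n)) (boundaries X n)"

definition homology_map ::
    "('r, 'n) cx \<Rightarrow> (int \<Rightarrow> 'm \<Rightarrow> 'n) \<Rightarrow> int \<Rightarrow> 'm set \<Rightarrow> 'n set"
  where "homology_map Y f n A = (\<Union>x\<in>A. boundaries Y n +>\<^bsub>Obj Y n\<^esub> f n x)"

definition quasi_iso ::
    "('r, 's) ring_scheme \<Rightarrow> ('r, 'm) cx \<Rightarrow> ('r, 'n) cx \<Rightarrow> (int \<Rightarrow> 'm \<Rightarrow> 'n) \<Rightarrow> bool"
  where "quasi_iso R X Y f \<longleftrightarrow>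
    chain_map R X Y f \<and>
    (\<forall>n. bij_betw (homology_map Y f n) (carrier (homology n X)) (carrier (homology n Y)))"

definition finite_cx :: "('r, 's) ring_scheme \<Rightarrow> ('r, 'm) cx \<Rightarrow> bool"
  where "finite_cx R X \<longleftrightarrow> fin_gen_mod R (dsum_mod (UNIV :: int set) (\<lambda>i. homology i X))"

text \<open>The \<open>k\<close>-fold suspension, for an arbitrary integer \<open>k\<close>.\<close>

definition shift :: "int \<Rightarrow> ('r, 'm) cx \<Rightarrow> ('r, 'm) cx"
  where "shift k X =
    \<lparr>Obj = (\<lambda>n. Obj X (n - k)),
     Diff = (\<lambda>n x. if even k then Diff X (n - k) x
                   else \<ominus>\<^bsub>Obj X (n - k - 1)\<^esub> Diff X (n - k) x)\<rparr>"

definition shift_map :: "int \<Rightarrow> (int \<Rightarrow> 'm \<Rightarrow> 'n) \<Rightarrow> int \<Rightarrow> 'm \<Rightarrow> 'n"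
  where "shift_map k f = (\<lambda>n. f (n - k))"

text \<open>A module viewed as a complex concentrated in degree \<open>0\<close>.\<close>

definition stalk :: "('r, 'm) module \<Rightarrow> ('r, 'm) cx"
  where "stalk M =
    \<lparr>Obj = (\<lambda>n. if n = 0 then M else submod M {\<zero>\<^bsub>M\<^esub>}), Diff = (\<lambda>n x. \<zero>\<^bsub>M\<^esub>)\<rparr>"

definition dsum_cx :: "'i set \<Rightarrow> ('i \<Rightarrow> ('r, 'm) cx) \<Rightarrow> ('r, 'i \<Rightarrow> 'm) cx"
  where "dsum_cx I X =
    \<lparr>Obj = (\<lambda>n. dsum_mod I (\<lambda>i. Obj (X i) n)), Diff = (\<lambda>n x. \<lambda>i\<in>I. Diff (X i) n (x i))\<rparr>"

definition cone ::
    "('r, 'm) cx \<Rightarrow> ('r, 'n) cx \<Rightarrow> (int \<Rightarrow> 'm \<Rightarrow> 'n) \<Rightarrow> ('r, 'm \<times> 'n) cx"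
  where "cone X Y f =
    \<lparr>Obj = (\<lambda>n. prod_mod (Obj X (n - 1)) (Obj Y n)),
     Diff = (\<lambda>n (x, y). (\<ominus>\<^bsub>Obj X (n - 2)\<^esub> Diff X (n - 1) x,
                         f (n - 1) x \<oplus>\<^bsub>Obj Y (n - 1)\<^esub> Diff Y n y))\<rparr>"


section \<open>The derived category\<close>

text \<open>
  The derived category is the localization of the category of chain complexes at the
  quasi-isomorphisms. A morphism of it is represented by a path of composable arrows, each
  being a chain map (\<open>Map X f Y\<close>) or the formal inverse \<open>Y \<rightarrow> X\<close> of a quasi-isomorphism
  \<open>f : X \<rightarrow> Y\<close> (\<open>Inv X f Y\<close>). Two parallel paths represent the same morphism iff they are related
  by \<open>path_eq\<close>, the congruence generated by the defining relations of the localization.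
  Paths are written in diagrammatic order, so that composition is concatenation.

  All complexes forming the derived category have their elements in one type \<open>'u\<close>, which plays
  the role of the universe. It should be infinite and at least as large as the ring: then cones,
  homology modules and free resolutions of complexes over \<open>'u\<close> have isomorphic copies over \<open>'u\<close>,
  as do direct sums indexed by subsets of \<open>'u\<close>.
\<close>

datatype ('r, 'u) arrow =
    Map "('r, 'u) cx" "int \<Rightarrow> 'u \<Rightarrow> 'u" "('r, 'u) cx"
  | Inv "('r, 'u) cx" "int \<Rightarrow> 'u \<Rightarrow> 'u" "('r, 'u) cx"

inductive path ::
    "('r, 's) ring_scheme \<Rightarrow> ('r, 'u) cx \<Rightarrow> ('r, 'u) cx \<Rightarrow> ('r, 'u) arrow list \<Rightarrow> bool"
  for R where
  Nil: "chain_cx R X \<Longrightarrow> path R X X []"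
| Map: "chain_map R X Y f \<Longrightarrow> path R Y Z p \<Longrightarrow> path R X Z (Map X f Y # p)"
| Inv: "quasi_iso R Y X f \<Longrightarrow> path R Y Z p \<Longrightarrow> path R X Z (Inv Y f X # p)"

text \<open>
  Chain maps are functions on the whole type \<open>'u\<close>; rule \<open>ext\<close> identifies those that agree on the
  carriers.
\<close>

inductive path_eq ::
    "('r, 's) ring_scheme \<Rightarrow> ('r, 'u) cx \<Rightarrow> ('r, 'u) cx \<Rightarrow>
      ('r, 'u) arrow list \<Rightarrow> ('r, 'u) arrow list \<Rightarrow> bool"
  for R where
  refl: "path R X Y p \<Longrightarrow> path_eq R X Y p p"
| sym: "path_eq R X Y p q \<Longrightarrow> path_eq R X Y q p"
| trans: "path_eq R X Y p q \<Longrightarrow> path_eq R X Y q r \<Longrightarrow> path_eq R X Y p r"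
| append: "path_eq R X Y p p' \<Longrightarrow> path_eq R Y Z q q' \<Longrightarrow> path_eq R X Z (p @ q) (p' @ q')"
| ext: "chain_map R X Y f \<Longrightarrow> chain_map R X Y g \<Longrightarrow>
    (\<And>n x. x \<in> carrier (Obj X n) \<Longrightarrow> f n x = g n x) \<Longrightarrow>
    path_eq R X Y [Map X f Y] [Map X g Y]"
| ident: "chain_cx R X \<Longrightarrow> path_eq R X X [Map X (\<lambda>n x. x) X] []"
| comp: "chain_map R X Y f \<Longrightarrow> chain_map R Y Z g \<Longrightarrow>
    path_eq R X Z [Map X f Y, Map Y g Z] [Map X (\<lambda>n x. g n (f n x)) Z]"
| inv_right: "quasi_iso R X Y f \<Longrightarrow> path_eq R X X [Map X f Y, Inv X f Y] []"
| inv_left: "quasi_iso R X Y f \<Longrightarrow> path_eq R Y Y [Inv X f Y, Map X f Y] []"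

definition path_iso ::
    "('r, 's) ring_scheme \<Rightarrow> ('r, 'u) cx \<Rightarrow> ('r, 'u) cx \<Rightarrow> ('r, 'u) arrow list \<Rightarrow> bool"
  where "path_iso R X Y p \<longleftrightarrow>
    path R X Y p \<and> (\<exists>q. path R Y X q \<and> path_eq R X X (p @ q) [] \<and> path_eq R Y Y (q @ p) [])"

fun susp_arrow :: "('r, 'u) arrow \<Rightarrow> ('r, 'u) arrow" where
  "susp_arrow (Map X f Y) = Map (shift 1 X) (shift_map 1 f) (shift 1 Y)"
| "susp_arrow (Inv X f Y) = Inv (shift 1 X) (shift_map 1 f) (shift 1 Y)"

text \<open>
  The standard triangle \<open>A \<rightarrow> B \<rightarrow> cone f \<rightarrow> \<Sigma>A\<close> of a chain map \<open>f\<close>. Since the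
  complex \<open>cone A B f\<close> has elements in \<open>'u \<times> 'u\<close>, it is replaced by an isomorphic complex \<open>K\<close> with
  elements in \<open>'u\<close>; \<open>j\<close> and \<open>q\<close> correspond to the inclusion and the projection of the cone.
\<close>

definition cone_triangle ::
    "('r, 's) ring_scheme \<Rightarrow> ('r, 'u) cx \<Rightarrow> ('r, 'u) cx \<Rightarrow> ('r, 'u) cx \<Rightarrow>
      (int \<Rightarrow> 'u \<Rightarrow> 'u) \<Rightarrow> (int \<Rightarrow> 'u \<Rightarrow> 'u) \<Rightarrow> (int \<Rightarrow> 'u \<Rightarrow> 'u) \<Rightarrow> bool"
  where "cone_triangle R A B K f j q \<longleftrightarrow>
    chain_map R A B f \<and> chain_map R B K j \<and> chain_map R K (shift 1 A) q \<and>
    (\<exists>\<phi>. chain_iso R (cone A B f) K \<phi> \<and>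
      (\<forall>n. \<forall>b\<in>carrier (Obj B n). j n b = \<phi> n (\<zero>\<^bsub>Obj A (n - 1)\<^esub>, b)) \<and>
      (\<forall>n. \<forall>a\<in>carrier (Obj A (n - 1)). \<forall>b\<in>carrier (Obj B n). q n (\<phi> n (a, b)) = a))"

text \<open>Exact triangles \<open>X \<rightarrow> Y \<rightarrow> Z \<rightarrow> \<Sigma>X\<close>: those isomorphic to a standard triangle.\<close>

definition exact_triangle ::
    "('r, 's) ring_scheme \<Rightarrow> ('r, 'u) cx \<Rightarrow> ('r, 'u) cx \<Rightarrow> ('r, 'u) cx \<Rightarrow>
      ('r, 'u) arrow list \<Rightarrow> ('r, 'u) arrow list \<Rightarrow> ('r, 'u) arrow list \<Rightarrow> bool"
  where "exact_triangle R X Y Z u v w \<longleftrightarrow>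
    path R X Y u \<and> path R Y Z v \<and> path R Z (shift 1 X) w \<and>
    (\<exists>A B K f j q a b c.
      cone_triangle R A B K f j q \<and>
      path_iso R X A a \<and> path_iso R Y B b \<and> path_iso R Z K c \<and>
      path_eq R X B (u @ b) (a @ [Map A f B]) \<and>
      path_eq R Y K (v @ c) (b @ [Map B j K]) \<and>
      path_eq R Z (shift 1 A) (w @ map susp_arrow a) (c @ [Map K q (shift 1 A)]))"


section \<open>Cellular classes\<close>

text \<open>
  A direct sum \<open>dsum_cx I X\<close> has its elements in a function type, so closure under direct sums
  refers to the complexes over \<open>'u\<close> isomorphic to it. Index sets are subsets of \<open>'u\<close>. For infinite
  \<open>'u\<close> this covers every direct sum that exists in the universe: if there is room for the direct
  sum in \<open>'u\<close>, then the nonzero summands can be indexed by elements of \<open>'u\<close>.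
\<close>

definition cellular_class :: "('r, 's) ring_scheme \<Rightarrow> ('r, 'u) cx set \<Rightarrow> bool"
  where "cellular_class R C \<longleftrightarrow>
    C \<noteq> {} \<and> (\<forall>X\<in>C. chain_cx R X) \<and>
    (\<forall>(I :: 'u set) X Y \<phi>. (\<forall>i\<in>I. X i \<in> C) \<and> chain_iso R (dsum_cx I X) Y \<phi> \<longrightarrow> Y \<in> C) \<and>
    (\<forall>X Y Z u v w. exact_triangle R X Y Z u v w \<and> X \<in> C \<and> Y \<in> C \<longrightarrow> Z \<in> C)"

definition generated_class :: "('r, 's) ring_scheme \<Rightarrow> ('r, 'u) cx \<Rightarrow> ('r, 'u) cx set"
  where "generated_class R X = \<Inter>{C. cellular_class R C \<and> X \<in> C}"

text \<open>
  \<open>Y\<close> is \<open>X\<close>-cellular. The elements of \<open>Y\<close> may lie in a type other than the universe \<open>'u\<close> of \<open>X\<close>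
  (homology modules consist of cosets), hence the isomorphic copy \<open>Y'\<close>.
\<close>

definition is_cellular :: "('r, 's) ring_scheme \<Rightarrow> ('r, 'u) cx \<Rightarrow> ('r, 'm) cx \<Rightarrow> bool"
  where "is_cellular R X Y \<longleftrightarrow> (\<exists>Y' \<phi>. chain_iso R Y Y' \<phi> \<and> Y' \<in> generated_class R X)"

end

theory Submission
  imports Defs "HOL-Library.Equipollence"
begin

text \<open>
  Fix a cellular class \<open>C\<close> containing \<open>X\<close>. Besides \<open>C\<close> consider the complexes that are
  absorbed by \<open>C\<close>: every extension of such a complex by an element of \<open>C\<close> is again in \<open>C\<close>. The
  suspension of an element of \<open>C\<close> is absorbed, and the absorbed complexes are closed under
  extensions, retracts and suspensions.

  Let \<open>n\<close> be the lowest degree in which \<open>X\<close> is not zero, let \<open>I\<close> be the annihilator of \<open>H\<^sub>n X\<close> and let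
  \<open>U\<close> be the kernel of \<open>X \<rightarrow> \<Sigma>\<^sup>n H\<^sub>n X\<close>. First, \<open>\<Sigma>\<^sup>c R/J\<close> is absorbed for \<open>c > n\<close> whenever \<open>I\<close> is
  contained in the radical of \<open>J\<close>: by Noetherian induction \<open>J\<close> may be assumed to be a prime \<open>p\<close>, and then
  for some \<open>d \<notin> p\<close> multiplication by \<open>d\<close> on a free resolution \<open>F\<close> of \<open>\<Sigma>\<^sup>c R/p\<close> factors through
  the absorbed complex \<open>\<Sigma>X \<otimes> F\<close>. Hence all complexes that are concentrated above \<open>n\<close> and have finite
  homology killed by powers of generators \<open>c\<^sub>1, \<dots>, c\<^sub>r\<close> of \<open>I\<close> are absorbed, among them the Koszul complex
  \<open>U // (c\<^sub>1, \<dots>, c\<^sub>r)\<close>. Since multiplication by \<open>c\<^sub>i\<close> on \<open>U\<close> factors through \<open>X\<close>, \<open>U\<close> is a retract of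
  an extension of this Koszul complex by an element of \<open>C\<close>, so that \<open>U\<close> and its quotient complex
  \<open>\<Sigma>\<^sup>n H\<^sub>n X\<close> are in \<open>C\<close>. The complex \<open>U\<close> has its homology in degrees above \<open>n\<close>, and one continues with it.
\<close>

section \<open>Modules\<close>

text \<open>The obstacle is that a cellular class is closed under cones only. Neither the fibre of a
  map between two members nor an extension of two members has to be a member, so that U cannot be
  placed in \<open>C\<close> by means of the triangle U -> X -> \<Sigma>^n H_n X alone. The
  annihilator gives access to U: c_i H_n X = 0 says that c_i X lies in U, and hence multiplication
  by c_i on U passes through X. The Koszul complex is built from U by cones on which c_i acts
  trivially in homology, up to powers once further cones are formed. Its homology therefore lives
  over the radical of I and above degree n, where it can be filtered by the modules R/J of the first
  step. There the element d lies outside p, so it acts injectively on R/p, and the cone of d on F is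
  a resolution of R/(p + dR), whose ideal is larger than p. Retracts appear because a factored
  multiplication splits a cone only up to such a factor; a retract is the colimit of a constant
  sequence and so costs a countable direct sum and a cone. The derived category is met only when
  cones and isomorphic objects are shown to stay in \<open>C\<close>; after that every argument is a
  chase with degreewise exact sequences and fibre products.\<close>

definition ring_module :: "('r, 's) ring_scheme \<Rightarrow> ('r, 'r) module" where
  "ring_module R = \<lparr>carrier = carrier R, mult = undefined, one = undefined, zero = \<zero>\<^bsub>R\<^esub>,
    add = add R, smult = mult R\<rparr>"

locale cring_complexes = cring R for R :: "('r, 's) ring_scheme" (structure)
begin

text \<open>The module laws are restated with \<open>module R M\<close> as a premise: the modules
  \<open>Obj X n\<close> come in families indexed by the degree, which no single interpretation
  covers, while the simplifier can discharge the premise for each of them.\<close>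

lemma md_closed [simp]:
  assumes "module R M"
  shows "x \<in> carrier M \<Longrightarrow> y \<in> carrier M \<Longrightarrow> x \<oplus>\<^bsub>M\<^esub> y \<in> carrier M"
    and "\<zero>\<^bsub>M\<^esub> \<in> carrier M"
    and "x \<in> carrier M \<Longrightarrow> \<ominus>\<^bsub>M\<^esub> x \<in> carrier M"
    and "r \<in> carrier R \<Longrightarrow> x \<in> carrier M \<Longrightarrow> r \<odot>\<^bsub>M\<^esub> x \<in> carrier M"
proof -
  interpret M: module R M by fact
  show "x \<in> carrier M \<Longrightarrow> y \<in> carrier M \<Longrightarrow> x \<oplus>\<^bsub>M\<^esub> y \<in> carrier M"
    and "\<zero>\<^bsub>M\<^esub> \<in> carrier M"
    and "x \<in> carrier M \<Longrightarrow> \<ominus>\<^bsub>M\<^esub> x \<in> carrier M"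
    and "r \<in> carrier R \<Longrightarrow> x \<in> carrier M \<Longrightarrow> r \<odot>\<^bsub>M\<^esub> x \<in> carrier M" by auto
qed

lemma md_simps [simp]:
  assumes "module R M"
  shows "x \<in> carrier M \<Longrightarrow> x \<oplus>\<^bsub>M\<^esub> \<zero>\<^bsub>M\<^esub> = x"
    and "x \<in> carrier M \<Longrightarrow> \<zero>\<^bsub>M\<^esub> \<oplus>\<^bsub>M\<^esub> x = x"
    and "x \<in> carrier M \<Longrightarrow> x \<oplus>\<^bsub>M\<^esub> \<ominus>\<^bsub>M\<^esub> x = \<zero>\<^bsub>M\<^esub>"
    and "x \<in> carrier M \<Longrightarrow> \<ominus>\<^bsub>M\<^esub> x \<oplus>\<^bsub>M\<^esub> x = \<zero>\<^bsub>M\<^esub>"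
    and "x \<in> carrier M \<Longrightarrow> y \<in> carrier M \<Longrightarrow> x \<oplus>\<^bsub>M\<^esub> (\<ominus>\<^bsub>M\<^esub> x \<oplus>\<^bsub>M\<^esub> y) = y"
    and "x \<in> carrier M \<Longrightarrow> y \<in> carrier M \<Longrightarrow> \<ominus>\<^bsub>M\<^esub> x \<oplus>\<^bsub>M\<^esub> (x \<oplus>\<^bsub>M\<^esub> y) = y"
    and "x \<in> carrier M \<Longrightarrow> \<ominus>\<^bsub>M\<^esub> (\<ominus>\<^bsub>M\<^esub> x) = x"
    and "\<ominus>\<^bsub>M\<^esub> \<zero>\<^bsub>M\<^esub> = \<zero>\<^bsub>M\<^esub>"
    and "x \<in> carrier M \<Longrightarrow> y \<in> carrier M \<Longrightarrow>
      \<ominus>\<^bsub>M\<^esub> (x \<oplus>\<^bsub>M\<^esub> y) = \<ominus>\<^bsub>M\<^esub> x \<oplus>\<^bsub>M\<^esub> \<ominus>\<^bsub>M\<^esub> y"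
    and "r \<in> carrier R \<Longrightarrow> r \<odot>\<^bsub>M\<^esub> \<zero>\<^bsub>M\<^esub> = \<zero>\<^bsub>M\<^esub>"
    and "x \<in> carrier M \<Longrightarrow> \<zero> \<odot>\<^bsub>M\<^esub> x = \<zero>\<^bsub>M\<^esub>"
    and "x \<in> carrier M \<Longrightarrow> \<one> \<odot>\<^bsub>M\<^esub> x = x"
    and "r \<in> carrier R \<Longrightarrow> x \<in> carrier M \<Longrightarrow> r \<odot>\<^bsub>M\<^esub> (\<ominus>\<^bsub>M\<^esub> x) = \<ominus>\<^bsub>M\<^esub> (r \<odot>\<^bsub>M\<^esub> x)"
    and "r \<in> carrier R \<Longrightarrow> x \<in> carrier M \<Longrightarrow> (\<ominus> r) \<odot>\<^bsub>M\<^esub> x = \<ominus>\<^bsub>M\<^esub> (r \<odot>\<^bsub>M\<^esub> x)"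
    and "r \<in> carrier R \<Longrightarrow> x \<in> carrier M \<Longrightarrow> y \<in> carrier M \<Longrightarrow>
      r \<odot>\<^bsub>M\<^esub> (x \<oplus>\<^bsub>M\<^esub> y) = r \<odot>\<^bsub>M\<^esub> x \<oplus>\<^bsub>M\<^esub> r \<odot>\<^bsub>M\<^esub> y"
proof -
  interpret M: module R M by fact
  show "x \<in> carrier M \<Longrightarrow> x \<oplus>\<^bsub>M\<^esub> \<zero>\<^bsub>M\<^esub> = x"
    and "x \<in> carrier M \<Longrightarrow> \<zero>\<^bsub>M\<^esub> \<oplus>\<^bsub>M\<^esub> x = x"
    and "x \<in> carrier M \<Longrightarrow> x \<oplus>\<^bsub>M\<^esub> \<ominus>\<^bsub>M\<^esub> x = \<zero>\<^bsub>M\<^esub>"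
    and "x \<in> carrier M \<Longrightarrow> \<ominus>\<^bsub>M\<^esub> x \<oplus>\<^bsub>M\<^esub> x = \<zero>\<^bsub>M\<^esub>"
    and "x \<in> carrier M \<Longrightarrow> y \<in> carrier M \<Longrightarrow> x \<oplus>\<^bsub>M\<^esub> (\<ominus>\<^bsub>M\<^esub> x \<oplus>\<^bsub>M\<^esub> y) = y"
    and "x \<in> carrier M \<Longrightarrow> y \<in> carrier M \<Longrightarrow> \<ominus>\<^bsub>M\<^esub> x \<oplus>\<^bsub>M\<^esub> (x \<oplus>\<^bsub>M\<^esub> y) = y"
    and "x \<in> carrier M \<Longrightarrow> \<ominus>\<^bsub>M\<^esub> (\<ominus>\<^bsub>M\<^esub> x) = x"
    and "\<ominus>\<^bsub>M\<^esub> \<zero>\<^bsub>M\<^esub> = \<zero>\<^bsub>M\<^esub>"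
    and "x \<in> carrier M \<Longrightarrow> y \<in> carrier M \<Longrightarrow>
      \<ominus>\<^bsub>M\<^esub> (x \<oplus>\<^bsub>M\<^esub> y) = \<ominus>\<^bsub>M\<^esub> x \<oplus>\<^bsub>M\<^esub> \<ominus>\<^bsub>M\<^esub> y"
    and "r \<in> carrier R \<Longrightarrow> r \<odot>\<^bsub>M\<^esub> \<zero>\<^bsub>M\<^esub> = \<zero>\<^bsub>M\<^esub>"
    and "x \<in> carrier M \<Longrightarrow> \<zero> \<odot>\<^bsub>M\<^esub> x = \<zero>\<^bsub>M\<^esub>"
    and "x \<in> carrier M \<Longrightarrow> \<one> \<odot>\<^bsub>M\<^esub> x = x"
    and "r \<in> carrier R \<Longrightarrow> x \<in> carrier M \<Longrightarrow> r \<odot>\<^bsub>M\<^esub> (\<ominus>\<^bsub>M\<^esub> x) = \<ominus>\<^bsub>M\<^esub> (r \<odot>\<^bsub>M\<^esub> x)"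
    and "r \<in> carrier R \<Longrightarrow> x \<in> carrier M \<Longrightarrow> (\<ominus> r) \<odot>\<^bsub>M\<^esub> x = \<ominus>\<^bsub>M\<^esub> (r \<odot>\<^bsub>M\<^esub> x)"
    and "r \<in> carrier R \<Longrightarrow> x \<in> carrier M \<Longrightarrow> y \<in> carrier M \<Longrightarrow>
      r \<odot>\<^bsub>M\<^esub> (x \<oplus>\<^bsub>M\<^esub> y) = r \<odot>\<^bsub>M\<^esub> x \<oplus>\<^bsub>M\<^esub> r \<odot>\<^bsub>M\<^esub> y"
    by (auto simp: M.M.r_neg M.M.l_neg M.M.r_neg2 M.M.r_neg1 M.M.minus_add M.smult_r_minus
        M.smult_l_minus M.smult_r_distr)
qed

lemma md_ac:
  assumes "module R M"
  shows "x \<in> carrier M \<Longrightarrow> y \<in> carrier M \<Longrightarrow> z \<in> carrier M \<Longrightarrow>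
      (x \<oplus>\<^bsub>M\<^esub> y) \<oplus>\<^bsub>M\<^esub> z = x \<oplus>\<^bsub>M\<^esub> (y \<oplus>\<^bsub>M\<^esub> z)"
    and "x \<in> carrier M \<Longrightarrow> y \<in> carrier M \<Longrightarrow> x \<oplus>\<^bsub>M\<^esub> y = y \<oplus>\<^bsub>M\<^esub> x"
    and "x \<in> carrier M \<Longrightarrow> y \<in> carrier M \<Longrightarrow> z \<in> carrier M \<Longrightarrow>
      x \<oplus>\<^bsub>M\<^esub> (y \<oplus>\<^bsub>M\<^esub> z) = y \<oplus>\<^bsub>M\<^esub> (x \<oplus>\<^bsub>M\<^esub> z)"
proof -
  interpret M: module R M by fact
  show "x \<in> carrier M \<Longrightarrow> y \<in> carrier M \<Longrightarrow> z \<in> carrier M \<Longrightarrow>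
      (x \<oplus>\<^bsub>M\<^esub> y) \<oplus>\<^bsub>M\<^esub> z = x \<oplus>\<^bsub>M\<^esub> (y \<oplus>\<^bsub>M\<^esub> z)"
    and "x \<in> carrier M \<Longrightarrow> y \<in> carrier M \<Longrightarrow> x \<oplus>\<^bsub>M\<^esub> y = y \<oplus>\<^bsub>M\<^esub> x"
    and "x \<in> carrier M \<Longrightarrow> y \<in> carrier M \<Longrightarrow> z \<in> carrier M \<Longrightarrow>
      x \<oplus>\<^bsub>M\<^esub> (y \<oplus>\<^bsub>M\<^esub> z) = y \<oplus>\<^bsub>M\<^esub> (x \<oplus>\<^bsub>M\<^esub> z)" 
    by (auto simp: M.M.a_ac)
qed

lemma md_cancel [simp]:
  assumes "module R M" "x \<in> carrier M" "y \<in> carrier M"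
  shows "x \<oplus>\<^bsub>M\<^esub> (y \<oplus>\<^bsub>M\<^esub> \<ominus>\<^bsub>M\<^esub> x) = y" "\<ominus>\<^bsub>M\<^esub> x \<oplus>\<^bsub>M\<^esub> (y \<oplus>\<^bsub>M\<^esub> x) = y"
    "(x \<oplus>\<^bsub>M\<^esub> y) \<oplus>\<^bsub>M\<^esub> \<ominus>\<^bsub>M\<^esub> y = x" "(x \<oplus>\<^bsub>M\<^esub> \<ominus>\<^bsub>M\<^esub> y) \<oplus>\<^bsub>M\<^esub> y = x"
    "(x \<oplus>\<^bsub>M\<^esub> y) \<oplus>\<^bsub>M\<^esub> \<ominus>\<^bsub>M\<^esub> x = y" "(\<ominus>\<^bsub>M\<^esub> x \<oplus>\<^bsub>M\<^esub> y) \<oplus>\<^bsub>M\<^esub> x = y"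
proof -
  show *: "x \<oplus>\<^bsub>M\<^esub> (y \<oplus>\<^bsub>M\<^esub> \<ominus>\<^bsub>M\<^esub> x) = y" "\<ominus>\<^bsub>M\<^esub> x \<oplus>\<^bsub>M\<^esub> (y \<oplus>\<^bsub>M\<^esub> x) = y"
    using assms md_ac(3)[OF assms(1), of x y "\<ominus>\<^bsub>M\<^esub> x"] md_ac(3)[OF assms(1), of "\<ominus>\<^bsub>M\<^esub> x" y x]
    by simp_all
  show "(x \<oplus>\<^bsub>M\<^esub> y) \<oplus>\<^bsub>M\<^esub> \<ominus>\<^bsub>M\<^esub> y = x" "(x \<oplus>\<^bsub>M\<^esub> \<ominus>\<^bsub>M\<^esub> y) \<oplus>\<^bsub>M\<^esub> y = x"
    "(x \<oplus>\<^bsub>M\<^esub> y) \<oplus>\<^bsub>M\<^esub> \<ominus>\<^bsub>M\<^esub> x = y" "(\<ominus>\<^bsub>M\<^esub> x \<oplus>\<^bsub>M\<^esub> y) \<oplus>\<^bsub>M\<^esub> x = y"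
    using assms * by (simp_all add: md_ac(1)[OF assms(1)])
qed

lemma md_smult:
  assumes "module R M"
  shows "r \<in> carrier R \<Longrightarrow> s \<in> carrier R \<Longrightarrow> x \<in> carrier M \<Longrightarrow>
      (r \<oplus> s) \<odot>\<^bsub>M\<^esub> x = r \<odot>\<^bsub>M\<^esub> x \<oplus>\<^bsub>M\<^esub> s \<odot>\<^bsub>M\<^esub> x"
    and "r \<in> carrier R \<Longrightarrow> s \<in> carrier R \<Longrightarrow> x \<in> carrier M \<Longrightarrow>
      (r \<otimes> s) \<odot>\<^bsub>M\<^esub> x = r \<odot>\<^bsub>M\<^esub> (s \<odot>\<^bsub>M\<^esub> x)"
  using assms by (auto simp: module.smult_l_distr module.smult_assoc1)

lemma md_smult_comm:
  assumes "module R M"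
  shows "r \<in> carrier R \<Longrightarrow> s \<in> carrier R \<Longrightarrow> x \<in> carrier M \<Longrightarrow>
      r \<odot>\<^bsub>M\<^esub> (s \<odot>\<^bsub>M\<^esub> x) = s \<odot>\<^bsub>M\<^esub> (r \<odot>\<^bsub>M\<^esub> x)"
  using assms by (metis m_comm md_smult(2))

lemma md_minus_eqI:
  "module R M \<Longrightarrow> x \<in> carrier M \<Longrightarrow> y \<in> carrier M \<Longrightarrow> y \<oplus>\<^bsub>M\<^esub> x = \<zero>\<^bsub>M\<^esub> \<Longrightarrow> \<ominus>\<^bsub>M\<^esub> x = y"
  using abelian_group.minus_equality module.axioms(2) by metis

lemma md_add_eq_zero:
  "module R M \<Longrightarrow> x \<in> carrier M \<Longrightarrow> y \<in> carrier M \<Longrightarrow>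
    x \<oplus>\<^bsub>M\<^esub> y = \<zero>\<^bsub>M\<^esub> \<longleftrightarrow> y = \<ominus>\<^bsub>M\<^esub> x"
  by (metis md_ac(2) md_closed(3) md_minus_eqI md_simps(3))

lemma md_neg_zero [simp]:
  "module R M \<Longrightarrow> x \<in> carrier M \<Longrightarrow> \<ominus>\<^bsub>M\<^esub> x = \<zero>\<^bsub>M\<^esub> \<longleftrightarrow> x = \<zero>\<^bsub>M\<^esub>"
  by (metis md_simps(7,8))

lemma moduleI':
  assumes "\<And>x y. x \<in> carrier M \<Longrightarrow> y \<in> carrier M \<Longrightarrow> x \<oplus>\<^bsub>M\<^esub> y \<in> carrier M"
    and "\<zero>\<^bsub>M\<^esub> \<in> carrier M"
    and "\<And>x y z. x \<in> carrier M \<Longrightarrow> y \<in> carrier M \<Longrightarrow> z \<in> carrier M \<Longrightarrow>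
      (x \<oplus>\<^bsub>M\<^esub> y) \<oplus>\<^bsub>M\<^esub> z = x \<oplus>\<^bsub>M\<^esub> (y \<oplus>\<^bsub>M\<^esub> z)"
    and "\<And>x y. x \<in> carrier M \<Longrightarrow> y \<in> carrier M \<Longrightarrow> x \<oplus>\<^bsub>M\<^esub> y = y \<oplus>\<^bsub>M\<^esub> x"
    and "\<And>x. x \<in> carrier M \<Longrightarrow> \<zero>\<^bsub>M\<^esub> \<oplus>\<^bsub>M\<^esub> x = x"
    and "\<And>x. x \<in> carrier M \<Longrightarrow> \<exists>y\<in>carrier M. y \<oplus>\<^bsub>M\<^esub> x = \<zero>\<^bsub>M\<^esub>"
    and "\<And>a x. a \<in> carrier R \<Longrightarrow> x \<in> carrier M \<Longrightarrow> a \<odot>\<^bsub>M\<^esub> x \<in> carrier M"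
    and "\<And>a b x. a \<in> carrier R \<Longrightarrow> b \<in> carrier R \<Longrightarrow> x \<in> carrier M \<Longrightarrow>
      (a \<oplus> b) \<odot>\<^bsub>M\<^esub> x = (a \<odot>\<^bsub>M\<^esub> x) \<oplus>\<^bsub>M\<^esub> (b \<odot>\<^bsub>M\<^esub> x)"
    and "\<And>a x y. a \<in> carrier R \<Longrightarrow> x \<in> carrier M \<Longrightarrow> y \<in> carrier M \<Longrightarrow>
      a \<odot>\<^bsub>M\<^esub> (x \<oplus>\<^bsub>M\<^esub> y) = (a \<odot>\<^bsub>M\<^esub> x) \<oplus>\<^bsub>M\<^esub> (a \<odot>\<^bsub>M\<^esub> y)"
    and "\<And>a b x. a \<in> carrier R \<Longrightarrow> b \<in> carrier R \<Longrightarrow> x \<in> carrier M \<Longrightarrow>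
      (a \<otimes> b) \<odot>\<^bsub>M\<^esub> x = a \<odot>\<^bsub>M\<^esub> (b \<odot>\<^bsub>M\<^esub> x)"
    and "\<And>x. x \<in> carrier M \<Longrightarrow> \<one> \<odot>\<^bsub>M\<^esub> x = x"
  shows "module R M"
  by (rule moduleI[OF is_cring abelian_groupI]) (use assms in auto)

definition sub_mod :: "('r, 'm) module \<Rightarrow> 'm set \<Rightarrow> bool" where
  "sub_mod M N \<longleftrightarrow> N \<subseteq> carrier M \<and> \<zero>\<^bsub>M\<^esub> \<in> N \<and> (\<forall>x\<in>N. \<forall>y\<in>N. x \<oplus>\<^bsub>M\<^esub> y \<in> N) \<and>
    (\<forall>r\<in>carrier R. \<forall>x\<in>N. r \<odot>\<^bsub>M\<^esub> x \<in> N)"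

text \<open>Closure under negation comes from multiplication by
  \<open>\<ominus> \<one>\<close>.\<close>

lemma sub_modD:
  assumes "sub_mod M N"
  shows "N \<subseteq> carrier M" "x \<in> N \<Longrightarrow> x \<in> carrier M" "\<zero>\<^bsub>M\<^esub> \<in> N"
    "x \<in> N \<Longrightarrow> y \<in> N \<Longrightarrow> x \<oplus>\<^bsub>M\<^esub> y \<in> N"
    "r \<in> carrier R \<Longrightarrow> x \<in> N \<Longrightarrow> r \<odot>\<^bsub>M\<^esub> x \<in> N"
    "module R M \<Longrightarrow> x \<in> N \<Longrightarrow> \<ominus>\<^bsub>M\<^esub> x \<in> N"
proof -
  show *: "x \<in> N \<Longrightarrow> x \<in> carrier M" "r \<in> carrier R \<Longrightarrow> x \<in> N \<Longrightarrow> r \<odot>\<^bsub>M\<^esub> x \<in> N" for x r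
    using assms by (auto simp: sub_mod_def)
  show "module R M \<Longrightarrow> x \<in> N \<Longrightarrow> \<ominus>\<^bsub>M\<^esub> x \<in> N"
    using *(2)[of "\<ominus> \<one>" x] *(1)[of x] by simp
qed (use assms in \<open>auto simp: sub_mod_def\<close>)

lemma sub_modI:
  assumes "N \<subseteq> carrier M" "\<zero>\<^bsub>M\<^esub> \<in> N" "\<And>x y. x \<in> N \<Longrightarrow> y \<in> N \<Longrightarrow> x \<oplus>\<^bsub>M\<^esub> y \<in> N"
    "\<And>r x. r \<in> carrier R \<Longrightarrow> x \<in> N \<Longrightarrow> r \<odot>\<^bsub>M\<^esub> x \<in> N"
  shows "sub_mod M N"
  using assms by (auto simp: sub_mod_def)

lemma sub_mod_add_cancel:
  assumes "module R M" "sub_mod M N" "x \<in> N" "y \<in> carrier M"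
  shows "x \<oplus>\<^bsub>M\<^esub> y \<in> N \<longleftrightarrow> y \<in> N"
  using assms sub_modD[OF assms(2)] by (metis md_simps(6))

lemma submod_simps [simp]:
  "carrier (submod M N) = N" "x \<oplus>\<^bsub>submod M N\<^esub> y = x \<oplus>\<^bsub>M\<^esub> y" "\<zero>\<^bsub>submod M N\<^esub> = \<zero>\<^bsub>M\<^esub>"
  "r \<odot>\<^bsub>submod M N\<^esub> x = r \<odot>\<^bsub>M\<^esub> x"
  by (simp_all add: submod_def)

lemma module_submod [simp]:
  assumes "module R M" "sub_mod M N" shows "module R (submod M N)"
proof -
  note s = sub_modD[OF assms(2)]
  have "\<exists>y\<in>N. y \<oplus>\<^bsub>M\<^esub> x = \<zero>\<^bsub>M\<^esub>" if "x \<in> N" for x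
    using that s(6)[OF assms(1) that] assms(1) s(2) by (intro bexI[of _ "\<ominus>\<^bsub>M\<^esub> x"]) auto
  then show ?thesis
    by (intro moduleI') (use assms(1) s in \<open>auto simp: md_ac md_smult\<close>)
qed

lemma prod_mod_simps [simp]:
  "carrier (prod_mod M N) = carrier M \<times> carrier N"
  "p \<oplus>\<^bsub>prod_mod M N\<^esub> q = (fst p \<oplus>\<^bsub>M\<^esub> fst q, snd p \<oplus>\<^bsub>N\<^esub> snd q)"
  "\<zero>\<^bsub>prod_mod M N\<^esub> = (\<zero>\<^bsub>M\<^esub>, \<zero>\<^bsub>N\<^esub>)"
  "r \<odot>\<^bsub>prod_mod M N\<^esub> p = (r \<odot>\<^bsub>M\<^esub> fst p, r \<odot>\<^bsub>N\<^esub> snd p)"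
  by (simp_all add: prod_mod_def case_prod_beta)

lemma module_prod [simp]:
  assumes "module R M" "module R N" shows "module R (prod_mod M N)"
proof -
  have "\<exists>y\<in>carrier (prod_mod M N). y \<oplus>\<^bsub>prod_mod M N\<^esub> x = \<zero>\<^bsub>prod_mod M N\<^esub>"
    if "x \<in> carrier (prod_mod M N)" for x
    using that assms by (intro bexI[of _ "(\<ominus>\<^bsub>M\<^esub> fst x, \<ominus>\<^bsub>N\<^esub> snd x)"]) auto
  then show ?thesis
    by (intro moduleI') (use assms in \<open>auto simp: md_ac md_smult\<close>)
qed

lemma dsum_mod_simps [simp]:
  "carrier (dsum_mod I M) = {x \<in> \<Pi>\<^sub>E i\<in>I. carrier (M i). finite {i \<in> I. x i \<noteq> \<zero>\<^bsub>M i\<^esub>}}"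
  "x \<oplus>\<^bsub>dsum_mod I M\<^esub> y = (\<lambda>i\<in>I. x i \<oplus>\<^bsub>M i\<^esub> y i)"
  "\<zero>\<^bsub>dsum_mod I M\<^esub> = (\<lambda>i\<in>I. \<zero>\<^bsub>M i\<^esub>)"
  "r \<odot>\<^bsub>dsum_mod I M\<^esub> x = (\<lambda>i\<in>I. r \<odot>\<^bsub>M i\<^esub> x i)"
  by (simp_all add: dsum_mod_def)

lemma restrict_dsum_mem:
  "restrict f I \<in> carrier (dsum_mod I M) \<longleftrightarrow>
    (\<forall>i\<in>I. f i \<in> carrier (M i)) \<and> finite {i \<in> I. f i \<noteq> \<zero>\<^bsub>M i\<^esub>}"
proof -
  have "{i \<in> I. restrict f I i \<noteq> \<zero>\<^bsub>M i\<^esub>} = {i \<in> I. f i \<noteq> \<zero>\<^bsub>M i\<^esub>}" by auto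
  then show ?thesis by (simp add: PiE_iff)
qed

lemma module_dsum [simp]:
  assumes M: "\<And>i. i \<in> I \<Longrightarrow> module R (M i)" shows "module R (dsum_mod I M)"
proof -
  have fin: "finite {i \<in> I. f i \<noteq> \<zero>\<^bsub>M i\<^esub>}"
    if "finite {i \<in> I. x i \<noteq> \<zero>\<^bsub>M i\<^esub>}" "finite {i \<in> I. y i \<noteq> \<zero>\<^bsub>M i\<^esub>}"
      "\<And>i. i \<in> I \<Longrightarrow> x i = \<zero>\<^bsub>M i\<^esub> \<Longrightarrow> y i = \<zero>\<^bsub>M i\<^esub> \<Longrightarrow> f i = \<zero>\<^bsub>M i\<^esub>" for f x y
    by (rule finite_subset[OF _ finite_UnI[OF that(1,2)]]) (use that(3) in auto)
  have PiE: "x i \<in> carrier (M i)" if "x \<in> (\<Pi>\<^sub>E i\<in>I. carrier (M i))" "i \<in> I" for x i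
    using that by auto
  show ?thesis
  proof (rule moduleI')
    fix x y assume "x \<in> carrier (dsum_mod I M)" "y \<in> carrier (dsum_mod I M)"
    then show "x \<oplus>\<^bsub>dsum_mod I M\<^esub> y \<in> carrier (dsum_mod I M)"
      unfolding dsum_mod_simps(2) restrict_dsum_mem by (auto simp: M PiE intro!: fin[of x y])
  next
    fix x assume "x \<in> carrier (dsum_mod I M)"
    then show "\<exists>y\<in>carrier (dsum_mod I M). y \<oplus>\<^bsub>dsum_mod I M\<^esub> x = \<zero>\<^bsub>dsum_mod I M\<^esub>"
      by (intro bexI[of _ "\<lambda>i\<in>I. \<ominus>\<^bsub>M i\<^esub> x i"]; (unfold restrict_dsum_mem)?)
        (auto simp: M PiE intro!: fin[of x x] restrict_ext)
  next
    fix a x assume "a \<in> carrier R" "x \<in> carrier (dsum_mod I M)"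
    then show "a \<odot>\<^bsub>dsum_mod I M\<^esub> x \<in> carrier (dsum_mod I M)"
      unfolding dsum_mod_simps(4) restrict_dsum_mem by (auto simp: M PiE intro!: fin[of x x])
  next
    show "\<zero>\<^bsub>dsum_mod I M\<^esub> \<in> carrier (dsum_mod I M)"
      unfolding dsum_mod_simps(3) restrict_dsum_mem by (auto simp: M)
  next
    fix x assume "x \<in> carrier (dsum_mod I M)"
    then have x: "x \<in> (\<Pi>\<^sub>E i\<in>I. carrier (M i))" by simp
    then have "restrict x I = x" by (auto simp: fun_eq_iff)
    moreover have "restrict (\<lambda>i. \<zero>\<^bsub>M i\<^esub> \<oplus>\<^bsub>M i\<^esub> x i) I = restrict x I"
      "restrict (\<lambda>i. \<one> \<odot>\<^bsub>M i\<^esub> x i) I = restrict x I"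
      by (rule restrict_ext; simp add: M PiE x)+
    moreover have "(\<lambda>i\<in>I. (\<lambda>i\<in>I. \<zero>\<^bsub>M i\<^esub>) i \<oplus>\<^bsub>M i\<^esub> x i) = restrict (\<lambda>i. \<zero>\<^bsub>M i\<^esub> \<oplus>\<^bsub>M i\<^esub> x i) I"
      by (rule restrict_ext) simp
    ultimately show "\<zero>\<^bsub>dsum_mod I M\<^esub> \<oplus>\<^bsub>dsum_mod I M\<^esub> x = x" "\<one> \<odot>\<^bsub>dsum_mod I M\<^esub> x = x"
      by simp_all
  qed (auto simp: M PiE md_ac md_smult intro!: restrict_ext)
qed

section \<open>Homomorphisms, kernels and images\<close>

lemma mod_homI:
  assumes "\<And>x. x \<in> carrier M \<Longrightarrow> h x \<in> carrier N"
    "\<And>x y. x \<in> carrier M \<Longrightarrow> y \<in> carrier M \<Longrightarrow> h (x \<oplus>\<^bsub>M\<^esub> y) = h x \<oplus>\<^bsub>N\<^esub> h y"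
    "\<And>r x. r \<in> carrier R \<Longrightarrow> x \<in> carrier M \<Longrightarrow> h (r \<odot>\<^bsub>M\<^esub> x) = r \<odot>\<^bsub>N\<^esub> h x"
  shows "h \<in> mod_hom R M N"
  using assms by (auto simp: mod_hom_def)

lemma mod_homD:
  assumes h: "h \<in> mod_hom R M N"
  shows "x \<in> carrier M \<Longrightarrow> h x \<in> carrier N"
    "x \<in> carrier M \<Longrightarrow> y \<in> carrier M \<Longrightarrow> h (x \<oplus>\<^bsub>M\<^esub> y) = h x \<oplus>\<^bsub>N\<^esub> h y"
    "r \<in> carrier R \<Longrightarrow> x \<in> carrier M \<Longrightarrow> h (r \<odot>\<^bsub>M\<^esub> x) = r \<odot>\<^bsub>N\<^esub> h x"
    "module R M \<Longrightarrow> module R N \<Longrightarrow> h \<zero>\<^bsub>M\<^esub> = \<zero>\<^bsub>N\<^esub>"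
    "module R M \<Longrightarrow> module R N \<Longrightarrow> x \<in> carrier M \<Longrightarrow> h (\<ominus>\<^bsub>M\<^esub> x) = \<ominus>\<^bsub>N\<^esub> h x"
proof -
  show *: "x \<in> carrier M \<Longrightarrow> h x \<in> carrier N"
    "r \<in> carrier R \<Longrightarrow> x \<in> carrier M \<Longrightarrow> h (r \<odot>\<^bsub>M\<^esub> x) = r \<odot>\<^bsub>N\<^esub> h x" for x r
    using h by (auto simp: mod_hom_def)
  show "x \<in> carrier M \<Longrightarrow> y \<in> carrier M \<Longrightarrow> h (x \<oplus>\<^bsub>M\<^esub> y) = h x \<oplus>\<^bsub>N\<^esub> h y"
    using h by (auto simp: mod_hom_def)
  show "module R M \<Longrightarrow> module R N \<Longrightarrow> h \<zero>\<^bsub>M\<^esub> = \<zero>\<^bsub>N\<^esub>"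
    using *(2)[of \<zero> "\<zero>\<^bsub>M\<^esub>"] *(1)[of "\<zero>\<^bsub>M\<^esub>"] by simp
  show "module R M \<Longrightarrow> module R N \<Longrightarrow> x \<in> carrier M \<Longrightarrow> h (\<ominus>\<^bsub>M\<^esub> x) = \<ominus>\<^bsub>N\<^esub> h x"
    using *(2)[of "\<ominus> \<one>" x] *(1)[of x] by simp
qed

lemma mod_hom_zero [simp]: "module R N \<Longrightarrow> (\<lambda>x. \<zero>\<^bsub>N\<^esub>) \<in> mod_hom R M N"
  by (auto simp: mod_hom_def)

lemma mod_hom_id [simp]: "(\<lambda>x. x) \<in> mod_hom R M M"
  by (auto simp: mod_hom_def)

lemma mod_hom_comp: "f \<in> mod_hom R L M \<Longrightarrow> g \<in> mod_hom R M N \<Longrightarrow> (\<lambda>x. g (f x)) \<in> mod_hom R L N"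
  by (auto simp: mod_hom_def Pi_iff)

lemma mod_hom_minus: "module R N \<Longrightarrow> f \<in> mod_hom R M N \<Longrightarrow> (\<lambda>x. \<ominus>\<^bsub>N\<^esub> f x) \<in> mod_hom R M N"
  by (auto simp: mod_hom_def Pi_iff)

lemma mod_hom_inv:
  assumes f: "f \<in> mod_hom R M N" and b: "bij_betw f (carrier M) (carrier N)" and M: "module R M"
  shows "inv_into (carrier M) f \<in> mod_hom R N M"
proof (rule mod_homI)
  note b = bij_betw_inv_into_left[OF b] bij_betw_inv_into_right[OF b] bij_betw_apply[OF bij_betw_inv_into[OF b]]
  let ?g = "inv_into (carrier M) f"
  show *: "?g x \<in> carrier M" if "x \<in> carrier N" for x using b that by auto
  show "?g (x \<oplus>\<^bsub>N\<^esub> y) = ?g x \<oplus>\<^bsub>M\<^esub> ?g y" if "x \<in> carrier N" "y \<in> carrier N" for x y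
    using b(1)[of "?g x \<oplus>\<^bsub>M\<^esub> ?g y"] M * that by (simp add: mod_homD(2)[OF f] b(2))
  show "?g (r \<odot>\<^bsub>N\<^esub> x) = r \<odot>\<^bsub>M\<^esub> ?g x" if "r \<in> carrier R" "x \<in> carrier N" for x r
    using b(1)[of "r \<odot>\<^bsub>M\<^esub> ?g x"] M * that by (simp add: mod_homD(3)[OF f] b(2))
qed

lemma sub_mod_ker:
  assumes "h \<in> mod_hom R M N" "module R M" "module R N"
  shows "sub_mod M {x \<in> carrier M. h x = \<zero>\<^bsub>N\<^esub>}"
  using assms by (intro sub_modI) (auto simp: mod_homD[OF assms(1)])

lemma sub_mod_image:
  assumes h: "h \<in> mod_hom R M N" "module R M" "module R N"
  shows "sub_mod N (h ` carrier M)"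
proof (intro sub_modI)
  note * = mod_homD[OF h(1)]
  show "h ` carrier M \<subseteq> carrier N" using * by auto
  show "\<zero>\<^bsub>N\<^esub> \<in> h ` carrier M" using *(4) h by (metis image_eqI md_closed(2))
  show "x \<oplus>\<^bsub>N\<^esub> y \<in> h ` carrier M" if "x \<in> h ` carrier M" "y \<in> h ` carrier M" for x y
    using that h(2) by (force simp: *(2)[symmetric])
  show "r \<odot>\<^bsub>N\<^esub> x \<in> h ` carrier M" if "r \<in> carrier R" "x \<in> h ` carrier M" for r x
    using that h(2) by (force simp: *(3)[symmetric])
qed

lemma sub_mod_zero [simp]: "module R M \<Longrightarrow> sub_mod M {\<zero>\<^bsub>M\<^esub>}"
  by (auto simp: sub_mod_def)

lemma sub_mod_carrier [simp]: "module R M \<Longrightarrow> sub_mod M (carrier M)"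
  by (auto simp: sub_mod_def)

lemma sub_mod_Int: "sub_mod M N \<Longrightarrow> sub_mod M N' \<Longrightarrow> sub_mod M (N \<inter> N')"
  by (auto simp: sub_mod_def)

section \<open>Cosets and quotient modules\<close>

lemma mem_coset: "y \<in> N +>\<^bsub>M\<^esub> x \<longleftrightarrow> (\<exists>h\<in>N. y = h \<oplus>\<^bsub>M\<^esub> x)"
  by (auto simp: a_r_coset_def')

lemma coset_eq_iff:
  assumes M: "module R M" and N: "sub_mod M N" and x: "x \<in> carrier M" "y \<in> carrier M"
  shows "N +>\<^bsub>M\<^esub> x = N +>\<^bsub>M\<^esub> y \<longleftrightarrow> (\<exists>h\<in>N. x = h \<oplus>\<^bsub>M\<^esub> y)"
proof
  assume "N +>\<^bsub>M\<^esub> x = N +>\<^bsub>M\<^esub> y"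
  moreover have "x \<in> N +>\<^bsub>M\<^esub> x"
    unfolding mem_coset using sub_modD(3)[OF N] x M by (intro bexI[of _ "\<zero>\<^bsub>M\<^esub>"]) simp_all
  ultimately show "\<exists>h\<in>N. x = h \<oplus>\<^bsub>M\<^esub> y" by (auto simp: mem_coset)
next
  note s = sub_modD[OF N]
  assume "\<exists>h\<in>N. x = h \<oplus>\<^bsub>M\<^esub> y"
  then obtain h where h: "h \<in> N" "x = h \<oplus>\<^bsub>M\<^esub> y" by auto
  show "N +>\<^bsub>M\<^esub> x = N +>\<^bsub>M\<^esub> y"
  proof (auto simp: mem_coset)
    fix k assume "k \<in> N"
    then show "\<exists>ha\<in>N. k \<oplus>\<^bsub>M\<^esub> x = ha \<oplus>\<^bsub>M\<^esub> y"
      using h s M x by (intro bexI[of _ "k \<oplus>\<^bsub>M\<^esub> h"]) (auto simp: md_ac(1))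
  next
    fix k assume "k \<in> N"
    then show "\<exists>ha\<in>N. k \<oplus>\<^bsub>M\<^esub> y = ha \<oplus>\<^bsub>M\<^esub> x"
      using h s M x by (intro bexI[of _ "k \<oplus>\<^bsub>M\<^esub> \<ominus>\<^bsub>M\<^esub> h"]) (auto simp: md_ac(1))
  qed
qed

lemma coset_zero: "module R M \<Longrightarrow> sub_mod M N \<Longrightarrow> N +>\<^bsub>M\<^esub> \<zero>\<^bsub>M\<^esub> = N"
  by (auto simp: mem_coset sub_modD(2))

lemma coset_eq_N:
  assumes M: "module R M" and N: "sub_mod M N" and x: "x \<in> carrier M"
  shows "N +>\<^bsub>M\<^esub> x = N \<longleftrightarrow> x \<in> N"
  using coset_eq_iff[OF M N x md_closed(2)[OF M]] coset_zero[OF M N] M sub_modD(2)[OF N]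
  by (auto)

text \<open>On cosets the set operations of \<open>quot_mod\<close> can be computed with
  representatives; in the scalar product the union over a coset is a union of equal cosets.\<close>

lemma quot_mod_simps:
  assumes M: "module R M" and N: "sub_mod M N"
  shows "carrier (quot_mod M N) = (\<lambda>x. N +>\<^bsub>M\<^esub> x) ` carrier M"
    and "x \<in> carrier M \<Longrightarrow> y \<in> carrier M \<Longrightarrow>
      (N +>\<^bsub>M\<^esub> x) \<oplus>\<^bsub>quot_mod M N\<^esub> (N +>\<^bsub>M\<^esub> y) = N +>\<^bsub>M\<^esub> (x \<oplus>\<^bsub>M\<^esub> y)"
    and "\<zero>\<^bsub>quot_mod M N\<^esub> = N +>\<^bsub>M\<^esub> \<zero>\<^bsub>M\<^esub>"
    and "r \<in> carrier R \<Longrightarrow> x \<in> carrier M \<Longrightarrow>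
      r \<odot>\<^bsub>quot_mod M N\<^esub> (N +>\<^bsub>M\<^esub> x) = N +>\<^bsub>M\<^esub> (r \<odot>\<^bsub>M\<^esub> x)"
proof -
  note s = sub_modD[OF N]
  show "carrier (quot_mod M N) = (\<lambda>x. N +>\<^bsub>M\<^esub> x) ` carrier M"
    by (auto simp: quot_mod_def A_RCOSETS_def')
  show "\<zero>\<^bsub>quot_mod M N\<^esub> = N +>\<^bsub>M\<^esub> \<zero>\<^bsub>M\<^esub>"
    using coset_zero[OF M N] by (simp add: quot_mod_def)
  show "(N +>\<^bsub>M\<^esub> x) \<oplus>\<^bsub>quot_mod M N\<^esub> (N +>\<^bsub>M\<^esub> y) = N +>\<^bsub>M\<^esub> (x \<oplus>\<^bsub>M\<^esub> y)"
    if "x \<in> carrier M" "y \<in> carrier M"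
  proof -
    have "\<exists>h\<in>N. h1 \<oplus>\<^bsub>M\<^esub> x \<oplus>\<^bsub>M\<^esub> (h2 \<oplus>\<^bsub>M\<^esub> y) = h \<oplus>\<^bsub>M\<^esub> (x \<oplus>\<^bsub>M\<^esub> y)" 
      if "h1 \<in> N" "h2 \<in> N" for h1 h2
      using that s M \<open>x \<in> carrier M\<close> \<open>y \<in> carrier M\<close>
      by (intro bexI[of _ "h1 \<oplus>\<^bsub>M\<^esub> h2"]) (auto simp: md_ac)
    moreover have "\<exists>h1\<in>N. \<exists>h2\<in>N. h \<oplus>\<^bsub>M\<^esub> (x \<oplus>\<^bsub>M\<^esub> y) = h1 \<oplus>\<^bsub>M\<^esub> x \<oplus>\<^bsub>M\<^esub> (h2 \<oplus>\<^bsub>M\<^esub> y)" if "h \<in> N" for h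
      using that s M \<open>x \<in> carrier M\<close> \<open>y \<in> carrier M\<close>
      by (intro bexI[of _ h] bexI[of _ "\<zero>\<^bsub>M\<^esub>"]) (auto simp: md_ac)
    moreover have "A \<oplus>\<^bsub>quot_mod M N\<^esub> B = (\<Union>a\<in>A. \<Union>b\<in>B. {a \<oplus>\<^bsub>M\<^esub> b})" for A B
      by (simp add: quot_mod_def set_add_def set_mult_def)
    ultimately show ?thesis
      unfolding a_r_coset_def' by (intro equalityI subsetI) force+
  qed
  show "r \<odot>\<^bsub>quot_mod M N\<^esub> (N +>\<^bsub>M\<^esub> x) = N +>\<^bsub>M\<^esub> (r \<odot>\<^bsub>M\<^esub> x)"
    if r: "r \<in> carrier R" and x: "x \<in> carrier M"
  proof -
    have "N +>\<^bsub>M\<^esub> (r \<odot>\<^bsub>M\<^esub> (h \<oplus>\<^bsub>M\<^esub> x)) = N +>\<^bsub>M\<^esub> (r \<odot>\<^bsub>M\<^esub> x)" if "h \<in> N" for h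
      using that s r x M N by (subst coset_eq_iff) (auto)
    moreover have "N +>\<^bsub>M\<^esub> x \<noteq> {}" using s(3) mem_coset[of "\<zero>\<^bsub>M\<^esub> \<oplus>\<^bsub>M\<^esub> x" M N x] by blast
    ultimately have "(\<Union>y\<in>N +>\<^bsub>M\<^esub> x. N +>\<^bsub>M\<^esub> (r \<odot>\<^bsub>M\<^esub> y)) = N +>\<^bsub>M\<^esub> (r \<odot>\<^bsub>M\<^esub> x)"
      by (intro SUP_eq_const) (auto simp: mem_coset)
    then show ?thesis by (simp add: quot_mod_def)
  qed
qed

lemma module_quot [simp]:
  assumes M: "module R M" and N: "sub_mod M N" shows "module R (quot_mod M N)"
proof -
  note q = quot_mod_simps[OF M N]
  have "\<exists>y\<in>carrier (quot_mod M N). y \<oplus>\<^bsub>quot_mod M N\<^esub> a = \<zero>\<^bsub>quot_mod M N\<^esub>"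
    if "a \<in> carrier (quot_mod M N)" for a
  proof -
    obtain x where "x \<in> carrier M" "a = N +>\<^bsub>M\<^esub> x" using \<open>a \<in> _\<close> by (auto simp: q)
    then show ?thesis
      using M by (intro bexI[of _ "N +>\<^bsub>M\<^esub> (\<ominus>\<^bsub>M\<^esub> x)"]) (auto simp: q)
  qed
  then show ?thesis
    by (intro moduleI') (use M in \<open>auto simp: q md_ac md_smult\<close>)
qed

lemma mod_hom_quot: 
  assumes M: "module R M" and N: "sub_mod M N"
  shows "(\<lambda>x. N +>\<^bsub>M\<^esub> x) \<in> mod_hom R M (quot_mod M N)"
  by (intro mod_homI) (auto simp: quot_mod_simps[OF M N])

abbreviation ring_mod where "ring_mod \<equiv> ring_module R"

lemma ring_mod_simps [simp]:
  "carrier ring_mod = carrier R" "x \<oplus>\<^bsub>ring_mod\<^esub> y = x \<oplus> y" "\<zero>\<^bsub>ring_mod\<^esub> = \<zero>"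
  "r \<odot>\<^bsub>ring_mod\<^esub> x = r \<otimes> x"
  by (simp_all add: ring_module_def)

lemma module_ring_mod [simp]: "module R ring_mod"
  by (intro moduleI') (auto simp: a_ac m_ac l_distr r_distr intro!: bexI[of _ "\<ominus> _"] l_neg)

lemma minus_ring_mod [simp]: "x \<in> carrier R \<Longrightarrow> \<ominus>\<^bsub>ring_mod\<^esub> x = \<ominus> x"
  by (rule md_minus_eqI) (auto simp: l_neg)

lemma sub_mod_ideal: assumes "ideal J R" shows "sub_mod ring_mod J"
proof -
  interpret ideal J R by fact
  show ?thesis by (intro sub_modI) (simp_all add: I_l_closed a_subset)
qed

lemma sub_mod_ideal':
  assumes J: "sub_mod ring_mod J"
  shows "ideal J R"
proof (rule idealI)
  note s = sub_modD(1,2,3,4,5,6)[OF J]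
  have "\<ominus> x \<in> J" if "x \<in> J" for x
    using s(6)[OF module_ring_mod that] s(2)[OF that] by simp
  moreover have "J \<subseteq> carrier R" "\<zero> \<in> J" using s(1,3) by simp_all
  moreover have "x \<oplus> y \<in> J" if "x \<in> J" "y \<in> J" for x y using s(4)[OF that] by simp
  ultimately show "subgroup J (add_monoid R)"
    by (intro subgroup.intro) (simp_all flip: a_inv_def)
  show *: "x \<otimes> a \<in> J" if "a \<in> J" "x \<in> carrier R" for a x
    using s(5)[OF that(2,1)] by simp
  show "a \<otimes> x \<in> J" if "a \<in> J" "x \<in> carrier R" for a x
    using *[OF that] s(2)[OF that(1)] that(2) by (simp add: m_comm)
qed (rule ring_axioms)

end

section \<open>Complexes\<close>

definition sub_cx :: "('r, 'm) cx \<Rightarrow> (int \<Rightarrow> 'm set) \<Rightarrow> ('r, 'm) cx" where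
  "sub_cx X S = \<lparr>Obj = (\<lambda>n. submod (Obj X n) (S n)), Diff = Diff X\<rparr>"

definition ker_cx :: "('r, 'm) cx \<Rightarrow> ('r, 'n) cx \<Rightarrow> (int \<Rightarrow> 'm \<Rightarrow> 'n) \<Rightarrow> ('r, 'm) cx" where
  "ker_cx X Y f = sub_cx X (\<lambda>n. {x \<in> carrier (Obj X n). f n x = \<zero>\<^bsub>Obj Y n\<^esub>})"

definition conc_cx :: "int \<Rightarrow> ('r, 'm) module \<Rightarrow> ('r, 'm) cx" where
  "conc_cx b M =
    \<lparr>Obj = (\<lambda>n. if n = b then M else submod M {\<zero>\<^bsub>M\<^esub>}), Diff = (\<lambda>n x. \<zero>\<^bsub>M\<^esub>)\<rparr>"

text \<open>The extension of \<open>A\<close> by \<open>B\<close> with twisting map \<open>h\<close> of degree \<open>-1\<close>; the cone of \<open>f : X \<rightarrow> B\<close>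
  is the case \<open>A = \<Sigma>X\<close>, and the homotopy fibre of \<open>A \<rightarrow> \<Sigma>B\<close> is another one.\<close>

definition twist :: "('r, 'm) cx \<Rightarrow> ('r, 'n) cx \<Rightarrow> (int \<Rightarrow> 'm \<Rightarrow> 'n) \<Rightarrow> ('r, 'm \<times> 'n) cx" where
  "twist A B h = \<lparr>Obj = (\<lambda>n. prod_mod (Obj A n) (Obj B n)),
     Diff = (\<lambda>n p. (Diff A n (fst p), h n (fst p) \<oplus>\<^bsub>Obj B (n - 1)\<^esub> Diff B n (snd p)))\<rparr>"

abbreviation prod_cx :: "('r, 'm) cx \<Rightarrow> ('r, 'n) cx \<Rightarrow> ('r, 'm \<times> 'n) cx" where
  "prod_cx A B \<equiv> twist A B (\<lambda>n x. \<zero>\<^bsub>Obj B (n - 1)\<^esub>)"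

text \<open>The fibre product of \<open>f\<close> and \<open>g\<close>, cut out of the product
  complex. The product is a twist by zero, which is where the summand zero in its differential comes
  from.\<close>

definition pull_cx :: "('r, 'a) cx \<Rightarrow> ('r, 'b) cx \<Rightarrow> (int \<Rightarrow> 'a \<Rightarrow> 'c) \<Rightarrow> (int \<Rightarrow> 'b \<Rightarrow> 'c) \<Rightarrow>
    ('r, 'a \<times> 'b) cx" where
  "pull_cx A B f g = sub_cx (prod_cx A B)
    (\<lambda>n. {p \<in> carrier (Obj A n) \<times> carrier (Obj B n). f n (fst p) = g n (snd p)})"

text \<open>Transport of structure along the injections \<open>g n\<close>. Cones, products and
  direct sums have elements in larger types and return to the universe in this way.\<close>

definition copy_cx :: "(int \<Rightarrow> 'm \<Rightarrow> 'n) \<Rightarrow> ('r, 'm) cx \<Rightarrow> ('r, 'n) cx" where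
  "copy_cx g X = (let i = (\<lambda>n. inv_into (carrier (Obj X n)) (g n)) in
    \<lparr>Obj = (\<lambda>n. \<lparr>carrier = g n ` carrier (Obj X n), mult = undefined, one = undefined,
        zero = g n \<zero>\<^bsub>Obj X n\<^esub>, add = (\<lambda>a b. g n (i n a \<oplus>\<^bsub>Obj X n\<^esub> i n b)),
        smult = (\<lambda>r a. g n (r \<odot>\<^bsub>Obj X n\<^esub> i n a))\<rparr>),
     Diff = (\<lambda>n a. g (n - 1) (Diff X n (i n a)))\<rparr>)"

definition acyclic_cx :: "('r, 'm) cx \<Rightarrow> bool" where
  "acyclic_cx X \<longleftrightarrow> (\<forall>n. cycles X n \<subseteq> boundaries X n)"

text \<open>The bound that \<open>copy_cx\<close> needs in order to reach the universe. The argument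
  \<open>C\<close> names the type \<open>'u\<close> in question.\<close>

definition small_cx :: "('r, 'u) cx set \<Rightarrow> ('r, 'm) cx \<Rightarrow> bool" where
  "small_cx C X \<longleftrightarrow> (\<forall>n. carrier (Obj X n) \<lesssim> (UNIV :: 'u set))"

lemma sub_cx_simps [simp]:
  "Obj (sub_cx X S) n = submod (Obj X n) (S n)" "Diff (sub_cx X S) = Diff X"
  by (simp_all add: sub_cx_def)

lemma twist_simps [simp]:
  "Obj (twist A B h) n = prod_mod (Obj A n) (Obj B n)"
  "Diff (twist A B h) n p = (Diff A n (fst p), h n (fst p) \<oplus>\<^bsub>Obj B (n - 1)\<^esub> Diff B n (snd p))"
  by (simp_all add: twist_def)

lemma shift_simps [simp]:
  "Obj (shift k X) n = Obj X (n - k)"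
  "Diff (shift 1 X) n x = \<ominus>\<^bsub>Obj X (n - 2)\<^esub> Diff X (n - 1) x"
  by (simp_all add: shift_def)

lemma cone_eq_twist: "cone A B f = twist (shift 1 A) B (\<lambda>n. f (n - 1))"
  by (simp add: cone_def twist_def shift_def fun_eq_iff)

lemma mem_boundaries:
  "x \<in> boundaries X n \<longleftrightarrow> (\<exists>y\<in>carrier (Obj X (n + 1)). x = Diff X (n + 1) y)"
  by (auto simp: boundaries_def)

lemma mem_cycles: "x \<in> cycles X n \<longleftrightarrow> x \<in> carrier (Obj X n) \<and> Diff X n x = \<zero>\<^bsub>Obj X (n - 1)\<^esub>"
  by (auto simp: cycles_def)

context cring_complexes
begin

abbreviation "cpx X \<equiv> chain_cx R X"
abbreviation "cmap X Y f \<equiv> chain_map R X Y f"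

lemma cpx_module [simp]: "cpx X \<Longrightarrow> module R (Obj X n)"
  by (auto simp: chain_cx_def)

lemma cpxI:
  assumes "\<And>n. module R (Obj X n)"
    and "\<And>n x. x \<in> carrier (Obj X n) \<Longrightarrow> Diff X n x \<in> carrier (Obj X (n - 1))"
    and "\<And>n x y. x \<in> carrier (Obj X n) \<Longrightarrow> y \<in> carrier (Obj X n) \<Longrightarrow>
      Diff X n (x \<oplus>\<^bsub>Obj X n\<^esub> y) = Diff X n x \<oplus>\<^bsub>Obj X (n - 1)\<^esub> Diff X n y"
    and "\<And>n r x. r \<in> carrier R \<Longrightarrow> x \<in> carrier (Obj X n) \<Longrightarrow>
      Diff X n (r \<odot>\<^bsub>Obj X n\<^esub> x) = r \<odot>\<^bsub>Obj X (n - 1)\<^esub> Diff X n x"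
    and "\<And>n x. x \<in> carrier (Obj X n) \<Longrightarrow> Diff X (n - 1) (Diff X n x) = \<zero>\<^bsub>Obj X (n - 2)\<^esub>"
  shows "cpx X"
  using assms by (auto simp: chain_cx_def intro!: mod_homI)

lemma Diff_hom: "cpx X \<Longrightarrow> Diff X n \<in> mod_hom R (Obj X n) (Obj X (n - 1))"
  by (auto simp: chain_cx_def)

lemma Diff_simps [simp]:
  assumes X: "cpx X"
  shows "x \<in> carrier (Obj X n) \<Longrightarrow> m = n - 1 \<Longrightarrow> Diff X n x \<in> carrier (Obj X m)"
    and "x \<in> carrier (Obj X n) \<Longrightarrow> y \<in> carrier (Obj X n) \<Longrightarrow>
      Diff X n (x \<oplus>\<^bsub>Obj X n\<^esub> y) = Diff X n x \<oplus>\<^bsub>Obj X (n - 1)\<^esub> Diff X n y"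
    and "r \<in> carrier R \<Longrightarrow> x \<in> carrier (Obj X n) \<Longrightarrow>
      Diff X n (r \<odot>\<^bsub>Obj X n\<^esub> x) = r \<odot>\<^bsub>Obj X (n - 1)\<^esub> Diff X n x"
    and "Diff X n \<zero>\<^bsub>Obj X n\<^esub> = \<zero>\<^bsub>Obj X (n - 1)\<^esub>"
    and "x \<in> carrier (Obj X n) \<Longrightarrow> Diff X n (\<ominus>\<^bsub>Obj X n\<^esub> x) = \<ominus>\<^bsub>Obj X (n - 1)\<^esub> Diff X n x"
    and "x \<in> carrier (Obj X n) \<Longrightarrow> m = n - 1 \<Longrightarrow> Diff X m (Diff X n x) = \<zero>\<^bsub>Obj X (m - 1)\<^esub>"
proof -
  note * = mod_homD[OF Diff_hom[OF X, of n]]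
  show "x \<in> carrier (Obj X n) \<Longrightarrow> m = n - 1 \<Longrightarrow> Diff X n x \<in> carrier (Obj X m)"
    and "x \<in> carrier (Obj X n) \<Longrightarrow> y \<in> carrier (Obj X n) \<Longrightarrow>
      Diff X n (x \<oplus>\<^bsub>Obj X n\<^esub> y) = Diff X n x \<oplus>\<^bsub>Obj X (n - 1)\<^esub> Diff X n y"
    and "r \<in> carrier R \<Longrightarrow> x \<in> carrier (Obj X n) \<Longrightarrow>
      Diff X n (r \<odot>\<^bsub>Obj X n\<^esub> x) = r \<odot>\<^bsub>Obj X (n - 1)\<^esub> Diff X n x"
    and "Diff X n \<zero>\<^bsub>Obj X n\<^esub> = \<zero>\<^bsub>Obj X (n - 1)\<^esub>"
    and "x \<in> carrier (Obj X n) \<Longrightarrow> Diff X n (\<ominus>\<^bsub>Obj X n\<^esub> x) = \<ominus>\<^bsub>Obj X (n - 1)\<^esub> Diff X n x"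
    using * X by auto
  show "x \<in> carrier (Obj X n) \<Longrightarrow> m = n - 1 \<Longrightarrow> Diff X m (Diff X n x) = \<zero>\<^bsub>Obj X (m - 1)\<^esub>"
    using X by (auto simp: chain_cx_def)
qed

lemma cmapI:
  assumes "cpx X" "cpx Y"
    and "\<And>n x. x \<in> carrier (Obj X n) \<Longrightarrow> f n x \<in> carrier (Obj Y n)"
    and "\<And>n x y. x \<in> carrier (Obj X n) \<Longrightarrow> y \<in> carrier (Obj X n) \<Longrightarrow>
      f n (x \<oplus>\<^bsub>Obj X n\<^esub> y) = f n x \<oplus>\<^bsub>Obj Y n\<^esub> f n y"
    and "\<And>n r x. r \<in> carrier R \<Longrightarrow> x \<in> carrier (Obj X n) \<Longrightarrow>
      f n (r \<odot>\<^bsub>Obj X n\<^esub> x) = r \<odot>\<^bsub>Obj Y n\<^esub> f n x"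
    and "\<And>n x. x \<in> carrier (Obj X n) \<Longrightarrow> f (n - 1) (Diff X n x) = Diff Y n (f n x)"
  shows "cmap X Y f"
  using assms by (auto simp: chain_map_def intro!: mod_homI)

lemma cmap_hom: "cmap X Y f \<Longrightarrow> f n \<in> mod_hom R (Obj X n) (Obj Y n)"
  by (auto simp: chain_map_def)

lemma cmapD:
  assumes f: "cmap X Y f"
  shows "cpx X" "cpx Y"
    and "x \<in> carrier (Obj X n) \<Longrightarrow> f n x \<in> carrier (Obj Y n)"
    and "x \<in> carrier (Obj X n) \<Longrightarrow> y \<in> carrier (Obj X n) \<Longrightarrow>
      f n (x \<oplus>\<^bsub>Obj X n\<^esub> y) = f n x \<oplus>\<^bsub>Obj Y n\<^esub> f n y"
    and "r \<in> carrier R \<Longrightarrow> x \<in> carrier (Obj X n) \<Longrightarrow>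
      f n (r \<odot>\<^bsub>Obj X n\<^esub> x) = r \<odot>\<^bsub>Obj Y n\<^esub> f n x"
    and "f n \<zero>\<^bsub>Obj X n\<^esub> = \<zero>\<^bsub>Obj Y n\<^esub>"
    and "x \<in> carrier (Obj X n) \<Longrightarrow> f n (\<ominus>\<^bsub>Obj X n\<^esub> x) = \<ominus>\<^bsub>Obj Y n\<^esub> f n x"
    and "x \<in> carrier (Obj X n) \<Longrightarrow> m = n - 1 \<Longrightarrow> f m (Diff X n x) = Diff Y n (f n x)"
proof -
  note * = mod_homD[OF cmap_hom[OF f, of n]]
  show **: "cpx X" "cpx Y" using f by (auto simp: chain_map_def)
  show "x \<in> carrier (Obj X n) \<Longrightarrow> f n x \<in> carrier (Obj Y n)"
    and "x \<in> carrier (Obj X n) \<Longrightarrow> y \<in> carrier (Obj X n) \<Longrightarrow>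
      f n (x \<oplus>\<^bsub>Obj X n\<^esub> y) = f n x \<oplus>\<^bsub>Obj Y n\<^esub> f n y"
    and "r \<in> carrier R \<Longrightarrow> x \<in> carrier (Obj X n) \<Longrightarrow>
      f n (r \<odot>\<^bsub>Obj X n\<^esub> x) = r \<odot>\<^bsub>Obj Y n\<^esub> f n x"
    and "f n \<zero>\<^bsub>Obj X n\<^esub> = \<zero>\<^bsub>Obj Y n\<^esub>"
    and "x \<in> carrier (Obj X n) \<Longrightarrow> f n (\<ominus>\<^bsub>Obj X n\<^esub> x) = \<ominus>\<^bsub>Obj Y n\<^esub> f n x"
    using * ** by auto
  show "x \<in> carrier (Obj X n) \<Longrightarrow> m = n - 1 \<Longrightarrow> f m (Diff X n x) = Diff Y n (f n x)"
    using f by (auto simp: chain_map_def)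
qed

lemma cmap_id [simp]: "cpx X \<Longrightarrow> cmap X X (\<lambda>n x. x)"
  by (auto intro!: cmapI)

lemma cmap_comp: "cmap X Y f \<Longrightarrow> cmap Y Z g \<Longrightarrow> cmap X Z (\<lambda>n x. g n (f n x))"
  by (auto intro!: cmapI simp: cmapD)

lemma cmap_zero: "cpx X \<Longrightarrow> cpx Y \<Longrightarrow> cmap X Y (\<lambda>n x. \<zero>\<^bsub>Obj Y n\<^esub>)"
  by (auto intro!: cmapI)

definition "iso_inv X f = (\<lambda>n. inv_into (carrier (Obj X n)) (f n))"

lemma chain_iso_inv:
  assumes "chain_iso R X Y f"
  shows "chain_iso R Y X (iso_inv X f)"
    and "x \<in> carrier (Obj X n) \<Longrightarrow> iso_inv X f n (f n x) = x"
    and "y \<in> carrier (Obj Y n) \<Longrightarrow> f n (iso_inv X f n y) = y"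
    and "y \<in> carrier (Obj Y n) \<Longrightarrow> iso_inv X f n y \<in> carrier (Obj X n)"
proof -
  have f: "cmap X Y f" and b: "bij_betw (f n) (carrier (Obj X n)) (carrier (Obj Y n))" for n
    using assms by (auto simp: chain_iso_def)
  note c = cmapD[OF f]
  show i: "x \<in> carrier (Obj X n) \<Longrightarrow> iso_inv X f n (f n x) = x"
    "y \<in> carrier (Obj Y n) \<Longrightarrow> f n (iso_inv X f n y) = y" 
    "y \<in> carrier (Obj Y n) \<Longrightarrow> iso_inv X f n y \<in> carrier (Obj X n)" for n x y
    using bij_betw_inv_into_left[OF b[of n]] bij_betw_inv_into_right[OF b[of n]]
      bij_betw_apply[OF bij_betw_inv_into[OF b[of n]]] by (auto simp: iso_inv_def)
  have h: "iso_inv X f n \<in> mod_hom R (Obj Y n) (Obj X n)" for n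
    unfolding iso_inv_def by (rule mod_hom_inv[OF cmap_hom[OF f] b]) (simp add: c)
  note h' = mod_homD[OF h]
  have "iso_inv X f (n - 1) (Diff Y n y) = Diff X n (iso_inv X f n y)"
    if y: "y \<in> carrier (Obj Y n)" for n y
    using i(1)[of "Diff X n (iso_inv X f n y)" "n - 1"] y c(1)
    by (simp add: i c)
  then have "cmap Y X (iso_inv X f)"
    by (intro cmapI) (simp_all add: c h')
  then show "chain_iso R Y X (iso_inv X f)"
    using bij_betw_inv_into[OF b] by (simp add: chain_iso_def iso_inv_def)
qed

lemma chain_isoD: 
  assumes "chain_iso R X Y f"
  shows "cmap X Y f" "cmap Y X (iso_inv X f)" 
    "inj_on (f n) (carrier (Obj X n))" "f n ` carrier (Obj X n) = carrier (Obj Y n)"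
  using assms chain_iso_inv(1)[OF assms] by (auto simp: chain_iso_def bij_betw_def)

lemma chain_isoI:
  assumes "cmap X Y f" "\<And>n x. x \<in> carrier (Obj X n) \<Longrightarrow> f n x = \<zero>\<^bsub>Obj Y n\<^esub> \<Longrightarrow> x = \<zero>\<^bsub>Obj X n\<^esub>"
    "\<And>n y. y \<in> carrier (Obj Y n) \<Longrightarrow> \<exists>x\<in>carrier (Obj X n). y = f n x"
  shows "chain_iso R X Y f"
proof -
  note c = cmapD[OF assms(1)]
  have "inj_on (f n) (carrier (Obj X n))" for n
  proof (rule inj_onI)
    fix x y assume *: "x \<in> carrier (Obj X n)" "y \<in> carrier (Obj X n)" "f n x = f n y"
    then have "f n (x \<oplus>\<^bsub>Obj X n\<^esub> \<ominus>\<^bsub>Obj X n\<^esub> y) = \<zero>\<^bsub>Obj Y n\<^esub>"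
      by (simp add: c(1-7))
    then have "x \<oplus>\<^bsub>Obj X n\<^esub> \<ominus>\<^bsub>Obj X n\<^esub> y = \<zero>\<^bsub>Obj X n\<^esub>"
      by (rule assms(2)[rotated]) (simp add: c(1) *)
    then have "\<ominus>\<^bsub>Obj X n\<^esub> (\<ominus>\<^bsub>Obj X n\<^esub> y) = x"
      by (intro md_minus_eqI) (simp_all add: c(1) *)
    then show "x = y" using * c(1) by simp
  qed
  moreover have "f n ` carrier (Obj X n) = carrier (Obj Y n)" for n
    using assms(3)[of _ n] c(3) by auto
  ultimately show ?thesis using assms(1) by (auto simp: chain_iso_def bij_betw_def)
qed

lemma chain_iso_trans:
  assumes "chain_iso R X Y f" "chain_iso R Y Z g"
  shows "chain_iso R X Z (\<lambda>n x. g n (f n x))"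
proof -
  have "bij_betw (g n \<circ> f n) (carrier (Obj X n)) (carrier (Obj Z n))" for n
    using assms by (intro bij_betw_trans[of "f n"]) (auto simp: chain_iso_def)
  then show ?thesis
    using assms cmap_comp[of X Y f Z g] by (auto simp: chain_iso_def comp_def)
qed

lemma chain_iso_id: "cpx X \<Longrightarrow> chain_iso R X X (\<lambda>n x. x)"
  by (auto simp: chain_iso_def bij_betw_def)

lemma copy_cx_iso:
  assumes X: "cpx X" and inj: "\<And>n. inj_on (g n) (carrier (Obj X n))"
  shows "chain_iso R X (copy_cx g X) g"
proof -
  have i: "inv_into (carrier (Obj X n)) (g n) (g n x) = x" if "x \<in> carrier (Obj X n)" for n x
    using inj that by simp
  have s: "carrier (Obj (copy_cx g X) n) = g n ` carrier (Obj X n)"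
    "\<zero>\<^bsub>Obj (copy_cx g X) n\<^esub> = g n \<zero>\<^bsub>Obj X n\<^esub>"
    "x \<in> carrier (Obj X n) \<Longrightarrow> y \<in> carrier (Obj X n) \<Longrightarrow>
       g n x \<oplus>\<^bsub>Obj (copy_cx g X) n\<^esub> g n y = g n (x \<oplus>\<^bsub>Obj X n\<^esub> y)"
    "x \<in> carrier (Obj X n) \<Longrightarrow>
       r \<odot>\<^bsub>Obj (copy_cx g X) n\<^esub> g n x = g n (r \<odot>\<^bsub>Obj X n\<^esub> x)"
    "x \<in> carrier (Obj X n) \<Longrightarrow> Diff (copy_cx g X) n (g n x) = g (n - 1) (Diff X n x)"
    for n x y r
    by (simp_all add: copy_cx_def Let_def i)
  have inv: "\<exists>y\<in>carrier (Obj X n). g n (y \<oplus>\<^bsub>Obj X n\<^esub> x) = g n \<zero>\<^bsub>Obj X n\<^esub>"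
    if "x \<in> carrier (Obj X n)" for n x
    using that X by (intro bexI[of _ "\<ominus>\<^bsub>Obj X n\<^esub> x"]) simp_all
  have "module R (Obj (copy_cx g X) n)" for n
    by (intro moduleI') (use X inv in \<open>auto simp: s md_ac md_smult\<close>)
  then have "cpx (copy_cx g X)"
    by (intro cpxI) (use X in \<open>auto simp: s\<close>)
  then have "cmap X (copy_cx g X) g"
    using X by (intro cmapI) (auto simp: s)
  then show ?thesis using inj by (auto simp: chain_iso_def bij_betw_def s)
qed

lemma small_copy:
  assumes "cpx X" "small_cx (C :: ('r, 'u) cx set) X"
  obtains Y :: "('r, 'u) cx" and g where "chain_iso R X Y g"
proof -
  have "\<exists>g :: 'a \<Rightarrow> 'u. inj_on g (carrier (Obj X n))" for n
    using assms(2) by (auto simp: small_cx_def lepoll_def)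
  then obtain g :: "int \<Rightarrow> 'a \<Rightarrow> 'u" where "\<And>n. inj_on (g n) (carrier (Obj X n))" by metis
  from copy_cx_iso[OF assms(1) this] that show thesis by blast
qed

lemma cpx_shift [simp]: 
  assumes X: "cpx X" shows "cpx (shift k X)"
proof (rule cpxI)
  have idx: "n - 1 - k = n - k - 1" "n - 2 - k = n - k - 2" for n by auto
  show "Diff (shift k X) (n - 1) (Diff (shift k X) n x) = \<zero>\<^bsub>Obj (shift k X) (n - 2)\<^esub>"
    if "x \<in> carrier (Obj (shift k X) n)" for n x
    using X that by (simp add: shift_def idx)
qed (use X in \<open>auto simp: shift_def algebra_simps\<close>)

definition subcomplex :: "('r, 'm) cx \<Rightarrow> (int \<Rightarrow> 'm set) \<Rightarrow> bool" where
  "subcomplex X S \<longleftrightarrow> (\<forall>n. sub_mod (Obj X n) (S n) \<and> (\<forall>x\<in>S n. Diff X n x \<in> S (n - 1)))"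

lemma cpx_sub [simp]:
  assumes X: "cpx X" and S: "subcomplex X S" shows "cpx (sub_cx X S)"
proof -
  have s: "sub_mod (Obj X n) (S n)" and d: "x \<in> S n \<Longrightarrow> Diff X n x \<in> S (n - 1)" for n x
    using S by (auto simp: subcomplex_def)
  note sD = sub_modD(2)[OF s]
  show ?thesis by (intro cpxI) (use X s d sD in auto)
qed

lemma subcomplex_ker: 
  assumes "cmap X Y f"
  shows "subcomplex X (\<lambda>n. {x \<in> carrier (Obj X n). f n x = \<zero>\<^bsub>Obj Y n\<^esub>})"
  using cmapD[OF assms] sub_mod_ker[OF cmap_hom[OF assms]] by (auto simp: subcomplex_def)

lemma cpx_ker [simp]: "cmap X Y f \<Longrightarrow> cpx (ker_cx X Y f)"
  unfolding ker_cx_def by (intro cpx_sub subcomplex_ker) (auto dest: cmapD)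

lemma ker_cx_simps [simp]:
  "carrier (Obj (ker_cx X Y f) n) = {x \<in> carrier (Obj X n). f n x = \<zero>\<^bsub>Obj Y n\<^esub>}"
  "Diff (ker_cx X Y f) = Diff X" "\<zero>\<^bsub>Obj (ker_cx X Y f) n\<^esub> = \<zero>\<^bsub>Obj X n\<^esub>"
  "x \<oplus>\<^bsub>Obj (ker_cx X Y f) n\<^esub> y = x \<oplus>\<^bsub>Obj X n\<^esub> y"
  "r \<odot>\<^bsub>Obj (ker_cx X Y f) n\<^esub> y = r \<odot>\<^bsub>Obj X n\<^esub> y"
  by (simp_all add: ker_cx_def)

lemma cmap_sub: "cpx X \<Longrightarrow> subcomplex X S \<Longrightarrow> cmap (sub_cx X S) X (\<lambda>n x. x)"
  by (intro cmapI) (auto simp: subcomplex_def dest: sub_modD)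

lemma cmap_into_sub:
  assumes "cmap Y X f" "subcomplex X S" "\<And>n y. y \<in> carrier (Obj Y n) \<Longrightarrow> f n y \<in> S n"
  shows "cmap Y (sub_cx X S) f"
  using cmapD[OF assms(1)] assms by (intro cmapI) auto

lemma conc_simps:
  "Obj (conc_cx b M) b = M" "n \<noteq> b \<Longrightarrow> Obj (conc_cx b M) n = submod M {\<zero>\<^bsub>M\<^esub>}"
  "Diff (conc_cx b M) n x = \<zero>\<^bsub>M\<^esub>" "\<zero>\<^bsub>Obj (conc_cx b M) n\<^esub> = \<zero>\<^bsub>M\<^esub>"
  "x \<oplus>\<^bsub>Obj (conc_cx b M) n\<^esub> y = x \<oplus>\<^bsub>M\<^esub> y" "r \<odot>\<^bsub>Obj (conc_cx b M) n\<^esub> y = r \<odot>\<^bsub>M\<^esub> y"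
  "carrier (Obj (conc_cx b M) n) = (if n = b then carrier M else {\<zero>\<^bsub>M\<^esub>})"
  by (simp_all add: conc_cx_def)

lemma cpx_conc [simp]: "module R M \<Longrightarrow> cpx (conc_cx b M)"
  by (rule cpxI) (auto simp: conc_cx_def)

text \<open>The square of the twisted differential has one mixed component \<open>h d + d h\<close>,
  and \<open>dh\<close> says that it vanishes.\<close>

lemma cpx_twist [simp]:
  assumes A: "cpx A" and B: "cpx B"
    and h: "\<And>n. h n \<in> mod_hom R (Obj A n) (Obj B (n - 1))"
    and dh: "\<And>n a. a \<in> carrier (Obj A n) \<Longrightarrow>
      h (n - 1) (Diff A n a) \<oplus>\<^bsub>Obj B (n - 2)\<^esub> Diff B (n - 1) (h n a) = \<zero>\<^bsub>Obj B (n - 2)\<^esub>"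
  shows "cpx (twist A B h)"
proof -
  note h' = mod_homD[OF h]
  show ?thesis
    by (intro cpxI) (use A B dh in \<open>auto simp: h' md_ac\<close>)
qed

lemma cpx_prod [simp]: "cpx A \<Longrightarrow> cpx B \<Longrightarrow> cpx (prod_cx A B)"
  by (intro cpx_twist) auto

lemma cpx_cone [simp]: "cmap A B f \<Longrightarrow> cpx (cone A B f)"
  unfolding cone_eq_twist
  by (intro cpx_twist) (auto simp: cmapD intro!: mod_homI)

lemma subcomplex_pull:
  assumes "cmap A Z f" "cmap B Z g"
  shows "subcomplex (prod_cx A B)
    (\<lambda>n. {p \<in> carrier (Obj A n) \<times> carrier (Obj B n). f n (fst p) = g n (snd p)})"
  using cmapD[OF assms(1)] cmapD[OF assms(2)]
  by (auto simp: subcomplex_def intro!: sub_modI)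

lemma cpx_pull [simp]: "cmap A Z f \<Longrightarrow> cmap B Z g \<Longrightarrow> cpx (pull_cx A B f g)"
  unfolding pull_cx_def by (intro cpx_sub cpx_prod subcomplex_pull) (auto dest: cmapD)

lemma pull_cx_simps [simp]:
  "carrier (Obj (pull_cx A B f g) n) =
    {p \<in> carrier (Obj A n) \<times> carrier (Obj B n). f n (fst p) = g n (snd p)}"
  "Diff (pull_cx A B f g) n p = (Diff A n (fst p), \<zero>\<^bsub>Obj B (n - 1)\<^esub> \<oplus>\<^bsub>Obj B (n - 1)\<^esub> Diff B n (snd p))"
  "\<zero>\<^bsub>Obj (pull_cx A B f g) n\<^esub> = (\<zero>\<^bsub>Obj A n\<^esub>, \<zero>\<^bsub>Obj B n\<^esub>)"
  "p \<oplus>\<^bsub>Obj (pull_cx A B f g) n\<^esub> q = (fst p \<oplus>\<^bsub>Obj A n\<^esub> fst q, snd p \<oplus>\<^bsub>Obj B n\<^esub> snd q)"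
  "r \<odot>\<^bsub>Obj (pull_cx A B f g) n\<^esub> p = (r \<odot>\<^bsub>Obj A n\<^esub> fst p, r \<odot>\<^bsub>Obj B n\<^esub> snd p)"
  by (simp_all add: pull_cx_def)

lemma cmap_pull:
  assumes "cmap A Z f" "cmap B Z g"
  shows "cmap (pull_cx A B f g) A (\<lambda>n. fst)" "cmap (pull_cx A B f g) B (\<lambda>n. snd)"
  using cpx_pull[OF assms] cmapD[OF assms(1)] cmapD[OF assms(2)] by (auto intro!: cmapI)

lemma cmap_into_pull:
  assumes "cmap A Z f" "cmap B Z g" "cmap Y A a" "cmap Y B b"
    "\<And>n y. y \<in> carrier (Obj Y n) \<Longrightarrow> f n (a n y) = g n (b n y)"
  shows "cmap Y (pull_cx A B f g) (\<lambda>n y. (a n y, b n y))"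
  using cpx_pull[OF assms(1,2)] cmapD[OF assms(3)] cmapD[OF assms(4)] assms(5)
  by (auto intro!: cmapI)

lemma cpx_dsum [simp]:
  assumes X: "\<And>i. i \<in> I \<Longrightarrow> cpx (X i)"
  shows "cpx (dsum_cx I X)"
proof -
  have fin: "finite {i \<in> I. Diff (X i) n (x i) \<noteq> \<zero>\<^bsub>Obj (X i) (n - 1)\<^esub>}"
    if "finite {i \<in> I. x i \<noteq> \<zero>\<^bsub>Obj (X i) n\<^esub>}" for x n
    by (rule finite_subset[OF _ that]) (use X in auto)
  have PiE: "x i \<in> carrier (Obj (X i) n)" if "x \<in> (\<Pi>\<^sub>E i\<in>I. carrier (Obj (X i) n))" "i \<in> I" for x i n
    using that by auto
  show ?thesis
  proof (rule cpxI)
    show "Diff (dsum_cx I X) n x \<in> carrier (Obj (dsum_cx I X) (n - 1))"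
      if "x \<in> carrier (Obj (dsum_cx I X) n)" for n x
      using that X unfolding dsum_cx_def
      by (auto simp: PiE fin restrict_dsum_mem simp del: dsum_mod_simps(1))
        (auto simp: PiE fin)
  qed (use X in \<open>auto simp: dsum_cx_def PiE intro!: restrict_ext module_dsum\<close>)
qed

lemma dsum_cx_simps [simp]:
  "Obj (dsum_cx I X) n = dsum_mod I (\<lambda>i. Obj (X i) n)"
  "Diff (dsum_cx I X) n x = (\<lambda>i\<in>I. Diff (X i) n (x i))"
  by (simp_all add: dsum_cx_def)

subsection \<open>Quasi-isomorphisms\<close>

lemma sub_mod_cycles: "cpx X \<Longrightarrow> sub_mod (Obj X n) (cycles X n)"
  unfolding cycles_def by (rule sub_mod_ker[OF Diff_hom]) auto

lemma sub_mod_boundaries: "cpx X \<Longrightarrow> sub_mod (Obj X n) (boundaries X n)"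
  unfolding boundaries_def using sub_mod_image[OF Diff_hom[of X "n + 1"]] by simp

lemma boundaries_subset_cycles: "cpx X \<Longrightarrow> boundaries X n \<subseteq> cycles X n"
  by (auto simp: mem_boundaries mem_cycles)

lemma sub_mod_boundaries': "cpx X \<Longrightarrow> sub_mod (submod (Obj X n) (cycles X n)) (boundaries X n)"
  using sub_mod_boundaries[of X n] boundaries_subset_cycles[of X n] by (auto simp: sub_mod_def)

lemma module_homology [simp]: "cpx X \<Longrightarrow> module R (homology n X)"
  unfolding homology_def by (intro module_quot module_submod sub_mod_cycles sub_mod_boundaries') auto

lemma submod_coset: "N +>\<^bsub>submod M Z\<^esub> x = N +>\<^bsub>M\<^esub> x"
  by (simp add: a_r_coset_def')

lemma carrier_homology:
  "cpx X \<Longrightarrow> carrier (homology n X) = (\<lambda>x. boundaries X n +>\<^bsub>Obj X n\<^esub> x) ` cycles X n"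
  unfolding homology_def
  by (subst quot_mod_simps) (auto simp: sub_mod_cycles sub_mod_boundaries' submod_coset)

text \<open>Injectivity and surjectivity on homology expressed by representatives, so that diagram
  chases can stay with elements instead of cosets.\<close>

definition qis :: "('r, 'm) cx \<Rightarrow> ('r, 'n) cx \<Rightarrow> (int \<Rightarrow> 'm \<Rightarrow> 'n) \<Rightarrow> bool" where
  "qis X Y f \<longleftrightarrow> cmap X Y f \<and>
    (\<forall>n. \<forall>x\<in>cycles X n. f n x \<in> boundaries Y n \<longrightarrow> x \<in> boundaries X n) \<and>
    (\<forall>n. \<forall>y\<in>cycles Y n. \<exists>x\<in>cycles X n. \<exists>b\<in>boundaries Y n. y = b \<oplus>\<^bsub>Obj Y n\<^esub> f n x)"

lemma qis_quasi_iso: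
  assumes "qis X Y f" shows "quasi_iso R X Y f"
proof -
  have f: "cmap X Y f"
    and inj: "\<And>n x. x \<in> cycles X n \<Longrightarrow> f n x \<in> boundaries Y n \<Longrightarrow> x \<in> boundaries X n"
    and sur: "\<And>n y. y \<in> cycles Y n \<Longrightarrow> \<exists>x\<in>cycles X n. \<exists>b\<in>boundaries Y n. y = b \<oplus>\<^bsub>Obj Y n\<^esub> f n x"
    using assms by (auto simp: qis_def)
  note c = cmapD[OF f]
  note X = c(1) and Y = c(2)
  have fz: "f n x \<in> cycles Y n" if "x \<in> cycles X n" for n x
    using that by (auto simp: mem_cycles c(3) c(6) c(8)[symmetric])
  have fb: "f n x \<in> boundaries Y n" if "x \<in> boundaries X n" for n x
    using that by (force simp: mem_boundaries c(3) c(8))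
  have sb: "sub_mod (Obj X n) (boundaries X n)" "sub_mod (Obj Y n) (boundaries Y n)" for n
    using sub_mod_boundaries X Y by auto
  have cyc: "x \<in> cycles X n \<Longrightarrow> x \<in> carrier (Obj X n)" "x \<in> boundaries X n \<Longrightarrow> x \<in> carrier (Obj X n)"
     "y \<in> cycles Y n \<Longrightarrow> y \<in> carrier (Obj Y n)" "y \<in> boundaries Y n \<Longrightarrow> y \<in> carrier (Obj Y n)" for x y n
    using sub_modD(2)[OF sb(1)] sub_modD(2)[OF sb(2)] by (auto simp: mem_cycles)
  \<comment> \<open>The union in \<open>homology_map\<close> runs over a coset, all of whose members
    lead to the same coset of boundaries.\<close>
  have hm: "homology_map Y f n (boundaries X n +>\<^bsub>Obj X n\<^esub> x) = boundaries Y n +>\<^bsub>Obj Y n\<^esub> f n x"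
    if x: "x \<in> cycles X n" for n x
    unfolding homology_map_def
  proof (rule SUP_eq_const)
    show "boundaries X n +>\<^bsub>Obj X n\<^esub> x \<noteq> {}"
      using sub_modD(3)[OF sb(1)] mem_coset[of "\<zero>\<^bsub>Obj X n\<^esub> \<oplus>\<^bsub>Obj X n\<^esub> x"] by blast
    fix y assume "y \<in> boundaries X n +>\<^bsub>Obj X n\<^esub> x"
    then obtain b where "b \<in> boundaries X n" "y = b \<oplus>\<^bsub>Obj X n\<^esub> x" by (auto simp: mem_coset)
    then show "boundaries Y n +>\<^bsub>Obj Y n\<^esub> f n y = boundaries Y n +>\<^bsub>Obj Y n\<^esub> f n x"
      using x fb[of b n] Y by (subst coset_eq_iff) (auto simp: c(3,4) cyc sb)
  qed
  show ?thesis unfolding quasi_iso_def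
  proof (intro conjI allI f)
    fix n
    have "inj_on (homology_map Y f n) (carrier (homology n X))"
    proof (rule inj_onI)
      fix a a' assume "a \<in> carrier (homology n X)" "a' \<in> carrier (homology n X)"
        and eq: "homology_map Y f n a = homology_map Y f n a'"
      then obtain x x' where x: "x \<in> cycles X n" "x' \<in> cycles X n"
        and a: "a = boundaries X n +>\<^bsub>Obj X n\<^esub> x" "a' = boundaries X n +>\<^bsub>Obj X n\<^esub> x'"
        by (auto simp: carrier_homology X)
      obtain b where b: "b \<in> boundaries Y n" "f n x = b \<oplus>\<^bsub>Obj Y n\<^esub> f n x'"
        using eq coset_eq_iff[OF cpx_module[OF Y] sb(2)] x by (auto simp: a hm c(3) cyc)
      let ?z = "x \<oplus>\<^bsub>Obj X n\<^esub> \<ominus>\<^bsub>Obj X n\<^esub> x'"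
      have z: "?z \<in> cycles X n"
        using x sub_modD[OF sub_mod_cycles[OF X]] X by simp
      have "f n ?z = b"
        using x b Y X by (simp add: c cyc md_ac)
      then have "?z \<in> boundaries X n" using inj[OF z] b by simp
      moreover have "x = ?z \<oplus>\<^bsub>Obj X n\<^esub> x'" using x X by (simp add: cyc md_ac)
      ultimately show "a = a'" unfolding a
        using coset_eq_iff[OF cpx_module[OF X] sb(1)] x by (auto simp: cyc)
    qed
    moreover have "homology_map Y f n ` carrier (homology n X) = carrier (homology n Y)"
    proof
      show "homology_map Y f n ` carrier (homology n X) \<subseteq> carrier (homology n Y)"
        by (auto simp: carrier_homology X Y hm fz)
      show "carrier (homology n Y) \<subseteq> homology_map Y f n ` carrier (homology n X)"
      proof
        fix a assume "a \<in> carrier (homology n Y)"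
        then obtain y where y: "y \<in> cycles Y n" "a = boundaries Y n +>\<^bsub>Obj Y n\<^esub> y"
          by (auto simp: carrier_homology Y)
        obtain x b where "x \<in> cycles X n" "b \<in> boundaries Y n" "y = b \<oplus>\<^bsub>Obj Y n\<^esub> f n x"
          using sur[OF y(1)] by auto
        moreover from this have "a = homology_map Y f n (boundaries X n +>\<^bsub>Obj X n\<^esub> x)"
          unfolding y(2) hm[OF \<open>x \<in> _\<close>] using coset_eq_iff[OF cpx_module[OF Y] sb(2)] y(1)
          by (auto simp: cyc c(3))
        ultimately show "a \<in> homology_map Y f n ` carrier (homology n X)"
          by (auto simp: carrier_homology X)
      qed
    qed
    ultimately show "bij_betw (homology_map Y f n) (carrier (homology n X)) (carrier (homology n Y))"
      by (simp add: bij_betw_def)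
  qed
qed

end

subsection \<open>Short exact sequences\<close>

lemma path_append:
  "path R X Y p \<Longrightarrow> path R Y Z q \<Longrightarrow> path R X Z (p @ q)"
  by (induction rule: path.induct) (auto intro: path.intros)

context cring_complexes
begin

text \<open>Degreewise exact sequences stand in for exact triangles: by \<open>ses_cone_qis\<close>
  the third term is, up to quasi-isomorphism, the cone of the first map.\<close>

definition ses :: "('r, 'a) cx \<Rightarrow> ('r, 'b) cx \<Rightarrow> ('r, 'd) cx \<Rightarrow> (int \<Rightarrow> 'a \<Rightarrow> 'b) \<Rightarrow>
    (int \<Rightarrow> 'b \<Rightarrow> 'd) \<Rightarrow> bool" where
  "ses A B D f g \<longleftrightarrow> cmap A B f \<and> cmap B D g \<and>
    (\<forall>n. \<forall>a\<in>carrier (Obj A n). f n a = \<zero>\<^bsub>Obj B n\<^esub> \<longrightarrow> a = \<zero>\<^bsub>Obj A n\<^esub>) \<and>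
    (\<forall>n. \<forall>y\<in>carrier (Obj D n). \<exists>b\<in>carrier (Obj B n). y = g n b) \<and>
    (\<forall>n. \<forall>a\<in>carrier (Obj A n). g n (f n a) = \<zero>\<^bsub>Obj D n\<^esub>) \<and>
    (\<forall>n. \<forall>b\<in>carrier (Obj B n). g n b = \<zero>\<^bsub>Obj D n\<^esub> \<longrightarrow> (\<exists>a\<in>carrier (Obj A n). b = f n a))"

lemma sesD:
  assumes "ses A B D f g"
  shows "cmap A B f" "cmap B D g"
    "a \<in> carrier (Obj A n) \<Longrightarrow> f n a = \<zero>\<^bsub>Obj B n\<^esub> \<Longrightarrow> a = \<zero>\<^bsub>Obj A n\<^esub>"
    "y \<in> carrier (Obj D n) \<Longrightarrow> \<exists>b\<in>carrier (Obj B n). y = g n b"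
    "a \<in> carrier (Obj A n) \<Longrightarrow> g n (f n a) = \<zero>\<^bsub>Obj D n\<^esub>"
    "b \<in> carrier (Obj B n) \<Longrightarrow> g n b = \<zero>\<^bsub>Obj D n\<^esub> \<Longrightarrow> \<exists>a\<in>carrier (Obj A n). b = f n a"
  using assms by (auto simp: ses_def)

lemma ses_eqD:
  assumes S: "ses A B D f g" and a: "a \<in> carrier (Obj A n)" "a' \<in> carrier (Obj A n)" "f n a = f n a'"
  shows "a = a'"
proof -
  note c = cmapD[OF sesD(1)[OF S]]
  have "f n (a \<oplus>\<^bsub>Obj A n\<^esub> \<ominus>\<^bsub>Obj A n\<^esub> a') = \<zero>\<^bsub>Obj B n\<^esub>"
    using a c(1,2) by (simp add: c(3-7))
  then have "a \<oplus>\<^bsub>Obj A n\<^esub> \<ominus>\<^bsub>Obj A n\<^esub> a' = \<zero>\<^bsub>Obj A n\<^esub>"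
    by (rule sesD(3)[OF S, rotated]) (use a c(1) in simp)
  then show "a = a'" using a c(1) by (simp add: md_add_eq_zero)
      (metis cpx_module md_simps(7))
qed

lemma ses_diffD:
  assumes S: "ses A B D f g" and b: "b \<in> carrier (Obj B n)" "b' \<in> carrier (Obj B n)" "g n b = g n b'"
  obtains a where "a \<in> carrier (Obj A n)" "b = b' \<oplus>\<^bsub>Obj B n\<^esub> f n a"
proof -
  note c = cmapD[OF sesD(2)[OF S]]
  have "g n (b \<oplus>\<^bsub>Obj B n\<^esub> \<ominus>\<^bsub>Obj B n\<^esub> b') = \<zero>\<^bsub>Obj D n\<^esub>"
    using b c(1,2) by (simp add: c(3-7))
  then obtain a where "a \<in> carrier (Obj A n)" "b \<oplus>\<^bsub>Obj B n\<^esub> \<ominus>\<^bsub>Obj B n\<^esub> b' = f n a"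
    using sesD(6)[OF S, of "b \<oplus>\<^bsub>Obj B n\<^esub> \<ominus>\<^bsub>Obj B n\<^esub> b'" n] b c(1) by auto
  moreover from this have "b = b' \<oplus>\<^bsub>Obj B n\<^esub> f n a" using b c(1) by (simp flip: \<open>_ = f n a\<close>)
  ultimately show thesis using that by blast
qed

lemma ses_ker:
  assumes p: "cmap T Z p" and sur: "\<And>n. carrier (Obj Z n) \<subseteq> p n ` carrier (Obj T n)"
  shows "ses (ker_cx T Z p) T Z (\<lambda>n x. x) p"
proof -
  have "cmap (ker_cx T Z p) T (\<lambda>n x. x)"
    unfolding ker_cx_def by (intro cmap_sub subcomplex_ker p cmapD(1)[OF p])
  then show ?thesis using p sur unfolding ses_def by auto
qed

lemma ses_twist:
  assumes "cpx A" "cpx B" "cpx (twist A B h)"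
    and h: "\<And>n. h n \<in> mod_hom R (Obj A n) (Obj B (n - 1))"
  shows "ses B (twist A B h) A (\<lambda>n b. (\<zero>\<^bsub>Obj A n\<^esub>, b)) (\<lambda>n. fst)"
proof -
  have "\<exists>y. y \<in> carrier (Obj B n)" for n
    using md_closed(2)[OF cpx_module[OF assms(2)]] by blast
  then show ?thesis
    using assms(1-3) mod_homD[OF h] unfolding ses_def by (auto intro!: cmapI)
qed

lemma ses_cone:
  "cmap A B f \<Longrightarrow> ses B (cone A B f) (shift 1 A) (\<lambda>n b. (\<zero>\<^bsub>Obj A (n - 1)\<^esub>, b)) (\<lambda>n. fst)"
  using ses_twist[of "shift 1 A" B "\<lambda>n. f (n - 1)"] cpx_cone[of A B f] cmap_hom[of A B f]
  by (simp add: cone_eq_twist cmapD)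

lemma qisD:
  assumes "qis X Y f"
  shows "cmap X Y f" "x \<in> cycles X n \<Longrightarrow> f n x \<in> boundaries Y n \<Longrightarrow> x \<in> boundaries X n"
    "y \<in> cycles Y n \<Longrightarrow> \<exists>x\<in>cycles X n. \<exists>b\<in>boundaries Y n. y = b \<oplus>\<^bsub>Obj Y n\<^esub> f n x"
  using assms by (auto simp: qis_def)

lemma cmap_cycles: "cmap X Y f \<Longrightarrow> x \<in> cycles X n \<Longrightarrow> f n x \<in> cycles Y n"
  by (auto simp: mem_cycles cmapD(3) cmapD(6) cmapD(8)[symmetric])

lemma cmap_boundaries: "cmap X Y f \<Longrightarrow> x \<in> boundaries X n \<Longrightarrow> f n x \<in> boundaries Y n"
  by (force simp: mem_boundaries cmapD(3) cmapD(8))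

lemma qis_comp:
  assumes f: "qis X Y f" and g: "qis Y Z g" shows "qis X Z (\<lambda>n x. g n (f n x))"
  unfolding qis_def
proof (intro conjI allI ballI impI)
  note f' = qisD(1)[OF f] and g' = qisD(1)[OF g]
  show "cmap X Z (\<lambda>n x. g n (f n x))" using cmap_comp[OF f' g'] .
  show "x \<in> boundaries X n" if "x \<in> cycles X n" "g n (f n x) \<in> boundaries Z n" for x n
    using qisD(2)[OF f] qisD(2)[OF g] that cmap_cycles[OF f'] by blast
  fix n z assume "z \<in> cycles Z n"
  then obtain y b where y: "y \<in> cycles Y n" "b \<in> boundaries Z n" "z = b \<oplus>\<^bsub>Obj Z n\<^esub> g n y"
    using qisD(3)[OF g] by blast
  then obtain x b' where x: "x \<in> cycles X n" "b' \<in> boundaries Y n" "y = b' \<oplus>\<^bsub>Obj Y n\<^esub> f n x"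
    using qisD(3)[OF f] by blast
  have s: "sub_mod (Obj Z n) (boundaries Z n)" "sub_mod (Obj Y n) (boundaries Y n)"
    using sub_mod_boundaries cmapD(2)[OF f'] cmapD(2)[OF g'] by auto
  show "\<exists>x\<in>cycles X n. \<exists>b\<in>boundaries Z n. z = b \<oplus>\<^bsub>Obj Z n\<^esub> g n (f n x)"
  proof (intro bexI)
    show "z = (b \<oplus>\<^bsub>Obj Z n\<^esub> g n b') \<oplus>\<^bsub>Obj Z n\<^esub> g n (f n x)"
      using x y sub_modD(2)[OF s(1)] sub_modD(2)[OF s(2)] cmapD(2)[OF g'] cmapD(3)[OF f']
      by (simp add: mem_cycles cmapD(3,4)[OF g'] md_ac)
    show "b \<oplus>\<^bsub>Obj Z n\<^esub> g n b' \<in> boundaries Z n"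
      using sub_modD(4)[OF s(1)] x(2) y(2) cmap_boundaries[OF g'] by blast
  qed (rule x)
qed

lemma chain_iso_qis:
  assumes "chain_iso R X Y f" shows "qis X Y f"
  unfolding qis_def
proof (intro conjI allI ballI impI)
  note d = chain_isoD[OF assms] and i = chain_iso_inv[OF assms]
  show "cmap X Y f" by (rule d)
  show "x \<in> boundaries X n" if "x \<in> cycles X n" "f n x \<in> boundaries Y n" for x n
    using cmap_boundaries[OF d(2) that(2)] that(1) i(2) by (simp add: mem_cycles)
  fix n y assume y: "y \<in> cycles Y n"
  then show "\<exists>x\<in>cycles X n. \<exists>b\<in>boundaries Y n. y = b \<oplus>\<^bsub>Obj Y n\<^esub> f n x"
    using cmap_cycles[OF d(2) y] i(3)[of y n] cmapD(2)[OF d(1)] sub_modD(3)[OF sub_mod_boundaries[of Y n]]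
    by (intro bexI[of _ "iso_inv X f n y"] bexI[of _ "\<zero>\<^bsub>Obj Y n\<^esub>"]) (auto simp: mem_cycles)
qed

lemma ses_cone_qis:
  assumes S: "ses A B D f g"
  shows "qis (cone A B f) D (\<lambda>n p. g n (snd p))"
  unfolding qis_def
proof (intro conjI allI ballI impI)
  note s = sesD[OF S]
  note f = cmapD[OF s(1)] and g = cmapD[OF s(2)]
  note cone = cone_eq_twist[of A B f]
  show "cmap (cone A B f) D (\<lambda>n p. g n (snd p))"
    using cpx_cone[OF s(1)] f(1) g(1,2) unfolding cone
    by (intro cmapI) (auto simp: f(3-8) g(3-8) s(5))
  fix n p
  {
    assume p: "p \<in> cycles (cone A B f) n" and gb: "g n (snd p) \<in> boundaries D n"
    obtain a b where ab: "p = (a, b)" by force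
    have a: "a \<in> carrier (Obj A (n - 1))" "Diff A (n - 1) a = \<zero>\<^bsub>Obj A (n - 2)\<^esub>"
      and b: "b \<in> carrier (Obj B n)" "f (n - 1) a \<oplus>\<^bsub>Obj B (n - 1)\<^esub> Diff B n b = \<zero>\<^bsub>Obj B (n - 1)\<^esub>"
      using p f(1) unfolding ab cone by (auto simp: mem_cycles)
    \<comment> \<open>An element bounding \<open>g n b\<close> is lifted to \<open>b'\<close>; then
      \<open>b - d b'\<close> lies in the image of \<open>A\<close>, and its preimage
      \<open>a'\<close> is the missing first component of a bounding element.\<close>
    obtain y where y: "y \<in> carrier (Obj D (n + 1))" "g n b = Diff D (n + 1) y"
      using gb by (auto simp: mem_boundaries ab)
    obtain b' where b': "b' \<in> carrier (Obj B (n + 1))" "y = g (n + 1) b'" using s(4)[OF y(1)] by auto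
    then have "g n b = g n (Diff B (n + 1) b')" using y g(1) by (simp add: g(8))
    then obtain a' where a': "a' \<in> carrier (Obj A n)" "b = Diff B (n + 1) b' \<oplus>\<^bsub>Obj B n\<^esub> f n a'"
      using ses_diffD[OF S, of b n "Diff B (n + 1) b'"] b b' g(1) by auto
    have "f (n - 1) (\<ominus>\<^bsub>Obj A (n - 1)\<^esub> Diff A n a') = f (n - 1) a"
      using b(2) a a' b' f(1,2) by (simp add: f(3) f(7) f(8)) (simp add: md_minus_eqI f(3))
    then have "\<ominus>\<^bsub>Obj A (n - 1)\<^esub> Diff A n a' = a"
      using a a' f(1) by (intro ses_eqD[OF S, of _ "n - 1"]) auto
    then show "p \<in> boundaries (cone A B f) n"
      unfolding mem_boundaries ab cone using a' b' f(1,2)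
      by (intro bexI[of _ "(a', b')"]) (auto simp: md_ac f(3))
  }
  {
    assume p: "p \<in> cycles D n"
    obtain b where b: "b \<in> carrier (Obj B n)" "p = g n b" using s(4) p by (auto simp: mem_cycles)
    then have "g (n - 1) (Diff B n b) = \<zero>\<^bsub>Obj D (n - 1)\<^esub>" using p by (simp add: mem_cycles g(8))
    then obtain a where a: "a \<in> carrier (Obj A (n - 1))" "Diff B n b = f (n - 1) a"
      using s(6)[of "Diff B n b" "n - 1"] b g(1) by auto
    have "f (n - 2) (Diff A (n - 1) a) = \<zero>\<^bsub>Obj B (n - 2)\<^esub>"
      using a b f(2) by (simp add: f(8) flip: a(2))
    then have "Diff A (n - 1) a = \<zero>\<^bsub>Obj A (n - 2)\<^esub>"
      using s(3)[of "Diff A (n - 1) a" "n - 2"] a f(1) by auto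
    \<comment> \<open>The sign is forced by the second component \<open>f x + d b\<close> of the
      cone differential, since here \<open>d b = f a\<close>.\<close>
    then have "(\<ominus>\<^bsub>Obj A (n - 1)\<^esub> a, b) \<in> cycles (cone A B f) n"
      unfolding mem_cycles cone using a b f(1,2) by (auto simp: f(3) f(7))
    then show "\<exists>x\<in>cycles (cone A B f) n. \<exists>b\<in>boundaries D n. p = b \<oplus>\<^bsub>Obj D n\<^esub> g n (snd x)"
      using b sub_modD(3)[OF sub_mod_boundaries[OF g(2)], of n] g(2)
      by (intro bexI[of _ "\<zero>\<^bsub>Obj D n\<^esub>"] bexI[of _ "(\<ominus>\<^bsub>Obj A (n - 1)\<^esub> a, b)"]) (auto simp: g(3))
  }
qed

text \<open>A piece of the long exact homology sequence, chased by hand: an element of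
  \<open>D\<close> that bounds a cycle is lifted to \<open>B\<close>, and its boundary is
  subtracted.\<close>

lemma ses_acyclic_qis:
  assumes S: "ses A B D f g" and D: "acyclic_cx D"
  shows "qis A B f"
  unfolding qis_def
proof (intro conjI allI ballI impI)
  note s = sesD[OF S]
  note f = cmapD[OF s(1)] and g = cmapD[OF s(2)]
  have D: "y \<in> cycles D n \<Longrightarrow> \<exists>b\<in>carrier (Obj B (n + 1)). y = g n (Diff B (n + 1) b)" for y n
    using D s(4)[of _ "n + 1"] by (fastforce simp: acyclic_cx_def mem_boundaries subset_iff g(8))
  show "cmap A B f" by (rule s)
  fix n
  show "a \<in> boundaries A n" if a: "a \<in> cycles A n" "f n a \<in> boundaries B n" for a
  proof -
    obtain b where b: "b \<in> carrier (Obj B (n + 1))" "f n a = Diff B (n + 1) b"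
      using a by (auto simp: mem_boundaries)
    have "Diff D (n + 1) (g (n + 1) b) = g n (f n a)" using b by (simp add: g(8))
    also have "\<dots> = \<zero>\<^bsub>Obj D n\<^esub>" using s(5) a by (simp add: mem_cycles)
    finally have "g (n + 1) b \<in> cycles D (n + 1)" using b by (simp add: mem_cycles g(3))
    then obtain b' where b': "b' \<in> carrier (Obj B (n + 2))" "g (n + 1) b = g (n + 1) (Diff B (n + 2) b')"
      using D[of "g (n + 1) b" "n + 1"] by (auto simp: add.commute[of 2 n])
    then obtain a' where a': "a' \<in> carrier (Obj A (n + 1))"
        "b = Diff B (n + 2) b' \<oplus>\<^bsub>Obj B (n + 1)\<^esub> f (n + 1) a'"
      using ses_diffD[OF S, of b "n + 1" "Diff B (n + 2) b'"] b g(1) by auto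
    have "f n a = f n (Diff A (n + 1) a')" 
      using a' b' b(2) f(2) by (simp add: f(3) f(8))
    then have "a = Diff A (n + 1) a'"
      using a a' f(1) by (intro ses_eqD[OF S, of _ n]) (auto simp: mem_cycles)
    then show ?thesis using a' by (auto simp: mem_boundaries)
  qed
  show "\<exists>x\<in>cycles A n. \<exists>c\<in>boundaries B n. b = c \<oplus>\<^bsub>Obj B n\<^esub> f n x" if b: "b \<in> cycles B n" for b
  proof -
    have "g n b \<in> cycles D n" using cmap_cycles[OF s(2) b] .
    then obtain b' where b': "b' \<in> carrier (Obj B (n + 1))" "g n b = g n (Diff B (n + 1) b')"
      using D by blast
    then obtain a where a: "a \<in> carrier (Obj A n)" "b = Diff B (n + 1) b' \<oplus>\<^bsub>Obj B n\<^esub> f n a"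
      using ses_diffD[OF S, of b n "Diff B (n + 1) b'"] b g(1) by (auto simp: mem_cycles)
    have "f (n - 1) (Diff A n a) = \<zero>\<^bsub>Obj B (n - 1)\<^esub>"
      using a b b' f(2) by (simp add: f(3) f(8) mem_cycles)
    then have "Diff A n a = \<zero>\<^bsub>Obj A (n - 1)\<^esub>"
      using s(3)[of "Diff A n a" "n - 1"] a f(1) by auto
    then show ?thesis
      using a b' by (intro bexI[of _ a] bexI[of _ "Diff B (n + 1) b'"]) (auto simp: mem_cycles mem_boundaries)
  qed
qed

lemma small_image:
  "\<lbrakk>small_cx U B; \<And>n. carrier (Obj D n) \<subseteq> g n ` carrier (Obj B n)\<rbrakk> \<Longrightarrow> small_cx U D"
  unfolding small_cx_def by (meson lepoll_trans subset_image_lepoll)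

lemma small_iso: "chain_iso R X Y f \<Longrightarrow> small_cx U X \<longleftrightarrow> small_cx U Y"
  using small_image[of U X Y f] small_image[of U Y X "iso_inv X f"] chain_isoD(4)[of X Y f] 
    chain_isoD(4)[OF chain_iso_inv(1)] by blast

lemma small_UNIV [simp]: "small_cx (C :: ('r, 'u) cx set) (X :: ('r, 'u) cx)"
  by (auto simp: small_cx_def intro: subset_imp_lepoll)

lemma qis_path_iso:
  assumes "qis X Y f" shows "path_iso R X Y [Map X f Y]" "path_iso R Y X [Inv X f Y]"
proof -
  have q: "quasi_iso R X Y f" "cmap X Y f" "cpx X" "cpx Y"
    using qis_quasi_iso[OF assms] qisD(1)[OF assms] cmapD[OF qisD(1)[OF assms]] by auto
  have "path R X Y [Map X f Y]" "path R Y X [Inv X f Y]"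
    using q by (auto intro!: path.intros)
  then show "path_iso R X Y [Map X f Y]" "path_iso R Y X [Inv X f Y]"
    using path_eq.inv_right[OF q(1)] path_eq.inv_left[OF q(1)] unfolding path_iso_def by auto
qed

end

section \<open>Closure of a cellular class under isomorphisms and short exact sequences\<close>

locale cellular = cring_complexes R for R :: "('r, 's) ring_scheme" (structure) +
  fixes C :: "('r, 'u) cx set"
  assumes cellular: "cellular_class R C"
    and infinite_u: "infinite (UNIV :: 'u set)"
begin

abbreviation "small X \<equiv> small_cx C X"

lemma cell_cpx: "X \<in> C \<Longrightarrow> cpx X"
  using cellular[unfolded cellular_class_def, THEN conjunct2, THEN conjunct1] by blast

text \<open>A triangle isomorphic to the standard one is written down with empty paths at
  \<open>A\<close> and \<open>B\<close>; only the third vertex is moved, by composing the inclusion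
  of the cone with the inverse of \<open>c\<close> and its projection with \<open>c\<close>.\<close>

lemma cell_cone:
  assumes AB: "A \<in> C" "B \<in> C" and f: "cmap A B f"
    and iso: "chain_iso R (cone A B f) K \<phi>" and c: "path_iso R Z K c"
  shows "Z \<in> C"
proof -
  define j where "j = (\<lambda>n b. \<phi> n (\<zero>\<^bsub>Obj A (n - 1)\<^esub>, b))"
  define q where "q = (\<lambda>n k. fst (iso_inv (cone A B f) \<phi> n k))"
  note s = sesD[OF ses_cone[OF f]] and d = chain_isoD[OF iso] and i = chain_iso_inv[OF iso]
  have jq: "cmap B K j" "cmap K (shift 1 A) q"
    unfolding j_def q_def using cmap_comp[OF s(1) d(1)] cmap_comp[OF d(2) s(2)] by auto
  note cp = cmapD(1,2)[OF f] cmapD(2)[OF jq(1)]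
  have "carrier (Obj (cone A B f) n) = carrier (Obj A (n - 1)) \<times> carrier (Obj B n)" for n
    by (simp add: cone_eq_twist)
  then have tri: "cone_triangle R A B K f j q"
    unfolding cone_triangle_def using f jq iso i(2) by (auto simp: j_def q_def intro!: exI[of _ \<phi>])
  obtain c' where c': "path R Z K c" "path R K Z c'" "path_eq R Z Z (c @ c') []" "path_eq R K K (c' @ c) []"
    using c by (auto simp: path_iso_def)
  have p: "path R A B [Map A f B]" "path R B K [Map B j K]" "path R K (shift 1 A) [Map K q (shift 1 A)]"
    using f jq cp by (auto intro!: path.intros)
  have id: "path_iso R A A []" "path_iso R B B []"
    using cp by (auto simp: path_iso_def intro!: path.intros path_eq.refl exI[of _ "[]"])
  have "path_eq R B K ([Map B j K] @ (c' @ c)) ([Map B j K] @ [])"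
    by (rule path_eq.append[OF path_eq.refl[OF p(2)] c'(4)])
  then have e2: "path_eq R B K (([Map B j K] @ c') @ c) ([] @ [Map B j K])" by simp
  have e1: "path_eq R A B ([Map A f B] @ []) ([] @ [Map A f B])"
    using path_eq.refl[OF p(1)] by simp
  have w: "path R Z (shift 1 A) (c @ [Map K q (shift 1 A)])" by (rule path_append[OF c'(1) p(3)])
  have e3: "path_eq R Z (shift 1 A) ((c @ [Map K q (shift 1 A)]) @ map susp_arrow [])
      (c @ [Map K q (shift 1 A)])"
    using path_eq.refl[OF w] by simp
  have "exact_triangle R A B Z [Map A f B] ([Map B j K] @ c') (c @ [Map K q (shift 1 A)])"
    unfolding exact_triangle_def
    by (intro conjI p(1) path_append[OF p(2) c'(2)] w, rule exI[of _ A], rule exI[of _ B],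
        rule exI[of _ K], rule exI[of _ f], rule exI[of _ j], rule exI[of _ q], rule exI[of _ "[]"],
        rule exI[of _ "[]"], rule exI[of _ c], intro conjI tri id c e1 e2 e3)
  then show ?thesis
    using AB cellular[unfolded cellular_class_def, THEN conjunct2, THEN conjunct2, THEN conjunct2,
      rule_format, of A B Z] by simp
qed

lemma cell_dsum:
  "(\<And>i. i \<in> I \<Longrightarrow> X i \<in> C) \<Longrightarrow> chain_iso R (dsum_cx (I :: 'u set) X) Y \<phi> \<Longrightarrow> Y \<in> C"
  using cellular[unfolded cellular_class_def, THEN conjunct2, THEN conjunct2, THEN conjunct1,
    rule_format, of I X Y \<phi>] by simp

text \<open>The empty direct sum belongs to every cellular class. The family of summands may be
  \<open>undefined\<close>, because the index set has no element.\<close>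

lemma cell_zero:
  obtains Z where "Z \<in> C" "\<And>n. carrier (Obj Z n) = {\<zero>\<^bsub>Obj Z n\<^esub>}"
proof -
  let ?D = "dsum_cx ({} :: 'u set) (\<lambda>_. undefined) :: ('r, 'u \<Rightarrow> 'u) cx"
  have "small ?D" by (simp add: small_cx_def lepoll_def)
  moreover have "cpx ?D" by (rule cpx_dsum) simp
  ultimately obtain Z :: "('r, 'u) cx" and g where g: "chain_iso R ?D Z g"
    using small_copy[of ?D C] by blast
  have D: "carrier (Obj ?D n) = {\<zero>\<^bsub>Obj ?D n\<^esub>}" for n by auto
  have "carrier (Obj Z n) = {\<zero>\<^bsub>Obj Z n\<^esub>}" for n
    unfolding chain_isoD(4)[OF g, of n, symmetric] D cmapD(6)[OF chain_isoD(1)[OF g], of n, symmetric]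
    by (rule image_insert[of _ _ "{}", unfolded image_empty])
  moreover have "Z \<in> C" using cell_dsum[OF _ g] by simp
  ultimately show thesis using that by blast
qed

text \<open>\<open>Y\<close> is the cone of the map from a zero complex of \<open>C\<close>, and
  closure under cones allows the third vertex of a triangle to be any object isomorphic to the
  cone.\<close>

lemma cell_path_iso:
  assumes Y: "Y \<in> C" and c: "path_iso R Z Y c" shows "Z \<in> C"
proof -
  obtain N where N: "N \<in> C" "\<And>n. carrier (Obj N n) = {\<zero>\<^bsub>Obj N n\<^esub>}" using cell_zero by blast
  let ?f = "\<lambda>n x. \<zero>\<^bsub>Obj Y n\<^esub>"
  have f: "cmap N Y ?f" using N Y cell_cpx cmap_zero by blast
  have "cmap (cone N Y ?f) Y (\<lambda>n. snd)"
    using cpx_cone[OF f] cell_cpx[OF N(1)] cell_cpx[OF Y] unfolding cone_eq_twist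
    by (intro cmapI) auto
  then have "chain_iso R (cone N Y ?f) Y (\<lambda>n. snd)"
    by (rule chain_isoI) (auto simp: cone_eq_twist N(2))
  from cell_cone[OF N(1) Y f this c] show ?thesis .
qed

lemma cell_qis:
  assumes "qis Y Z f" shows "Y \<in> C \<longleftrightarrow> Z \<in> C"
  using qis_path_iso[OF assms] cell_path_iso by blast

lemma small_twist: "small A \<Longrightarrow> small B \<Longrightarrow> small (twist A B h)"
proof -
  have "(UNIV :: 'u set) \<times> (UNIV :: 'u set) \<approx> (UNIV :: 'u set)"
    using card_of_Times_same_infinite[OF infinite_u] eqpoll_iff_card_of_ordIso by blast
  then show "small A \<Longrightarrow> small B \<Longrightarrow> small (twist A B h)"
    unfolding small_cx_def
    by (auto intro: lepoll_trans[OF times_lepoll_mono eqpoll_imp_lepoll])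
qed

lemma small_shift: "small A \<Longrightarrow> small (shift k A)"
  by (simp add: small_cx_def)

lemma small_subset: "small A \<Longrightarrow> (\<And>n. carrier (Obj B n) \<subseteq> carrier (Obj A n)) \<Longrightarrow> small B"
  by (rule small_image[of C A B "\<lambda>n x. x"]) auto

text \<open>The cone of \<open>f\<close> is copied into the universe; it is quasi-isomorphic to
  \<open>D\<close>.\<close>

lemma cell_ses:
  assumes S: "ses A B D f g" and AB: "A \<in> C" "B \<in> C" shows "D \<in> C"
proof -
  have "small (cone A B f)"
    unfolding cone_eq_twist by (intro small_twist small_shift small_UNIV)
  then obtain K :: "('r, 'u) cx" and \<phi> where \<phi>: "chain_iso R (cone A B f) K \<phi>"
    using small_copy[OF cpx_cone[OF sesD(1)[OF S]]] by blast
  have "qis K D (\<lambda>n x. g n (snd (iso_inv (cone A B f) \<phi> n x)))"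
    using qis_comp[OF chain_iso_qis[OF chain_iso_inv(1)[OF \<phi>]] ses_cone_qis[OF S]] .
  from cell_cone[OF AB sesD(1)[OF S] \<phi> qis_path_iso(2)[OF this]] show ?thesis .
qed

text \<open>Membership up to isomorphism, for complexes with elements of any type. It is what allows
  cones, products and tensor products to be handled without naming a copy each time.\<close>

definition in_cell :: "('r, 'm) cx \<Rightarrow> bool" where
  "in_cell X \<longleftrightarrow> (\<exists>Y \<phi>. chain_iso R X Y \<phi> \<and> Y \<in> C)"

lemma in_cell_iff: "in_cell X \<longleftrightarrow> X \<in> C" for X :: "('r, 'u) cx"
  unfolding in_cell_def using cell_qis chain_iso_qis chain_iso_id cell_cpx by metis

lemma in_cell_iso:
  assumes "chain_iso R X Y f" shows "in_cell X \<longleftrightarrow> in_cell Y"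
  unfolding in_cell_def using chain_iso_trans assms chain_iso_inv(1) by metis

lemma in_cell_small: "in_cell X \<Longrightarrow> small X"
  unfolding in_cell_def using small_iso small_UNIV by blast

lemma in_cell_cpx: "in_cell X \<Longrightarrow> cpx X"
  unfolding in_cell_def using chain_isoD(1) cmapD(1) by blast

lemma in_cell_qis:
  assumes f: "qis X Y f" and s: "small X" "small Y" shows "in_cell X \<longleftrightarrow> in_cell Y"
proof -
  note c = cmapD(1,2)[OF qisD(1)[OF f]]
  obtain X' :: "('r, 'u) cx" and a where a: "chain_iso R X X' a" using small_copy c s by blast
  obtain Y' :: "('r, 'u) cx" and b where b: "chain_iso R Y Y' b" using small_copy c s by blast
  have "qis X' Y' (\<lambda>n x. b n (f n (iso_inv X a n x)))"
    using qis_comp[OF chain_iso_qis[OF chain_iso_inv(1)[OF a]] qis_comp[OF f chain_iso_qis[OF b]]] .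
  from cell_qis[OF this] show ?thesis
    using in_cell_iso[OF a] in_cell_iso[OF b] by (simp add: in_cell_iff)
qed

lemma ses_iso:
  assumes S: "ses A B D f g" and a: "chain_iso R A A' a" and b: "chain_iso R B B' b" and d: "chain_iso R D D' d"
  shows "ses A' B' D' (\<lambda>n x. b n (f n (iso_inv A a n x))) (\<lambda>n x. d n (g n (iso_inv B b n x)))"
proof -
  note s = sesD[OF S]
  note ca = chain_isoD[OF a] and cb = chain_isoD[OF b] and cd = chain_isoD[OF d]
  note ia = chain_iso_inv[OF a] and ib = chain_iso_inv[OF b] and id = chain_iso_inv[OF d]
  note f = cmapD(3,6)[OF s(1)] and g = cmapD(3,6)[OF s(2)]
  note a' = cmapD(3,6)[OF ca(1)] and b' = cmapD(3,6)[OF cb(1)] and d' = cmapD(3,6)[OF cd(1)]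
  note a'' = cmapD(6)[OF ca(2)] and b'' = cmapD(6)[OF cb(2)] and d'' = cmapD(6)[OF cd(2)]
  have z: "x = \<zero>\<^bsub>Obj B n\<^esub>" if "x \<in> carrier (Obj B n)" "b n x = \<zero>\<^bsub>Obj B' n\<^esub>" for n x
    using ib(2)[OF that(1)] that(2) b''[of n] by simp
  have z2: "x = \<zero>\<^bsub>Obj A' n\<^esub>" if "x \<in> carrier (Obj A' n)" "iso_inv A a n x = \<zero>\<^bsub>Obj A n\<^esub>" for n x
    using ia(3)[OF that(1)] that(2) a'(2)[of n] by simp
  have z3: "x = \<zero>\<^bsub>Obj D n\<^esub>" if "x \<in> carrier (Obj D n)" "d n x = \<zero>\<^bsub>Obj D' n\<^esub>" for n x
    using id(2)[OF that(1)] that(2) d''[of n] by simp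
  show ?thesis unfolding ses_def
  proof (intro conjI allI ballI impI)
    show "cmap A' B' (\<lambda>n x. b n (f n (iso_inv A a n x)))"
      using cmap_comp[OF ca(2) cmap_comp[OF s(1) cb(1)]] .
    show "cmap B' D' (\<lambda>n x. d n (g n (iso_inv B b n x)))"
      using cmap_comp[OF cb(2) cmap_comp[OF s(2) cd(1)]] .
    fix n
    show "x = \<zero>\<^bsub>Obj A' n\<^esub>" if "x \<in> carrier (Obj A' n)" "b n (f n (iso_inv A a n x)) = \<zero>\<^bsub>Obj B' n\<^esub>" for x
      using z2[OF that(1)] s(3)[OF ia(4)[OF that(1)]] z[OF f(1)[OF ia(4)[OF that(1)]] that(2)] by blast
    show "\<exists>x\<in>carrier (Obj B' n). y = d n (g n (iso_inv B b n x))" if y: "y \<in> carrier (Obj D' n)" for y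
    proof -
      obtain x where x: "x \<in> carrier (Obj B n)" "iso_inv D d n y = g n x" using s(4)[OF id(4)[OF y]] by blast
      then show ?thesis using b'(1)[OF x(1)] ib(2)[OF x(1)] id(3)[OF y] by (intro bexI[of _ "b n x"]) simp_all
    qed
    show "d n (g n (iso_inv B b n (b n (f n (iso_inv A a n x))))) = \<zero>\<^bsub>Obj D' n\<^esub>"
      if x: "x \<in> carrier (Obj A' n)" for x
      using ib(2)[OF f(1)[OF ia(4)[OF x]]] s(5)[OF ia(4)[OF x]] d'(2) by simp
    show "\<exists>u\<in>carrier (Obj A' n). x = b n (f n (iso_inv A a n u))"
      if x: "x \<in> carrier (Obj B' n)" "d n (g n (iso_inv B b n x)) = \<zero>\<^bsub>Obj D' n\<^esub>" for x
    proof -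
      obtain u where u: "u \<in> carrier (Obj A n)" "iso_inv B b n x = f n u"
        using s(6)[OF ib(4)[OF x(1)]] z3[OF g(1)[OF ib(4)[OF x(1)]] x(2)] by blast
      then show ?thesis using a'(1)[OF u(1)] ia(2)[OF u(1)] ib(3)[OF x(1)]
        by (intro bexI[of _ "a n u"]) simp_all
    qed
  qed
qed

text \<open>\<open>D\<close> is small as an image of \<open>B\<close>, so that the whole sequence
  can be moved into the universe.\<close>

lemma in_cell_ses:
  assumes S: "ses A B D f g" and AB: "in_cell A" "in_cell B" shows "in_cell D"
proof -
  have "small D"
    by (rule small_image[OF in_cell_small[OF AB(2)], of _ g]) (use sesD(4)[OF S] in fast)
  then obtain D' :: "('r, 'u) cx" and d where d: "chain_iso R D D' d"
    using small_copy cmapD(2)[OF sesD(2)[OF S]] by blast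
  obtain A' B' a b where ab: "chain_iso R A A' a" "A' \<in> C" "chain_iso R B B' b" "B' \<in> C"
    using AB by (auto simp: in_cell_def)
  from cell_ses[OF ses_iso[OF S ab(1,3) d] ab(2,4)] show ?thesis
    using in_cell_iso[OF d] by (simp add: in_cell_iff)
qed

end

section \<open>Finite sums, cardinalities and countable direct sums\<close>

primrec msum :: "('r, 'm) module \<Rightarrow> (nat \<Rightarrow> 'm) \<Rightarrow> nat \<Rightarrow> 'm" where
  "msum M f 0 = \<zero>\<^bsub>M\<^esub>"
| "msum M f (Suc k) = msum M f k \<oplus>\<^bsub>M\<^esub> f k"

lemma lepoll_iff_ordLeq: "A \<lesssim> B \<longleftrightarrow> (card_of A, card_of B) \<in> ordLeq"
  using card_of_ordLeq[of A B] by (auto simp: lepoll_def)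

lemma lepoll_Times_infinite:
  assumes "infinite C" "A \<lesssim> C" "B \<lesssim> C" shows "A \<times> B \<lesssim> C"
proof -
  have "C \<times> C \<approx> C"
    using card_of_Times_same_infinite[OF assms(1)] eqpoll_iff_card_of_ordIso by blast
  then show ?thesis
    using lepoll_trans[OF times_lepoll_mono[OF assms(2,3)] eqpoll_imp_lepoll] by blast
qed

text \<open>Finite sets are the sets of entries of lists, and the lists form a countable union of
  finite powers of an infinite type.\<close>

lemma Fpow_lepoll:
  assumes "infinite (UNIV :: 'a set)" shows "Fpow (UNIV :: 'a set) \<lesssim> (UNIV :: 'a set)"
proof -
  have "{xs :: 'a list. length xs = n} \<lesssim> (UNIV :: 'a set)" for n
  proof (induction n)
    case 0
    then show ?case by (simp add: lepoll_def)
  next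
    case (Suc n)
    have "{xs :: 'a list. length xs = Suc n} = (\<lambda>(x, xs). x # xs) ` (UNIV \<times> {xs. length xs = n})"
      by (auto simp: length_Suc_conv image_iff)
    then show ?case
      using lepoll_trans[OF image_lepoll lepoll_Times_infinite[OF assms lepoll_refl Suc]] by simp
  qed
  moreover have "(UNIV :: nat set) \<lesssim> (UNIV :: 'a set)" using assms infinite_le_lepoll by blast
  ultimately have "(\<Union>n. {xs :: 'a list. length xs = n}) \<lesssim> (UNIV :: 'a set)"
    unfolding lepoll_iff_ordLeq by (intro card_of_UNION_ordLeq_infinite assms ballI)
  moreover have "(\<Union>n. {xs :: 'a list. length xs = n}) = UNIV" by auto
  ultimately have *: "(UNIV :: 'a list set) \<lesssim> (UNIV :: 'a set)" by simp
  have "Fpow (UNIV :: 'a set) \<subseteq> set ` UNIV" using finite_list by (force simp: Fpow_def)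
  from lepoll_trans[OF subset_image_lepoll[OF this] *] show ?thesis .
qed

context cring_complexes
begin

lemma msum_closed [simp]:
  "module R M \<Longrightarrow> (\<And>i. i < k \<Longrightarrow> f i \<in> carrier M) \<Longrightarrow> msum M f k \<in> carrier M"
  by (induction k) auto

lemma msum_add:
  "module R M \<Longrightarrow> (\<And>i. i < k \<Longrightarrow> f i \<in> carrier M) \<Longrightarrow> (\<And>i. i < k \<Longrightarrow> g i \<in> carrier M) \<Longrightarrow>
    msum M (\<lambda>i. f i \<oplus>\<^bsub>M\<^esub> g i) k = msum M f k \<oplus>\<^bsub>M\<^esub> msum M g k"
  by (induction k) (auto simp: md_ac)

lemma msum_hom:
  assumes "h \<in> mod_hom R M N" "module R M" "module R N" "\<And>i. i < k \<Longrightarrow> f i \<in> carrier M"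
  shows "h (msum M f k) = msum N (\<lambda>i. h (f i)) k"
  using assms(4) by (induction k) (auto simp: mod_homD[OF assms(1)] assms(2,3))

lemma msum_smult:
  "module R M \<Longrightarrow> r \<in> carrier R \<Longrightarrow> (\<And>i. i < k \<Longrightarrow> f i \<in> carrier M) \<Longrightarrow>
    r \<odot>\<^bsub>M\<^esub> msum M f k = msum M (\<lambda>i. r \<odot>\<^bsub>M\<^esub> f i) k"
  by (induction k) auto

lemma msum_cong:
  "(\<And>i. i < k \<Longrightarrow> f i = g i) \<Longrightarrow> msum M f k = msum M g k"
  by (induction k) auto

lemma msum_zero:
  "module R M \<Longrightarrow> (\<And>i. i < k \<Longrightarrow> f i = \<zero>\<^bsub>M\<^esub>) \<Longrightarrow> msum M f k = \<zero>\<^bsub>M\<^esub>"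
  by (induction k) auto

lemma msum_extend:
  assumes "module R M" "\<And>i. i < N \<Longrightarrow> f i \<in> carrier M" "\<And>i. N \<le> i \<Longrightarrow> f i = \<zero>\<^bsub>M\<^esub>" "N \<le> m"
  shows "msum M f m = msum M f N"
  using assms(4) by (induction m rule: dec_induct) (use assms(1-3) in auto)

end

context cellular
begin

lemma nat_lepoll: "(UNIV :: nat set) \<lesssim> (UNIV :: 'u set)"
  using infinite_u infinite_le_lepoll by blast

text \<open>An element of a direct sum is determined by the finite set of pairs of an index and a
  value over its support, and there are no more such finite sets than elements of the
  universe.\<close>

lemma small_dsum:
  assumes I: "I \<lesssim> (UNIV :: 'u set)" and X: "\<And>i. i \<in> I \<Longrightarrow> small (X i)"
  shows "small (dsum_cx I X)"
  unfolding small_cx_def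
proof
  fix n
  obtain \<iota> where \<iota>: "inj_on (\<iota> :: _ \<Rightarrow> 'u) I" using I by (auto simp: lepoll_def)
  have "\<forall>i\<in>I. \<exists>f :: _ \<Rightarrow> 'u. inj_on f (carrier (Obj (X i) n))"
    using X by (auto simp: small_cx_def lepoll_def)
  then obtain f where f: "\<And>i. i \<in> I \<Longrightarrow> inj_on (f i :: _ \<Rightarrow> 'u) (carrier (Obj (X i) n))" by metis
  let ?g = "\<lambda>x. (\<lambda>i. (\<iota> i, f i (x i))) ` {i \<in> I. x i \<noteq> \<zero>\<^bsub>Obj (X i) n\<^esub>}"
  have "inj_on ?g (carrier (Obj (dsum_cx I X) n))"
  proof (rule inj_onI)
    fix x y assume x: "x \<in> carrier (Obj (dsum_cx I X) n)" and y: "y \<in> carrier (Obj (dsum_cx I X) n)"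
      and eq: "?g x = ?g y"
    have *: "x i = y i" if x: "x \<in> carrier (Obj (dsum_cx I X) n)" and y: "y \<in> carrier (Obj (dsum_cx I X) n)"
      and eq: "?g x = ?g y" and i: "i \<in> I" and xi: "x i \<noteq> \<zero>\<^bsub>Obj (X i) n\<^esub>" for x y i
    proof -
      have "(\<iota> i, f i (x i)) \<in> ?g x" using i xi by blast
      then have "(\<iota> i, f i (x i)) \<in> ?g y" using eq by simp
      then obtain j where "j \<in> I" "\<iota> i = \<iota> j" "f i (x i) = f j (y j)" by auto
      moreover from this have "i = j" using \<iota> i by (auto dest: inj_onD)
      ultimately show ?thesis using inj_onD[OF f[OF i], of "x i" "y i"] x y i by auto
    qed
    show "x = y"
    proof (rule PiE_ext[of _ I "\<lambda>i. carrier (Obj (X i) n)"])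
      show "x \<in> (\<Pi>\<^sub>E i\<in>I. carrier (Obj (X i) n))" "y \<in> (\<Pi>\<^sub>E i\<in>I. carrier (Obj (X i) n))" using x y by auto
      show "x i = y i" if "i \<in> I" for i
        using *[OF x y eq that] *[OF y x eq[symmetric] that] by metis
    qed
  qed
  moreover have "?g ` carrier (Obj (dsum_cx I X) n) \<subseteq> Fpow UNIV" by (auto simp: Fpow_def)
  ultimately have 1: "carrier (Obj (dsum_cx I X) n) \<lesssim> Fpow (UNIV :: ('u \<times> 'u) set)"
    unfolding lepoll_def by blast
  have 2: "Fpow (UNIV :: ('u \<times> 'u) set) \<lesssim> (UNIV :: ('u \<times> 'u) set)"
    by (rule Fpow_lepoll) (simp add: finite_prod infinite_u)
  have 3: "(UNIV :: ('u \<times> 'u) set) \<lesssim> (UNIV :: 'u set)"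
    using lepoll_Times_infinite[OF infinite_u lepoll_refl lepoll_refl] by simp
  show "carrier (Obj (dsum_cx I X) n) \<lesssim> (UNIV :: 'u set)"
    using lepoll_trans[OF 1 lepoll_trans[OF 2 3]] .
qed

text \<open>A cellular class is closed under sums indexed by subsets of \<open>'u\<close>; an
  embedding of the natural numbers into the infinite universe carries the index set over.\<close>

lemma in_cell_dsum_nat:
  assumes X: "\<And>k :: nat. X k \<in> C" shows "in_cell (dsum_cx UNIV X)"
proof -
  obtain \<iota> :: "nat \<Rightarrow> 'u" where \<iota>: "inj \<iota>" using nat_lepoll by (auto simp: lepoll_def)
  let ?X = "\<lambda>u. X (inv_into UNIV \<iota> u)"
  let ?D = "dsum_cx (range \<iota>) ?X"
  let ?f = "\<lambda>(n :: int) x. \<lambda>u\<in>range \<iota>. x (inv_into UNIV \<iota> u)"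
  have cX: "cpx (X k)" for k using cell_cpx[OF X] .
  have D: "cpx ?D" and D': "cpx (dsum_cx UNIV X)" using cX by auto
  have sup: "{u \<in> range \<iota>. P (inv_into UNIV \<iota> u)} = \<iota> ` {k. P k}" for P using \<iota> by (auto simp: inv_f_f)
  have c: "cmap (dsum_cx UNIV X) ?D ?f"
  proof (rule cmapI[OF D' D])
    show "?f n x \<in> carrier (Obj ?D n)" if "x \<in> carrier (Obj (dsum_cx UNIV X) n)" for n x
      unfolding dsum_cx_simps restrict_dsum_mem
      using that by (auto simp: sup[of "\<lambda>k. x k \<noteq> \<zero>\<^bsub>Obj (X k) n\<^esub>"])
  qed (auto intro!: restrict_ext simp: \<iota>)
  have "chain_iso R (dsum_cx UNIV X) ?D ?f"
  proof (rule chain_isoI[OF c])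
    show "x = \<zero>\<^bsub>Obj (dsum_cx UNIV X) n\<^esub>" 
      if "x \<in> carrier (Obj (dsum_cx UNIV X) n)" "?f n x = \<zero>\<^bsub>Obj ?D n\<^esub>" for n x
    proof
      fix k
      show "x k = \<zero>\<^bsub>Obj (dsum_cx UNIV X) n\<^esub> k"
        using fun_cong[OF that(2), of "\<iota> k"] \<iota> by simp
    qed
    fix n y assume y: "y \<in> carrier (Obj ?D n)"
    then have "finite (\<iota> ` {k. y (\<iota> k) \<noteq> \<zero>\<^bsub>Obj (X k) n\<^esub>})"
      by (rule_tac finite_subset[of _ "{u \<in> range \<iota>. y u \<noteq> \<zero>\<^bsub>Obj (?X u) n\<^esub>}"]) (auto simp: \<iota>)
    then have fin: "finite {k. y (\<iota> k) \<noteq> \<zero>\<^bsub>Obj (X k) n\<^esub>}"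
      using \<iota> by (meson finite_imageD inj_on_subset subset_UNIV)
    have mem: "y (\<iota> k) \<in> carrier (Obj (X k) n)" for k
      using y \<iota> PiE_mem[of y "range \<iota>" "\<lambda>u. carrier (Obj (?X u) n)" "\<iota> k"] by simp
    have ext: "y \<in> extensional (range \<iota>)" using y by (auto simp: PiE_def)
    show "\<exists>x\<in>carrier (Obj (dsum_cx UNIV X) n). y = ?f n x"
    proof (rule bexI[of _ "\<lambda>k. y (\<iota> k)"])
      show "y = ?f n (\<lambda>k. y (\<iota> k))"
        by (rule extensionalityI[OF ext]) (auto simp: \<iota>)
      show "(\<lambda>k. y (\<iota> k)) \<in> carrier (Obj (dsum_cx UNIV X) n)"
        using mem fin by auto
    qed
  qed
  moreover have "small ?D"
    by (rule small_dsum) (auto intro: subset_imp_lepoll)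
  then obtain Y :: "('r, 'u) cx" and g where g: "chain_iso R ?D Y g"
    using small_copy[OF D, of C] by blast
  moreover have "Y \<in> C" using cell_dsum[OF _ g] X by blast
  ultimately show ?thesis unfolding in_cell_def using chain_iso_trans by blast
qed

text \<open>Sequential colimits: the cokernel of \<open>1 - shift\<close> on the direct sum. The hypothesis on kernels
  is stronger than needed, but it holds for unions and for the splitting of an idempotent.\<close>

lemma in_cell_colim:
  assumes X: "\<And>k :: nat. X k \<in> C" and e: "\<And>k. cmap (X k) (X (Suc k)) (e k)"
    and r: "\<And>k. cmap (X k) Y (r k)"
    and re: "\<And>k n x. x \<in> carrier (Obj (X k) n) \<Longrightarrow> r (Suc k) n (e k n x) = r k n x"
    and ker: "\<And>k n x. x \<in> carrier (Obj (X k) n) \<Longrightarrow> r k n x = \<zero>\<^bsub>Obj Y n\<^esub> \<Longrightarrow>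
      e k n x = \<zero>\<^bsub>Obj (X (Suc k)) n\<^esub>"
    and sur: "\<And>n y. y \<in> carrier (Obj Y n) \<Longrightarrow> \<exists>k. \<exists>x\<in>carrier (Obj (X k) n). y = r k n x"
  shows "in_cell Y"
proof -
  let ?S = "dsum_cx UNIV X"
  note cX = cell_cpx[OF X] and ce = cmapD(3-8)[OF e] and cr = cmapD(3-8)[OF r]
  have Y: "cpx Y" using cmapD(2)[OF r] .
  have S: "cpx ?S" using cX by auto
  have carr: "carrier (Obj ?S n) = {x. (\<forall>k. x k \<in> carrier (Obj (X k) n)) \<and>
      (\<exists>N. \<forall>k\<ge>N. x k = \<zero>\<^bsub>Obj (X k) n\<^esub>)}" for n
  proof -
    have "finite {k. x k \<noteq> \<zero>\<^bsub>Obj (X k) n\<^esub>} \<longleftrightarrow> (\<exists>N. \<forall>k\<ge>N. x k = \<zero>\<^bsub>Obj (X k) n\<^esub>)" for x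
      unfolding finite_nat_iff_bounded subset_iff mem_Collect_eq lessThan_iff not_le[symmetric] by blast
    then show ?thesis by (auto simp: PiE_iff)
  qed
  note carr = carr carr[unfolded dsum_cx_simps] and dsum_mod_simps(1) [simp del]
  have ops: "x \<oplus>\<^bsub>Obj ?S n\<^esub> y = (\<lambda>k. x k \<oplus>\<^bsub>Obj (X k) n\<^esub> y k)" "\<zero>\<^bsub>Obj ?S n\<^esub> = (\<lambda>k. \<zero>\<^bsub>Obj (X k) n\<^esub>)"
    "a \<odot>\<^bsub>Obj ?S n\<^esub> x = (\<lambda>k. a \<odot>\<^bsub>Obj (X k) n\<^esub> x k)" "Diff ?S n x = (\<lambda>k. Diff (X k) n (x k))"
    for n x y a by auto
  define \<sigma> where "\<sigma> = (\<lambda>n x k. case k of 0 \<Rightarrow> x 0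
    | Suc j \<Rightarrow> x (Suc j) \<oplus>\<^bsub>Obj (X (Suc j)) n\<^esub> \<ominus>\<^bsub>Obj (X (Suc j)) n\<^esub> e j n (x j))"
  have \<sigma>0: "\<sigma> n x 0 = x 0" and \<sigma>S: "\<sigma> n x (Suc j) =
      x (Suc j) \<oplus>\<^bsub>Obj (X (Suc j)) n\<^esub> \<ominus>\<^bsub>Obj (X (Suc j)) n\<^esub> e j n (x j)" for n x j
    by (auto simp: \<sigma>_def)
  have \<sigma>: "cmap ?S ?S \<sigma>"
  proof (rule cmapI[OF S S])
    show "\<sigma> n x \<in> carrier (Obj ?S n)" if x: "x \<in> carrier (Obj ?S n)" for n x
    proof -
      have "\<sigma> n x k \<in> carrier (Obj (X k) n)" for k
        using x cX by (cases k) (auto simp: carr \<sigma>0 \<sigma>S ce)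
      moreover obtain N where N: "\<And>k. k \<ge> N \<Longrightarrow> x k = \<zero>\<^bsub>Obj (X k) n\<^esub>"
        using x unfolding carr by blast
      then have "\<sigma> n x k = \<zero>\<^bsub>Obj (X k) n\<^esub>" if "k \<ge> Suc N" for k
        using that cX by (cases k) (auto simp: \<sigma>S ce)
      ultimately show ?thesis unfolding carr by blast
    qed
    show "\<sigma> n (x \<oplus>\<^bsub>Obj ?S n\<^esub> y) = \<sigma> n x \<oplus>\<^bsub>Obj ?S n\<^esub> \<sigma> n y"
      if "x \<in> carrier (Obj ?S n)" "y \<in> carrier (Obj ?S n)" for n x y
      unfolding ops(1)
    proof
      fix k show "\<sigma> n (\<lambda>k. x k \<oplus>\<^bsub>Obj (X k) n\<^esub> y k) k = \<sigma> n x k \<oplus>\<^bsub>Obj (X k) n\<^esub> \<sigma> n y k"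
        using that cX by (cases k) (auto simp: carr \<sigma>0 \<sigma>S ce md_ac)
    qed
    show "\<sigma> n (a \<odot>\<^bsub>Obj ?S n\<^esub> x) = a \<odot>\<^bsub>Obj ?S n\<^esub> \<sigma> n x"
      if "a \<in> carrier R" "x \<in> carrier (Obj ?S n)" for n a x
      unfolding ops(3)
    proof
      fix k show "\<sigma> n (\<lambda>k. a \<odot>\<^bsub>Obj (X k) n\<^esub> x k) k = a \<odot>\<^bsub>Obj (X k) n\<^esub> \<sigma> n x k"
        using that cX by (cases k) (auto simp: carr \<sigma>0 \<sigma>S ce)
    qed
    show "\<sigma> (n - 1) (Diff ?S n x) = Diff ?S n (\<sigma> n x)" if "x \<in> carrier (Obj ?S n)" for n x
      unfolding ops(4)
    proof
      fix k show "\<sigma> (n - 1) (\<lambda>k. Diff (X k) n (x k)) k = Diff (X k) n (\<sigma> n x k)"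
        using that cX by (cases k) (auto simp: carr \<sigma>0 \<sigma>S ce)
    qed
  qed
  \<comment> \<open>The sum over all \<open>k\<close>, cut off at the least bound of the support; by
    \<open>msum_extend\<close> every later bound gives the same value.\<close>
  define \<pi> where "\<pi> = (\<lambda>n x. msum (Obj Y n) (\<lambda>k. r k n (x k)) (LEAST N. \<forall>k\<ge>N. x k = \<zero>\<^bsub>Obj (X k) n\<^esub>))"
  have \<pi>: "\<pi> n x = msum (Obj Y n) (\<lambda>k. r k n (x k)) N"
    if x: "x \<in> carrier (Obj ?S n)" and N: "\<And>k. k \<ge> N \<Longrightarrow> x k = \<zero>\<^bsub>Obj (X k) n\<^esub>" for n x N
  proof -
    let ?P = "\<lambda>N. \<forall>k\<ge>N. x k = \<zero>\<^bsub>Obj (X k) n\<^esub>"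
    have "?P N" using N by blast
    then have L: "?P (LEAST N. ?P N)" "(LEAST N. ?P N) \<le> N" by (rule LeastI, rule Least_le)
    have "r k n (x k) \<in> carrier (Obj Y n)" for k using x by (simp add: carr cr)
    moreover have "r k n (x k) = \<zero>\<^bsub>Obj Y n\<^esub>" if "(LEAST N. ?P N) \<le> k" for k
      using L(1)[rule_format, OF that] by (simp only: cr)
    ultimately show ?thesis unfolding \<pi>_def
      by (intro msum_extend[symmetric] cpx_module[OF Y] L(2))
  qed
  have two: "\<exists>N. \<forall>k\<ge>N. x k = \<zero>\<^bsub>Obj (X k) n\<^esub> \<and> y k = \<zero>\<^bsub>Obj (X k) n\<^esub>"
    if xy: "x \<in> carrier (Obj ?S n)" "y \<in> carrier (Obj ?S n)" for n x y
  proof -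
    obtain N N' where "\<forall>k\<ge>N. x k = \<zero>\<^bsub>Obj (X k) n\<^esub>" "\<forall>k\<ge>N'. y k = \<zero>\<^bsub>Obj (X k) n\<^esub>"
      using xy unfolding carr by blast
    then show ?thesis by (intro exI[of _ "max N N'"]) simp
  qed
  have \<pi>c: "cmap ?S Y \<pi>"
  proof (rule cmapI[OF S Y])
    fix n x assume x: "x \<in> carrier (Obj ?S n)"
    obtain N where N: "\<And>k. k \<ge> N \<Longrightarrow> x k = \<zero>\<^bsub>Obj (X k) n\<^esub>" using x unfolding carr by blast
    have xk: "x k \<in> carrier (Obj (X k) n)" for k using x by (simp add: carr)
    have \<pi>x: "\<pi> n x = msum (Obj Y n) (\<lambda>k. r k n (x k)) N" by (rule \<pi>[OF x N])
    show "\<pi> n x \<in> carrier (Obj Y n)" using Y xk by (simp add: \<pi>x cr)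
    show "\<pi> n (a \<odot>\<^bsub>Obj ?S n\<^esub> x) = a \<odot>\<^bsub>Obj Y n\<^esub> \<pi> n x" if a: "a \<in> carrier R" for a
    proof -
      have "\<pi> n (a \<odot>\<^bsub>Obj ?S n\<^esub> x) = msum (Obj Y n) (\<lambda>k. r k n ((a \<odot>\<^bsub>Obj ?S n\<^esub> x) k)) N"
        by (rule \<pi>[OF md_closed(4)[OF cpx_module[OF S] a x]])
          (simp only: ops N md_simps(10)[OF cpx_module[OF cX] a])
      also have "\<dots> = a \<odot>\<^bsub>Obj Y n\<^esub> \<pi> n x"
        unfolding \<pi>x using a xk Y by (subst msum_smult) (auto simp: cr intro!: msum_cong)
      finally show ?thesis .
    qed
    show "\<pi> (n - 1) (Diff ?S n x) = Diff Y n (\<pi> n x)"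
    proof -
      have "\<pi> (n - 1) (Diff ?S n x) = msum (Obj Y (n - 1)) (\<lambda>k. r k (n - 1) (Diff ?S n x k)) N"
        by (rule \<pi>[OF Diff_simps(1)[OF S x HOL.refl]]) (simp only: ops N Diff_simps(4)[OF cX])
      also have "\<dots> = Diff Y n (\<pi> n x)"
        unfolding \<pi>x using xk Y
        by (subst msum_hom[OF Diff_hom[OF Y]]) (auto simp: cr intro!: msum_cong)
      finally show ?thesis .
    qed
    fix y assume y: "y \<in> carrier (Obj ?S n)"
    obtain M where M: "\<And>k. k \<ge> M \<Longrightarrow> x k = \<zero>\<^bsub>Obj (X k) n\<^esub>" "\<And>k. k \<ge> M \<Longrightarrow> y k = \<zero>\<^bsub>Obj (X k) n\<^esub>"
      using two[OF x y] by blast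
    have yk: "y k \<in> carrier (Obj (X k) n)" for k using y by (simp add: carr)
    have \<pi>xy: "\<pi> n x = msum (Obj Y n) (\<lambda>k. r k n (x k)) M"
      "\<pi> n y = msum (Obj Y n) (\<lambda>k. r k n (y k)) M"
      using \<pi>[OF x, of M] \<pi>[OF y, of M] M by blast+
    have "\<pi> n (x \<oplus>\<^bsub>Obj ?S n\<^esub> y) = msum (Obj Y n) (\<lambda>k. r k n ((x \<oplus>\<^bsub>Obj ?S n\<^esub> y) k)) M"
      by (rule \<pi>[OF md_closed(1)[OF cpx_module[OF S] x y]])
        (simp only: ops M md_simps(1)[OF cpx_module[OF cX]] md_closed(2)[OF cpx_module[OF cX]])
    also have "\<dots> = \<pi> n x \<oplus>\<^bsub>Obj Y n\<^esub> \<pi> n y"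
      unfolding \<pi>xy using xk yk Y
      by (subst msum_add[symmetric]) (auto simp: cr intro!: msum_cong)
    finally show "\<pi> n (x \<oplus>\<^bsub>Obj ?S n\<^esub> y) = \<pi> n x \<oplus>\<^bsub>Obj Y n\<^esub> \<pi> n y" .
  qed
  \<comment> \<open>The sum telescopes because \<open>r (Suc k)\<close> after \<open>e k\<close> is
    \<open>r k\<close>.\<close>
  have tel: "msum (Obj Y n) (\<lambda>k. r k n (\<sigma> n x k)) (Suc m) = r m n (x m)" if x: "x \<in> carrier (Obj ?S n)" for n x m
  proof (induction m)
    case 0
    then show ?case using x Y by (simp add: \<sigma>0 carr cr)
  next
    case (Suc m)
    have "x k \<in> carrier (Obj (X k) n)" for k using x by (simp add: carr)
    then show ?case unfolding msum.simps(2)[of _ _ "Suc m"] Suc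
      using cX Y by (simp add: \<sigma>S cr ce re)
  qed
  have "ses ?S ?S Y \<sigma> \<pi>" unfolding ses_def
  proof (intro conjI allI ballI impI \<sigma> \<pi>c)
    fix n x assume x: "x \<in> carrier (Obj ?S n)"
    have xk: "x k \<in> carrier (Obj (X k) n)" for k using x by (simp add: carr)
    obtain N where N: "\<And>k. k \<ge> N \<Longrightarrow> x k = \<zero>\<^bsub>Obj (X k) n\<^esub>" using x unfolding carr by blast
    show "x = \<zero>\<^bsub>Obj ?S n\<^esub>" if z: "\<sigma> n x = \<zero>\<^bsub>Obj ?S n\<^esub>"
    proof -
      have z: "\<sigma> n x k = \<zero>\<^bsub>Obj (X k) n\<^esub>" for k using fun_cong[OF z, of k] by simp
      have "x k = \<zero>\<^bsub>Obj (X k) n\<^esub>" for k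
      proof (induction k)
        case (Suc k)
        then show ?case using z[of "Suc k"] xk[of "Suc k"] cX by (simp add: \<sigma>S ce)
      qed (use z[of 0] \<sigma>0 in simp)
      then show ?thesis by (simp add: fun_eq_iff)
    qed
    show "\<pi> n (\<sigma> n x) = \<zero>\<^bsub>Obj Y n\<^esub>"
    proof -
      have "\<sigma> n x k = \<zero>\<^bsub>Obj (X k) n\<^esub>" if "k \<ge> Suc N" for k
        using that N cX by (cases k) (auto simp: \<sigma>S ce)
      then have "\<pi> n (\<sigma> n x) = msum (Obj Y n) (\<lambda>k. r k n (\<sigma> n x k)) (Suc N)"
        using cmapD(3)[OF \<sigma> x] by (intro \<pi>) auto
      then show ?thesis using tel[OF x, of N] N[of N] by (simp add: cr)
    qed
  next
    fix n y assume "y \<in> carrier (Obj Y n)"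
    then obtain k x where kx: "x \<in> carrier (Obj (X k) n)" "y = r k n x" using sur by blast
    let ?x = "\<lambda>j. if j = k then x else \<zero>\<^bsub>Obj (X j) n\<^esub>"
    have x: "?x \<in> carrier (Obj ?S n)" 
    proof -
      have "\<forall>j\<ge>Suc k. ?x j = \<zero>\<^bsub>Obj (X j) n\<^esub>" by simp
      moreover have "\<forall>j. ?x j \<in> carrier (Obj (X j) n)" using kx cX by simp
      ultimately show ?thesis unfolding carr by blast
    qed
    have "\<pi> n ?x = msum (Obj Y n) (\<lambda>j. r j n (?x j)) (Suc k)" by (rule \<pi>[OF x]) auto
    also have "\<dots> = y" using kx Y by (simp add: cr msum_zero)
    finally show "\<exists>x\<in>carrier (Obj ?S n). y = \<pi> n x" using x by metis
  next
    fix n y assume y: "y \<in> carrier (Obj ?S n)" and z: "\<pi> n y = \<zero>\<^bsub>Obj Y n\<^esub>"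
    obtain N where N: "\<And>k. k \<ge> N \<Longrightarrow> y k = \<zero>\<^bsub>Obj (X k) n\<^esub>" using y unfolding carr by blast
    have yk: "y k \<in> carrier (Obj (X k) n)" for k using y by (simp add: carr)
    \<comment> \<open>The equation \<open>\<sigma> x = y\<close> is solved by recursion. Beyond the
      support of \<open>y\<close> the image of \<open>x k\<close> in \<open>Y\<close> is the full
      sum \<open>\<pi> y\<close>, hence zero, and by \<open>ker\<close> the next term vanishes: the
      solution has finite support.\<close>
    define x where "x = rec_nat (y 0) (\<lambda>k z. y (Suc k) \<oplus>\<^bsub>Obj (X (Suc k)) n\<^esub> e k n z)"
    have x0: "x 0 = y 0" and xS: "x (Suc k) = y (Suc k) \<oplus>\<^bsub>Obj (X (Suc k)) n\<^esub> e k n (x k)" for k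
      by (auto simp: x_def)
    have xk: "x k \<in> carrier (Obj (X k) n)" for k
      by (induction k) (use yk cX in \<open>auto simp: x0 xS ce\<close>)
    have rx: "r k n (x k) = msum (Obj Y n) (\<lambda>k. r k n (y k)) (Suc k)" for k
    proof (induction k)
      case (Suc k)
      show ?case unfolding msum.simps(2)[of _ _ "Suc k"] Suc[symmetric]
        using yk xk cX Y by (simp add: xS cr ce re md_ac)
    qed (use yk Y in \<open>simp add: x0 cr\<close>)
    have "x (Suc k) = \<zero>\<^bsub>Obj (X (Suc k)) n\<^esub>" if "k \<ge> N" for k
    proof -
      have "r k n (x k) = \<zero>\<^bsub>Obj Y n\<^esub>"
        unfolding rx z[symmetric] by (rule \<pi>[OF y, symmetric]) (use that N in auto)
      then show ?thesis using ker[OF xk] N[of "Suc k"] that cX by (simp add: xS)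
    qed
    then have "x k = \<zero>\<^bsub>Obj (X k) n\<^esub>" if "k \<ge> Suc N" for k using that by (cases k) auto
    then have "x \<in> carrier (Obj ?S n)" using xk unfolding carr by blast
    moreover have "y k = \<sigma> n x k" for k
    proof (cases k)
      case (Suc j)
      then show ?thesis using yk[of k] xk[of j] cX by (simp add: \<sigma>S xS ce)
    qed (simp add: \<sigma>0 x0)
    then have "y = \<sigma> n x" by blast
    ultimately show "\<exists>x\<in>carrier (Obj ?S n). y = \<sigma> n x" by blast
  qed
  moreover have "in_cell ?S" by (rule in_cell_dsum_nat) (rule X)
  ultimately show ?thesis using in_cell_ses by blast
qed

text \<open>\<open>Y\<close> is the colimit of the constant sequence \<open>X\<close> under the
  idempotent \<open>i r\<close>; a kernel element of \<open>r\<close> is killed by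
  \<open>i r\<close> at once, as \<open>in_cell_colim\<close> demands.\<close>

lemma in_cell_retract:
  assumes X: "in_cell X" and i: "cmap Y X i" and r: "cmap X Y r"
    and ri: "\<And>n y. y \<in> carrier (Obj Y n) \<Longrightarrow> r n (i n y) = y"
  shows "in_cell Y"
proof -
  obtain X' a where a: "chain_iso R X X' a" "X' \<in> C" using X by (auto simp: in_cell_def)
  note d = chain_isoD(1,2)[OF a(1)] and ia = chain_iso_inv[OF a(1)]
  let ?r = "\<lambda>n x. r n (iso_inv X a n x)" and ?i = "\<lambda>n x. a n (i n x)"
  have c: "cmap X' Y ?r" "cmap Y X' ?i" using cmap_comp[OF d(2) r] cmap_comp[OF i d(1)] by auto
  have ri': "?r n (?i n y) = y" if "y \<in> carrier (Obj Y n)" for n y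
    using ri[OF that] ia(2)[OF cmapD(3)[OF i that]] by simp
  show ?thesis
  proof (rule in_cell_colim[of "\<lambda>_. X'" "\<lambda>_ n x. ?i n (?r n x)" Y "\<lambda>_. ?r"])
    show "cmap X' X' (\<lambda>n x. ?i n (?r n x))" using cmap_comp[OF c] .
    show "?r n (?i n (?r n x)) = ?r n x" if "x \<in> carrier (Obj X' n)" for n x
      using ri'[OF cmapD(3)[OF c(1) that]] .
    show "?i n (?r n x) = \<zero>\<^bsub>Obj X' n\<^esub>" if "?r n x = \<zero>\<^bsub>Obj Y n\<^esub>" for n x
      unfolding that using cmapD(6)[OF c(2)] .
    show "\<exists>k. \<exists>x\<in>carrier (Obj X' n). y = ?r n x" if "y \<in> carrier (Obj Y n)" for n y
      using ri'[OF that] cmapD(3)[OF c(2) that] by metis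
  qed (use a c in auto)
qed

end

section \<open>Absorbed complexes\<close>

context cellular
begin

text \<open>The absorbed complexes are the suspensions of the complexes acyclic with respect to \<open>C\<close>:
  unlike \<open>C\<close> they are closed under extensions.\<close>

definition absorbed :: "('r, 'm) cx \<Rightarrow> bool" where
  "absorbed Z \<longleftrightarrow> cpx Z \<and> small Z \<and> (\<forall>(T :: ('r, 'u) cx) p. cmap T Z p \<and>
    (\<forall>n. carrier (Obj Z n) \<subseteq> p n ` carrier (Obj T n)) \<and> ker_cx T Z p \<in> C \<longrightarrow> T \<in> C)"

lemma absorbed_cpx [simp]: "absorbed Z \<Longrightarrow> cpx Z"
  and absorbed_small: "absorbed Z \<Longrightarrow> small Z"
  by (auto simp: absorbed_def)

text \<open>An element of \<open>B\<close> is recovered from its image in \<open>D\<close> and the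
  element of \<open>A\<close> that corrects a chosen preimage.\<close>

lemma ses_small:
  assumes S: "ses A B D f g" and A: "small A" and D: "small D" shows "small B"
  unfolding small_cx_def
proof
  fix n
  note s = sesD[OF S]
  have "\<forall>y\<in>carrier (Obj D n). \<exists>b. b \<in> carrier (Obj B n) \<and> y = g n b" using s(4) by blast
  then obtain b where b: "\<And>y. y \<in> carrier (Obj D n) \<Longrightarrow> b y \<in> carrier (Obj B n) \<and> y = g n (b y)" by metis
  have "carrier (Obj B n) \<subseteq> (\<lambda>(y, a). b y \<oplus>\<^bsub>Obj B n\<^esub> f n a) ` (carrier (Obj D n) \<times> carrier (Obj A n))"
  proof
    fix x assume x: "x \<in> carrier (Obj B n)"
    then have y: "g n x \<in> carrier (Obj D n)" using cmapD(3)[OF s(2)] by blast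
    then obtain a where "a \<in> carrier (Obj A n)" "x = b (g n x) \<oplus>\<^bsub>Obj B n\<^esub> f n a"
      using ses_diffD[OF S x, of "b (g n x)"] b[OF y] by metis
    then show "x \<in> (\<lambda>(y, a). b y \<oplus>\<^bsub>Obj B n\<^esub> f n a) ` (carrier (Obj D n) \<times> carrier (Obj A n))"
      using y by (intro image_eqI[of _ _ "(g n x, a)"]) auto
  qed
  from lepoll_trans[OF subset_image_lepoll[OF this] lepoll_Times_infinite[OF infinite_u]]
  show "carrier (Obj B n) \<lesssim> (UNIV :: 'u set)"
    using A D by (auto simp: small_cx_def)
qed

lemma ker_cx_iso:
  assumes p: "cmap T Z p" and a: "chain_iso R T T' a" and z: "chain_iso R Z Z' z"
  shows "chain_iso R (ker_cx T Z p) (ker_cx T' Z' (\<lambda>n x. z n (p n (iso_inv T a n x)))) a"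
proof (rule chain_isoI)
  note d = chain_isoD[OF a] and i = chain_iso_inv[OF a] and c = cmapD[OF chain_isoD(1)[OF a]]
  note dz = chain_isoD[OF z] and iz = chain_iso_inv[OF z]
  have p': "cmap T' Z' (\<lambda>n x. z n (p n (iso_inv T a n x)))"
    using cmap_comp[OF d(2) cmap_comp[OF p dz(1)]] .
  show "cmap (ker_cx T Z p) (ker_cx T' Z' (\<lambda>n x. z n (p n (iso_inv T a n x)))) a"
    using cpx_ker[OF p] cpx_ker[OF p'] by (intro cmapI) (auto simp: c i(2) cmapD(6)[OF dz(1)])
  show "x = \<zero>\<^bsub>Obj (ker_cx T Z p) n\<^esub>"
    if "x \<in> carrier (Obj (ker_cx T Z p) n)" "a n x = \<zero>\<^bsub>Obj (ker_cx T' Z' (\<lambda>n x. z n (p n (iso_inv T a n x)))) n\<^esub>" for n x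
    using that i(2)[of x n] cmapD(6)[OF d(2), of n] by simp
  fix n y assume "y \<in> carrier (Obj (ker_cx T' Z' (\<lambda>n x. z n (p n (iso_inv T a n x)))) n)"
  then have y: "y \<in> carrier (Obj T' n)" "z n (p n (iso_inv T a n y)) = \<zero>\<^bsub>Obj Z' n\<^esub>" by auto
  have "p n (iso_inv T a n y) = iso_inv Z z n (z n (p n (iso_inv T a n y)))"
    using cmapD(3)[OF p i(4)[OF y(1)]] by (simp add: iz(2))
  also have "\<dots> = \<zero>\<^bsub>Obj Z n\<^esub>" using y(2) cmapD(6)[OF dz(2)] by simp
  finally show "\<exists>x\<in>carrier (Obj (ker_cx T Z p) n). y = a n x"
    using i(3,4)[OF y(1)] by (intro bexI[of _ "iso_inv T a n y"]) auto
qed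

lemma ses_ker_iso:
  assumes S: "ses A B D f g" shows "chain_iso R A (ker_cx B D g) f"
  using sesD[OF S] cmapD[OF sesD(1)[OF S]] cpx_ker[OF sesD(2)[OF S]]
  by (intro chain_isoI cmapI) auto

text \<open>The definition of \<open>absorbed\<close> quantifies over complexes with elements in the
  universe; copies extend it to middle terms of any type. \<open>absorbedI\<close> goes the other
  way and asks only for the universe.\<close>

lemma absorbedD:
  assumes Z: "absorbed Z" and S: "ses B T Z f p" and B: "in_cell B"
  shows "in_cell T"
proof -
  note s = sesD[OF S]
  have "small T" using ses_small[OF S in_cell_small[OF B] absorbed_small[OF Z]] .
  then obtain T' :: "('r, 'u) cx" and a where a: "chain_iso R T T' a"
    using small_copy cmapD(1)[OF s(2)] by blast
  note d = chain_isoD[OF a] and i = chain_iso_inv[OF a]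
  let ?p = "\<lambda>n x. p n (iso_inv T a n x)"
  have k: "chain_iso R B (ker_cx T' Z ?p) (\<lambda>n x. a n (f n x))"
    using chain_iso_trans[OF ses_ker_iso[OF S] ker_cx_iso[OF s(2) a chain_iso_id]] Z by simp
  then have "ker_cx T' Z ?p \<in> C" using in_cell_iso[OF k] B by (simp add: in_cell_iff)
  moreover have "cmap T' Z ?p" using cmap_comp[OF d(2) s(2)] .
  moreover have "carrier (Obj Z n) \<subseteq> ?p n ` carrier (Obj T' n)" for n
  proof
    fix y assume "y \<in> carrier (Obj Z n)"
    then obtain x where x: "x \<in> carrier (Obj T n)" "y = p n x" using s(4) by blast
    then show "y \<in> ?p n ` carrier (Obj T' n)"
      using i(2)[OF x(1)] cmapD(3)[OF d(1) x(1)] by (intro image_eqI[of _ _ "a n x"]) auto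
  qed
  ultimately have "T' \<in> C" using Z unfolding absorbed_def by blast
  then show ?thesis using in_cell_iso[OF a] by (simp add: in_cell_iff)
qed

lemma absorbedI:
  assumes "cpx Z" "small Z"
    and "\<And>(B :: ('r, 'u) cx) (T :: ('r, 'u) cx) f p. ses B T Z f p \<Longrightarrow> B \<in> C \<Longrightarrow> in_cell T"
  shows "absorbed Z"
  unfolding absorbed_def using assms(1,2) assms(3)[OF ses_ker] by (auto simp: in_cell_iff)

lemma in_cell_acyclic:
  assumes "cpx N" "small N" "acyclic_cx N" shows "in_cell N"
proof -
  obtain Z where Z: "Z \<in> C" "\<And>n. carrier (Obj Z n) = {\<zero>\<^bsub>Obj Z n\<^esub>}" using cell_zero by blast
  have cZ: "cpx Z" using cell_cpx[OF Z(1)] .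
  have "qis Z N (\<lambda>n x. \<zero>\<^bsub>Obj N n\<^esub>)"
    unfolding qis_def
  proof (intro conjI allI ballI impI cmap_zero cZ assms(1))
    show "x \<in> boundaries Z n" if "x \<in> cycles Z n" for n x
      using that sub_modD(3)[OF sub_mod_boundaries[OF cZ, of n]] Z(2) by (auto simp: mem_cycles)
    fix n y assume y: "y \<in> cycles N n"
    then have "y \<in> boundaries N n" using assms(3) by (auto simp: acyclic_cx_def)
    moreover have "y = y \<oplus>\<^bsub>Obj N n\<^esub> \<zero>\<^bsub>Obj N n\<^esub>" using y assms(1) by (simp add: mem_cycles)
    ultimately show "\<exists>x\<in>cycles Z n. \<exists>b\<in>boundaries N n. y = b \<oplus>\<^bsub>Obj N n\<^esub> \<zero>\<^bsub>Obj N n\<^esub>"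
      using sub_modD(3)[OF sub_mod_cycles[OF cZ, of n]] by blast
  qed
  then show ?thesis using in_cell_qis[OF _ small_UNIV assms(2)] Z(1) in_cell_iff by blast
qed

text \<open>If the quotient is acyclic, the inclusion of the kernel is a quasi-isomorphism.\<close>

lemma absorbed_acyclic:
  assumes "cpx N" "small N" "acyclic_cx N" shows "absorbed N"
proof (rule absorbedI[OF assms(1,2)])
  fix B T :: "('r, 'u) cx" and f p
  assume S: "ses B T N f p" and B: "B \<in> C"
  show "in_cell T"
    using in_cell_qis[OF ses_acyclic_qis[OF S assms(3)] small_UNIV small_UNIV] B by (simp add: in_cell_iff)
qed

text \<open>The identity of \<open>Z\<close> exhibits \<open>Z\<close> as an extension of itself by
  a zero complex.\<close>

lemma absorbed_in_cell:
  assumes Z: "absorbed Z" shows "in_cell Z"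
proof -
  let ?N = "ker_cx Z Z (\<lambda>n x. x)"
  have S: "ses ?N Z Z (\<lambda>n x. x) (\<lambda>n x. x)" using Z by (intro ses_ker) auto
  have "cpx ?N" using Z by simp
  from sub_modD(3)[OF sub_mod_boundaries[OF this]] have "acyclic_cx ?N"
    by (auto simp: acyclic_cx_def mem_cycles)
  moreover have "small ?N" using absorbed_small[OF Z] by (rule small_subset) auto
  ultimately have "in_cell ?N" using Z by (intro in_cell_acyclic) auto
  from absorbedD[OF Z S this] show ?thesis .
qed

text \<open>An extension \<open>T\<close> of \<open>B\<close> is built in two stages: the kernel of
  \<open>T \<rightarrow> D\<close> is an extension of \<open>A\<close> by the given member of
  \<open>C\<close>, and \<open>T\<close> is an extension of \<open>D\<close> by that kernel.\<close>

lemma absorbed_ext: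
  assumes S: "ses A B D f g" and A: "absorbed A" and D: "absorbed D"
  shows "absorbed B"
proof (rule absorbedI)
  note s = sesD[OF S] and cg = cmapD[OF sesD(2)[OF S]]
  show "cpx B" by (rule cg)
  show "small B" using ses_small[OF S absorbed_small[OF A] absorbed_small[OF D]] .
  fix N T :: "('r, 'u) cx" and a p
  assume N: "ses N T B a p" "N \<in> C"
  note n = sesD[OF N(1)] and cp = cmapD[OF sesD(2)[OF N(1)]]
  have gp: "cmap T D (\<lambda>n x. g n (p n x))" using cmap_comp[OF n(2) s(2)] .
  let ?K = "ker_cx T D (\<lambda>n x. g n (p n x))"
  have S1: "ses ?K T D (\<lambda>n x. x) (\<lambda>n x. g n (p n x))"
  proof (rule ses_ker[OF gp])
    show "carrier (Obj D n) \<subseteq> (\<lambda>x. g n (p n x)) ` carrier (Obj T n)" for n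
    proof
      fix y assume "y \<in> carrier (Obj D n)"
      then obtain b where b: "b \<in> carrier (Obj B n)" "y = g n b" using s(4) by blast
      obtain t where "t \<in> carrier (Obj T n)" "b = p n t" using n(4)[OF b(1)] by blast
      then show "y \<in> (\<lambda>x. g n (p n x)) ` carrier (Obj T n)" using b(2) by simp
    qed
  qed
  let ?j = "\<lambda>n x. iso_inv A f n (p n x)"
  note k = chain_isoD[OF ses_ker_iso[OF S]] and ik = chain_iso_inv[OF ses_ker_iso[OF S]]
  have "cmap ?K (ker_cx B D g) p"
    using cpx_ker[OF gp] cpx_ker[OF s(2)] by (intro cmapI) (auto simp: cp)
  then have j: "cmap ?K A ?j" using cmap_comp[OF _ k(2)] by blast
  have pk: "p n x \<in> carrier (Obj (ker_cx B D g) n)" if "x \<in> carrier (Obj ?K n)" for n x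
    using that cp(3) by auto
  have "ses N ?K A a ?j"
    unfolding ses_def
  proof (intro conjI allI ballI impI j)
    show "cmap N ?K a"
      using cpx_ker[OF gp] cmapD[OF n(1)] n(5) cg(6) by (intro cmapI) auto
    fix n' x assume "x \<in> carrier (Obj N n')" "a n' x = \<zero>\<^bsub>Obj ?K n'\<^esub>"
    then show "x = \<zero>\<^bsub>Obj N n'\<^esub>" using n(3) by simp
  next
    fix n' y assume y: "y \<in> carrier (Obj A n')"
    obtain t where t: "t \<in> carrier (Obj T n')" "f n' y = p n' t" using n(4)[OF cmapD(3)[OF s(1) y]] by blast
    then have "t \<in> carrier (Obj ?K n')" using s(5)[OF y] by auto
    then show "\<exists>x\<in>carrier (Obj ?K n'). y = ?j n' x" using t(2) ik(2)[OF y] by (metis)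
  next
    fix n' x assume "x \<in> carrier (Obj N n')"
    then show "?j n' (a n' x) = \<zero>\<^bsub>Obj A n'\<^esub>" using n(5) cmapD(6)[OF k(2), of n'] by simp
  next
    fix n' x assume x: "x \<in> carrier (Obj ?K n')" and z: "?j n' x = \<zero>\<^bsub>Obj A n'\<^esub>"
    have "p n' x = f n' (?j n' x)" using ik(3)[OF pk[OF x]] by simp
    then have "p n' x = \<zero>\<^bsub>Obj B n'\<^esub>" using z cmapD(6)[OF s(1)] by simp
    then show "\<exists>y\<in>carrier (Obj N n'). x = a n' y" using n(6) x by auto
  qed
  then have "in_cell ?K" by (rule absorbedD[OF A]) (simp add: N(2) in_cell_iff)
  from absorbedD[OF D S1 this] show "in_cell T" .
qed

text \<open>Let \<open>V\<close> be the homotopy fibre of \<open>T \<rightarrow> \<Sigma>X\<close>.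
  As this map is onto, \<open>V\<close> is quasi-isomorphic to its kernel \<open>B\<close>, and
  \<open>T\<close> is the quotient of \<open>V\<close> by \<open>X\<close>. So \<open>T\<close>
  arises from two members of \<open>C\<close> by a cone, although it was given as an
  extension.\<close>

lemma absorbed_shift:
  assumes X: "in_cell X" shows "absorbed (shift 1 X)"
proof (rule absorbedI)
  have cX: "cpx X" using in_cell_cpx[OF X] .
  show "cpx (shift 1 X)" using cX by simp
  show "small (shift 1 X)" using small_shift in_cell_small[OF X] .
  fix B T :: "('r, 'u) cx" and f p
  assume S: "ses B T (shift 1 X) f p" and B: "B \<in> C"
  note s = sesD[OF S] and cp = cmapD[OF sesD(2)[OF S]] and cf = cmapD[OF sesD(1)[OF S]]
  \<comment> \<open>\<open>?Q\<close> is the contractible path complex of \<open>\<Sigma>X\<close>;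
    it receives \<open>?V\<close>, with kernel \<open>B\<close>.\<close>
  let ?V = "twist T X p" and ?Q = "twist (shift 1 X) X (\<lambda>n x. x)"
  have p: "p n \<in> mod_hom R (Obj T n) (Obj X (n - 1))" for n using cmap_hom[OF s(2), of n] by simp
  have V: "cpx ?V"
  proof (rule cpx_twist[OF cp(1) cX p])
    show "p (n - 1) (Diff T n a) \<oplus>\<^bsub>Obj X (n - 2)\<^esub> Diff X (n - 1) (p n a) = \<zero>\<^bsub>Obj X (n - 2)\<^esub>"
      if "a \<in> carrier (Obj T n)" for n a
      using that cp(3)[OF that] cX by (simp add: cp(8))
  qed
  have Q: "cpx ?Q"
    using cX cmap_hom[OF cmap_id[OF cX]] by (intro cpx_twist) auto
  have "ses B ?V ?Q (\<lambda>n b. (f n b, \<zero>\<^bsub>Obj X n\<^esub>)) (\<lambda>n v. (p n (fst v), snd v))"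
    unfolding ses_def
  proof (intro conjI allI ballI impI)
    show "cmap B ?V (\<lambda>n b. (f n b, \<zero>\<^bsub>Obj X n\<^esub>))"
      using cf(1) V cX s(5) by (intro cmapI) (auto simp: cf)
    show "cmap ?V ?Q (\<lambda>n v. (p n (fst v), snd v))"
      using Q V cX cp(3) by (intro cmapI) (auto simp: cp)
  qed (use s in \<open>auto simp: Bex_def\<close>)
  moreover have "acyclic_cx ?Q"
    unfolding acyclic_cx_def
  proof (intro allI subsetI)
    fix n v assume v: "v \<in> cycles ?Q n"
    then have "fst v \<in> carrier (Obj X (n - 1))" "snd v \<in> carrier (Obj X n)"
      "\<ominus>\<^bsub>Obj X (n - 1)\<^esub> Diff X n (snd v) = fst v"
      using cX by (auto simp: mem_cycles intro!: md_minus_eqI)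
    then show "v \<in> boundaries ?Q n"
      unfolding mem_boundaries using cX by (intro bexI[of _ "(snd v, \<zero>\<^bsub>Obj X (n + 1)\<^esub>)"]) (auto simp: prod_eq_iff)
  qed
  ultimately have "qis B ?V (\<lambda>n b. (f n b, \<zero>\<^bsub>Obj X n\<^esub>))" by (rule ses_acyclic_qis)
  from in_cell_qis[OF this small_UNIV] have "in_cell ?V"
    using B in_cell_small[OF X] by (simp add: in_cell_iff small_twist)
  from in_cell_ses[OF ses_twist[OF cp(1) cX V p] X this] show "in_cell T" .
qed

lemma absorbed_shift': "absorbed Z \<Longrightarrow> absorbed (shift 1 Z)"
  by (rule absorbed_shift[OF absorbed_in_cell])

text \<open>The fibre product projects onto \<open>Z'\<close> with the same kernel \<open>B\<close>
  as \<open>T \<rightarrow> Z\<close>.\<close>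

lemma in_cell_pull:
  assumes Z': "absorbed Z'" and r: "cmap Z' Z r" and S: "ses B T Z f p" and B: "in_cell B"
  shows "in_cell (pull_cx T Z' p r)"
proof -
  note s = sesD[OF S] and cr = cmapD[OF r] and cf = cmapD[OF sesD(1)[OF S]] 
  have V: "cpx (pull_cx T Z' p r)" using s(2) r by simp
  have "ses B (pull_cx T Z' p r) Z' (\<lambda>n b. (f n b, \<zero>\<^bsub>Obj Z' n\<^esub>)) (\<lambda>n. snd)"
    unfolding ses_def
  proof (intro conjI allI ballI impI cmap_pull[OF s(2) r])
    show "cmap B (pull_cx T Z' p r) (\<lambda>n b. (f n b, \<zero>\<^bsub>Obj Z' n\<^esub>))"
      using cf(1) V cr(1) s(5) by (intro cmapI) (auto simp: cf cr(6))
    fix n y assume y: "y \<in> carrier (Obj Z' n)"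
    then obtain t where "t \<in> carrier (Obj T n)" "r n y = p n t" using s(4) cr(3) by blast
    then show "\<exists>b\<in>carrier (Obj (pull_cx T Z' p r) n). y = snd b"
      using y by (intro bexI[of _ "(t, y)"]) auto
  qed (use s cr in \<open>auto\<close>)
  from absorbedD[OF Z' this B] show ?thesis .
qed

text \<open>An extension \<open>T\<close> of \<open>Y\<close> is a retract of its pullback along
  \<open>r\<close>, by means of the section \<open>t \<mapsto> (t, i (p t))\<close>, and
  \<open>in_cell_retract\<close> applies to it.\<close>

lemma absorbed_retract:
  assumes X: "absorbed X" and i: "cmap Y X i" and r: "cmap X Y r"
    and ri: "\<And>n y. y \<in> carrier (Obj Y n) \<Longrightarrow> r n (i n y) = y"
  shows "absorbed Y"
proof (rule absorbedI)
  show "cpx Y" using i cmapD(1) by blast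
  show "small Y"
    by (rule small_image[OF absorbed_small[OF X], of _ r]) (use ri cmapD(3)[OF i] in \<open>force\<close>)
  fix B T :: "('r, 'u) cx" and f p
  assume S: "ses B T Y f p" and B: "B \<in> C"
  note s = sesD[OF S]
  have V: "in_cell (pull_cx T X p r)" using in_cell_pull[OF X r S] B by (simp add: in_cell_iff)
  have "cmap T (pull_cx T X p r) (\<lambda>n t. (t, i n (p n t)))"
    by (rule cmap_into_pull[OF s(2) r cmap_id[OF cmapD(1)[OF s(2)]] cmap_comp[OF s(2) i]])
      (use ri cmapD(3)[OF s(2)] in auto)
  from in_cell_retract[OF V this cmap_pull(1)[OF s(2) r]] show "in_cell T" by simp
qed

text \<open>The pullback of an extension \<open>T\<close> of \<open>Y\<close> to \<open>X\<close>
  projects onto \<open>T\<close> with kernel \<open>N\<close>. An acyclic kernel is in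
  \<open>C\<close>, so \<open>T\<close> is a quotient of one member of \<open>C\<close> by
  another.\<close>

lemma absorbed_quot_acyclic:
  assumes S: "ses N X Y i q" and N: "acyclic_cx N" and X: "absorbed X"
  shows "absorbed Y"
proof (rule absorbedI)
  note s' = sesD[OF S] and ci = cmapD[OF sesD(1)[OF S]] and cq = cmapD[OF sesD(2)[OF S]]
  show "cpx Y" by (rule cq)
  show "small Y" by (rule small_image[OF absorbed_small[OF X], of _ q]) (use s'(4) in fast)
  have "small N"
    unfolding small_cx_def
  proof
    fix n 
    have "inj_on (i n) (carrier (Obj N n))" using ses_eqD[OF S] by (auto simp: inj_on_def)
    then have "carrier (Obj N n) \<lesssim> carrier (Obj X n)" using ci(3) by (auto simp: lepoll_def)
    then show "carrier (Obj N n) \<lesssim> (UNIV :: 'u set)"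
      using absorbed_small[OF X] by (auto simp: small_cx_def intro: lepoll_trans)
  qed
  then have N': "in_cell N" using N ci(1) by (intro in_cell_acyclic)
  fix B T :: "('r, 'u) cx" and f p
  assume S1: "ses B T Y f p" and B: "B \<in> C"
  note s = sesD[OF S1] and cp = cmapD[OF sesD(2)[OF S1]]
  let ?V = "pull_cx T X p q"
  have V: "in_cell ?V" using in_cell_pull[OF X s'(2) S1] B by (simp add: in_cell_iff)
  have "ses N ?V T (\<lambda>n x. (\<zero>\<^bsub>Obj T n\<^esub>, i n x)) (\<lambda>n. fst)"
    unfolding ses_def
  proof (intro conjI allI ballI impI cmap_pull[OF s(2) s'(2)])
    show "cmap N ?V (\<lambda>n x. (\<zero>\<^bsub>Obj T n\<^esub>, i n x))"
      using ci(1,2) in_cell_cpx[OF V] cp(1) s'(5) by (intro cmapI) (auto simp: ci cp(6))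
    fix n y assume y: "y \<in> carrier (Obj T n)"
    then obtain x where "x \<in> carrier (Obj X n)" "p n y = q n x" using s'(4) cp(3) by blast
    then show "\<exists>b\<in>carrier (Obj ?V n). y = fst b" using y by (intro bexI[of _ "(y, x)"]) auto
  qed (use s' cp in \<open>auto simp: prod_eq_iff\<close>)
  from in_cell_ses[OF this N' V] show "in_cell T" .
qed

lemma absorbed_iso:
  assumes "chain_iso R X Y f" "absorbed X" shows "absorbed Y"
  using absorbed_retract[OF assms(2) chain_isoD(2,1)[OF assms(1)]] chain_iso_inv(3)[OF assms(1)] by blast

end

section \<open>Koszul complexes\<close>

context cring_complexes
begin

text \<open>A degreewise retraction \<open>\<rho>\<close> of \<open>\<kappa> : U \<rightarrow> K\<close> whose failure to be a chain map factors through
  \<open>e : E \<rightarrow> U\<close>: this makes \<open>U\<close> a retract of an extension of \<open>K\<close> by \<open>E\<close>.\<close>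

definition factored_retraction ::
    "('r, 'a) cx \<Rightarrow> ('r, 'b) cx \<Rightarrow> (int \<Rightarrow> 'a \<Rightarrow> 'b) \<Rightarrow> (int \<Rightarrow> 'b \<Rightarrow> 'a) \<Rightarrow> ('r, 'c) cx \<Rightarrow>
      (int \<Rightarrow> 'b \<Rightarrow> 'c) \<Rightarrow> (int \<Rightarrow> 'c \<Rightarrow> 'a) \<Rightarrow> bool" where
  "factored_retraction U K \<kappa> \<rho> E h e \<longleftrightarrow> cmap U K \<kappa> \<and> cmap E U e \<and>
    (\<forall>n. \<rho> n \<in> mod_hom R (Obj K n) (Obj U n)) \<and> (\<forall>n. h n \<in> mod_hom R (Obj K n) (Obj E (n - 1))) \<and>
    (\<forall>n. \<forall>u\<in>carrier (Obj U n). \<rho> n (\<kappa> n u) = u \<and> h n (\<kappa> n u) = \<zero>\<^bsub>Obj E (n - 1)\<^esub>) \<and>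
    (\<forall>n. \<forall>k\<in>carrier (Obj K n).
      Diff U n (\<rho> n k) = \<rho> (n - 1) (Diff K n k) \<oplus>\<^bsub>Obj U (n - 1)\<^esub> e (n - 1) (h n k) \<and>
      h (n - 1) (Diff K n k) \<oplus>\<^bsub>Obj E (n - 2)\<^esub> Diff E (n - 1) (h n k) = \<zero>\<^bsub>Obj E (n - 2)\<^esub>)"

lemma factored_retractionD:
  assumes "factored_retraction U K \<kappa> \<rho> E h e"
  shows "cmap U K \<kappa>" "cmap E U e" "\<rho> n \<in> mod_hom R (Obj K n) (Obj U n)"
    "h n \<in> mod_hom R (Obj K n) (Obj E (n - 1))"
    "u \<in> carrier (Obj U n) \<Longrightarrow> \<rho> n (\<kappa> n u) = u"
    "u \<in> carrier (Obj U n) \<Longrightarrow> h n (\<kappa> n u) = \<zero>\<^bsub>Obj E (n - 1)\<^esub>"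
    "k \<in> carrier (Obj K n) \<Longrightarrow>
      Diff U n (\<rho> n k) = \<rho> (n - 1) (Diff K n k) \<oplus>\<^bsub>Obj U (n - 1)\<^esub> e (n - 1) (h n k)"
    "k \<in> carrier (Obj K n) \<Longrightarrow>
      h (n - 1) (Diff K n k) \<oplus>\<^bsub>Obj E (n - 2)\<^esub> Diff E (n - 1) (h n k) = \<zero>\<^bsub>Obj E (n - 2)\<^esub>"
  using assms by (auto simp: factored_retraction_def)

text \<open>The defect of \<open>\<rho>\<close> is \<open>e\<close> after \<open>h\<close>; adding
  \<open>e\<close> on the component \<open>E\<close> repairs it. As \<open>h\<close> vanishes on the
  image of \<open>\<kappa>\<close>, the complex \<open>U\<close> enters the extension with second
  component zero.\<close>

lemma factored_retraction_twist:
  assumes "factored_retraction U K \<kappa> \<rho> E h e"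
  shows "ses E (twist K E h) K (\<lambda>n b. (\<zero>\<^bsub>Obj K n\<^esub>, b)) (\<lambda>n. fst)"
    and "cmap U (twist K E h) (\<lambda>n u. (\<kappa> n u, \<zero>\<^bsub>Obj E n\<^esub>))"
    and "cmap (twist K E h) U (\<lambda>n p. \<rho> n (fst p) \<oplus>\<^bsub>Obj U n\<^esub> e n (snd p))"
    and "u \<in> carrier (Obj U n) \<Longrightarrow> \<rho> n (\<kappa> n u) \<oplus>\<^bsub>Obj U n\<^esub> e n \<zero>\<^bsub>Obj E n\<^esub> = u"
proof -
  note f = factored_retractionD[OF assms]
  note \<kappa> = cmapD[OF f(1)] and e = cmapD[OF f(2)]
  note \<rho> = mod_homD(1-3)[OF f(3)] and h = mod_homD(1-3)[OF f(4)]
  have T: "cpx (twist K E h)" using \<kappa>(2) e(1) f(4) f(8) by (rule cpx_twist)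
  show "ses E (twist K E h) K (\<lambda>n b. (\<zero>\<^bsub>Obj K n\<^esub>, b)) (\<lambda>n. fst)"
    using ses_twist[OF \<kappa>(2) e(1) T f(4)] .
  show "cmap U (twist K E h) (\<lambda>n u. (\<kappa> n u, \<zero>\<^bsub>Obj E n\<^esub>))"
    using T \<kappa>(1) e(1) by (intro cmapI) (auto simp: \<kappa> f(6))
  show "cmap (twist K E h) U (\<lambda>n p. \<rho> n (fst p) \<oplus>\<^bsub>Obj U n\<^esub> e n (snd p))"
    using T \<kappa>(1,2) e(1) by (intro cmapI) (auto simp: f(7) \<rho> h e(3-8) md_ac)
  show "u \<in> carrier (Obj U n) \<Longrightarrow> \<rho> n (\<kappa> n u) \<oplus>\<^bsub>Obj U n\<^esub> e n \<zero>\<^bsub>Obj E n\<^esub> = u"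
    using \<kappa>(1) by (simp add: f(5) e(6))
qed

lemma factored_retraction_iso:
  assumes F: "factored_retraction U K \<kappa> \<rho> E h e" and a: "chain_iso R K K' a" and b: "chain_iso R E E' b"
  shows "factored_retraction U K' (\<lambda>n u. a n (\<kappa> n u)) (\<lambda>n k. \<rho> n (iso_inv K a n k)) E'
    (\<lambda>n k. b (n - 1) (h n (iso_inv K a n k))) (\<lambda>n x. e n (iso_inv E b n x))"
proof -
  note f = factored_retractionD[OF F]
  note da = chain_isoD[OF a] and ia = chain_iso_inv[OF a] and db = chain_isoD[OF b] and ib = chain_iso_inv[OF b]
  note h = mod_homD(1)[OF f(4)] and \<kappa> = cmapD(3)[OF f(1)]
  note ca = cmapD(3,8)[OF da(2)] and cb = cmapD(3,8)[OF db(2)] and cb' = cmapD[OF db(1)]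
  show ?thesis unfolding factored_retraction_def
  proof (intro conjI allI ballI)
    fix n
    show "cmap U K' (\<lambda>n u. a n (\<kappa> n u))" using cmap_comp[OF f(1) da(1)] .
    show "cmap E' U (\<lambda>n x. e n (iso_inv E b n x))" using cmap_comp[OF db(2) f(2)] .
    show "(\<lambda>k. \<rho> n (iso_inv K a n k)) \<in> mod_hom R (Obj K' n) (Obj U n)"
      using mod_hom_comp[OF cmap_hom[OF da(2)] f(3)] .
    show "(\<lambda>k. b (n - 1) (h n (iso_inv K a n k))) \<in> mod_hom R (Obj K' n) (Obj E' (n - 1))"
      using mod_hom_comp[OF cmap_hom[OF da(2)] mod_hom_comp[OF f(4) cmap_hom[OF db(1)]]] .
    fix u assume u: "u \<in> carrier (Obj U n)"
    show "\<rho> n (iso_inv K a n (a n (\<kappa> n u))) = u" using u by (simp add: ia(2) \<kappa> f(5))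
    show "b (n - 1) (h n (iso_inv K a n (a n (\<kappa> n u)))) = \<zero>\<^bsub>Obj E' (n - 1)\<^esub>"
      using u by (simp add: ia(2) \<kappa> f(6) cmapD(6)[OF db(1)])
  next
    fix n k assume k: "k \<in> carrier (Obj K' n)"
    let ?k = "iso_inv K a n k"
    have k': "?k \<in> carrier (Obj K n)" "h n ?k \<in> carrier (Obj E (n - 1))" using ca(1)[OF k] h by auto
    show "Diff U n (\<rho> n ?k) = \<rho> (n - 1) (iso_inv K a (n - 1) (Diff K' n k)) \<oplus>\<^bsub>Obj U (n - 1)\<^esub>
        e (n - 1) (iso_inv E b (n - 1) (b (n - 1) (h n ?k)))"
      using k k' by (simp add: ca f(7) ib(2))
    have "h (n - 1) (Diff K n ?k) \<in> carrier (Obj E (n - 2))"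
      using h[of "Diff K n ?k" "n - 1"] k'(1) cmapD(1)[OF da(1)] by simp
    then have "b (n - 2) (h (n - 1) (Diff K n ?k)) \<oplus>\<^bsub>Obj E' (n - 2)\<^esub> b (n - 2) (Diff E (n - 1) (h n ?k)) =
        b (n - 2) \<zero>\<^bsub>Obj E (n - 2)\<^esub>"
      using f(8)[OF k'(1)] k' cb'(1) by (simp flip: cb'(4))
    then show "b (n - 1 - 1) (h (n - 1) (iso_inv K a (n - 1) (Diff K' n k))) \<oplus>\<^bsub>Obj E' (n - 2)\<^esub>
        Diff E' (n - 1) (b (n - 1) (h n ?k)) = \<zero>\<^bsub>Obj E' (n - 2)\<^esub>"
      using k k' by (simp add: ca(2) cb'(8) cb'(6))
  qed
qed

text \<open>The factor for the next Koszul stage: \<open>E\<close> carries the old defect,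
  \<open>X\<close> carries multiplication by \<open>c\<close> on \<open>U\<close>, and the summand
  \<open>\<Sigma>E\<close> records how far the two are from being compatible with the
  differentials.\<close>

definition koszul_cell :: "('r, 'c) cx \<Rightarrow> ('r, 'x) cx \<Rightarrow> 'r \<Rightarrow> (int \<Rightarrow> 'c \<Rightarrow> 'x) \<Rightarrow> ('r, 'c \<times> 'c \<times> 'x) cx" where
  "koszul_cell E X c j = twist (shift 1 E) (prod_cx E X)
    (\<lambda>n x. (c \<odot>\<^bsub>Obj E (n - 1)\<^esub> x, \<ominus>\<^bsub>Obj X (n - 1)\<^esub> j (n - 1) x))"

lemma cmap_smult:
  "cpx X \<Longrightarrow> c \<in> carrier R \<Longrightarrow> cmap X X (\<lambda>n x. c \<odot>\<^bsub>Obj X n\<^esub> x)"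
  by (intro cmapI) (auto simp: md_smult_comm)

lemma koszul_cell_ses:
  assumes j: "cmap E X j" and c: "c \<in> carrier R"
  shows "ses (prod_cx E X) (koszul_cell E X c j) (shift 1 E)
    (\<lambda>n b. (\<zero>\<^bsub>Obj (shift 1 E) n\<^esub>, b)) (\<lambda>n. fst)"
    and "cpx (koszul_cell E X c j)"
proof -
  note cj = cmapD[OF j]
  have h: "(\<lambda>x. (c \<odot>\<^bsub>Obj E (n - 1)\<^esub> x, \<ominus>\<^bsub>Obj X (n - 1)\<^esub> j (n - 1) x))
      \<in> mod_hom R (Obj (shift 1 E) n) (Obj (prod_cx E X) (n - 1))" for n
    using cj(1,2) c by (intro mod_homI) (auto simp: cj(3-5) md_smult_comm)
  show cp: "cpx (koszul_cell E X c j)"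
    unfolding koszul_cell_def
    using cj(1,2) c by (intro cpx_twist h) (auto simp: cj(3-8) md_simps(3,4))
  show "ses (prod_cx E X) (koszul_cell E X c j) (shift 1 E)
    (\<lambda>n b. (\<zero>\<^bsub>Obj (shift 1 E) n\<^esub>, b)) (\<lambda>n. fst)"
    using ses_twist[OF _ _ cp[unfolded koszul_cell_def] h] cj(1,2) unfolding koszul_cell_def by simp
qed

text \<open>On \<open>(k0, k1)\<close> the retraction \<open>\<rho> k1\<close> has the defect
  \<open>e (h k1) - c \<rho> k0\<close>, and \<open>c \<rho> k0\<close> equals
  \<open>r (\<iota> (\<rho> k0))\<close>; this accounts for the components in \<open>E\<close> and
  \<open>X\<close>. But \<open>\<rho>\<close> is itself no chain map, so the component in
  \<open>X\<close> is off by \<open>\<iota> (e (h k0))\<close> and the one in \<open>E\<close> by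
  \<open>c h k0\<close>. The twist of \<open>koszul_cell\<close>, evaluated at the component
  \<open>- h k0\<close> in \<open>\<Sigma>E\<close>, cancels both.\<close>

lemma koszul_step:
  assumes F: "factored_retraction U K \<kappa> \<rho> E h e" and c: "c \<in> carrier R"
    and \<iota>: "cmap U X \<iota>" and r: "cmap X U r"
    and r\<iota>: "\<And>n u. u \<in> carrier (Obj U n) \<Longrightarrow> r n (\<iota> n u) = c \<odot>\<^bsub>Obj U n\<^esub> u"
  shows "factored_retraction U (cone K K (\<lambda>n k. c \<odot>\<^bsub>Obj K n\<^esub> k)) (\<lambda>n u. (\<zero>\<^bsub>Obj K (n - 1)\<^esub>, \<kappa> n u))
    (\<lambda>n p. \<rho> n (snd p)) (koszul_cell E X c (\<lambda>n x. \<iota> n (e n x)))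
    (\<lambda>n p. (\<ominus>\<^bsub>Obj E (n - 2)\<^esub> h (n - 1) (fst p),
       h n (snd p), \<ominus>\<^bsub>Obj X (n - 1)\<^esub> \<iota> (n - 1) (\<rho> (n - 1) (fst p))))
    (\<lambda>n q. e n (fst (snd q)) \<oplus>\<^bsub>Obj U n\<^esub> r n (snd (snd q)))"
proof -
  note f = factored_retractionD[OF F]
  note \<kappa> = cmapD[OF f(1)] and e = cmapD[OF f(2)] and i = cmapD[OF \<iota>] and r' = cmapD[OF r]
  note \<rho> = mod_homD(1-3)[OF f(3)]
  have h: "x \<in> carrier (Obj K n) \<Longrightarrow> m = n - 1 \<Longrightarrow> h n x \<in> carrier (Obj E m)"
    "x \<in> carrier (Obj K n) \<Longrightarrow> y \<in> carrier (Obj K n) \<Longrightarrow>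
      h n (x \<oplus>\<^bsub>Obj K n\<^esub> y) = h n x \<oplus>\<^bsub>Obj E (n - 1)\<^esub> h n y"
    "a \<in> carrier R \<Longrightarrow> x \<in> carrier (Obj K n) \<Longrightarrow>
      h n (a \<odot>\<^bsub>Obj K n\<^esub> x) = a \<odot>\<^bsub>Obj E (n - 1)\<^esub> h n x" for a x y n m
    using mod_homD(1-3)[OF f(4)] by auto
  note hz = mod_homD(4,5)[OF f(4) cpx_module[OF \<kappa>(2)] cpx_module[OF e(1)]]
    and \<rho>z = mod_homD(4,5)[OF f(3) cpx_module[OF \<kappa>(2)] cpx_module[OF \<kappa>(1)]]
  note cp = \<kappa>(1,2) e(1) i(2)
  let ?K = "cone K K (\<lambda>n k. c \<odot>\<^bsub>Obj K n\<^esub> k)"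
  let ?E = "koszul_cell E X c (\<lambda>n x. \<iota> n (e n x))"
  have K: "cpx ?K" using cmap_smult[OF \<kappa>(2) c] by simp
  have E: "cpx ?E" using koszul_cell_ses(2)[OF cmap_comp[OF f(2) \<iota>] c] .
  note D = cone_eq_twist koszul_cell_def
  have hd: "h (n - 1) (Diff K n k) = \<ominus>\<^bsub>Obj E (n - 2)\<^esub> Diff E (n - 1) (h n k)" if "k \<in> carrier (Obj K n)" for n k
    using f(8)[OF that] that cp h(1)[of "Diff K n k" "n - 1" "n - 2"] h(1)[OF that, of "n - 1"]
    by (intro md_minus_eqI[symmetric, OF cpx_module[OF e(1)]]) auto
  have \<rho>d: "\<rho> (n - 1) (Diff K n k) =
      Diff U n (\<rho> n k) \<oplus>\<^bsub>Obj U (n - 1)\<^esub> \<ominus>\<^bsub>Obj U (n - 1)\<^esub> e (n - 1) (h n k)" if "k \<in> carrier (Obj K n)" for n k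
    using that cp unfolding f(7)[OF that] by (simp add: \<rho> e h)
  show ?thesis unfolding factored_retraction_def
  proof (intro conjI allI ballI)
    show "cmap U ?K (\<lambda>n u. (\<zero>\<^bsub>Obj K (n - 1)\<^esub>, \<kappa> n u))"
      using K cp c unfolding D by (intro cmapI) (auto simp: \<kappa>)
    show "cmap ?E U (\<lambda>n q. e n (fst (snd q)) \<oplus>\<^bsub>Obj U n\<^esub> r n (snd (snd q)))"
      using E cp c unfolding D
      by (intro cmapI) (auto simp: e(3-8) r'(3-8) i(3) r\<iota> md_ac)
    fix n
    show "(\<lambda>p. \<rho> n (snd p)) \<in> mod_hom R (Obj ?K n) (Obj U n)"
      unfolding D by (intro mod_homI) (auto simp: \<rho>)
    show "(\<lambda>p. (\<ominus>\<^bsub>Obj E (n - 2)\<^esub> h (n - 1) (fst p),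
       h n (snd p), \<ominus>\<^bsub>Obj X (n - 1)\<^esub> \<iota> (n - 1) (\<rho> (n - 1) (fst p)))) \<in> mod_hom R (Obj ?K n) (Obj ?E (n - 1))"
      unfolding D using cp by (intro mod_homI) (auto simp: \<rho> h i(3-5))
    fix u assume u: "u \<in> carrier (Obj U n)"
    show "\<rho> n (snd (\<zero>\<^bsub>Obj K (n - 1)\<^esub>, \<kappa> n u)) = u" using u f(5) by simp
    show "(\<ominus>\<^bsub>Obj E (n - 2)\<^esub> h (n - 1) (fst (\<zero>\<^bsub>Obj K (n - 1)\<^esub>, \<kappa> n u)),
         h n (snd (\<zero>\<^bsub>Obj K (n - 1)\<^esub>, \<kappa> n u)),
         \<ominus>\<^bsub>Obj X (n - 1)\<^esub> \<iota> (n - 1) (\<rho> (n - 1) (fst (\<zero>\<^bsub>Obj K (n - 1)\<^esub>, \<kappa> n u)))) = \<zero>\<^bsub>Obj ?E (n - 1)\<^esub>"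
      using u cp f(6) unfolding D by (simp add: hz(1)[of "n - 1", simplified] \<rho>z(1) i(6))
  next
    fix n p assume "p \<in> carrier (Obj ?K n)"
    then obtain k0 k1 where p: "p = (k0, k1)" and k: "k0 \<in> carrier (Obj K (n - 1))" "k1 \<in> carrier (Obj K n)"
      unfolding D by (cases p) auto
    note hh = h(1)[OF k(1), of "n - 2", simplified] h(1)[OF k(2), of "n - 1", simplified]
    have dk: "Diff K (n - 1) k0 \<in> carrier (Obj K (n - 2))" "Diff K n k1 \<in> carrier (Obj K (n - 1))" using k cp by auto
    note rr = \<rho>(1)[OF k(1)] \<rho>(1)[OF k(2)]
    show "Diff U n (\<rho> n (snd p)) = \<rho> (n - 1) (snd (Diff ?K n p)) \<oplus>\<^bsub>Obj U (n - 1)\<^esub>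
      (e (n - 1) (fst (snd (\<ominus>\<^bsub>Obj E (n - 2)\<^esub> h (n - 1) (fst p),
         h n (snd p), \<ominus>\<^bsub>Obj X (n - 1)\<^esub> \<iota> (n - 1) (\<rho> (n - 1) (fst p))))) \<oplus>\<^bsub>Obj U (n - 1)\<^esub>
      r (n - 1) (snd (snd (\<ominus>\<^bsub>Obj E (n - 2)\<^esub> h (n - 1) (fst p),
         h n (snd p), \<ominus>\<^bsub>Obj X (n - 1)\<^esub> \<iota> (n - 1) (\<rho> (n - 1) (fst p))))))"
      using k cp c dk hh rr unfolding p D
      by (simp add: f(7) \<rho> r'(7) i(3) r\<iota> e(3) md_ac)
    have hdk: "h (n - 2) (Diff K (n - 1) k0) = \<ominus>\<^bsub>Obj E (n - 3)\<^esub> Diff E (n - 2) (h (n - 1) k0)"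
      using hd[OF k(1)] by simp
    have \<rho>dk: "\<rho> (n - 2) (Diff K (n - 1) k0) = Diff U (n - 1) (\<rho> (n - 1) k0) \<oplus>\<^bsub>Obj U (n - 2)\<^esub>
       \<ominus>\<^bsub>Obj U (n - 2)\<^esub> e (n - 2) (h (n - 1) k0)" using \<rho>d[OF k(1)] by simp
    have hm: "h (n - 2) (\<ominus>\<^bsub>Obj K (n - 2)\<^esub> Diff K (n - 1) k0) = \<ominus>\<^bsub>Obj E (n - 3)\<^esub> h (n - 2) (Diff K (n - 1) k0)"
      using hz(2)[OF dk(1)] by simp
    have ha: "h (n - 1) (c \<odot>\<^bsub>Obj K (n - 1)\<^esub> k0 \<oplus>\<^bsub>Obj K (n - 1)\<^esub> Diff K n k1) =
        c \<odot>\<^bsub>Obj E (n - 2)\<^esub> h (n - 1) k0 \<oplus>\<^bsub>Obj E (n - 2)\<^esub> \<ominus>\<^bsub>Obj E (n - 2)\<^esub> Diff E (n - 1) (h n k1)"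
      using h(2)[of "c \<odot>\<^bsub>Obj K (n - 1)\<^esub> k0" "n - 1" "Diff K n k1"] h(3)[OF c k(1)] hd[OF k(2)] k c dk cp by simp
    have ha': "h (n - 1) (Diff K n k1 \<oplus>\<^bsub>Obj K (n - 1)\<^esub> c \<odot>\<^bsub>Obj K (n - 1)\<^esub> k0) =
        c \<odot>\<^bsub>Obj E (n - 2)\<^esub> h (n - 1) k0 \<oplus>\<^bsub>Obj E (n - 2)\<^esub> \<ominus>\<^bsub>Obj E (n - 2)\<^esub> Diff E (n - 1) (h n k1)"
      unfolding ha[symmetric] using md_ac(2)[OF cpx_module[OF cp(2)] dk(2) md_closed(4)[OF cpx_module[OF cp(2)] c k(1)]]
      by simp
    show "(\<ominus>\<^bsub>Obj E (n - 1 - 2)\<^esub> h (n - 1 - 1) (fst (Diff ?K n p)), h (n - 1) (snd (Diff ?K n p)),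
        \<ominus>\<^bsub>Obj X (n - 1 - 1)\<^esub> \<iota> (n - 1 - 1) (\<rho> (n - 1 - 1) (fst (Diff ?K n p)))) \<oplus>\<^bsub>Obj ?E (n - 2)\<^esub>
      Diff ?E (n - 1) (\<ominus>\<^bsub>Obj E (n - 2)\<^esub> h (n - 1) (fst p),
         h n (snd p), \<ominus>\<^bsub>Obj X (n - 1)\<^esub> \<iota> (n - 1) (\<rho> (n - 1) (fst p))) = \<zero>\<^bsub>Obj ?E (n - 2)\<^esub>"
      using k cp c dk hh rr unfolding p D
      by (simp add: hdk \<rho>dk hm ha ha' \<rho>z(2) i(3-8) e(3-8) md_ac)
  qed
qed

end

context cellular
begin

text \<open>The product is a retract of the countable direct sum with summands
  \<open>A', B', B', ...\<close>, which \<open>in_cell_dsum_nat\<close> provides.\<close>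

lemma in_cell_prod:
  assumes A: "in_cell A" and B: "in_cell B" shows "in_cell (prod_cx A B)"
proof -
  obtain A' B' a b where a: "chain_iso R A A' a" "A' \<in> C" and b: "chain_iso R B B' b" "B' \<in> C"
    using A B by (auto simp: in_cell_def)
  define X where "X = (\<lambda>k :: nat. if k = 0 then A' else B')"
  have X: "in_cell (dsum_cx UNIV X)" by (rule in_cell_dsum_nat) (auto simp: X_def a b)
  have cX: "cpx (X k)" for k by (auto simp: X_def cell_cpx a b)
  note da = chain_isoD(1,2)[OF a(1)] and db = chain_isoD(1,2)[OF b(1)]
  have P: "cpx (prod_cx A B)" using cmapD(1)[OF da(1)] cmapD(1)[OF db(1)] by simp
  have S: "cpx (dsum_cx UNIV X)" using cX by simp
  note ca = cmapD[OF da(1)] and ca' = cmapD[OF da(2)] and cb = cmapD[OF db(1)] and cb' = cmapD[OF db(2)]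
  let ?i = "\<lambda>n p k. if k = 0 then a n (fst p) else if k = 1 then b n (snd p) else \<zero>\<^bsub>Obj (X k) n\<^esub>"
  let ?r = "\<lambda>n x. (iso_inv A a n (x (0 :: nat)), iso_inv B b n (x 1))"
  have mem: "?i n p \<in> carrier (Obj (dsum_cx UNIV X) n)" if "p \<in> carrier (Obj (prod_cx A B) n)" for n p
  proof -
    have "finite {k. ?i n p k \<noteq> \<zero>\<^bsub>Obj (X k) n\<^esub>}" by (rule finite_subset[of _ "{0, 1}"]) auto
    moreover have "?i n p k \<in> carrier (Obj (X k) n)" for k
      using that md_closed(2)[OF cpx_module[OF cX]] by (auto simp: X_def ca cb)
    ultimately show ?thesis by auto
  qed
  show ?thesis
  proof (rule in_cell_retract[OF X, of _ ?i ?r])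
    show "cmap (prod_cx A B) (dsum_cx UNIV X) ?i"
    proof (rule cmapI[OF P S mem])
      fix n p assume p: "p \<in> carrier (Obj (prod_cx A B) n)"
      show "?i (n - 1) (Diff (prod_cx A B) n p) = Diff (dsum_cx UNIV X) n (?i n p)"
      proof
        fix k show "?i (n - 1) (Diff (prod_cx A B) n p) k = Diff (dsum_cx UNIV X) n (?i n p) k"
          using p Diff_simps(4)[OF cX, of k] cb(1) by (auto simp: X_def ca(8) cb(8))
      qed
      show "?i n (s \<odot>\<^bsub>Obj (prod_cx A B) n\<^esub> p) = s \<odot>\<^bsub>Obj (dsum_cx UNIV X) n\<^esub> ?i n p" if "s \<in> carrier R" for s
        using p that ca(2) cb(2) by (auto simp: X_def ca(5) cb(5) fun_eq_iff)
      fix q assume q: "q \<in> carrier (Obj (prod_cx A B) n)"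
      show "?i n (p \<oplus>\<^bsub>Obj (prod_cx A B) n\<^esub> q) = ?i n p \<oplus>\<^bsub>Obj (dsum_cx UNIV X) n\<^esub> ?i n q"
        using p q ca(2) cb(2) by (auto simp: X_def ca(4) cb(4) fun_eq_iff)
    qed
    have comp: "x 0 \<in> carrier (Obj A' n)" "x 1 \<in> carrier (Obj B' n)"
      if x: "x \<in> carrier (Obj (dsum_cx UNIV X) n)" for x n
    proof -
      have "x k \<in> carrier (Obj (X k) n)" for k using x by auto
      from this[of 0] this[of 1] show "x 0 \<in> carrier (Obj A' n)" "x 1 \<in> carrier (Obj B' n)"
        by (simp_all add: X_def)
    qed
    show "cmap (dsum_cx UNIV X) (prod_cx A B) ?r"
    proof (rule cmapI[OF S P])
      fix n x assume "x \<in> carrier (Obj (dsum_cx UNIV X) n)"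
      note x = comp[OF this]
      show "?r n x \<in> carrier (Obj (prod_cx A B) n)" using x by (simp add: ca' cb')
      show "?r (n - 1) (Diff (dsum_cx UNIV X) n x) = Diff (prod_cx A B) n (?r n x)"
        using x ca(1) cb(1) by (simp add: ca' cb' X_def)
      show "?r n (s \<odot>\<^bsub>Obj (dsum_cx UNIV X) n\<^esub> x) = s \<odot>\<^bsub>Obj (prod_cx A B) n\<^esub> ?r n x" if "s \<in> carrier R" for s
        using x that by (simp add: ca' cb' X_def)
      fix y assume "y \<in> carrier (Obj (dsum_cx UNIV X) n)"
      note y = comp[OF this]
      show "?r n (x \<oplus>\<^bsub>Obj (dsum_cx UNIV X) n\<^esub> y) = ?r n x \<oplus>\<^bsub>Obj (prod_cx A B) n\<^esub> ?r n y"
        using x y by (simp add: ca' cb' X_def)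
    qed
  qed (auto simp: chain_iso_inv(2)[OF a(1)] chain_iso_inv(2)[OF b(1)])
qed

lemma in_cell_factored_retraction:
  assumes F: "factored_retraction U K \<kappa> \<rho> E h e" and K: "absorbed K" and E: "in_cell E"
  shows "in_cell U"
  using in_cell_retract[OF absorbedD[OF K factored_retraction_twist(1)[OF F] E]
      factored_retraction_twist(2,3)[OF F]] factored_retraction_twist(4)[OF F] by simp

lemma absorbed_factored_retraction:
  assumes F: "factored_retraction U K \<kappa> \<rho> E h e" and K: "absorbed K" and E: "absorbed E"
  shows "absorbed U"
  using absorbed_retract[OF absorbed_ext[OF factored_retraction_twist(1)[OF F] E K]
      factored_retraction_twist(2,3)[OF F]] factored_retraction_twist(4)[OF F] by simp

lemma in_cell_koszul_cell:
  assumes j: "cmap E X j" and c: "c \<in> carrier R" and E: "in_cell E" and X: "in_cell X"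
  shows "in_cell (koszul_cell E X c j)"
  using absorbedD[OF absorbed_shift[OF E] koszul_cell_ses(1)[OF j c] in_cell_prod[OF E X]] .

end

section \<open>Tensoring with a free resolution\<close>

text \<open>A complex \<open>F\<close> of finite free modules is given by the ranks \<open>b i\<close> and the matrices \<open>a i\<close> of its
  differentials from degree \<open>i + 1\<close> to degree \<open>i\<close>; \<open>tensor_cx b a Y\<close> is \<open>Y \<otimes> F\<close>.\<close>

definition basis :: "(nat \<Rightarrow> nat) \<Rightarrow> (nat \<times> nat) set" where
  "basis b = {(i, s). s < b i}"

text \<open>The differential of the \<open>i\<close>-fold suspension, as
  \<open>Diff_shift_nat\<close> confirms; the alternating sign makes the two parts of the
  differential of \<open>tensor_cx\<close> anticommute.\<close>

definition sdiff :: "('r, 'm) cx \<Rightarrow> nat \<Rightarrow> int \<Rightarrow> 'm \<Rightarrow> 'm" where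
  "sdiff Y i m y = (if even i then Diff Y m y else \<ominus>\<^bsub>Obj Y (m - 1)\<^esub> Diff Y m y)"

text \<open>One row of a matrix over the ring times a column with entries in the module. For
  \<open>ring_mod\<close> this is the ordinary product, so one definition serves for the relations
  of the free complex and for its tensor products.\<close>

definition mat_apply :: "(nat \<Rightarrow> nat) \<Rightarrow> (nat \<Rightarrow> nat \<Rightarrow> nat \<Rightarrow> 'r) \<Rightarrow> ('r, 'm) module \<Rightarrow> nat \<Rightarrow> nat \<Rightarrow>
    (nat \<Rightarrow> 'm) \<Rightarrow> 'm" where
  "mat_apply b a M i s f = msum M (\<lambda>t. a i s t \<odot>\<^bsub>M\<^esub> f t) (b (Suc i))"

definition tensor_cx :: "(nat \<Rightarrow> nat) \<Rightarrow> (nat \<Rightarrow> nat \<Rightarrow> nat \<Rightarrow> 'r) \<Rightarrow> ('r, 'm) cx \<Rightarrow>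
    ('r, nat \<times> nat \<Rightarrow> 'm) cx" where
  "tensor_cx b a Y = \<lparr>Obj = (\<lambda>n. dsum_mod (basis b) (\<lambda>q. Obj Y (n - int (fst q)))),
     Diff = (\<lambda>n x. \<lambda>q\<in>basis b. sdiff Y (fst q) (n - int (fst q)) (x q)
       \<oplus>\<^bsub>Obj Y (n - int (Suc (fst q)))\<^esub> mat_apply b a (Obj Y (n - int (Suc (fst q)))) (fst q) (snd q)
         (\<lambda>t. x (Suc (fst q), t)))\<rparr>"

lemma diff_int_Suc:
  "n - 1 - int i = n - int (Suc i)" "n - int i - 1 = n - int (Suc i)"
  "n - 2 - int i = n - int (Suc (Suc i))" "n - int i - 2 = n - int (Suc (Suc i))"
  by auto

context cring_complexes
begin

text \<open>The lowest module has rank one because the complexes resolve cyclic modules; the last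
  clause is the vanishing of the product of consecutive matrices.\<close>

definition free_cx :: "(nat \<Rightarrow> nat) \<Rightarrow> (nat \<Rightarrow> nat \<Rightarrow> nat \<Rightarrow> 'r) \<Rightarrow> bool" where
  "free_cx b a \<longleftrightarrow> b 0 = 1 \<and> (\<forall>i s t. a i s t \<in> carrier R) \<and>
    (\<forall>i s u. s < b i \<longrightarrow> u < b (Suc (Suc i)) \<longrightarrow>
      mat_apply b a ring_mod i s (\<lambda>t. a (Suc i) t u) = \<zero>)"

lemma msum_swap:
  assumes M: "module R M" and f: "\<And>t u. t < l \<Longrightarrow> u < k \<Longrightarrow> f t u \<in> carrier M"
  shows "msum M (\<lambda>t. msum M (\<lambda>u. f t u) k) l = msum M (\<lambda>u. msum M (\<lambda>t. f t u) l) k"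
  using f
proof (induction l)
  case 0
  then show ?case using M by (simp add: msum_zero)
next
  case (Suc l)
  then show ?case using M by (simp add: msum_add)
qed

lemma sdiff_hom: "cpx Y \<Longrightarrow> sdiff Y i m \<in> mod_hom R (Obj Y m) (Obj Y (m - 1))"
  unfolding sdiff_def using Diff_hom[of Y m] mod_hom_minus[OF _ Diff_hom, of Y m]
  by (cases "even i") auto

lemma sdiff_closed [simp]:
  "cpx Y \<Longrightarrow> y \<in> carrier (Obj Y m) \<Longrightarrow> k = m - 1 \<Longrightarrow> sdiff Y i m y \<in> carrier (Obj Y k)"
  using mod_homD(1)[OF sdiff_hom] by simp

lemma Diff_shift_nat: "Diff (shift (int i) Y) n = sdiff Y i (n - int i)"
  by (simp add: shift_def sdiff_def fun_eq_iff)

lemma mat_apply_closed [simp]: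
  "\<lbrakk>free_cx b a; module R M; \<And>t. t < b (Suc i) \<Longrightarrow> f t \<in> carrier M\<rbrakk> \<Longrightarrow> mat_apply b a M i s f \<in> carrier M"
  by (simp add: mat_apply_def free_cx_def)

lemma mat_apply_add:
  "\<lbrakk>free_cx b a; module R M; \<And>t. t < b (Suc i) \<Longrightarrow> f t \<in> carrier M; \<And>t. t < b (Suc i) \<Longrightarrow> g t \<in> carrier M\<rbrakk> \<Longrightarrow>
    mat_apply b a M i s (\<lambda>t. f t \<oplus>\<^bsub>M\<^esub> g t) = mat_apply b a M i s f \<oplus>\<^bsub>M\<^esub> mat_apply b a M i s g"
  unfolding mat_apply_def by (subst msum_add[symmetric]) (auto simp: free_cx_def intro!: msum_cong)

lemma mat_apply_hom:
  "\<lbrakk>free_cx b a; h \<in> mod_hom R M N; module R M; module R N; \<And>t. t < b (Suc i) \<Longrightarrow> f t \<in> carrier M\<rbrakk> \<Longrightarrow>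
    h (mat_apply b a M i s f) = mat_apply b a N i s (\<lambda>t. h (f t))"
  unfolding mat_apply_def
  by (subst msum_hom[of h M N]) (auto simp: free_cx_def mod_homD(3) intro!: msum_cong)

lemma mat_apply_cong:
  "(\<And>t. t < b (Suc i) \<Longrightarrow> f t = g t) \<Longrightarrow> mat_apply b a M i s f = mat_apply b a M i s g"
  unfolding mat_apply_def by (intro msum_cong) auto

lemma mat_apply_zero:
  "\<lbrakk>free_cx b a; module R M; \<And>t. t < b (Suc i) \<Longrightarrow> f t = \<zero>\<^bsub>M\<^esub>\<rbrakk> \<Longrightarrow> mat_apply b a M i s f = \<zero>\<^bsub>M\<^esub>"
  unfolding mat_apply_def by (intro msum_zero) (auto simp: free_cx_def)

lemma mat_apply_twice:
  assumes F: "free_cx b a" and M: "module R M" and s: "s < b i"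
    and x: "\<And>u. u < b (Suc (Suc i)) \<Longrightarrow> x u \<in> carrier M"
  shows "mat_apply b a M i s (\<lambda>t. mat_apply b a M (Suc i) t x) = \<zero>\<^bsub>M\<^esub>"
proof -
  have a: "a i s t \<in> carrier R" for i s t using F by (simp add: free_cx_def)
  have "mat_apply b a M i s (\<lambda>t. mat_apply b a M (Suc i) t x) =
      msum M (\<lambda>t. msum M (\<lambda>u. (a i s t \<otimes> a (Suc i) t u) \<odot>\<^bsub>M\<^esub> x u) (b (Suc (Suc i)))) (b (Suc i))"
    unfolding mat_apply_def
    by (intro msum_cong) (use M a x in \<open>subst msum_smult; auto simp: md_smult intro!: msum_cong\<close>)
  also have "\<dots> = msum M (\<lambda>u. msum M (\<lambda>t. (a i s t \<otimes> a (Suc i) t u) \<odot>\<^bsub>M\<^esub> x u) (b (Suc i))) (b (Suc (Suc i)))"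
    using M a x by (intro msum_swap) auto
  also have "\<dots> = \<zero>\<^bsub>M\<^esub>"
  proof (rule msum_zero[OF M])
    fix u assume u: "u < b (Suc (Suc i))"
    have h: "(\<lambda>r. r \<odot>\<^bsub>M\<^esub> x u) \<in> mod_hom R ring_mod M"
      using M x[OF u] by (intro mod_homI) (auto simp: md_smult)
    have "msum M (\<lambda>t. (a i s t \<otimes> a (Suc i) t u) \<odot>\<^bsub>M\<^esub> x u) (b (Suc i)) =
        mat_apply b a ring_mod i s (\<lambda>t. a (Suc i) t u) \<odot>\<^bsub>M\<^esub> x u"
      unfolding mat_apply_def using M a by (subst msum_hom[OF h]) auto
    then show "msum M (\<lambda>t. (a i s t \<otimes> a (Suc i) t u) \<odot>\<^bsub>M\<^esub> x u) (b (Suc i)) = \<zero>\<^bsub>M\<^esub>"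
      using F s u M x[OF u] by (simp add: free_cx_def)
  qed
  finally show ?thesis .
qed

text \<open>The two mixed terms are the same matrix expression with opposite signs, since
  \<open>sdiff\<close> changes sign from \<open>i\<close> to \<open>i + 1\<close>; the pure terms
  vanish by the differential of \<open>Y\<close> and by \<open>mat_apply_twice\<close>.\<close>

lemma tensor_dd:
  assumes F: "free_cx b a" and Y: "cpx Y" and s: "s < b i"
    and x0: "x0 \<in> carrier (Obj Y m)" and x1: "\<And>t. t < b (Suc i) \<Longrightarrow> x1 t \<in> carrier (Obj Y (m - 1))"
    and x2: "\<And>u. u < b (Suc (Suc i)) \<Longrightarrow> x2 u \<in> carrier (Obj Y (m - 2))"
  shows "sdiff Y i (m - 1) (sdiff Y i m x0 \<oplus>\<^bsub>Obj Y (m - 1)\<^esub> mat_apply b a (Obj Y (m - 1)) i s x1)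
    \<oplus>\<^bsub>Obj Y (m - 2)\<^esub> mat_apply b a (Obj Y (m - 2)) i s
      (\<lambda>t. sdiff Y (Suc i) (m - 1) (x1 t) \<oplus>\<^bsub>Obj Y (m - 2)\<^esub> mat_apply b a (Obj Y (m - 2)) (Suc i) t x2)
    = \<zero>\<^bsub>Obj Y (m - 2)\<^esub>"
proof -
  note M = cpx_module[OF Y]
  have h: "sdiff Y i (m - 1) \<in> mod_hom R (Obj Y (m - 1)) (Obj Y (m - 2))"
    using sdiff_hom[OF Y, of i "m - 1"] by simp
  have d1: "sdiff Y i (m - 1) (sdiff Y i m x0) = \<zero>\<^bsub>Obj Y (m - 2)\<^esub>"
    using Y x0 by (simp add: sdiff_def)
  let ?A = "mat_apply b a (Obj Y (m - 2)) i s (\<lambda>t. sdiff Y i (m - 1) (x1 t))"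
  have A: "?A \<in> carrier (Obj Y (m - 2))" using F Y x1 by (intro mat_apply_closed) auto
  have l: "sdiff Y i (m - 1) (sdiff Y i m x0 \<oplus>\<^bsub>Obj Y (m - 1)\<^esub> mat_apply b a (Obj Y (m - 1)) i s x1) = ?A"
    using F Y x0 x1 A by (simp add: mod_homD(2)[OF h] d1 mat_apply_hom[OF F h])
  have "mat_apply b a (Obj Y (m - 2)) i s (\<lambda>t. sdiff Y (Suc i) (m - 1) (x1 t)) =
      mat_apply b a (Obj Y (m - 2)) i s (\<lambda>t. \<ominus>\<^bsub>Obj Y (m - 2)\<^esub> sdiff Y i (m - 1) (x1 t))"
    using Y x1 by (intro mat_apply_cong) (auto simp: sdiff_def)
  also have "\<dots> = \<ominus>\<^bsub>Obj Y (m - 2)\<^esub> ?A"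
    using F Y x1 mod_hom_minus[OF M mod_hom_id] by (subst mat_apply_hom[of b a "a_inv (Obj Y (m - 2))"]) auto
  finally have "mat_apply b a (Obj Y (m - 2)) i s
      (\<lambda>t. sdiff Y (Suc i) (m - 1) (x1 t) \<oplus>\<^bsub>Obj Y (m - 2)\<^esub> mat_apply b a (Obj Y (m - 2)) (Suc i) t x2) =
    \<ominus>\<^bsub>Obj Y (m - 2)\<^esub> ?A"
    using F Y x1 x2 A s by (subst mat_apply_add) (auto simp: mat_apply_twice)
  then show ?thesis unfolding l using A Y by simp
qed

text \<open>There are finitely many basis elements in each degree, so finite support means bounded
  degree.\<close>

lemma finite_basis:
  "finite {q \<in> basis b. P q} \<longleftrightarrow> (\<exists>N. \<forall>i s. s < b i \<longrightarrow> N \<le> i \<longrightarrow> \<not> P (i, s))"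
proof
  assume "finite {q \<in> basis b. P q}"
  then have "finite (fst ` {q \<in> basis b. P q})" by simp
  then obtain N where N: "fst ` {q \<in> basis b. P q} \<subseteq> {..<N}"
    unfolding finite_nat_iff_bounded by (elim exE)
  have "\<not> P (i, s)" if "s < b i" "N \<le> i" for i s
  proof
    assume "P (i, s)"
    then have "i \<in> fst ` {q \<in> basis b. P q}" using that by (intro image_eqI[of _ _ "(i, s)"]) (auto simp: basis_def)
    then show False using N that by auto
  qed
  then show "\<exists>N. \<forall>i s. s < b i \<longrightarrow> N \<le> i \<longrightarrow> \<not> P (i, s)" by blast
next
  assume "\<exists>N. \<forall>i s. s < b i \<longrightarrow> N \<le> i \<longrightarrow> \<not> P (i, s)"
  then obtain N where N: "\<forall>i s. s < b i \<longrightarrow> N \<le> i \<longrightarrow> \<not> P (i, s)" by (elim exE)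
  have "{q \<in> basis b. P q} \<subseteq> Sigma {..<N} (\<lambda>i. {..<b i})"
  proof
    fix q assume "q \<in> {q \<in> basis b. P q}"
    then have "snd q < b (fst q)" "P (fst q, snd q)" by (auto simp: basis_def)
    then have "\<not> N \<le> fst q" using N by blast
    then show "q \<in> Sigma {..<N} (\<lambda>i. {..<b i})" using \<open>snd q < _\<close> by (cases q) simp
  qed
  then show "finite {q \<in> basis b. P q}" by (rule finite_subset) auto
qed

lemma tensor_carrier:
  "x \<in> carrier (Obj (tensor_cx b a Y) n) \<longleftrightarrow> x \<in> extensional (basis b) \<and>
    (\<forall>i s. s < b i \<longrightarrow> x (i, s) \<in> carrier (Obj Y (n - int i))) \<and>
    (\<exists>N. \<forall>i s. s < b i \<longrightarrow> N \<le> i \<longrightarrow> x (i, s) = \<zero>\<^bsub>Obj Y (n - int i)\<^esub>)"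
  by (auto simp: tensor_cx_def finite_basis PiE_def Pi_iff) (auto simp: basis_def)

lemma tensor_elt:
  assumes "x \<in> carrier (Obj (tensor_cx b a Y) n)" "s < b i"
  shows "x (i, s) \<in> carrier (Obj Y (n - int i))"
  using assms tensor_carrier by blast

lemma tensor_restrict:
  "restrict f (basis b) \<in> carrier (Obj (tensor_cx b a Y) n) \<longleftrightarrow>
    (\<forall>i s. s < b i \<longrightarrow> f (i, s) \<in> carrier (Obj Y (n - int i))) \<and>
    (\<exists>N. \<forall>i s. s < b i \<longrightarrow> N \<le> i \<longrightarrow> f (i, s) = \<zero>\<^bsub>Obj Y (n - int i)\<^esub>)"
  unfolding tensor_carrier by (auto simp: basis_def)

lemma basis_iff [simp]: "(i, s) \<in> basis b \<longleftrightarrow> s < b i"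
  by (simp add: basis_def)

lemma tensor_eqI:
  "\<lbrakk>x \<in> extensional (basis b); y \<in> extensional (basis b); \<And>i s. s < b i \<Longrightarrow> x (i, s) = y (i, s)\<rbrakk> \<Longrightarrow> x = y"
  by (rule extensionalityI) (auto simp: basis_def)

lemma tensor_simps:
  "x \<oplus>\<^bsub>Obj (tensor_cx b a Y) n\<^esub> y = (\<lambda>q\<in>basis b. x q \<oplus>\<^bsub>Obj Y (n - int (fst q))\<^esub> y q)"
  "\<zero>\<^bsub>Obj (tensor_cx b a Y) n\<^esub> = (\<lambda>q\<in>basis b. \<zero>\<^bsub>Obj Y (n - int (fst q))\<^esub>)"
  "r \<odot>\<^bsub>Obj (tensor_cx b a Y) n\<^esub> x = (\<lambda>q\<in>basis b. r \<odot>\<^bsub>Obj Y (n - int (fst q))\<^esub> x q)"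
  "Diff (tensor_cx b a Y) n x = (\<lambda>q\<in>basis b. sdiff Y (fst q) (n - int (fst q)) (x q)
       \<oplus>\<^bsub>Obj Y (n - int (Suc (fst q)))\<^esub> mat_apply b a (Obj Y (n - int (Suc (fst q)))) (fst q) (snd q)
         (\<lambda>t. x (Suc (fst q), t)))"
  by (simp_all add: tensor_cx_def)

lemma tensor_at:
  assumes "s < b i"
  shows "(x \<oplus>\<^bsub>Obj (tensor_cx b a Y) n\<^esub> y) (i, s) = x (i, s) \<oplus>\<^bsub>Obj Y (n - int i)\<^esub> y (i, s)"
    "\<zero>\<^bsub>Obj (tensor_cx b a Y) n\<^esub> (i, s) = \<zero>\<^bsub>Obj Y (n - int i)\<^esub>"
    "(r \<odot>\<^bsub>Obj (tensor_cx b a Y) n\<^esub> x) (i, s) = r \<odot>\<^bsub>Obj Y (n - int i)\<^esub> x (i, s)"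
    "Diff (tensor_cx b a Y) n x (i, s) = sdiff Y i (n - int i) (x (i, s)) \<oplus>\<^bsub>Obj Y (n - int (Suc i))\<^esub>
      mat_apply b a (Obj Y (n - int (Suc i))) i s (\<lambda>t. x (Suc i, t))"
  using assms by (simp_all add: tensor_simps del: of_nat_Suc)

lemma tensor_extensional [simp]:
  "x \<oplus>\<^bsub>Obj (tensor_cx b a Y) n\<^esub> y \<in> extensional (basis b)"
  "\<zero>\<^bsub>Obj (tensor_cx b a Y) n\<^esub> \<in> extensional (basis b)"
  "r \<odot>\<^bsub>Obj (tensor_cx b a Y) n\<^esub> x \<in> extensional (basis b)"
  "Diff (tensor_cx b a Y) n x \<in> extensional (basis b)"
  by (simp_all add: tensor_simps)

lemma cpx_tensor [simp]:
  assumes F: "free_cx b a" and Y: "cpx Y" shows "cpx (tensor_cx b a Y)"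
proof (rule cpxI)
  let ?T = "tensor_cx b a Y"
  show "module R (Obj ?T n)" for n
    unfolding tensor_cx_def using Y by simp
  note idx = diff_int_Suc
  have sd: "sdiff Y i (n - int i) \<in> mod_hom R (Obj Y (n - int i)) (Obj Y (n - int (Suc i)))" for n i
    using sdiff_hom[OF Y, of i "n - int i"] by (simp add: algebra_simps)
  note h = mod_homD[OF sd]
  have Suc: "x (Suc i, t) \<in> carrier (Obj Y (n - int (Suc i)))"
    if "x \<in> carrier (Obj ?T n)" "t < b (Suc i)" for x n i t
    using tensor_elt[OF that] .
  fix n x assume x: "x \<in> carrier (Obj ?T n)"
  obtain N where N: "\<And>i s. s < b i \<Longrightarrow> N \<le> i \<Longrightarrow> x (i, s) = \<zero>\<^bsub>Obj Y (n - int i)\<^esub>"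
    using x unfolding tensor_carrier by blast
  have "sdiff Y i (n - int i) (x (i, s)) \<oplus>\<^bsub>Obj Y (n - int (Suc i))\<^esub>
      mat_apply b a (Obj Y (n - int (Suc i))) i s (\<lambda>t. x (Suc i, t)) = \<zero>\<^bsub>Obj Y (n - int (Suc i))\<^esub>"
    if "s < b i" "N \<le> i" for i s
    using that F Y N by (simp add: mat_apply_zero h(4) del: of_nat_Suc)
  moreover have "sdiff Y i (n - int i) (x (i, s)) \<oplus>\<^bsub>Obj Y (n - int (Suc i))\<^esub>
      mat_apply b a (Obj Y (n - int (Suc i))) i s (\<lambda>t. x (Suc i, t)) \<in> carrier (Obj Y (n - int (Suc i)))"
    if "s < b i" for i s
    using that F Y x by (simp add: Suc h(1) tensor_elt del: of_nat_Suc)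
  ultimately show Dx: "Diff ?T n x \<in> carrier (Obj ?T (n - 1))"
    unfolding tensor_simps(4) tensor_restrict idx by (auto simp del: of_nat_Suc)
  show "Diff ?T n (r \<odot>\<^bsub>Obj ?T n\<^esub> x) = r \<odot>\<^bsub>Obj ?T (n - 1)\<^esub> Diff ?T n x" if r: "r \<in> carrier R" for r
  proof (rule tensor_eqI[of _ b])
    fix i s assume s: "s < b i"
    have hr: "(\<lambda>y. r \<odot>\<^bsub>Obj Y (n - int (Suc i))\<^esub> y) \<in> mod_hom R (Obj Y (n - int (Suc i))) (Obj Y (n - int (Suc i)))"
      using Y r by (intro mod_homI) (auto simp: md_smult_comm simp del: of_nat_Suc)
    have "mat_apply b a (Obj Y (n - int (Suc i))) i s (\<lambda>t. (r \<odot>\<^bsub>Obj ?T n\<^esub> x) (Suc i, t)) =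
        r \<odot>\<^bsub>Obj Y (n - int (Suc i))\<^esub> mat_apply b a (Obj Y (n - int (Suc i))) i s (\<lambda>t. x (Suc i, t))"
      using F Y x Suc[OF x] by (subst mat_apply_hom[OF F hr])
        (auto simp: tensor_at simp del: of_nat_Suc intro!: mat_apply_cong)
    then show "Diff ?T n (r \<odot>\<^bsub>Obj ?T n\<^esub> x) (i, s) = (r \<odot>\<^bsub>Obj ?T (n - 1)\<^esub> Diff ?T n x) (i, s)"
      using s F Y r x Suc[OF x] tensor_elt[OF x s]
      by (simp add: idx tensor_at h del: of_nat_Suc)
  qed simp_all
  show "Diff ?T (n - 1) (Diff ?T n x) = \<zero>\<^bsub>Obj ?T (n - 2)\<^esub>"
  proof (rule tensor_eqI[of _ b])
    fix i s assume s: "s < b i"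
    have "n - int i - 1 = n - int (Suc i)" "n - int i - 2 = n - int (Suc (Suc i))" by auto
    note dd = tensor_dd[OF F Y s tensor_elt[OF x s], unfolded this, of "\<lambda>t. x (Suc i, t)" "\<lambda>u. x (Suc (Suc i), u)",
      OF Suc[OF x] Suc[OF x]]
    have "mat_apply b a (Obj Y (n - int (Suc (Suc i)))) i s (\<lambda>t. Diff ?T n x (Suc i, t)) =
      mat_apply b a (Obj Y (n - int (Suc (Suc i)))) i s (\<lambda>t. sdiff Y (Suc i) (n - int (Suc i)) (x (Suc i, t)) \<oplus>\<^bsub>Obj Y (n - int (Suc (Suc i)))\<^esub>
        mat_apply b a (Obj Y (n - int (Suc (Suc i)))) (Suc i) t (\<lambda>u. x (Suc (Suc i), u)))"
      by (rule mat_apply_cong) (simp add: tensor_at del: of_nat_Suc)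
    then show "Diff ?T (n - 1) (Diff ?T n x) (i, s) = \<zero>\<^bsub>Obj ?T (n - 2)\<^esub> (i, s)"
      using s dd by (simp add: idx tensor_at del: of_nat_Suc)
  qed simp_all
  fix y assume y: "y \<in> carrier (Obj ?T n)"
  show "Diff ?T n (x \<oplus>\<^bsub>Obj ?T n\<^esub> y) = Diff ?T n x \<oplus>\<^bsub>Obj ?T (n - 1)\<^esub> Diff ?T n y"
  proof (rule tensor_eqI[of _ b])
    fix i s assume s: "s < b i"
    have "mat_apply b a (Obj Y (n - int (Suc i))) i s (\<lambda>t. (x \<oplus>\<^bsub>Obj ?T n\<^esub> y) (Suc i, t)) =
      mat_apply b a (Obj Y (n - int (Suc i))) i s (\<lambda>t. x (Suc i, t)) \<oplus>\<^bsub>Obj Y (n - int (Suc i))\<^esub>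
      mat_apply b a (Obj Y (n - int (Suc i))) i s (\<lambda>t. y (Suc i, t))"
      using F Y Suc[OF x] Suc[OF y] by (subst mat_apply_add[symmetric])
        (auto simp: tensor_at simp del: of_nat_Suc intro!: mat_apply_cong)
    then show "Diff ?T n (x \<oplus>\<^bsub>Obj ?T n\<^esub> y) (i, s) = (Diff ?T n x \<oplus>\<^bsub>Obj ?T (n - 1)\<^esub> Diff ?T n y) (i, s)"
      using s F Y Suc[OF x] Suc[OF y] tensor_elt[OF x s] tensor_elt[OF y s]
      by (simp add: idx tensor_at h md_ac del: of_nat_Suc)
  qed simp_all
qed

definition tensor_map :: "(nat \<Rightarrow> nat) \<Rightarrow> (int \<Rightarrow> 'm \<Rightarrow> 'n) \<Rightarrow> int \<Rightarrow> (nat \<times> nat \<Rightarrow> 'm) \<Rightarrow> nat \<times> nat \<Rightarrow> 'n" where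
  "tensor_map b f n x = (\<lambda>q\<in>basis b. f (n - int (fst q)) (x q))"

lemma tensor_map_at: "s < b i \<Longrightarrow> tensor_map b f n x (i, s) = f (n - int i) (x (i, s))"
  by (simp add: tensor_map_def)

lemma tensor_map_extensional [simp]: "tensor_map b f n x \<in> extensional (basis b)"
  by (simp add: tensor_map_def)

lemma cmap_tensor:
  assumes F: "free_cx b a" and f: "cmap X Y f"
  shows "cmap (tensor_cx b a X) (tensor_cx b a Y) (tensor_map b f)"
proof -
  let ?X = "tensor_cx b a X" and ?Y = "tensor_cx b a Y"
  note c = cmapD[OF f]
  have XY: "cpx ?X" "cpx ?Y" using F c(1,2) by auto
  have idx: "n - 1 - int i = n - int (Suc i)" for n i by simp
  show ?thesis
  proof (rule cmapI[OF XY])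
    fix n x assume x: "x \<in> carrier (Obj ?X n)"
    note xe = tensor_elt[OF x]
    obtain N where "\<And>i s. s < b i \<Longrightarrow> N \<le> i \<Longrightarrow> x (i, s) = \<zero>\<^bsub>Obj X (n - int i)\<^esub>"
      using x unfolding tensor_carrier by blast
    then have "\<forall>i s. s < b i \<longrightarrow> N \<le> i \<longrightarrow> f (n - int i) (x (i, s)) = \<zero>\<^bsub>Obj Y (n - int i)\<^esub>"
      using c(6) by simp
    then show "tensor_map b f n x \<in> carrier (Obj ?Y n)"
      unfolding tensor_map_def tensor_restrict using xe c(3) by auto
    show "tensor_map b f n (r \<odot>\<^bsub>Obj ?X n\<^esub> x) = r \<odot>\<^bsub>Obj ?Y n\<^esub> tensor_map b f n x" if "r \<in> carrier R" for r
      by (rule tensor_eqI[of _ b]) (use xe that in \<open>auto simp: tensor_at tensor_map_at c(5)\<close>)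
    show "tensor_map b f (n - 1) (Diff ?X n x) = Diff ?Y n (tensor_map b f n x)"
    proof (rule tensor_eqI[of _ b])
      fix i s assume s: "s < b i"
      let ?M = "Obj X (n - int (Suc i))" and ?N = "Obj Y (n - int (Suc i))"
      have xS: "t < b (Suc i) \<Longrightarrow> x (Suc i, t) \<in> carrier ?M" for t using xe by blast
      have "f (n - int (Suc i)) (mat_apply b a ?M i s (\<lambda>t. x (Suc i, t))) =
          mat_apply b a ?N i s (\<lambda>t. f (n - int (Suc i)) (x (Suc i, t)))"
        using F c(1,2) xS by (intro mat_apply_hom[OF F cmap_hom[OF f]]) auto
      also have "\<dots> = mat_apply b a ?N i s (\<lambda>t. tensor_map b f n x (Suc i, t))"
        by (rule mat_apply_cong) (simp add: tensor_map_at del: of_nat_Suc)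
      finally have 1: "f (n - int (Suc i)) (mat_apply b a ?M i s (\<lambda>t. x (Suc i, t))) =
        mat_apply b a ?N i s (\<lambda>t. tensor_map b f n x (Suc i, t))" .
      have 2: "sdiff Y i (n - int i) (f (n - int i) (x (i, s))) = f (n - int (Suc i)) (sdiff X i (n - int i) (x (i, s)))"
        using xe[OF s] c(1) by (simp add: sdiff_def c(7) c(8) diff_int_Suc del: of_nat_Suc)
      have 3: "sdiff X i (n - int i) (x (i, s)) \<in> carrier ?M" using xe[OF s] c(1) by simp
      show "tensor_map b f (n - 1) (Diff ?X n x) (i, s) = Diff ?Y n (tensor_map b f n x) (i, s)"
        using s 1 3 F c(1) xS
        by (simp add: idx c(4) tensor_at tensor_map_at 2 del: of_nat_Suc)
    qed simp_all
    fix y assume y: "y \<in> carrier (Obj ?X n)"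
    show "tensor_map b f n (x \<oplus>\<^bsub>Obj ?X n\<^esub> y) = tensor_map b f n x \<oplus>\<^bsub>Obj ?Y n\<^esub> tensor_map b f n y"
      by (rule tensor_eqI[of _ b]) (use xe tensor_elt[OF y] in \<open>auto simp: tensor_at tensor_map_at c(4)\<close>)
  qed
qed

definition tensor_aug :: "int \<Rightarrow> ('r, 'd) module \<Rightarrow> ('m \<Rightarrow> 'd) \<Rightarrow> int \<Rightarrow> (nat \<times> nat \<Rightarrow> 'm) \<Rightarrow> 'd" where
  "tensor_aug c D g n x = (if n = c then g (x (0, 0)) else \<zero>\<^bsub>D\<^esub>)"

text \<open>The map reads off the component at \<open>(0, 0)\<close>, the only generator in degree
  zero. Only the differential from degree \<open>c + 1\<close> can hit it: its part from
  \<open>Y\<close> is killed by \<open>gd\<close>, and its part from the first matrix by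
  \<open>ga\<close>.\<close>

lemma cmap_tensor_aug:
  assumes F: "free_cx b a" and Y: "cpx Y" and D: "module R D" and g: "g \<in> mod_hom R (Obj Y c) D"
    and gd: "\<And>y. y \<in> carrier (Obj Y (c + 1)) \<Longrightarrow> g (Diff Y (c + 1) y) = \<zero>\<^bsub>D\<^esub>"
    and ga: "\<And>t y. t < b 1 \<Longrightarrow> y \<in> carrier (Obj Y c) \<Longrightarrow> a 0 0 t \<odot>\<^bsub>D\<^esub> g y = \<zero>\<^bsub>D\<^esub>"
  shows "cmap (tensor_cx b a Y) (conc_cx c D) (tensor_aug c D g)"
proof -
  have b0: "0 < b 0" using F by (simp add: free_cx_def)
  note g' = mod_homD[OF g]
  show ?thesis
  proof (rule cmapI)
    fix n x assume x: "x \<in> carrier (Obj (tensor_cx b a Y) n)"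
    note xe = tensor_elt[OF x b0, simplified]
    show "tensor_aug c D g n x \<in> carrier (Obj (conc_cx c D) n)"
      using xe g' D by (auto simp: tensor_aug_def conc_simps)
    show "tensor_aug c D g n (r \<odot>\<^bsub>Obj (tensor_cx b a Y) n\<^esub> x) = r \<odot>\<^bsub>Obj (conc_cx c D) n\<^esub> tensor_aug c D g n x"
      if "r \<in> carrier R" for r
      using xe g' D b0 that by (auto simp: tensor_aug_def conc_simps tensor_at)
    show "tensor_aug c D g (n - 1) (Diff (tensor_cx b a Y) n x) = Diff (conc_cx c D) n (tensor_aug c D g n x)"
    proof (cases "n = c + 1")
      case True
      have x1: "x (1, t) \<in> carrier (Obj Y c)" if "t < b 1" for t
        using tensor_elt[OF x that] True by simp
      have "g (mat_apply b a (Obj Y c) 0 0 (\<lambda>t. x (1, t))) = mat_apply b a D 0 0 (\<lambda>t. g (x (1, t)))"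
        using x1 Y D by (intro mat_apply_hom[OF F g]) auto
      also have "\<dots> = \<zero>\<^bsub>D\<^esub>" unfolding mat_apply_def using x1 ga D by (intro msum_zero) auto
      finally have "g (mat_apply b a (Obj Y c) 0 0 (\<lambda>t. x (1, t))) = \<zero>\<^bsub>D\<^esub>" .
      moreover have "mat_apply b a (Obj Y c) 0 0 (\<lambda>t. x (1, t)) \<in> carrier (Obj Y c)"
        using F Y x1 by (intro mat_apply_closed) auto
      ultimately show ?thesis
        using True xe b0 Y D gd by (simp add: tensor_aug_def conc_simps tensor_at sdiff_def g')
    qed (simp add: tensor_aug_def conc_simps)
    fix y assume y: "y \<in> carrier (Obj (tensor_cx b a Y) n)"
    show "tensor_aug c D g n (x \<oplus>\<^bsub>Obj (tensor_cx b a Y) n\<^esub> y) =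
        tensor_aug c D g n x \<oplus>\<^bsub>Obj (conc_cx c D) n\<^esub> tensor_aug c D g n y"
      using xe tensor_elt[OF y b0, simplified] g' D b0 by (auto simp: tensor_aug_def conc_simps tensor_at)
  qed (use F Y D in auto)
qed

end

context cellular
begin

text \<open>The basis is added one element at a time, in order of degree. Each basis element of
  degree \<open>i\<close> contributes the quotient \<open>shift (int i) Y\<close>, which is
  absorbed, and an extension of the tensor product is the union of the preimages of these
  stages.\<close>

lemma absorbed_tensor:
  assumes F: "free_cx b a" and Y: "cpx Y" and sh: "\<And>i :: nat. absorbed (shift (int i) Y)"
  shows "absorbed (tensor_cx b a Y)"
proof (rule absorbedI)
  let ?T = "tensor_cx b a Y"
  show T: "cpx ?T" using F Y by simp
  have "basis b \<lesssim> (UNIV :: 'u set)"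
    using lepoll_trans[OF subset_imp_lepoll lepoll_Times_infinite[OF infinite_u nat_lepoll nat_lepoll]]
    by simp
  then have "small (dsum_cx (basis b) (\<lambda>q. shift (int (fst q)) Y))"
    by (rule small_dsum) (rule absorbed_small[OF sh])
  then show "small ?T" by (simp add: small_cx_def tensor_cx_def)
  fix B V :: "('r, 'u) cx" and f p
  assume S: "ses B V ?T f p" and B: "B \<in> C"
  note s = sesD[OF S] and cp = cmapD[OF sesD(2)[OF S]]
  have V: "cpx V" by (rule cp)
  \<comment> \<open>The elements of \<open>V\<close> whose image is supported before
    \<open>(i, s)\<close> in the lexicographic order. They form a subcomplex because the matrices
    only lower the degree \<open>i\<close>.\<close>
  define P where "P = (\<lambda>i s n. {v \<in> carrier (Obj V n). \<forall>j t. t < b j \<longrightarrow> (i < j \<or> j = i \<and> s \<le> t) \<longrightarrow>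
    p n v (j, t) = \<zero>\<^bsub>Obj Y (n - int j)\<^esub>})"
  define W where "W = (\<lambda>i s. sub_cx V (P i s))"
  have pe: "p n v (j, t) \<in> carrier (Obj Y (n - int j))" if "v \<in> carrier (Obj V n)" "t < b j" for n v j t
    using tensor_elt[OF cp(3)[OF that(1)] that(2)] .
  have sd0: "sdiff Y j (n - int j) \<zero>\<^bsub>Obj Y (n - int j)\<^esub> = \<zero>\<^bsub>Obj Y (n - int (Suc j))\<^esub>" for j n
    using mod_homD(4)[OF sdiff_hom[OF Y, of j "n - int j"]] Y by (simp add: diff_int_Suc del: of_nat_Suc)
  have pd: "p (n - 1) (Diff V n v) (j, t) = sdiff Y j (n - int j) (p n v (j, t))"
    if v: "v \<in> carrier (Obj V n)" and t: "t < b j"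
      and z: "\<And>t'. t' < b (Suc j) \<Longrightarrow> p n v (Suc j, t') = \<zero>\<^bsub>Obj Y (n - int (Suc j))\<^esub>" for n v j t
    using v t F Y pe[OF v t] by (simp add: cp(8) tensor_at mat_apply_zero z del: of_nat_Suc)
  have SP: "subcomplex V (P i s)" for i s
    unfolding subcomplex_def
  proof (intro allI conjI ballI)
    fix n
    show "sub_mod (Obj V n) (P i s n)"
    proof (rule sub_modI)
      show "P i s n \<subseteq> carrier (Obj V n)" by (auto simp: P_def)
      show "\<zero>\<^bsub>Obj V n\<^esub> \<in> P i s n" using V by (simp add: P_def cp(6) tensor_at)
      show "x \<oplus>\<^bsub>Obj V n\<^esub> y \<in> P i s n" if "x \<in> P i s n" "y \<in> P i s n" for x y
        using that V Y by (auto simp: P_def cp(4) tensor_at)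
      show "r \<odot>\<^bsub>Obj V n\<^esub> x \<in> P i s n" if "r \<in> carrier R" "x \<in> P i s n" for r x
        using that V Y by (auto simp: P_def cp(5) tensor_at)
    qed
    fix v assume v: "v \<in> P i s n"
    then have v': "v \<in> carrier (Obj V n)"
      and z: "\<And>j t. t < b j \<Longrightarrow> i < j \<or> j = i \<and> s \<le> t \<Longrightarrow> p n v (j, t) = \<zero>\<^bsub>Obj Y (n - int j)\<^esub>"
      by (auto simp: P_def)
    have "p (n - 1) (Diff V n v) (j, t) = \<zero>\<^bsub>Obj Y (n - 1 - int j)\<^esub>"
      if "t < b j" "i < j \<or> j = i \<and> s \<le> t" for j t
    proof -
      have "p (n - 1) (Diff V n v) (j, t) = sdiff Y j (n - int j) (p n v (j, t))"
        using that by (intro pd v') (auto intro!: z simp del: of_nat_Suc)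
      then show ?thesis using z[OF that] sd0 by (simp add: diff_int_Suc del: of_nat_Suc)
    qed
    then show "Diff V n v \<in> P i s (n - 1)" using v' V by (simp add: P_def)
  qed
  have cW: "cpx (W i s)" for i s unfolding W_def using V SP by simp
  \<comment> \<open>On \<open>W i (Suc s)\<close> all entries of degree \<open>i + 1\<close> vanish,
    and with them the matrix part of the differential at \<open>(i, s)\<close>; hence this entry is
    a chain map to the suspension of \<open>Y\<close>, with kernel \<open>W i s\<close>.\<close>
  have step: "in_cell (W i (Suc s))" if W: "in_cell (W i s)" and s_b: "s < b i" for i s
  proof (rule absorbedD[OF sh[of i] _ W])
    let ?q = "\<lambda>n v. p n v (i, s)"
    have sub: "P i s n \<subseteq> P i (Suc s) n" for n by (auto simp: P_def)
    have q: "cmap (W i (Suc s)) (shift (int i) Y) ?q"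
    proof (rule cmapI[OF cW])
      show "cpx (shift (int i) Y)" using Y by simp
      fix n v assume "v \<in> carrier (Obj (W i (Suc s)) n)"
      then have v: "v \<in> carrier (Obj V n)"
        and z: "\<And>j t. t < b j \<Longrightarrow> i < j \<or> j = i \<and> Suc s \<le> t \<Longrightarrow> p n v (j, t) = \<zero>\<^bsub>Obj Y (n - int j)\<^esub>"
        by (auto simp: W_def P_def)
      show "?q n v \<in> carrier (Obj (shift (int i) Y) n)" using pe[OF v s_b] by simp
      show "?q n (r \<odot>\<^bsub>Obj (W i (Suc s)) n\<^esub> v) = r \<odot>\<^bsub>Obj (shift (int i) Y) n\<^esub> ?q n v" if "r \<in> carrier R" for r
        using that v s_b by (simp add: W_def cp(5) tensor_at)
      have "?q (n - 1) (Diff V n v) = sdiff Y i (n - int i) (p n v (i, s))"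
        by (rule pd[OF v s_b]) (rule z, auto)
      then show "?q (n - 1) (Diff (W i (Suc s)) n v) = Diff (shift (int i) Y) n (?q n v)"
        by (simp add: W_def Diff_shift_nat)
      fix u assume "u \<in> carrier (Obj (W i (Suc s)) n)"
      then have "u \<in> carrier (Obj V n)" by (auto simp: W_def P_def)
      then show "?q n (v \<oplus>\<^bsub>Obj (W i (Suc s)) n\<^esub> u) = ?q n v \<oplus>\<^bsub>Obj (shift (int i) Y) n\<^esub> ?q n u"
        using v s_b by (simp add: W_def cp(4) tensor_at)
    qed
    show "ses (W i s) (W i (Suc s)) (shift (int i) Y) (\<lambda>n x. x) ?q"
      unfolding ses_def
    proof (intro conjI allI ballI impI q)
      show "cmap (W i s) (W i (Suc s)) (\<lambda>n x. x)"
        using cW sub by (intro cmapI) (auto simp: W_def)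
      fix n
      show "x = \<zero>\<^bsub>Obj (W i s) n\<^esub>" if "x = \<zero>\<^bsub>Obj (W i (Suc s)) n\<^esub>" for x using that by (simp add: W_def)
      show "?q n v = \<zero>\<^bsub>Obj (shift (int i) Y) n\<^esub>" if "v \<in> carrier (Obj (W i s) n)" for v
        using that s_b by (auto simp: W_def P_def)
      show "\<exists>u\<in>carrier (Obj (W i s) n). v = u"
        if v: "v \<in> carrier (Obj (W i (Suc s)) n)" and z: "?q n v = \<zero>\<^bsub>Obj (shift (int i) Y) n\<^esub>" for v
      proof -
        have "p n v (j, t) = \<zero>\<^bsub>Obj Y (n - int j)\<^esub>" if "t < b j" "i < j \<or> j = i \<and> s \<le> t" for j t
          using v z that by (cases "j = i \<and> t = s") (auto simp: W_def P_def)
        then show ?thesis using v by (auto simp: W_def P_def)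
      qed
      fix y assume y: "y \<in> carrier (Obj (shift (int i) Y) n)"
      let ?y = "\<lambda>q\<in>basis b. if q = (i, s) then y else \<zero>\<^bsub>Obj Y (n - int (fst q))\<^esub>"
      have "?y \<in> carrier (Obj ?T n)"
        unfolding tensor_restrict
      proof (intro conjI)
        show "\<exists>N. \<forall>j t. t < b j \<longrightarrow> N \<le> j \<longrightarrow>
            (if (j, t) = (i, s) then y else \<zero>\<^bsub>Obj Y (n - int (fst (j, t)))\<^esub>) = \<zero>\<^bsub>Obj Y (n - int j)\<^esub>"
          by (rule exI[of _ "Suc i"]) auto
      qed (use y Y in auto)
      then obtain v where v: "v \<in> carrier (Obj V n)" "?y = p n v" using s(4) by blast
      have "p n v (j, t) = \<zero>\<^bsub>Obj Y (n - int j)\<^esub>" if "t < b j" "i < j \<or> j = i \<and> Suc s \<le> t" for j t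
        unfolding v(2)[symmetric] using that by auto
      then have "v \<in> carrier (Obj (W i (Suc s)) n)" using v(1) by (simp add: W_def P_def)
      moreover have "y = p n v (i, s)" unfolding v(2)[symmetric] using s_b by simp
      ultimately show "\<exists>v\<in>carrier (Obj (W i (Suc s)) n). y = ?q n v" by blast
    qed
  qed
  have next_i: "W i (b i) = W (Suc i) 0" for i
  proof -
    have "t < b j \<Longrightarrow> (i < j \<or> j = i \<and> b i \<le> t) = (Suc i < j \<or> j = Suc i \<and> 0 \<le> t)" for j t by auto
    then have "P i (b i) = P (Suc i) 0" unfolding P_def by (simp cong: imp_cong)
    then show ?thesis by (simp add: W_def)
  qed
  have row: "in_cell (W i s)" if "in_cell (W i 0)" "s \<le> b i" for i s
    using that(2) by (induction s) (use that(1) step in auto)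
  have base: "in_cell (W 0 0)"
  proof -
    have "P 0 0 n = {v \<in> carrier (Obj V n). p n v = \<zero>\<^bsub>Obj ?T n\<^esub>}" for n
    proof -
      have "p n v = \<zero>\<^bsub>Obj ?T n\<^esub> \<longleftrightarrow> (\<forall>j t. t < b j \<longrightarrow> p n v (j, t) = \<zero>\<^bsub>Obj Y (n - int j)\<^esub>)"
        if "v \<in> carrier (Obj V n)" for v
      proof
        assume "\<forall>j t. t < b j \<longrightarrow> p n v (j, t) = \<zero>\<^bsub>Obj Y (n - int j)\<^esub>"
        moreover have "p n v \<in> extensional (basis b)" using cp(3)[OF that] tensor_carrier by blast
        ultimately show "p n v = \<zero>\<^bsub>Obj ?T n\<^esub>" by (intro tensor_eqI[of _ b]) (auto simp: tensor_at)
      qed (simp add: tensor_at)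
      moreover have T: "(0 < j \<or> j = 0 \<and> 0 \<le> t) = True" for j t :: nat by auto
      ultimately show ?thesis unfolding P_def T simp_thms by auto
    qed
    then have "W 0 0 = ker_cx V ?T p" by (simp add: W_def ker_cx_def fun_eq_iff sub_cx_def)
    then show ?thesis using in_cell_iso[OF ses_ker_iso[OF S]] B by (simp add: in_cell_iff)
  qed
  have all: "in_cell (W i 0)" for i
  proof (induction i)
    case (Suc i)
    then show ?case using row[of i "b i"] next_i by simp
  qed (rule base)
  show "in_cell V"
  proof (rule in_cell_colim[of "\<lambda>k. W k 0" "\<lambda>_ _ x. x" V "\<lambda>_ _ x. x"])
    show "W k 0 \<in> C" for k using all in_cell_iff by blast
    show "cmap (W k 0) V (\<lambda>_ x. x)" for k unfolding W_def using cmap_sub[OF V SP] .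
    have "P k 0 n \<subseteq> P (Suc k) 0 n" for k n by (auto simp: P_def)
    then show "cmap (W k 0) (W (Suc k) 0) (\<lambda>_ x. x)" for k
      using cW by (intro cmapI) (auto simp: W_def)
    show "\<exists>k. \<exists>x\<in>carrier (Obj (W k 0) n). y = x" if y: "y \<in> carrier (Obj V n)" for n y
    proof -
      obtain N where "\<And>j t. t < b j \<Longrightarrow> N \<le> j \<Longrightarrow> p n y (j, t) = \<zero>\<^bsub>Obj Y (n - int j)\<^esub>"
        using cp(3)[OF y] unfolding tensor_carrier by blast
      then have "y \<in> carrier (Obj (W N 0) n)" using y by (auto simp: W_def P_def)
      then show ?thesis by blast
    qed
  qed (auto simp: W_def)
qed

end

section \<open>Cyclic modules\<close>

context cring_complexes
begin

text \<open>Exactness of the free complex augmented by R/J, written with column vectors: the first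
  matrix generates \<open>J\<close>, and at each later place the kernel is contained in the
  image.\<close>

definition resolves :: "(nat \<Rightarrow> nat) \<Rightarrow> (nat \<Rightarrow> nat \<Rightarrow> nat \<Rightarrow> 'r) \<Rightarrow> 'r set \<Rightarrow> bool" where
  "resolves b a J \<longleftrightarrow> free_cx b a \<and> (\<forall>t<b 1. a 0 0 t \<in> J) \<and>
    (\<forall>r\<in>J. \<exists>w. (\<forall>t<b 1. w t \<in> carrier R) \<and> r = mat_apply b a ring_mod 0 0 w) \<and>
    (\<forall>i v. (\<forall>t<b (Suc i). v t \<in> carrier R) \<and> (\<forall>s<b i. mat_apply b a ring_mod i s v = \<zero>) \<longrightarrow>
      (\<exists>w. (\<forall>u<b (Suc (Suc i)). w u \<in> carrier R) \<and>
        (\<forall>t<b (Suc i). v t = mat_apply b a ring_mod (Suc i) t w)))"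

abbreviation "quot_ring J \<equiv> quot_mod ring_mod J"

lemma quot_ring_zero_iff:
  "ideal J R \<Longrightarrow> r \<in> carrier R \<Longrightarrow> J +>\<^bsub>ring_mod\<^esub> r = \<zero>\<^bsub>quot_ring J\<^esub> \<longleftrightarrow> r \<in> J"
  using coset_eq_N[OF module_ring_mod sub_mod_ideal] by (simp add: quot_mod_def)

lemma quot_ring_smult_zero:
  assumes J: "ideal J R" and j: "j \<in> J" and r: "r \<in> carrier R"
  shows "j \<odot>\<^bsub>quot_ring J\<^esub> (J +>\<^bsub>ring_mod\<^esub> r) = \<zero>\<^bsub>quot_ring J\<^esub>"
proof -
  interpret ideal J R by fact
  have "j \<in> carrier R" "j \<otimes> r \<in> J" using j r a_subset I_r_closed by auto
  then show ?thesis
    using quot_mod_simps(4)[OF module_ring_mod sub_mod_ideal[OF J]] quot_ring_zero_iff[OF J, of "j \<otimes> r"] r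
    by simp
qed

lemma sdiff_conc: "module R M \<Longrightarrow> y \<in> carrier (Obj (conc_cx c M) m) \<Longrightarrow> sdiff (conc_cx c M) i m y = \<zero>\<^bsub>M\<^esub>"
  using md_simps(8)[OF cpx_module[OF cpx_conc[of M c]], of "m - 1"]
  by (simp add: sdiff_def conc_simps)

lemma mat_apply_conc:
  "mat_apply b a (Obj (conc_cx c M) m) i s f = mat_apply b a M i s f"
proof -
  have "msum (Obj (conc_cx c M) m) g k = msum M g k" for g k
    by (induction k) (simp_all add: conc_simps)
  then show ?thesis by (simp add: mat_apply_def conc_simps)
qed

lemma cmap_resolution:
  assumes F: "free_cx b a" and J: "ideal J R" and a: "\<And>t. t < b 1 \<Longrightarrow> a 0 0 t \<in> J"
  shows "cmap (tensor_cx b a (conc_cx c ring_mod)) (conc_cx c (quot_ring J))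
      (tensor_aug c (quot_ring J) (\<lambda>r. J +>\<^bsub>ring_mod\<^esub> r))"
    and "y \<in> carrier (Obj (conc_cx c (quot_ring J)) n) \<Longrightarrow>
      \<exists>x\<in>carrier (Obj (tensor_cx b a (conc_cx c ring_mod)) n).
        y = tensor_aug c (quot_ring J) (\<lambda>r. J +>\<^bsub>ring_mod\<^esub> r) n x"
proof -
  note sJ = sub_mod_ideal[OF J]
  note Q = quot_mod_simps[OF module_ring_mod sJ]
  have g: "(\<lambda>r. J +>\<^bsub>ring_mod\<^esub> r) \<in> mod_hom R (Obj (conc_cx c ring_mod) c) (quot_ring J)"
    using mod_hom_quot[OF module_ring_mod sJ] by (simp add: conc_simps)
  show "cmap (tensor_cx b a (conc_cx c ring_mod)) (conc_cx c (quot_ring J))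
      (tensor_aug c (quot_ring J) (\<lambda>r. J +>\<^bsub>ring_mod\<^esub> r))"
    using quot_ring_smult_zero[OF J a] sJ
    by (intro cmap_tensor_aug F g) (auto simp: conc_simps Q)
  assume y: "y \<in> carrier (Obj (conc_cx c (quot_ring J)) n)"
  show "\<exists>x\<in>carrier (Obj (tensor_cx b a (conc_cx c ring_mod)) n).
      y = tensor_aug c (quot_ring J) (\<lambda>r. J +>\<^bsub>ring_mod\<^esub> r) n x"
  proof (cases "n = c")
    case True
    then obtain r where r: "r \<in> carrier R" "y = J +>\<^bsub>ring_mod\<^esub> r"
      using y Q by (auto simp: conc_simps)
    have "(\<lambda>q\<in>basis b. if q = (0, 0) then r else \<zero>) \<in> carrier (Obj (tensor_cx b a (conc_cx c ring_mod)) n)"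
      unfolding tensor_restrict
    proof (intro conjI)
      show "\<exists>N. \<forall>i s. s < b i \<longrightarrow> N \<le> i \<longrightarrow>
          (if (i, s) = (0, 0) then r else \<zero>) = \<zero>\<^bsub>Obj (conc_cx c ring_mod) (n - int i)\<^esub>"
        by (rule exI[of _ 1]) (auto simp: conc_simps)
    qed (use r True in \<open>auto simp: conc_simps\<close>)
    moreover have "0 < b 0" using F by (simp add: free_cx_def)
    ultimately show ?thesis using True r by (intro bexI) (auto simp: tensor_aug_def)
  next
    case False
    then show ?thesis
      using y md_closed(2)[OF cpx_module[OF cpx_tensor[OF F cpx_conc[OF module_ring_mod]]]]
      by (auto simp: conc_simps tensor_aug_def)
  qed
qed

lemma resolution_elt:
  assumes x: "x \<in> carrier (Obj (tensor_cx b a (conc_cx c ring_mod)) n)" and s: "s < b i"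
  shows "x (i, s) \<in> carrier R" "n \<noteq> c + int i \<Longrightarrow> x (i, s) = \<zero>"
  using tensor_elt[OF x s] by (auto simp: conc_simps split: if_splits)

text \<open>In total degree \<open>n\<close> only the free module with index \<open>n - c\<close> is
  nonzero, so a cycle is one column vector. The augmentation puts it into \<open>J\<close> at the
  lowest place, and the previous matrix kills it at the others.\<close>

lemma resolution_ker_acyclic:
  assumes res: "resolves b a J" and J: "ideal J R"
  shows "acyclic_cx (ker_cx (tensor_cx b a (conc_cx c ring_mod)) (conc_cx c (quot_ring J))
      (tensor_aug c (quot_ring J) (\<lambda>r. J +>\<^bsub>ring_mod\<^esub> r)))" (is "acyclic_cx (ker_cx ?S _ ?e)")
  unfolding acyclic_cx_def
proof (intro allI subsetI)
  have F: "free_cx b a" and aJ: "\<And>t. t < b 1 \<Longrightarrow> a 0 0 t \<in> J"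
    and r0: "\<And>r. r \<in> J \<Longrightarrow> \<exists>w. (\<forall>t<b 1. w t \<in> carrier R) \<and> r = mat_apply b a ring_mod 0 0 w"
    and rS: "\<And>i v. (\<forall>t<b (Suc i). v t \<in> carrier R) \<Longrightarrow> (\<forall>s<b i. mat_apply b a ring_mod i s v = \<zero>) \<Longrightarrow>
      (\<exists>w. (\<forall>u<b (Suc (Suc i)). w u \<in> carrier R) \<and>
        (\<forall>t<b (Suc i). v t = mat_apply b a ring_mod (Suc i) t w))"
    using res by (auto simp: resolves_def)
  have b0: "b 0 = 1" using F by (simp add: free_cx_def)
  have S: "cpx ?S" using F by simp
  let ?N = "ker_cx ?S (conc_cx c (quot_ring J)) ?e"
  fix n x assume "x \<in> cycles ?N n"
  then have x: "x \<in> carrier (Obj ?S n)" and ex: "?e n x = \<zero>\<^bsub>quot_ring J\<^esub>"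
    and dx: "Diff ?S n x = \<zero>\<^bsub>Obj ?S (n - 1)\<^esub>"
    by (auto simp: mem_cycles conc_simps)
  note xe = resolution_elt[OF x]
  have xext: "x \<in> extensional (basis b)" using x tensor_carrier by blast
  have D: "Diff ?S m y (i, s) = mat_apply b a ring_mod i s (\<lambda>t. y (Suc i, t))"
    if y: "y \<in> carrier (Obj ?S m)" and s: "s < b i" for m y i s
  proof -
    have "mat_apply b a ring_mod i s (\<lambda>t. y (Suc i, t)) \<in> carrier ring_mod"
      using F resolution_elt(1)[OF y] by (intro mat_apply_closed) auto
    then show ?thesis using s tensor_elt[OF y s]
      by (simp add: tensor_at sdiff_conc mat_apply_conc conc_simps(4,5))
  qed
  \<comment> \<open>With the equation \<open>n = c + int i0\<close> as a hypothesis the claim also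
    covers degrees below \<open>c\<close>, where no index \<open>i0\<close> exists.\<close>
  have "\<exists>w. \<forall>i0. n = c + int i0 \<longrightarrow> (\<forall>u<b (Suc i0). w u \<in> carrier R) \<and>
      (\<forall>t<b i0. x (i0, t) = mat_apply b a ring_mod i0 t w)"
  proof (cases "n < c")
    case False
    then obtain i0 where i0: "n = c + int i0" using nonneg_int_cases[of "n - c"] by (metis add.commute diff_add_cancel diff_ge_0_iff_ge not_le)
    have "\<exists>w. (\<forall>u<b (Suc i0). w u \<in> carrier R) \<and> (\<forall>t<b i0. x (i0, t) = mat_apply b a ring_mod i0 t w)"
    proof (cases i0)
      case 0
      then have "x (0, 0) \<in> J"
        using ex xe(1)[of 0 0] b0 i0 quot_ring_zero_iff[OF J] by (simp add: tensor_aug_def)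
      from r0[OF this] show ?thesis using 0 b0 by auto
    next
      case (Suc i)
      have "mat_apply b a ring_mod i s (\<lambda>t. x (Suc i, t)) = \<zero>" if "s < b i" for s
        using D[OF x that] dx that by (simp add: tensor_at conc_simps)
      then show ?thesis using rS[of i "\<lambda>t. x (Suc i, t)"] xe(1) Suc by simp
    qed
    then show ?thesis using i0 by (metis add_left_cancel of_nat_eq_iff)
  qed auto
  then obtain w where w: "\<And>i0 u. n = c + int i0 \<Longrightarrow> u < b (Suc i0) \<Longrightarrow> w u \<in> carrier R"
    "\<And>i0 t. n = c + int i0 \<Longrightarrow> t < b i0 \<Longrightarrow> x (i0, t) = mat_apply b a ring_mod i0 t w" by blast
  \<comment> \<open>The vector \<open>w\<close> is placed one degree higher. The condition
    \<open>c \<le> n\<close> excludes the case \<open>n + 1 = c\<close>, where the entry would be at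
    \<open>(0, 0)\<close> and \<open>w\<close> is arbitrary.\<close>
  let ?y = "\<lambda>q\<in>basis b. if n + 1 = c + int (fst q) \<and> c \<le> n then w (snd q) else \<zero>"
  have wS: "w s \<in> carrier R" if "n + 1 = c + int i" "c \<le> n" "s < b i" for i s
    using that w(1)[of "i - 1" s] by (cases i) auto
  have y: "?y \<in> carrier (Obj ?S (n + 1))"
    unfolding tensor_restrict
  proof (intro conjI)
    show "\<exists>N. \<forall>i s. s < b i \<longrightarrow> N \<le> i \<longrightarrow>
        (if n + 1 = c + int (fst (i, s)) \<and> c \<le> n then w (snd (i, s)) else \<zero>) =
        \<zero>\<^bsub>Obj (conc_cx c ring_mod) (n + 1 - int i)\<^esub>"
      by (rule exI[of _ "Suc (Suc (nat (n - c)))"]) (auto simp: conc_simps)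
  qed (auto simp: conc_simps wS)
  have "Diff ?S (n + 1) ?y = x"
  proof (rule tensor_eqI[of _ b])
    fix i s assume s: "s < b i"
    have "mat_apply b a ring_mod i s (\<lambda>t. ?y (Suc i, t)) = x (i, s)"
    proof (cases "n = c + int i")
      case True
      then have "mat_apply b a ring_mod i s (\<lambda>t. ?y (Suc i, t)) = mat_apply b a ring_mod i s w"
        by (intro mat_apply_cong) auto
      then show ?thesis using w(2)[OF True s] by simp
    next
      case False
      then have "mat_apply b a ring_mod i s (\<lambda>t. ?y (Suc i, t)) = \<zero>\<^bsub>ring_mod\<^esub>"
        using F by (intro mat_apply_zero) auto
      then show ?thesis using xe(2)[OF s False] by simp
    qed
    then show "Diff ?S (n + 1) ?y (i, s) = x (i, s)" using D[OF y s] by simp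
  qed (use xext in auto)
  moreover have "?e (n + 1) ?y = \<zero>\<^bsub>quot_ring J\<^esub>"
    using quot_ring_zero_iff[OF J, of \<zero>] additive_subgroup.zero_closed[OF ideal.axioms(1)[OF J]] b0
    by (auto simp: tensor_aug_def)
  ultimately show "x \<in> boundaries ?N n"
    unfolding mem_boundaries using y by (intro bexI[of _ ?y]) (auto simp: conc_simps)
qed

end

section \<open>Multiplication by one element and functionals to cyclic modules\<close>

context cring_complexes
begin

text \<open>The second projection of the cone has the defect \<open>- c k0\<close>, which is
  \<open>r\<close> applied to \<open>- \<iota> k0\<close>. Here the factor is \<open>X\<close>
  itself, and no earlier Koszul stage is involved.\<close>

lemma factored_retraction_single:
  assumes \<iota>: "cmap U X \<iota>" and r: "cmap X U r" and c: "c \<in> carrier R"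
    and r\<iota>: "\<And>n u. u \<in> carrier (Obj U n) \<Longrightarrow> r n (\<iota> n u) = c \<odot>\<^bsub>Obj U n\<^esub> u"
  shows "factored_retraction U (cone U U (\<lambda>n k. c \<odot>\<^bsub>Obj U n\<^esub> k)) (\<lambda>n u. (\<zero>\<^bsub>Obj U (n - 1)\<^esub>, u))
    (\<lambda>n. snd) X (\<lambda>n p. \<ominus>\<^bsub>Obj X (n - 1)\<^esub> \<iota> (n - 1) (fst p)) r"
proof -
  note i = cmapD[OF \<iota>] and r' = cmapD[OF r]
  let ?K = "cone U U (\<lambda>n k. c \<odot>\<^bsub>Obj U n\<^esub> k)"
  have K: "cpx ?K" using cmap_smult[OF i(1) c] by simp
  note D = cone_eq_twist
  show ?thesis unfolding factored_retraction_def
  proof (intro conjI allI ballI r)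
    show "cmap U ?K (\<lambda>n u. (\<zero>\<^bsub>Obj U (n - 1)\<^esub>, u))"
      using K i(1) c unfolding D by (intro cmapI) auto
    fix n
    show "snd \<in> mod_hom R (Obj ?K n) (Obj U n)" unfolding D by (intro mod_homI) auto
    show "(\<lambda>p. \<ominus>\<^bsub>Obj X (n - 1)\<^esub> \<iota> (n - 1) (fst p)) \<in> mod_hom R (Obj ?K n) (Obj X (n - 1))"
      unfolding D using i(1,2) by (intro mod_homI) (auto simp: i(3-5))
  qed (use i(1,2) c in \<open>auto simp: D i(3-8) r'(7) r\<iota> md_ac\<close>)
qed

lemma cmap_cone:
  assumes f: "cmap A B f" and e: "cmap B D e"
    and ef: "\<And>n a. a \<in> carrier (Obj A n) \<Longrightarrow> e n (f n a) = \<zero>\<^bsub>Obj D n\<^esub>"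
  shows "cmap (cone A B f) D (\<lambda>n p. e n (snd p))"
  using cpx_cone[OF f] cmapD(1,2)[OF f] cmapD(2)[OF e] unfolding cone_eq_twist
  by (intro cmapI) (auto simp: cmapD(3-8)[OF e] cmapD(3)[OF f] ef)

text \<open>The functional is \<open>x \<mapsto> r\<close> where \<open>r\<close> is determined modulo \<open>p\<close> by \<open>d x \<in> r z + N\<close>.\<close>

lemma hom_to_quot:
  assumes M: "module R M" and N: "sub_mod M N" and z: "z \<in> carrier M" and d: "d \<in> carrier R" and p: "ideal p R"
    and ex: "\<And>x. x \<in> carrier M \<Longrightarrow> \<exists>r\<in>carrier R. \<exists>y\<in>N. d \<odot>\<^bsub>M\<^esub> x = r \<odot>\<^bsub>M\<^esub> z \<oplus>\<^bsub>M\<^esub> y"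
    and un: "\<And>r. r \<in> carrier R \<Longrightarrow> r \<odot>\<^bsub>M\<^esub> z \<in> N \<Longrightarrow> r \<in> p"
  obtains g where "g \<in> mod_hom R M (quot_ring p)"
    "\<And>x r y. x \<in> carrier M \<Longrightarrow> r \<in> carrier R \<Longrightarrow> y \<in> N \<Longrightarrow> d \<odot>\<^bsub>M\<^esub> x = r \<odot>\<^bsub>M\<^esub> z \<oplus>\<^bsub>M\<^esub> y \<Longrightarrow>
      g x = p +>\<^bsub>ring_mod\<^esub> r"
proof -
  define g where "g = (\<lambda>x. p +>\<^bsub>ring_mod\<^esub> (SOME r. r \<in> carrier R \<and> (\<exists>y\<in>N. d \<odot>\<^bsub>M\<^esub> x = r \<odot>\<^bsub>M\<^esub> z \<oplus>\<^bsub>M\<^esub> y)))"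
  note sp = sub_mod_ideal[OF p] and sN = sub_modD[OF N]
  note Q = quot_mod_simps[OF module_ring_mod sp]
  have uni: "p +>\<^bsub>ring_mod\<^esub> r = p +>\<^bsub>ring_mod\<^esub> r'"
    if r: "r \<in> carrier R" "r' \<in> carrier R" and y: "y \<in> N" "y' \<in> N"
      and eq: "r \<odot>\<^bsub>M\<^esub> z \<oplus>\<^bsub>M\<^esub> y = r' \<odot>\<^bsub>M\<^esub> z \<oplus>\<^bsub>M\<^esub> y'" for r r' y y'
  proof -
    have "(r \<oplus> \<ominus> r') \<odot>\<^bsub>M\<^esub> z \<oplus>\<^bsub>M\<^esub> y = \<ominus>\<^bsub>M\<^esub> (r' \<odot>\<^bsub>M\<^esub> z) \<oplus>\<^bsub>M\<^esub> (r \<odot>\<^bsub>M\<^esub> z \<oplus>\<^bsub>M\<^esub> y)"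
      using M r z sN(2)[OF y(1)] by (simp add: md_smult md_ac)
    also have "\<dots> = y'" unfolding eq using M r z sN(2)[OF y(2)] by simp
    finally have "y \<oplus>\<^bsub>M\<^esub> (r \<oplus> \<ominus> r') \<odot>\<^bsub>M\<^esub> z \<in> N"
      using M r z sN(2)[OF y(1)] y(2) by (simp add: md_ac)
    then have "(r \<oplus> \<ominus> r') \<odot>\<^bsub>M\<^esub> z \<in> N"
      using sub_mod_add_cancel[OF M N y(1)] M r z by simp
    then have "r \<oplus> \<ominus> r' \<in> p" using un r by simp
    moreover have "r = (r \<oplus> \<ominus> r') \<oplus> r'" using r by (simp add: a_assoc l_neg)
    ultimately show ?thesis using coset_eq_iff[OF module_ring_mod sp, of r r'] r by auto
  qed
  have g: "g x = p +>\<^bsub>ring_mod\<^esub> r"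
    if "x \<in> carrier M" "r \<in> carrier R" "y \<in> N" "d \<odot>\<^bsub>M\<^esub> x = r \<odot>\<^bsub>M\<^esub> z \<oplus>\<^bsub>M\<^esub> y" for x r y
  proof -
    let ?P = "\<lambda>r. r \<in> carrier R \<and> (\<exists>y\<in>N. d \<odot>\<^bsub>M\<^esub> x = r \<odot>\<^bsub>M\<^esub> z \<oplus>\<^bsub>M\<^esub> y)"
    have "?P r" using that by blast
    then have "?P (SOME r. ?P r)" by (rule someI)
    then obtain r' y' where r': "r' = (SOME r. ?P r)" "r' \<in> carrier R" "y' \<in> N"
      "d \<odot>\<^bsub>M\<^esub> x = r' \<odot>\<^bsub>M\<^esub> z \<oplus>\<^bsub>M\<^esub> y'" by blast
    have "g x = p +>\<^bsub>ring_mod\<^esub> r'" unfolding g_def r'(1) ..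
    also have "\<dots> = p +>\<^bsub>ring_mod\<^esub> r"
      by (rule uni[OF r'(2) that(2) r'(3) that(3)]) (simp flip: r'(4) that(4))
    finally show ?thesis .
  qed
  have "g \<in> mod_hom R M (quot_ring p)"
  proof (rule mod_homI)
    fix x assume x: "x \<in> carrier M"
    then obtain r y where r: "r \<in> carrier R" "y \<in> N" "d \<odot>\<^bsub>M\<^esub> x = r \<odot>\<^bsub>M\<^esub> z \<oplus>\<^bsub>M\<^esub> y" using ex by blast
    note gx = g[OF x r]
    show "g x \<in> carrier (quot_ring p)" using gx r(1) by (simp add: Q)
    show "g (s \<odot>\<^bsub>M\<^esub> x) = s \<odot>\<^bsub>quot_ring p\<^esub> g x" if s: "s \<in> carrier R" for s
    proof -
      have "d \<odot>\<^bsub>M\<^esub> (s \<odot>\<^bsub>M\<^esub> x) = (s \<otimes> r) \<odot>\<^bsub>M\<^esub> z \<oplus>\<^bsub>M\<^esub> s \<odot>\<^bsub>M\<^esub> y"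
        using M d s x z r sN(2)[OF r(2)] by (simp add: md_smult_comm[OF M d s x] md_smult)
      then have "g (s \<odot>\<^bsub>M\<^esub> x) = p +>\<^bsub>ring_mod\<^esub> (s \<otimes> r)"
        using M s x r sN(5) by (intro g[of _ _ "s \<odot>\<^bsub>M\<^esub> y"]) auto
      then show ?thesis unfolding gx using Q(4)[of s r] s r by simp
    qed
    fix x' assume x': "x' \<in> carrier M"
    then obtain r' y' where r': "r' \<in> carrier R" "y' \<in> N" "d \<odot>\<^bsub>M\<^esub> x' = r' \<odot>\<^bsub>M\<^esub> z \<oplus>\<^bsub>M\<^esub> y'" using ex by blast
    note gx' = g[OF x' r']
    have "d \<odot>\<^bsub>M\<^esub> (x \<oplus>\<^bsub>M\<^esub> x') = (r \<oplus> r') \<odot>\<^bsub>M\<^esub> z \<oplus>\<^bsub>M\<^esub> (y \<oplus>\<^bsub>M\<^esub> y')"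
      using M d x x' z r r' sN(2)[OF r(2)] sN(2)[OF r'(2)] by (simp add: md_smult md_ac)
    then have "g (x \<oplus>\<^bsub>M\<^esub> x') = p +>\<^bsub>ring_mod\<^esub> (r \<oplus> r')"
      using M x x' r r' sN(4) by (intro g[of _ _ "y \<oplus>\<^bsub>M\<^esub> y'"]) auto
    then show "g (x \<oplus>\<^bsub>M\<^esub> x') = g x \<oplus>\<^bsub>quot_ring p\<^esub> g x'"
      unfolding gx gx' using Q(2)[of r r'] r r' by simp
  qed
  with g that show thesis by blast
qed

end

section \<open>Absorbed cyclic modules over a Noetherian ring\<close>

locale noetherian_cellular = cellular R C for R :: "('r, 's) ring_scheme" (structure)
    and C :: "('r, 'u) cx set" +
  assumes noetherian: "noetherian_ring R" and small_ring: "carrier R \<lesssim> (UNIV :: 'u set)"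
begin

lemma small_conc_ring: "small (conc_cx c ring_mod)"
  using small_ring lepoll_trans[OF subset_imp_lepoll small_ring, of "{\<zero>}"]
  by (auto simp: small_cx_def conc_simps)

text \<open>With \<open>F\<close> a resolution of \<open>R/p\<close>, multiplication by \<open>d\<close> on \<open>\<Sigma>\<^sup>c F\<close> factors through \<open>Y \<otimes> F\<close> up to
  the quasi-isomorphism \<open>F \<rightarrow> R/p\<close>: the factors are given by \<open>z\<close> and by the functional of
  \<open>hom_to_quot\<close>. This makes \<open>\<Sigma>\<^sup>c F\<close> a retract of an extension of \<open>R/(p + d R)\<close> by \<open>Y \<otimes> F\<close>.\<close>

lemma absorbed_cyclic_step:
  assumes res: "resolves b a p" and p: "ideal p R"
    and prime: "\<And>r. r \<in> carrier R \<Longrightarrow> d \<otimes> r \<in> p \<Longrightarrow> r \<in> p"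
    and d: "d \<in> carrier R" and K: "ideal K R" "p \<subseteq> K" "d \<in> K"
    and Kd: "\<And>k. k \<in> K \<Longrightarrow> \<exists>r\<in>carrier R. \<exists>q\<in>p. k = d \<otimes> r \<oplus> q"
    and absK: "absorbed (conc_cx c (quot_ring K))"
    and Y: "cpx Y" and shY: "\<And>i :: nat. absorbed (shift (int i) Y)"
    and Y0: "carrier (Obj Y (c - 1)) = {\<zero>\<^bsub>Obj Y (c - 1)\<^esub>}"
    and N: "sub_mod (Obj Y c) N" "boundaries Y c \<subseteq> N"
    and z: "z \<in> carrier (Obj Y c)"
    and ex: "\<And>x. x \<in> carrier (Obj Y c) \<Longrightarrow>
      \<exists>r\<in>carrier R. \<exists>y\<in>N. d \<odot>\<^bsub>Obj Y c\<^esub> x = r \<odot>\<^bsub>Obj Y c\<^esub> z \<oplus>\<^bsub>Obj Y c\<^esub> y"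
    and un: "\<And>r. r \<in> carrier R \<Longrightarrow> r \<odot>\<^bsub>Obj Y c\<^esub> z \<in> N \<Longrightarrow> r \<in> p"
  shows "absorbed (conc_cx c (quot_ring p))"
proof -
  have F: "free_cx b a" and ap: "\<And>t. t < b 1 \<Longrightarrow> a 0 0 t \<in> p" using res by (auto simp: resolves_def)
  have b0: "b 0 = 1" and aR: "\<And>i s t. a i s t \<in> carrier R" using F by (auto simp: free_cx_def)
  let ?L = "conc_cx c ring_mod" and ?D = "conc_cx c (quot_ring p)"
  let ?S = "tensor_cx b a ?L" and ?T = "tensor_cx b a Y"
  let ?e = "tensor_aug c (quot_ring p) (\<lambda>r. p +>\<^bsub>ring_mod\<^esub> r)"
  note sp = sub_mod_ideal[OF p] and sK = sub_mod_ideal[OF K(1)] and sN = sub_modD[OF N(1)]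
  note Q = quot_mod_simps[OF module_ring_mod sp]
  have S: "cpx ?S" and T: "cpx ?T" using F Y by auto
  note M = cpx_module[OF Y, of c]
  have e: "cmap ?S ?D ?e" by (rule cmap_resolution(1)[OF F p ap])
  have N_e: "ses (ker_cx ?S ?D ?e) ?S ?D (\<lambda>n x. x) ?e"
    by (rule ses_ker[OF e]) (use cmap_resolution(2)[OF F p ap] in blast)
  have acyc: "acyclic_cx (ker_cx ?S ?D ?e)" by (rule resolution_ker_acyclic[OF res p])
  have "basis b \<lesssim> (UNIV :: 'u set)"
    using lepoll_trans[OF subset_imp_lepoll lepoll_Times_infinite[OF infinite_u nat_lepoll nat_lepoll]]
    by simp
  then have "small (dsum_cx (basis b) (\<lambda>q. shift (int (fst q)) ?L))"
    by (rule small_dsum) (rule small_shift[OF small_conc_ring])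
  then have smS: "small ?S" by (simp add: small_cx_def tensor_cx_def)
  have absN: "absorbed (ker_cx ?S ?D ?e)"
    by (rule absorbed_acyclic[OF cpx_ker[OF e] small_subset[OF smS] acyc]) auto
  obtain g where g: "g \<in> mod_hom R (Obj Y c) (quot_ring p)"
    and gx: "\<And>x r y. x \<in> carrier (Obj Y c) \<Longrightarrow> r \<in> carrier R \<Longrightarrow> y \<in> N \<Longrightarrow>
      d \<odot>\<^bsub>Obj Y c\<^esub> x = r \<odot>\<^bsub>Obj Y c\<^esub> z \<oplus>\<^bsub>Obj Y c\<^esub> y \<Longrightarrow> g x = p +>\<^bsub>ring_mod\<^esub> r"
    using hom_to_quot[OF M N(1) z d p ex un] by blast
  have gN: "g y = \<zero>\<^bsub>quot_ring p\<^esub>" if "y \<in> N" for y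
    unfolding Q(3) using gx[of y \<zero> "d \<odot>\<^bsub>Obj Y c\<^esub> y"] M d z sN(2)[OF that] sN(5)[OF d that] by simp
  \<comment> \<open>The functional multiplies by \<open>d\<close> on multiples of \<open>z\<close>;
    this is why the two factors compose to multiplication by \<open>d\<close>.\<close>
  have gz: "g (r \<odot>\<^bsub>Obj Y c\<^esub> z) = p +>\<^bsub>ring_mod\<^esub> (d \<otimes> r)" if r: "r \<in> carrier R" for r
    using gx[of "r \<odot>\<^bsub>Obj Y c\<^esub> z" "d \<otimes> r" "\<zero>\<^bsub>Obj Y c\<^esub>"] M d z r sN(3) by (simp add: md_smult)
  let ?f = "tensor_aug c (quot_ring p) g"
  have f: "cmap ?T ?D ?f"
  proof (rule cmap_tensor_aug[OF F Y _ g])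
    show "g (Diff Y (c + 1) y) = \<zero>\<^bsub>quot_ring p\<^esub>" if "y \<in> carrier (Obj Y (c + 1))" for y
      by (rule gN) (use N(2) that in \<open>auto simp: mem_boundaries subset_iff\<close>)
    show "a 0 0 t \<odot>\<^bsub>quot_ring p\<^esub> g y = \<zero>\<^bsub>quot_ring p\<^esub>" if "t < b 1" "y \<in> carrier (Obj Y c)" for t y
      using mod_homD(1)[OF g that(2)] quot_ring_smult_zero[OF p ap[OF that(1)]] by (auto simp: Q(1))
  qed (use sp in auto)
  \<comment> \<open>Multiplication of \<open>z\<close> by scalars, as a map from the ring in degree
    \<open>c\<close>. It is a chain map because \<open>Y\<close> vanishes in degree
    \<open>c - 1\<close>, so that \<open>z\<close> is a cycle.\<close>
  let ?z = "\<lambda>n r. if n = c then r \<odot>\<^bsub>Obj Y c\<^esub> z else \<zero>\<^bsub>Obj Y n\<^esub>"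
  have "Diff Y c (r \<odot>\<^bsub>Obj Y c\<^esub> z) = \<zero>\<^bsub>Obj Y (c - 1)\<^esub>" if "r \<in> carrier R" for r
    using Diff_simps(1)[OF Y md_closed(4)[OF M that z], of "c - 1"] Y0 by auto
  then have zL: "cmap ?L Y ?z"
    using Y z M by (intro cmapI) (auto simp: conc_simps md_smult)
  let ?i = "tensor_map b ?z"
  have i: "cmap ?S ?T ?i" by (rule cmap_tensor[OF F zL])
  \<comment> \<open>The functional ends in R/p, not in its resolution. The fibre product with the
    resolution makes up for the missing inverse of \<open>?e\<close> and differs from
    \<open>?T\<close> by the acyclic kernel of \<open>?e\<close> only.\<close>
  let ?A = "pull_cx ?T ?S ?f ?e"
  have "ses (ker_cx ?S ?D ?e) ?A ?T (\<lambda>n x. (\<zero>\<^bsub>Obj ?T n\<^esub>, x)) (\<lambda>n. fst)"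
    unfolding ses_def
  proof (intro conjI allI ballI impI cmap_pull[OF f e])
    show "cmap (ker_cx ?S ?D ?e) ?A (\<lambda>n x. (\<zero>\<^bsub>Obj ?T n\<^esub>, x))"
      using cpx_ker[OF e] cpx_pull[OF f e] T S cmapD(6)[OF f] by (intro cmapI) auto
    fix n y assume y: "y \<in> carrier (Obj ?T n)"
    then obtain s where "s \<in> carrier (Obj ?S n)" "?f n y = ?e n s"
      using sesD(4)[OF N_e] cmapD(3)[OF f] by blast
    then show "\<exists>v\<in>carrier (Obj ?A n). y = fst v" using y by (intro bexI[of _ "(y, s)"]) auto
  qed (use cmapD(6)[OF f] in \<open>auto simp: prod_eq_iff\<close>)
  then have absA: "absorbed ?A"
    by (rule absorbed_ext[OF _ absN absorbed_tensor[OF F Y shY]])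
  let ?d = "\<lambda>n s. d \<odot>\<^bsub>Obj ?S n\<^esub> s"
  have \<iota>: "cmap ?S ?A (\<lambda>n s. (?i n s, ?d n s))"
  proof (rule cmap_into_pull[OF f e i cmap_smult[OF S d]])
    fix n s assume s: "s \<in> carrier (Obj ?S n)"
    show "?f n (?i n s) = ?e n (?d n s)"
      using resolution_elt(1)[OF s, of 0 0] b0 d by (auto simp: tensor_aug_def tensor_map_at tensor_at conc_simps gz)
  qed
  have fr: "factored_retraction ?S (cone ?S ?S ?d) (\<lambda>n u. (\<zero>\<^bsub>Obj ?S (n - 1)\<^esub>, u)) (\<lambda>n. snd) ?A
      (\<lambda>n q. \<ominus>\<^bsub>Obj ?A (n - 1)\<^esub> (?i (n - 1) (fst q), ?d (n - 1) (fst q))) (\<lambda>n. snd)"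
    by (rule factored_retraction_single[OF \<iota> cmap_pull(2)[OF f e] d]) simp
  let ?DK = "conc_cx c (quot_ring K)" and ?eK = "tensor_aug c (quot_ring K) (\<lambda>r. K +>\<^bsub>ring_mod\<^esub> r)"
  have aK: "a 0 0 t \<in> K" if "t < b 1" for t using ap[OF that] K(2) by blast
  have eK: "cmap ?S ?DK ?eK"
    "\<And>y n. y \<in> carrier (Obj ?DK n) \<Longrightarrow> \<exists>x\<in>carrier (Obj ?S n). y = ?eK n x"
    using cmap_resolution[where c = c, OF F K(1) aK] by blast+
  \<comment> \<open>The cone of \<open>d\<close> on the resolution maps onto R/K. The kernel of this
    map is shown to be acyclic, which rests on \<open>d\<close> acting injectively on R/p.\<close>
  let ?C = "cone ?S ?S ?d" and ?\<pi> = "\<lambda>n q. ?eK n (snd q)"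
  have C: "cpx ?C" using cmap_smult[OF S d] by simp
  have eKd: "?eK n (?d n s) = \<zero>\<^bsub>quot_ring K\<^esub>" if "s \<in> carrier (Obj ?S n)" for n s
    using cmapD(5)[OF eK(1) d that] cmapD(3)[OF eK(1) that] quot_ring_smult_zero[OF K(1,3)]
      quot_mod_simps(1)[OF module_ring_mod sK] md_simps(10)[OF module_quot[OF module_ring_mod sK] d]
    by (auto simp: conc_simps split: if_splits)
  have \<pi>: "cmap ?C ?DK ?\<pi>"
    by (rule cmap_cone[OF cmap_smult[OF S d] eK(1)]) (simp add: eKd conc_simps)
  have C_carr: "carrier (Obj ?C n) = carrier (Obj ?S (n - 1)) \<times> carrier (Obj ?S n)" for n
    by (simp add: cone_eq_twist)
  have \<pi>s: "ses (ker_cx ?C ?DK ?\<pi>) ?C ?DK (\<lambda>n x. x) ?\<pi>"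
  proof (rule ses_ker[OF \<pi>])
    fix n
    show "carrier (Obj ?DK n) \<subseteq> ?\<pi> n ` carrier (Obj ?C n)"
    proof
      fix y assume "y \<in> carrier (Obj ?DK n)"
      then obtain x where "x \<in> carrier (Obj ?S n)" "y = ?eK n x" using eK(2) by blast
      then show "y \<in> ?\<pi> n ` carrier (Obj ?C n)"
        using S by (intro image_eqI[of _ _ "(\<zero>\<^bsub>Obj ?S (n - 1)\<^esub>, x)"]) (auto simp: C_carr)
    qed
  qed
  have bd: "\<exists>v\<in>carrier (Obj ?S (n + 1)). ?e (n + 1) v = \<zero>\<^bsub>quot_ring p\<^esub> \<and> s = Diff ?S (n + 1) v"
    if s: "s \<in> carrier (Obj ?S n)" "Diff ?S n s = \<zero>\<^bsub>Obj ?S (n - 1)\<^esub>" "?e n s = \<zero>\<^bsub>quot_ring p\<^esub>" for s n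
  proof -
    have "s \<in> cycles (ker_cx ?S ?D ?e) n" using s by (simp add: mem_cycles conc_simps)
    then have "s \<in> boundaries (ker_cx ?S ?D ?e) n" using acyc by (auto simp: acyclic_cx_def)
    then show ?thesis by (auto simp: mem_boundaries conc_simps)
  qed
  have eeK: "?eK n v = \<zero>\<^bsub>quot_ring K\<^esub>"
    if v: "v \<in> carrier (Obj ?S n)" "?e n v = \<zero>\<^bsub>quot_ring p\<^esub>" for n v
    using v resolution_elt(1)[OF v(1), of 0 0] b0 K(2) quot_ring_zero_iff[OF p] quot_ring_zero_iff[OF K(1)]
    by (auto simp: tensor_aug_def split: if_splits)
  have "acyclic_cx (ker_cx ?C ?DK ?\<pi>)"
    unfolding acyclic_cx_def
  proof (intro allI subsetI)
    fix n q assume q: "q \<in> cycles (ker_cx ?C ?DK ?\<pi>) n"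
    obtain s0 s where qs: "q = (s0, s)" by force
    have s0: "s0 \<in> carrier (Obj ?S (n - 1))" and s: "s \<in> carrier (Obj ?S n)"
      and es: "?eK n s = \<zero>\<^bsub>quot_ring K\<^esub>" and ds0: "Diff ?S (n - 1) s0 = \<zero>\<^bsub>Obj ?S (n - 2)\<^esub>"
      and dds: "?d (n - 1) s0 \<oplus>\<^bsub>Obj ?S (n - 1)\<^esub> Diff ?S n s = \<zero>\<^bsub>Obj ?S (n - 1)\<^esub>"
      using q S unfolding qs mem_cycles by (auto simp: cone_eq_twist conc_simps)
    have ds: "Diff ?S n s = \<ominus>\<^bsub>Obj ?S (n - 1)\<^esub> ?d (n - 1) s0"
      using dds S s s0 d by (subst (asm) md_add_eq_zero) auto
    \<comment> \<open>In degree \<open>c\<close> the multiple \<open>d s0\<close> is a boundary, so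
      its entry lies in \<open>p\<close>; by \<open>prime\<close> so does the entry of
      \<open>s0\<close>. In other degrees the augmentation is zero.\<close>
    have "?e (n - 1) s0 = \<zero>\<^bsub>quot_ring p\<^esub>"
    proof (cases "n - 1 = c")
      case True
      have "?e (n - 1) (?d (n - 1) s0) = \<zero>\<^bsub>quot_ring p\<^esub>"
      proof -
        have "?d (n - 1) s0 = Diff ?S n (\<ominus>\<^bsub>Obj ?S n\<^esub> s)" using S s ds s0 d by simp
        then have "?e (n - 1) (?d (n - 1) s0) = Diff ?D n (?e n (\<ominus>\<^bsub>Obj ?S n\<^esub> s))"
          using cmapD(8)[OF e, of "\<ominus>\<^bsub>Obj ?S n\<^esub> s" n "n - 1"] S s by simp
        then show ?thesis by (simp add: conc_simps)
      qed
      then have "p +>\<^bsub>ring_mod\<^esub> (d \<otimes> s0 (0, 0)) = \<zero>\<^bsub>quot_ring p\<^esub>"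
        using True b0 by (simp add: tensor_aug_def tensor_at conc_simps)
      then have "s0 (0, 0) \<in> p"
        using resolution_elt(1)[OF s0, of 0 0] b0 d quot_ring_zero_iff[OF p] prime by simp
      then show ?thesis
        using resolution_elt(1)[OF s0, of 0 0] b0 True quot_ring_zero_iff[OF p] by (simp add: tensor_aug_def)
    qed (simp add: tensor_aug_def)
    from bd[OF s0 _ this] ds0 obtain v where v: "v \<in> carrier (Obj ?S n)" "s0 = Diff ?S n v" by auto
    \<comment> \<open>In degree \<open>c\<close> the entry of \<open>s + d v\<close> lies in
      \<open>K\<close>, that is in \<open>dR + p\<close>. The cycle \<open>u\<close> carries its
      \<open>d\<close>-part, so that the remainder is killed by the augmentation and bounds.\<close>
    have "\<exists>u\<in>carrier (Obj ?S n). Diff ?S n u = \<zero>\<^bsub>Obj ?S (n - 1)\<^esub> \<and>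
      ?e n (s \<oplus>\<^bsub>Obj ?S n\<^esub> (?d n v \<oplus>\<^bsub>Obj ?S n\<^esub> \<ominus>\<^bsub>Obj ?S n\<^esub> ?d n u)) = \<zero>\<^bsub>quot_ring p\<^esub>"
    proof (cases "n = c")
      case False
      then show ?thesis using S by (intro bexI[of _ "\<zero>\<^bsub>Obj ?S n\<^esub>"]) (auto simp: tensor_aug_def)
    next
      case True
      note v0 = resolution_elt(1)[OF v(1), of 0 0] and s0 = resolution_elt(1)[OF s, of 0 0]
      have "s (0, 0) \<in> K"
        using es True s0 b0 quot_ring_zero_iff[OF K(1)] by (simp add: tensor_aug_def)
      then have "s (0, 0) \<oplus> d \<otimes> v (0, 0) \<in> K"
        using ideal.I_r_closed[OF K(1,3)] v0 b0 additive_subgroup.a_closed[OF ideal.axioms(1)[OF K(1)]] by simp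
      then obtain r y where r: "r \<in> carrier R" "y \<in> p" "s (0, 0) \<oplus> d \<otimes> v (0, 0) = d \<otimes> r \<oplus> y" using Kd by blast
      have "p +>\<^bsub>ring_mod\<^esub> r \<in> carrier (Obj ?D n)" using r True by (simp add: conc_simps Q)
      let ?u = "\<lambda>q\<in>basis b. if q = (0, 0) then r else \<zero>"
      have u: "?u \<in> carrier (Obj ?S n)" unfolding tensor_restrict
      proof (intro conjI)
        show "\<exists>N. \<forall>i s. s < b i \<longrightarrow> N \<le> i \<longrightarrow>
            (if (i, s) = (0, 0) then r else \<zero>) = \<zero>\<^bsub>Obj (conc_cx c ring_mod) (n - int i)\<^esub>"
          by (rule exI[of _ 1]) (auto simp: conc_simps)
      qed (use r True in \<open>auto simp: conc_simps\<close>)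
      have "Diff ?S n ?u = \<zero>\<^bsub>Obj ?S (n - 1)\<^esub>"
      proof (rule tensor_eqI[of _ b])
        fix i t assume t: "t < b i"
        have "Diff ?S n ?u \<in> carrier (Obj ?S (n - 1))" using S u by simp
        from resolution_elt(2)[OF this t] True
        show "Diff ?S n ?u (i, t) = \<zero>\<^bsub>Obj ?S (n - 1)\<^esub> (i, t)" using t by (simp add: tensor_at conc_simps)
      qed simp_all
      moreover have "(s \<oplus>\<^bsub>Obj ?S n\<^esub> (?d n v \<oplus>\<^bsub>Obj ?S n\<^esub> \<ominus>\<^bsub>Obj ?S n\<^esub> ?d n ?u)) (0, 0) = y"
      proof -
        have "\<ominus>\<^bsub>Obj ?S n\<^esub> ?d n ?u = (\<ominus> d) \<odot>\<^bsub>Obj ?S n\<^esub> ?u" using S u d by simp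
        then have "(s \<oplus>\<^bsub>Obj ?S n\<^esub> (?d n v \<oplus>\<^bsub>Obj ?S n\<^esub> \<ominus>\<^bsub>Obj ?S n\<^esub> ?d n ?u)) (0, 0) =
            s (0, 0) \<oplus> (d \<otimes> v (0, 0) \<oplus> (\<ominus> d) \<otimes> r)"
          using b0 by (simp add: tensor_at conc_simps)
        also have "\<dots> = (d \<otimes> r \<oplus> y) \<oplus> \<ominus> (d \<otimes> r)"
          unfolding r(3)[symmetric] using s0 v0 b0 d r(1) by (simp add: a_assoc l_minus)
        also have "\<dots> = y" using d r(1) ideal.Icarr[OF p r(2)] by (simp add: a_ac r_neg2 r_neg)
        finally show ?thesis .
      qed
      ultimately show ?thesis
        using u True r(2) ideal.Icarr[OF p r(2)] quot_ring_zero_iff[OF p]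
        by (intro bexI[of _ ?u]) (auto simp: tensor_aug_def)
    qed
    then obtain u where u: "u \<in> carrier (Obj ?S n)" "Diff ?S n u = \<zero>\<^bsub>Obj ?S (n - 1)\<^esub>"
      "?e n (s \<oplus>\<^bsub>Obj ?S n\<^esub> (?d n v \<oplus>\<^bsub>Obj ?S n\<^esub> \<ominus>\<^bsub>Obj ?S n\<^esub> ?d n u)) = \<zero>\<^bsub>quot_ring p\<^esub>" by blast
    let ?s = "s \<oplus>\<^bsub>Obj ?S n\<^esub> (?d n v \<oplus>\<^bsub>Obj ?S n\<^esub> \<ominus>\<^bsub>Obj ?S n\<^esub> ?d n u)"
    have "Diff ?S n ?s = \<zero>\<^bsub>Obj ?S (n - 1)\<^esub>" using S s v u d ds by simp
    from bd[OF _ this u(3)] S s v u d obtain w where w: "w \<in> carrier (Obj ?S (n + 1))"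
      "?e (n + 1) w = \<zero>\<^bsub>quot_ring p\<^esub>" "?s = Diff ?S (n + 1) w" by auto
    let ?v = "u \<oplus>\<^bsub>Obj ?S n\<^esub> \<ominus>\<^bsub>Obj ?S n\<^esub> v"
    have "(?v, w) \<in> carrier (Obj (ker_cx ?C ?DK ?\<pi>) (n + 1))"
      using S u v w eeK[OF w(1,2)] by (simp add: C_carr conc_simps)
    moreover have "?d n ?v \<oplus>\<^bsub>Obj ?S n\<^esub> Diff ?S (n + 1) w = s"
      unfolding w(3)[symmetric] using S s u v d by (simp add: md_ac)
    then have "q = Diff (ker_cx ?C ?DK ?\<pi>) (n + 1) (?v, w)"
      using S u v unfolding qs by (simp add: cone_eq_twist)
    ultimately show "q \<in> boundaries (ker_cx ?C ?DK ?\<pi>) n" unfolding mem_boundaries by blast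
  qed
  moreover have "small ?C" unfolding cone_eq_twist by (intro small_twist small_shift smS)
  then have "small (ker_cx ?C ?DK ?\<pi>)" by (rule small_subset) auto
  ultimately have "absorbed (ker_cx ?C ?DK ?\<pi>)" by (intro absorbed_acyclic cpx_ker[OF \<pi>])
  from absorbed_ext[OF \<pi>s this absK] have "absorbed ?C" .
  from absorbed_factored_retraction[OF fr this absA] have "absorbed ?S" .
  from absorbed_quot_acyclic[OF N_e acyc this] show ?thesis .
qed

end

section \<open>Noetherian rings\<close>

context cring_complexes
begin

definition spn :: "('r, 'm) module \<Rightarrow> 'm set \<Rightarrow> 'm set" where
  "spn M A = \<Inter> {P. sub_mod M P \<and> A \<subseteq> P}"

text \<open>Finite generation of W/N, when \<open>N\<close> is contained in \<open>W\<close>,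
  expressed without the quotient module.\<close>

definition fg_over :: "('r, 'm) module \<Rightarrow> 'm set \<Rightarrow> 'm set \<Rightarrow> bool" where
  "fg_over M N W \<longleftrightarrow> (\<exists>A. finite A \<and> A \<subseteq> W \<and> W \<subseteq> spn M (A \<union> N))"

lemma spn_least: "sub_mod M P \<Longrightarrow> A \<subseteq> P \<Longrightarrow> spn M A \<subseteq> P"
  by (auto simp: spn_def)

lemma spn_superset: "A \<subseteq> spn M A"
  by (auto simp: spn_def)

lemma sub_mod_spn: "module R M \<Longrightarrow> A \<subseteq> carrier M \<Longrightarrow> sub_mod M (spn M A)"
  by (rule sub_modI) (auto simp: spn_def sub_mod_def intro: md_closed)

lemma spn_mono: "A \<subseteq> B \<Longrightarrow> spn M A \<subseteq> spn M B"
  by (auto simp: spn_def)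

lemma spn_insert:
  assumes M: "module R M" and a: "a \<in> carrier M" and B: "B \<subseteq> carrier M" and x: "x \<in> spn M (insert a B)"
  obtains r q where "r \<in> carrier R" "q \<in> spn M B" "x = r \<odot>\<^bsub>M\<^esub> a \<oplus>\<^bsub>M\<^esub> q"
proof -
  note s = sub_modD[OF sub_mod_spn[OF M B]]
  let ?P = "{x. \<exists>r\<in>carrier R. \<exists>q\<in>spn M B. x = r \<odot>\<^bsub>M\<^esub> a \<oplus>\<^bsub>M\<^esub> q}"
  have "sub_mod M ?P"
  proof (rule sub_modI)
    show "?P \<subseteq> carrier M" using M a s(2) by auto
    show "\<zero>\<^bsub>M\<^esub> \<in> ?P" using M a s(3) by (auto intro!: bexI[of _ \<zero>] bexI[of _ "\<zero>\<^bsub>M\<^esub>"])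
    show "x \<oplus>\<^bsub>M\<^esub> y \<in> ?P" if xy: "x \<in> ?P" "y \<in> ?P" for x y
    proof -
      obtain r q r' q' where *: "r \<in> carrier R" "q \<in> spn M B" "x = r \<odot>\<^bsub>M\<^esub> a \<oplus>\<^bsub>M\<^esub> q"
        "r' \<in> carrier R" "q' \<in> spn M B" "y = r' \<odot>\<^bsub>M\<^esub> a \<oplus>\<^bsub>M\<^esub> q'" using xy by blast
      then have "x \<oplus>\<^bsub>M\<^esub> y = (r \<oplus> r') \<odot>\<^bsub>M\<^esub> a \<oplus>\<^bsub>M\<^esub> (q \<oplus>\<^bsub>M\<^esub> q')"
        using M a s(2) by (simp add: md_smult md_ac)
      then show ?thesis using * s(4) by blast
    qed
    show "c \<odot>\<^bsub>M\<^esub> x \<in> ?P" if c: "c \<in> carrier R" and x: "x \<in> ?P" for c x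
    proof -
      obtain r q where *: "r \<in> carrier R" "q \<in> spn M B" "x = r \<odot>\<^bsub>M\<^esub> a \<oplus>\<^bsub>M\<^esub> q" using x by blast
      then have "c \<odot>\<^bsub>M\<^esub> x = (c \<otimes> r) \<odot>\<^bsub>M\<^esub> a \<oplus>\<^bsub>M\<^esub> c \<odot>\<^bsub>M\<^esub> q" using M a c s(2) by (simp add: md_smult)
      moreover have "c \<otimes> r \<in> carrier R" "c \<odot>\<^bsub>M\<^esub> q \<in> spn M B" using * c s(5) by auto
      ultimately show ?thesis by blast
    qed
  qed
  moreover have "insert a B \<subseteq> ?P"
  proof -
    have "a = \<one> \<odot>\<^bsub>M\<^esub> a \<oplus>\<^bsub>M\<^esub> \<zero>\<^bsub>M\<^esub>" using M a by simp
    then have "a \<in> ?P" using s(3) by blast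
    moreover have "b \<in> ?P" if "b \<in> B" for b
    proof -
      have "b = \<zero> \<odot>\<^bsub>M\<^esub> a \<oplus>\<^bsub>M\<^esub> b" "b \<in> spn M B" using M a B that subsetD[OF spn_superset that, of M] by auto
      then show ?thesis by blast
    qed
    ultimately show ?thesis by blast
  qed
  ultimately have "x \<in> ?P" using spn_least x by blast
  then show thesis using that by blast
qed

lemma spn_sub_mod: "sub_mod M N \<Longrightarrow> spn M N = N"
  using spn_least[of M N N] spn_superset[of N M] by blast

text \<open>Submodules of finitely generated modules over a Noetherian ring, relative to
  \<open>N\<close>. The induction is over the generators; the coefficients of the new generator in
  elements of \<open>W\<close> form an ideal, and its finitely many generators account for the new
  direction.\<close>

lemma fg_over_span:
  assumes noeth: "noetherian_ring R" and M: "module R M" and N: "sub_mod M N"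
    and A: "finite A" "A \<subseteq> carrier M"
  shows "sub_mod M W \<Longrightarrow> N \<subseteq> W \<Longrightarrow> W \<subseteq> spn M (A \<union> N) \<Longrightarrow> fg_over M N W"
  using A
proof (induction A arbitrary: W rule: finite_induct)
  case empty
  then show ?case using spn_superset[of N M] spn_sub_mod[OF N]
    unfolding fg_over_def by (intro exI[of _ "{}"]) auto
next
  case (insert a A)
  let ?Q = "spn M (A \<union> N)"
  have a: "a \<in> carrier M" and AN: "A \<union> N \<subseteq> carrier M" using insert.prems(4) sub_modD(1)[OF N] by auto
  have Q: "sub_mod M ?Q" by (rule sub_mod_spn[OF M AN])
  note q = sub_modD[OF Q] and w = sub_modD[OF insert.prems(1)]
  have J_ideal: "ideal {r \<in> carrier R. \<exists>q\<in>?Q. r \<odot>\<^bsub>M\<^esub> a \<oplus>\<^bsub>M\<^esub> q \<in> P} R" if P: "sub_mod M P" for P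
  proof (rule sub_mod_ideal'[OF sub_modI])
    note P' = sub_modD[OF P]
    let ?J = "{r \<in> carrier R. \<exists>q\<in>?Q. r \<odot>\<^bsub>M\<^esub> a \<oplus>\<^bsub>M\<^esub> q \<in> P}"
    show "?J \<subseteq> carrier ring_mod" by auto
    show "\<zero>\<^bsub>ring_mod\<^esub> \<in> ?J" using M a q(3) P'(3) by (auto intro!: bexI[of _ "\<zero>\<^bsub>M\<^esub>"])
    show "x \<oplus>\<^bsub>ring_mod\<^esub> y \<in> ?J" if xy: "x \<in> ?J" "y \<in> ?J" for x y
    proof -
      obtain u v where uv: "u \<in> ?Q" "x \<odot>\<^bsub>M\<^esub> a \<oplus>\<^bsub>M\<^esub> u \<in> P" "v \<in> ?Q" "y \<odot>\<^bsub>M\<^esub> a \<oplus>\<^bsub>M\<^esub> v \<in> P" using xy by blast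
      have "(x \<oplus> y) \<odot>\<^bsub>M\<^esub> a \<oplus>\<^bsub>M\<^esub> (u \<oplus>\<^bsub>M\<^esub> v) = (x \<odot>\<^bsub>M\<^esub> a \<oplus>\<^bsub>M\<^esub> u) \<oplus>\<^bsub>M\<^esub> (y \<odot>\<^bsub>M\<^esub> a \<oplus>\<^bsub>M\<^esub> v)"
        using M a xy uv q(2) by (simp add: md_smult md_ac)
      then have "(x \<oplus> y) \<odot>\<^bsub>M\<^esub> a \<oplus>\<^bsub>M\<^esub> (u \<oplus>\<^bsub>M\<^esub> v) \<in> P" using P'(4) uv by simp
      then show ?thesis using q(4)[OF uv(1,3)] xy by auto
    qed
    show "c \<odot>\<^bsub>ring_mod\<^esub> x \<in> ?J" if c: "c \<in> carrier R" and x: "x \<in> ?J" for c x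
    proof -
      obtain u where u: "u \<in> ?Q" "x \<odot>\<^bsub>M\<^esub> a \<oplus>\<^bsub>M\<^esub> u \<in> P" using x by blast
      have "(c \<otimes> x) \<odot>\<^bsub>M\<^esub> a \<oplus>\<^bsub>M\<^esub> c \<odot>\<^bsub>M\<^esub> u = c \<odot>\<^bsub>M\<^esub> (x \<odot>\<^bsub>M\<^esub> a \<oplus>\<^bsub>M\<^esub> u)"
        using M a c x u q(2) by (simp add: md_smult)
      then have "(c \<otimes> x) \<odot>\<^bsub>M\<^esub> a \<oplus>\<^bsub>M\<^esub> c \<odot>\<^bsub>M\<^esub> u \<in> P" using P'(5) c u by simp
      then show ?thesis using q(5)[OF c u(1)] c x by auto
    qed
  qed
  \<comment> \<open>The coefficients of \<open>a\<close> that occur in \<open>W\<close> modulo the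
    span of the earlier generators. Each generator of this ideal is realized by some
    \<open>v j\<close> in \<open>W\<close>.\<close>
  let ?J = "{r \<in> carrier R. \<exists>q\<in>?Q. r \<odot>\<^bsub>M\<^esub> a \<oplus>\<^bsub>M\<^esub> q \<in> W}"
  obtain G where G: "G \<subseteq> carrier R" "finite G" "?J = Idl G"
    using noetherian_ring.finetely_gen[OF noeth J_ideal[OF insert.prems(1)]] by blast
  have "G \<subseteq> ?J" unfolding G(3) using genideal_self[OF G(1)] .
  then have "\<forall>j\<in>G. \<exists>v. v \<in> W \<and> (\<exists>q\<in>?Q. v = j \<odot>\<^bsub>M\<^esub> a \<oplus>\<^bsub>M\<^esub> q)" by blast
  then obtain v where v: "\<And>j. j \<in> G \<Longrightarrow> v j \<in> W \<and> (\<exists>q\<in>?Q. v j = j \<odot>\<^bsub>M\<^esub> a \<oplus>\<^bsub>M\<^esub> q)" by metis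
  \<comment> \<open>What remains after the coefficient of \<open>a\<close> has been removed lies in
    the span of the earlier generators, where the induction hypothesis applies.\<close>
  have "fg_over M N (W \<inter> ?Q)"
    using insert.prems spn_superset[of "A \<union> N" M]
    by (intro insert.IH sub_mod_Int Q) auto
  then obtain A2 where A2: "finite A2" "A2 \<subseteq> W \<inter> ?Q" "W \<inter> ?Q \<subseteq> spn M (A2 \<union> N)" by (auto simp: fg_over_def)
  let ?A = "v ` G \<union> A2"
  let ?P = "spn M (?A \<union> N)"
  have AW: "?A \<union> N \<subseteq> W" using v A2(2) insert.prems(2) by auto
  have P: "sub_mod M ?P" using AW w(1) by (intro sub_mod_spn[OF M]) auto
  note P' = sub_modD[OF P]
  have PW: "?P \<subseteq> W" by (rule spn_least[OF insert.prems(1) AW])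
  have "G \<subseteq> {r \<in> carrier R. \<exists>q\<in>?Q. r \<odot>\<^bsub>M\<^esub> a \<oplus>\<^bsub>M\<^esub> q \<in> ?P}"
  proof
    fix j assume j: "j \<in> G"
    then have "v j \<in> ?P" using spn_superset[of "?A \<union> N" M] by blast
    moreover obtain q where "q \<in> ?Q" "v j = j \<odot>\<^bsub>M\<^esub> a \<oplus>\<^bsub>M\<^esub> q" using v[OF j] by blast
    ultimately show "j \<in> {r \<in> carrier R. \<exists>q\<in>?Q. r \<odot>\<^bsub>M\<^esub> a \<oplus>\<^bsub>M\<^esub> q \<in> ?P}" using G(1) j by auto
  qed
  then have JP: "?J \<subseteq> {r \<in> carrier R. \<exists>q\<in>?Q. r \<odot>\<^bsub>M\<^esub> a \<oplus>\<^bsub>M\<^esub> q \<in> ?P}"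
    unfolding G(3) by (rule genideal_minimal[OF J_ideal[OF P]])
  have "W \<subseteq> ?P"
  proof
    fix x assume x: "x \<in> W"
    then have "x \<in> spn M (insert a (A \<union> N))" using insert.prems(3) by auto
    then obtain r q0 where r: "r \<in> carrier R" "q0 \<in> ?Q" "x = r \<odot>\<^bsub>M\<^esub> a \<oplus>\<^bsub>M\<^esub> q0"
      using spn_insert[OF M a AN] by blast
    then have "r \<in> ?J" using x by blast
    then obtain q1 where q1: "q1 \<in> ?Q" "r \<odot>\<^bsub>M\<^esub> a \<oplus>\<^bsub>M\<^esub> q1 \<in> ?P" using JP by blast
    let ?y = "r \<odot>\<^bsub>M\<^esub> a \<oplus>\<^bsub>M\<^esub> q1"
    have eq: "x \<oplus>\<^bsub>M\<^esub> \<ominus>\<^bsub>M\<^esub> ?y = q0 \<oplus>\<^bsub>M\<^esub> \<ominus>\<^bsub>M\<^esub> q1"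
      using M a r q1 q(2) by (simp add: md_ac)
    have "x \<oplus>\<^bsub>M\<^esub> \<ominus>\<^bsub>M\<^esub> ?y \<in> W" using x q1(2) PW w(4) w(6)[OF M] by blast
    moreover have "x \<oplus>\<^bsub>M\<^esub> \<ominus>\<^bsub>M\<^esub> ?y \<in> ?Q" unfolding eq using r(2) q1(1) q(4) q(6)[OF M] by blast
    ultimately have "x \<oplus>\<^bsub>M\<^esub> \<ominus>\<^bsub>M\<^esub> ?y \<in> ?P" using A2(3) spn_mono[of "A2 \<union> N" "?A \<union> N" M] by blast
    then have "(x \<oplus>\<^bsub>M\<^esub> \<ominus>\<^bsub>M\<^esub> ?y) \<oplus>\<^bsub>M\<^esub> ?y \<in> ?P" using P'(4) q1(2) by blast
    then show "x \<in> ?P" using M w(2)[OF x] P'(2)[OF q1(2)] by simp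
  qed
  moreover have "finite ?A" "?A \<subseteq> W" using G(2) A2(1) AW by auto
  ultimately show ?case unfolding fg_over_def by blast
qed

lemma fg_over_subset:
  assumes "noetherian_ring R" "module R M" "sub_mod M N" "fg_over M N W" "W \<subseteq> carrier M"
    "sub_mod M V" "N \<subseteq> V" "V \<subseteq> W"
  shows "fg_over M N V"
  using assms unfolding fg_over_def[of M N W] by (blast intro: fg_over_span)

text \<open>The kernel of a matrix is a submodule of a finite free module and so finitely generated;
  its generators are the columns of the next matrix.\<close>

lemma matrix_kernel:
  assumes noeth: "noetherian_ring R" and entries: "\<forall>s t. A s t \<in> carrier R"
  shows "\<exists>m' A'. (\<forall>t u. A' t u \<in> carrier R) \<and>
    (\<forall>s<n. \<forall>u<m'. msum ring_mod (\<lambda>t. A s t \<otimes> A' t u) m = \<zero>) \<and>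
    (\<forall>v. (\<forall>t<m. v t \<in> carrier R) \<and> (\<forall>s<n. msum ring_mod (\<lambda>t. A s t \<otimes> v t) m = \<zero>) \<longrightarrow>
      (\<exists>w. (\<forall>u<m'. w u \<in> carrier R) \<and> (\<forall>t<m. v t = msum ring_mod (\<lambda>u. A' t u \<otimes> w u) m')))"
proof -
  have A: "A s t \<in> carrier R" for s t using entries by blast
  let ?M = "dsum_mod {..<m} (\<lambda>_ :: nat. ring_mod)"
  have M: "module R ?M" by simp
  have Mc: "carrier ?M = (\<Pi>\<^sub>E i\<in>{..<m}. carrier R)" by auto
  define W where "W = {v \<in> carrier ?M. \<forall>s<n. msum ring_mod (\<lambda>t. A s t \<otimes> v t) m = \<zero>}"
  have sm: "msum ring_mod (\<lambda>t. A s t \<otimes> v t) m \<in> carrier R" if "\<And>t. t < m \<Longrightarrow> v t \<in> carrier R" for s v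
    using msum_closed[OF module_ring_mod, of m "\<lambda>t. A s t \<otimes> v t"] A that by simp
  have addm: "msum ring_mod (\<lambda>t. B t \<otimes> (v t \<oplus> w t)) k =
      msum ring_mod (\<lambda>t. B t \<otimes> v t) k \<oplus> msum ring_mod (\<lambda>t. B t \<otimes> w t) k"
    if "\<And>t. t < k \<Longrightarrow> B t \<in> carrier R" "\<And>t. t < k \<Longrightarrow> v t \<in> carrier R" "\<And>t. t < k \<Longrightarrow> w t \<in> carrier R" for B v w k
    using msum_add[OF module_ring_mod, of k "\<lambda>t. B t \<otimes> v t" "\<lambda>t. B t \<otimes> w t"] that
    by (simp add: r_distr cong: msum_cong)
  have smm: "msum ring_mod (\<lambda>t. B t \<otimes> (r \<otimes> v t)) k = r \<otimes> msum ring_mod (\<lambda>t. B t \<otimes> v t) k"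
    if "r \<in> carrier R" "\<And>t. t < k \<Longrightarrow> B t \<in> carrier R" "\<And>t. t < k \<Longrightarrow> v t \<in> carrier R" for B v r k
    using msum_smult[OF module_ring_mod that(1), of k "\<lambda>t. B t \<otimes> v t"] that
    by (simp add: m_lcomm cong: msum_cong)
  have Wsub: "sub_mod ?M W"
  proof (rule sub_modI)
    show "W \<subseteq> carrier ?M" by (auto simp: W_def)
    have "msum ring_mod (\<lambda>t. A s t \<otimes> \<zero>\<^bsub>?M\<^esub> t) m = \<zero>\<^bsub>ring_mod\<^esub>" for s
      by (rule msum_zero) (use A in auto)
    then show "\<zero>\<^bsub>?M\<^esub> \<in> W" using md_closed(2)[OF M] unfolding W_def by simp
    show "x \<oplus>\<^bsub>?M\<^esub> y \<in> W" if "x \<in> W" "y \<in> W" for x y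
    proof -
      have "msum ring_mod (\<lambda>t. A s t \<otimes> (x \<oplus>\<^bsub>?M\<^esub> y) t) m = msum ring_mod (\<lambda>t. A s t \<otimes> (x t \<oplus> y t)) m" for s
        by (rule msum_cong) simp
      also have "\<dots> s = \<zero>" if "s < n" for s
        using A that \<open>x \<in> W\<close> \<open>y \<in> W\<close> unfolding W_def Mc by (subst addm) (auto simp: PiE_iff)
      finally show ?thesis using that md_closed(1)[OF M, of x y] unfolding W_def by blast
    qed
    show "r \<odot>\<^bsub>?M\<^esub> x \<in> W" if r: "r \<in> carrier R" and x: "x \<in> W" for r x
    proof -
      have "msum ring_mod (\<lambda>t. A s t \<otimes> (r \<odot>\<^bsub>?M\<^esub> x) t) m = msum ring_mod (\<lambda>t. A s t \<otimes> (r \<otimes> x t)) m" for s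
        by (rule msum_cong) simp
      also have "\<dots> s = \<zero>" if "s < n" for s
        using A that x r unfolding W_def Mc by (subst smm) (auto simp: PiE_iff)
      finally show ?thesis using x md_closed(4)[OF M r, of x] unfolding W_def by blast
    qed
  qed
  let ?e = "\<lambda>t. \<lambda>i\<in>{..<m}. if i = t then \<one> else \<zero>"
  let ?E = "?e ` {..<m}"
  have E: "?E \<subseteq> carrier ?M" unfolding Mc by (intro image_subsetI) (simp only: restrict_PiE_iff, simp)
  have "carrier ?M \<subseteq> spn ?M (?E \<union> {\<zero>\<^bsub>?M\<^esub>})"
  proof
    fix v assume v: "v \<in> carrier ?M"
    let ?P = "spn ?M (?E \<union> {\<zero>\<^bsub>?M\<^esub>})"
    have "sub_mod ?M ?P" using E md_closed(2)[OF M] by (intro sub_mod_spn[OF M]) auto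
    note P = sub_modD[OF this]
    have vt: "v t \<in> carrier R" if "t < m" for t using v that unfolding Mc by auto
    \<comment> \<open>The initial segments of \<open>v\<close> enter the span one coordinate at a
      time.\<close>
    have "(\<lambda>i\<in>{..<m}. if i < k then v i else \<zero>) \<in> ?P" if "k \<le> m" for k
      using that
    proof (induction k)
      case 0
      have "(\<lambda>i\<in>{..<m}. if i < 0 then v i else \<zero>) = \<zero>\<^bsub>?M\<^esub>" by simp
      then show ?case using P(3) by (simp only:)
    next
      case (Suc k)
      have "(\<lambda>i\<in>{..<m}. if i < Suc k then v i else \<zero>) =
          (\<lambda>i\<in>{..<m}. if i < k then v i else \<zero>) \<oplus>\<^bsub>?M\<^esub> v k \<odot>\<^bsub>?M\<^esub> ?e k"
        using vt Suc.prems by (auto simp: fun_eq_iff restrict_def less_Suc_eq)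
      moreover have k: "k < m" "k \<le> m" using Suc.prems by auto
      have "?e k \<in> ?E" by (rule imageI) (simp add: k)
      then have "?e k \<in> ?P" by (rule subsetD[OF spn_superset UnI1])
      note P(4)[OF Suc.IH[OF k(2)] P(5)[OF vt[OF k(1)] this]]
      ultimately show ?case by (simp only:)
    qed
    from this[OF order_refl] have "(\<lambda>i\<in>{..<m}. if i < m then v i else \<zero>) \<in> ?P" .
    moreover have "(\<lambda>i\<in>{..<m}. if i < m then v i else \<zero>) = v"
      using v unfolding Mc by (auto simp: fun_eq_iff restrict_def PiE_def extensional_def)
    ultimately show "v \<in> ?P" by (simp only:)
  qed
  then have "fg_over ?M {\<zero>\<^bsub>?M\<^esub>} W"
    by (intro fg_over_span[OF noeth M sub_mod_zero[OF M] _ E Wsub])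
      (use sub_modD(1,3)[OF Wsub] in auto)
  then obtain G where G: "finite G" "G \<subseteq> W" "W \<subseteq> spn ?M (G \<union> {\<zero>\<^bsub>?M\<^esub>})" by (auto simp: fg_over_def)
  obtain gs where gs: "set gs = G" using finite_list[OF G(1)] by blast
  define m' where "m' = length gs"
  \<comment> \<open>Padding with zero keeps the entries in the ring for all indices, as
    \<open>free_cx\<close> demands.\<close>
  define A' where "A' = (\<lambda>t u. if t < m \<and> u < m' then (gs ! u) t else \<zero>)"
  have gW: "gs ! u \<in> W" if "u < m'" for u using that G(2) gs by (auto simp: m'_def)
  have A'R: "A' t u \<in> carrier R" for t u
    using gW[of u] unfolding W_def Mc A'_def by auto
  let ?P = "{v \<in> carrier ?M. \<exists>w. (\<forall>u<m'. w u \<in> carrier R) \<and> (\<forall>t<m. v t = msum ring_mod (\<lambda>u. A' t u \<otimes> w u) m')}"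
  have Psub: "sub_mod ?M ?P"
  proof (rule sub_modI)
    show "?P \<subseteq> carrier ?M" by auto
    have "msum ring_mod (\<lambda>u. A' t u \<otimes> \<zero>) m' = \<zero>\<^bsub>ring_mod\<^esub>" for t
      by (rule msum_zero) (use A'R in auto)
    then have "\<forall>t<m. \<zero>\<^bsub>?M\<^esub> t = msum ring_mod (\<lambda>u. A' t u \<otimes> \<zero>) m'" by simp
    then show "\<zero>\<^bsub>?M\<^esub> \<in> ?P"
      by (intro CollectI conjI exI[of _ "\<lambda>_. \<zero>"] md_closed(2)[OF M]) simp_all
    show "x \<oplus>\<^bsub>?M\<^esub> y \<in> ?P" if xy: "x \<in> ?P" "y \<in> ?P" for x y
    proof -
      obtain w w' where w: "\<forall>u<m'. w u \<in> carrier R" "\<forall>t<m. x t = msum ring_mod (\<lambda>u. A' t u \<otimes> w u) m'"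
        "\<forall>u<m'. w' u \<in> carrier R" "\<forall>t<m. y t = msum ring_mod (\<lambda>u. A' t u \<otimes> w' u) m'" using xy by blast
      have "\<forall>t<m. (x \<oplus>\<^bsub>?M\<^esub> y) t = msum ring_mod (\<lambda>u. A' t u \<otimes> (w u \<oplus> w' u)) m'"
        using w A'R by (simp add: addm)
      moreover have "\<forall>u<m'. w u \<oplus> w' u \<in> carrier R" using w by simp
      moreover have "x \<oplus>\<^bsub>?M\<^esub> y \<in> carrier ?M" by (rule md_closed(1)[OF M]) (use xy in blast)+
      ultimately show ?thesis by (intro CollectI conjI exI[of _ "\<lambda>u. w u \<oplus> w' u"])
    qed
    show "r \<odot>\<^bsub>?M\<^esub> x \<in> ?P" if r: "r \<in> carrier R" and x: "x \<in> ?P" for r x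
    proof -
      obtain w where w: "\<forall>u<m'. w u \<in> carrier R" "\<forall>t<m. x t = msum ring_mod (\<lambda>u. A' t u \<otimes> w u) m'"
        using x by blast
      have "\<forall>t<m. (r \<odot>\<^bsub>?M\<^esub> x) t = msum ring_mod (\<lambda>u. A' t u \<otimes> (r \<otimes> w u)) m'"
        using w A'R r by (simp add: smm)
      moreover have "\<forall>u<m'. r \<otimes> w u \<in> carrier R" using w r by simp
      moreover have "r \<odot>\<^bsub>?M\<^esub> x \<in> carrier ?M" by (rule md_closed(4)[OF M r]) (use x in blast)
      ultimately show ?thesis by (intro CollectI conjI exI[of _ "\<lambda>u. r \<otimes> w u"])
    qed
  qed
  have "G \<subseteq> ?P"
  proof
    fix g assume "g \<in> G"
    then obtain k where k: "k < m'" "g = gs ! k" using gs by (auto simp: m'_def in_set_conv_nth)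
    have g: "g \<in> carrier ?M" using gW[OF k(1)] k(2) by (simp add: W_def)
    let ?w = "\<lambda>u. if u = k then \<one> else \<zero>"
    have ms: "msum ring_mod (\<lambda>u. A' t u \<otimes> ?w u) j = (if k < j then A' t k else \<zero>)" for t j
      by (induction j) (use A'R in \<open>auto simp: less_Suc_eq\<close>)
    have "\<forall>t<m. g t = msum ring_mod (\<lambda>u. A' t u \<otimes> ?w u) m'"
      unfolding ms using k by (simp add: A'_def)
    moreover have "\<forall>u<m'. ?w u \<in> carrier R" by simp
    ultimately show "g \<in> ?P" using g by (intro CollectI conjI exI[of _ ?w])
  qed
  then have WP: "W \<subseteq> ?P" using G(3) spn_least[OF Psub, of "G \<union> {\<zero>\<^bsub>?M\<^esub>}"] sub_modD(3)[OF Psub] by blast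
  show ?thesis
  proof (intro exI[of _ m'] exI[of _ A'] conjI allI impI)
    show "A' t u \<in> carrier R" for t u by (rule A'R)
    show "msum ring_mod (\<lambda>t. A s t \<otimes> A' t u) m = \<zero>" if "s < n" "u < m'" for s u
    proof -
      have "msum ring_mod (\<lambda>t. A s t \<otimes> A' t u) m = msum ring_mod (\<lambda>t. A s t \<otimes> (gs ! u) t) m"
        using that by (intro msum_cong) (simp add: A'_def)
      then show ?thesis using gW[OF that(2)] that(1) by (simp add: W_def)
    qed
    fix v assume v: "(\<forall>t<m. v t \<in> carrier R) \<and> (\<forall>s<n. msum ring_mod (\<lambda>t. A s t \<otimes> v t) m = \<zero>)"
    have "msum ring_mod (\<lambda>t. A s t \<otimes> restrict v {..<m} t) m = msum ring_mod (\<lambda>t. A s t \<otimes> v t) m" for s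
      by (rule msum_cong) simp
    then have "restrict v {..<m} \<in> W" unfolding W_def Mc using v by auto
    then obtain w where "\<forall>u<m'. w u \<in> carrier R" "\<forall>t<m. restrict v {..<m} t = msum ring_mod (\<lambda>u. A' t u \<otimes> w u) m'"
      using WP by blast
    then show "\<exists>w. (\<forall>u<m'. w u \<in> carrier R) \<and> (\<forall>t<m. v t = msum ring_mod (\<lambda>u. A' t u \<otimes> w u) m')"
      by (intro exI[of _ w]) auto
  qed
qed

text \<open>The generators are written as the row with index \<open>0\<close> of a matrix, the form
  in which \<open>resolution_exists\<close> starts its iteration.\<close>

lemma ideal_generators:
  assumes noeth: "noetherian_ring R" and J: "ideal J R"
  shows "\<exists>m (A :: nat \<Rightarrow> nat \<Rightarrow> 'r). (\<forall>s t. A s t \<in> carrier R) \<and> (\<forall>t<m. A 0 t \<in> J) \<and>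
    (\<forall>r\<in>J. \<exists>w. (\<forall>t<m. w t \<in> carrier R) \<and> r = msum ring_mod (\<lambda>t. A 0 t \<otimes> w t) m)"
proof -
  obtain G where G: "G \<subseteq> carrier R" "finite G" "J = Idl G"
    using noetherian_ring.finetely_gen[OF noeth J] by blast
  obtain gs where gs: "set gs = G" using finite_list[OF G(2)] by blast
  let ?m = "length gs"
  define A where "A = (\<lambda>(s :: nat) t. if t < ?m then gs ! t else \<zero>)"
  have AR: "A s t \<in> carrier R" for s t using G(1) gs nth_mem by (fastforce simp: A_def)
  have AJ: "A 0 t \<in> J" if "t < ?m" for t
    using that G(3) gs genideal_self[OF G(1)] nth_mem by (fastforce simp: A_def)
  let ?P = "{r \<in> carrier R. \<exists>w. (\<forall>t<?m. w t \<in> carrier R) \<and> r = msum ring_mod (\<lambda>t. A 0 t \<otimes> w t) ?m}"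
  have "sub_mod ring_mod ?P"
  proof (rule sub_modI)
    show "?P \<subseteq> carrier ring_mod" by auto
    have "msum ring_mod (\<lambda>t. A 0 t \<otimes> \<zero>) ?m = \<zero>\<^bsub>ring_mod\<^esub>"
      by (rule msum_zero) (use AR in auto)
    then show "\<zero>\<^bsub>ring_mod\<^esub> \<in> ?P" by (auto intro!: exI[of _ "\<lambda>_. \<zero>"])
    show "x \<oplus>\<^bsub>ring_mod\<^esub> y \<in> ?P" if xy: "x \<in> ?P" "y \<in> ?P" for x y
    proof -
      obtain w w' where w: "\<forall>u<?m. w u \<in> carrier R" "x = msum ring_mod (\<lambda>u. A 0 u \<otimes> w u) ?m"
        "\<forall>u<?m. w' u \<in> carrier R" "y = msum ring_mod (\<lambda>u. A 0 u \<otimes> w' u) ?m" using xy by blast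
      have "x \<oplus> y = msum ring_mod (\<lambda>u. A 0 u \<otimes> w u \<oplus>\<^bsub>ring_mod\<^esub> A 0 u \<otimes> w' u) ?m"
        unfolding w(2,4) using w(1,3) AR by (subst msum_add) auto
      also have "\<dots> = msum ring_mod (\<lambda>u. A 0 u \<otimes> (w u \<oplus> w' u)) ?m"
        using w AR by (intro msum_cong) (simp add: r_distr)
      finally have "x \<oplus> y = msum ring_mod (\<lambda>u. A 0 u \<otimes> (w u \<oplus> w' u)) ?m" .
      moreover have "\<forall>u<?m. w u \<oplus> w' u \<in> carrier R" "x \<oplus> y \<in> carrier R" using w xy by auto
      ultimately show ?thesis unfolding ring_mod_simps
        by (intro CollectI conjI exI[of _ "\<lambda>u. w u \<oplus> w' u"])
    qed
    show "r \<odot>\<^bsub>ring_mod\<^esub> x \<in> ?P" if r: "r \<in> carrier R" and x: "x \<in> ?P" for r x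
    proof -
      obtain w where w: "\<forall>u<?m. w u \<in> carrier R" "x = msum ring_mod (\<lambda>u. A 0 u \<otimes> w u) ?m" using x by blast
      have "r \<otimes> x = msum ring_mod (\<lambda>u. r \<odot>\<^bsub>ring_mod\<^esub> (A 0 u \<otimes> w u)) ?m"
        unfolding w(2) using w(1) AR r msum_smult[OF module_ring_mod r, of ?m "\<lambda>u. A 0 u \<otimes> w u"] by simp
      also have "\<dots> = msum ring_mod (\<lambda>u. A 0 u \<otimes> (r \<otimes> w u)) ?m"
        using w AR r by (intro msum_cong) (simp add: m_lcomm)
      finally have "r \<otimes> x = msum ring_mod (\<lambda>u. A 0 u \<otimes> (r \<otimes> w u)) ?m" .
      moreover have "\<forall>u<?m. r \<otimes> w u \<in> carrier R" "r \<otimes> x \<in> carrier R" using w x r by auto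
      ultimately show ?thesis unfolding ring_mod_simps
        by (intro CollectI conjI exI[of _ "\<lambda>u. r \<otimes> w u"])
    qed
  qed
  then have "ideal ?P R" by (rule sub_mod_ideal')
  moreover have "G \<subseteq> ?P"
  proof
    fix g assume "g \<in> G"
    then obtain k where k: "k < ?m" "g = gs ! k" using gs by (auto simp: in_set_conv_nth)
    let ?w = "\<lambda>u. if u = k then \<one> else \<zero>"
    have ms: "msum ring_mod (\<lambda>u. A 0 u \<otimes> ?w u) j = (if k < j then A 0 k else \<zero>)" for j
      by (induction j) (use AR in \<open>auto simp: less_Suc_eq\<close>)
    have "g = msum ring_mod (\<lambda>u. A 0 u \<otimes> ?w u) ?m" unfolding ms using k by (simp add: A_def)
    moreover have "\<forall>u<?m. ?w u \<in> carrier R" by simp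
    ultimately show "g \<in> ?P"
      using subsetD[OF G(1) \<open>g \<in> G\<close>] by (intro CollectI conjI exI[of _ ?w])
  qed
  ultimately have "J \<subseteq> ?P" unfolding G(3) by (rule genideal_minimal)
  then have "\<forall>r\<in>J. \<exists>w. (\<forall>t<?m. w t \<in> carrier R) \<and> r = msum ring_mod (\<lambda>t. A 0 t \<otimes> w t) ?m" by blast
  then show ?thesis by (intro exI[of _ ?m] exI[of _ A] conjI allI impI AR AJ)
qed

text \<open>Kernels are covered by free modules again and again, by dependent choice;
  \<open>matrix_kernel\<close> is the single step.\<close>

lemma resolution_exists:
  assumes noeth: "noetherian_ring R" and J: "ideal J R"
  shows "\<exists>b a. resolves b a J"
proof -
  obtain m0 and A0 :: "nat \<Rightarrow> nat \<Rightarrow> 'r" where A0: "\<forall>s t. A0 s t \<in> carrier R" "\<forall>t<m0. A0 0 t \<in> J"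
    "\<forall>r\<in>J. \<exists>w. (\<forall>t<m0. w t \<in> carrier R) \<and> r = msum ring_mod (\<lambda>t. A0 0 t \<otimes> w t) m0"
    using ideal_generators[OF noeth J] by (elim exE conjE)
  \<comment> \<open>A state consists of the number of rows, the number of columns and the matrix.
    The relation \<open>?Q\<close> makes the columns of the next matrix generate the kernel of the
    present one.\<close>
  let ?P = "\<lambda>i (x :: nat \<times> nat \<times> (nat \<Rightarrow> nat \<Rightarrow> 'r)).
    (\<forall>s t. snd (snd x) s t \<in> carrier R) \<and> (i = (0 :: nat) \<longrightarrow> x = (1, m0, A0))"
  let ?Q = "\<lambda>(i :: nat) (x :: nat \<times> nat \<times> (nat \<Rightarrow> nat \<Rightarrow> 'r)) (y :: nat \<times> nat \<times> (nat \<Rightarrow> nat \<Rightarrow> 'r)).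
    fst y = fst (snd x) \<and>
    (\<forall>s<fst x. \<forall>u<fst (snd y). msum ring_mod (\<lambda>t. snd (snd x) s t \<otimes> snd (snd y) t u) (fst (snd x)) = \<zero>) \<and>
    (\<forall>v. (\<forall>t<fst (snd x). v t \<in> carrier R) \<and>
        (\<forall>s<fst x. msum ring_mod (\<lambda>t. snd (snd x) s t \<otimes> v t) (fst (snd x)) = \<zero>) \<longrightarrow>
      (\<exists>w. (\<forall>u<fst (snd y). w u \<in> carrier R) \<and>
        (\<forall>t<fst (snd x). v t = msum ring_mod (\<lambda>u. snd (snd y) t u \<otimes> w u) (fst (snd y)))))"
  have "\<exists>f. \<forall>i. ?P i (f i) \<and> ?Q i (f i) (f (Suc i))"
  proof (rule dependent_nat_choice)
    show "\<exists>x. ?P 0 x" using A0(1) by (intro exI[of _ "(1, m0, A0)"]) auto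
    fix x i assume x: "?P i x"
    obtain n m A where xA: "x = (n, m, A)" by (cases x) auto
    have "\<forall>s t. A s t \<in> carrier R" using x xA by simp
    note kernel = matrix_kernel[where n = n and m = m, OF noeth this]
    obtain m' and A' :: "nat \<Rightarrow> nat \<Rightarrow> 'r" where
      "(\<forall>t u. A' t u \<in> carrier R)" "(\<forall>s<n. \<forall>u<m'. msum ring_mod (\<lambda>t. A s t \<otimes> A' t u) m = \<zero>)"
      "(\<forall>v. (\<forall>t<m. v t \<in> carrier R) \<and> (\<forall>s<n. msum ring_mod (\<lambda>t. A s t \<otimes> v t) m = \<zero>) \<longrightarrow>
        (\<exists>w. (\<forall>u<m'. w u \<in> carrier R) \<and> (\<forall>t<m. v t = msum ring_mod (\<lambda>u. A' t u \<otimes> w u) m')))"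
      using kernel by (elim exE conjE)
    then show "\<exists>y. ?P (Suc i) y \<and> ?Q i x y" unfolding xA by (intro exI[of _ "(m, m', A')"]) simp
  qed
  then obtain f where f: "\<forall>i. ?P i (f i) \<and> ?Q i (f i) (f (Suc i))" by (elim exE)
  define b where "b = (\<lambda>i. fst (f i))"
  define a where "a = (\<lambda>i. snd (snd (f i)))"
  note fP = f[THEN spec, THEN conjunct1] and fQ = f[THEN spec, THEN conjunct2]
  have bS: "fst (snd (f i)) = b (Suc i)" for i
    unfolding b_def by (rule fQ[THEN conjunct1, symmetric])
  have f0: "f 0 = (1, m0, A0)" by (rule fP[THEN conjunct2, THEN mp]) (rule HOL.refl)
  have b1: "b (Suc 0) = m0" and b0: "b 0 = 1" and a0: "a 0 = A0"
    using bS[of 0] f0 by (auto simp: b_def a_def)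
  have R: "\<forall>s t. a i s t \<in> carrier R" for i unfolding a_def by (rule fP[THEN conjunct1])
  have q1: "\<forall>s<b i. \<forall>u<b (Suc (Suc i)). msum ring_mod (\<lambda>t. a i s t \<otimes> a (Suc i) t u) (b (Suc i)) = \<zero>" for i
    using fQ[of i, THEN conjunct2, THEN conjunct1] unfolding bS unfolding a_def b_def .
  have q2: "\<forall>v. (\<forall>t<b (Suc i). v t \<in> carrier R) \<and> (\<forall>s<b i. msum ring_mod (\<lambda>t. a i s t \<otimes> v t) (b (Suc i)) = \<zero>) \<longrightarrow>
      (\<exists>w. (\<forall>u<b (Suc (Suc i)). w u \<in> carrier R) \<and>
        (\<forall>t<b (Suc i). v t = msum ring_mod (\<lambda>u. a (Suc i) t u \<otimes> w u) (b (Suc (Suc i)))))" for i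
    using fQ[of i, THEN conjunct2, THEN conjunct2] unfolding bS unfolding a_def b_def .
  have "resolves b a J"
    unfolding resolves_def free_cx_def mat_apply_def ring_mod_simps
  proof (intro conjI)
    show "\<forall>i s u. s < b i \<longrightarrow> u < b (Suc (Suc i)) \<longrightarrow> msum ring_mod (\<lambda>t. a i s t \<otimes> a (Suc i) t u) (b (Suc i)) = \<zero>"
      using q1 by blast
    show "\<forall>t<b 1. a 0 0 t \<in> J" using A0(2) by (simp add: a0 b1)
    show "\<forall>r\<in>J. \<exists>w. (\<forall>t<b 1. w t \<in> carrier R) \<and> r = msum ring_mod (\<lambda>t. a 0 0 t \<otimes> w t) (b (Suc 0))"
      unfolding One_nat_def b1 a0 by (rule A0(3))
  qed (rule b0, rule allI[OF R], rule allI[OF q2])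
  then show ?thesis by blast
qed

end

section \<open>Modules outside a prime ideal and truncations\<close>

context cring_complexes
begin

lemma colon_ideal:
  assumes M: "module R M" and N: "sub_mod M N" and g: "g \<in> carrier M"
  shows "ideal {r \<in> carrier R. r \<odot>\<^bsub>M\<^esub> g \<in> N} R"
  using M g sub_modD[OF N] by (intro sub_mod_ideal' sub_modI) (auto simp: md_smult)

lemma ann_ideal:
  assumes M: "module R M" and N: "sub_mod M N"
  shows "ideal {r \<in> carrier R. \<forall>x\<in>carrier M. r \<odot>\<^bsub>M\<^esub> x \<in> N} R"
  using M sub_modD[OF N] by (intro sub_mod_ideal' sub_modI) (auto simp: md_smult)

text \<open>Along the generators of a finitely generated module \<open>M/B\<close>, the first submodule that contains a
  multiple of \<open>M\<close> by an element outside \<open>p\<close> is larger than its predecessor \<open>N\<close> by a generator \<open>z\<close>.\<close>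

lemma quotient_witness:
  assumes M: "module R M" and B: "sub_mod M B" and fg: "fg_over M B (carrier M)"
    and p: "ideal p R" and prime: "\<And>x y. x \<in> carrier R \<Longrightarrow> y \<in> carrier R \<Longrightarrow> x \<otimes> y \<in> p \<Longrightarrow> x \<in> p \<or> y \<in> p"
    and one: "\<one> \<notin> p" and ann: "\<And>r. r \<in> carrier R \<Longrightarrow> \<forall>x\<in>carrier M. r \<odot>\<^bsub>M\<^esub> x \<in> B \<Longrightarrow> r \<in> p"
  shows "\<exists>N z d. sub_mod M N \<and> B \<subseteq> N \<and> z \<in> carrier M \<and> d \<in> carrier R \<and> d \<notin> p \<and>
    (\<forall>x\<in>carrier M. \<exists>r\<in>carrier R. \<exists>y\<in>N. d \<odot>\<^bsub>M\<^esub> x = r \<odot>\<^bsub>M\<^esub> z \<oplus>\<^bsub>M\<^esub> y) \<and>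
    (\<forall>r\<in>carrier R. r \<odot>\<^bsub>M\<^esub> z \<in> N \<longrightarrow> r \<in> p)"
proof -
  obtain A where A: "finite A" "A \<subseteq> carrier M" "carrier M \<subseteq> spn M (A \<union> B)" using fg by (auto simp: fg_over_def)
  obtain xs where xs: "set xs = A" using finite_list[OF A(1)] by blast
  define F where "F = (\<lambda>i. spn M (set (take i xs) \<union> B))"
  have sub: "set (take i xs) \<union> B \<subseteq> carrier M" for i
    using A(2) xs sub_modD(1)[OF B] set_take_subset[of i xs] by blast
  have F: "sub_mod M (F i)" for i unfolding F_def by (rule sub_mod_spn[OF M sub])
  \<comment> \<open>\<open>P i\<close> says that M/F_i vanishes after localization at
    \<open>p\<close>. It fails at \<open>B\<close>, because the annihilator lies in
    \<open>p\<close>, and holds at the end with \<open>d = 1\<close>; the generator sought sits at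
    the first index where it holds.\<close>
  define P where "P = (\<lambda>i. \<exists>d\<in>carrier R. d \<notin> p \<and> (\<forall>x\<in>carrier M. d \<odot>\<^bsub>M\<^esub> x \<in> F i))"
  have "\<one> \<odot>\<^bsub>M\<^esub> x \<in> F (length xs)" if "x \<in> carrier M" for x
    using A(3) that M by (auto simp: F_def xs)
  then have "P (length xs)" unfolding P_def using one by blast
  then have PL: "P (Least P)" by (rule LeastI)
  have "F 0 = B" using spn_sub_mod[OF B] by (simp add: F_def)
  then have "\<not> P 0" using ann by (auto simp: P_def)
  then have "Least P \<noteq> 0" using PL by (cases "Least P = 0") auto
  then obtain k where k: "Least P = Suc k" by (cases "Least P") auto
  then have "P (Suc k)" using PL by simp
  then obtain d where d: "d \<in> carrier R" "d \<notin> p" "\<And>x. x \<in> carrier M \<Longrightarrow> d \<odot>\<^bsub>M\<^esub> x \<in> F (Suc k)"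
    unfolding P_def by blast
  have nP: "\<not> P k" using not_less_Least[of k P] k by simp
  have "k < length xs"
  proof (rule ccontr)
    assume "\<not> k < length xs"
    then have "F (Suc k) = F k" by (simp add: F_def)
    then show False using nP d unfolding P_def by auto
  qed
  then have "set (take (Suc k) xs) = insert (xs ! k) (set (take k xs))" by (simp add: take_Suc_conv_app_nth)
  then have eq: "F (Suc k) = spn M (insert (xs ! k) (set (take k xs) \<union> B))" by (simp add: F_def)
  have z: "xs ! k \<in> carrier M" using nth_mem[OF \<open>k < length xs\<close>] A(2) xs by blast
  have BF: "B \<subseteq> F k"
    unfolding F_def using spn_superset[of "set (take k xs) \<union> B" M] by (rule order_trans[rotated]) simp
  have ex: "\<exists>r\<in>carrier R. \<exists>y\<in>F k. d \<odot>\<^bsub>M\<^esub> x = r \<odot>\<^bsub>M\<^esub> (xs ! k) \<oplus>\<^bsub>M\<^esub> y" if x: "x \<in> carrier M" for x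
  proof (rule spn_insert[OF M z sub d(3)[OF x, unfolded eq]])
    fix r q assume "r \<in> carrier R" "q \<in> spn M (set (take k xs) \<union> B)" "d \<odot>\<^bsub>M\<^esub> x = r \<odot>\<^bsub>M\<^esub> (xs ! k) \<oplus>\<^bsub>M\<^esub> q"
    then show ?thesis unfolding F_def by (intro bexI[of _ r] bexI[of _ q])
  qed
  \<comment> \<open>If \<open>r\<close> carries the generator into \<open>F k\<close>, then
    \<open>r d\<close> carries all of \<open>M\<close> into \<open>F k\<close>. Since
    \<open>P k\<close> fails, \<open>r d\<close> lies in \<open>p\<close>, whereas \<open>d\<close>
    does not.\<close>
  have pr: "r \<in> p" if r: "r \<in> carrier R" "r \<odot>\<^bsub>M\<^esub> (xs ! k) \<in> F k" for r
  proof -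
    have "(r \<otimes> d) \<odot>\<^bsub>M\<^esub> x \<in> F k" if x: "x \<in> carrier M" for x
    proof -
      obtain s y where s: "s \<in> carrier R" "y \<in> F k" "d \<odot>\<^bsub>M\<^esub> x = s \<odot>\<^bsub>M\<^esub> (xs ! k) \<oplus>\<^bsub>M\<^esub> y"
        using ex[OF x] by (elim bexE)
      have "(r \<otimes> d) \<odot>\<^bsub>M\<^esub> x = r \<odot>\<^bsub>M\<^esub> (d \<odot>\<^bsub>M\<^esub> x)" using M r(1) d(1) x by (simp add: md_smult)
      also have "\<dots> = s \<odot>\<^bsub>M\<^esub> (r \<odot>\<^bsub>M\<^esub> (xs ! k)) \<oplus>\<^bsub>M\<^esub> r \<odot>\<^bsub>M\<^esub> y"
        using M r(1) s z sub_modD(2)[OF F s(2)] by (simp add: md_smult md_smult_comm[OF M r(1) s(1) z])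
      finally show ?thesis using sub_modD(4,5)[OF F] r s by simp
    qed
    then have "r \<otimes> d \<in> p" using nP r(1) d(1) unfolding P_def by blast
    then show ?thesis using prime[OF r(1) d(1)] d(2) by blast
  qed
  show ?thesis
    by (intro exI[of _ "F k"] exI[of _ "xs ! k"] exI[of _ d] conjI ballI impI ex pr F BF z d(1,2))
qed

text \<open>Cycles in the bottom degree keep the homology in all degrees from \<open>b\<close> on
  unchanged and add none below.\<close>

definition trunc :: "int \<Rightarrow> ('r, 'm) cx \<Rightarrow> ('r, 'm) cx" where
  "trunc b Z = sub_cx Z (\<lambda>i. if i < b then {\<zero>\<^bsub>Obj Z i\<^esub>} else if i = b then cycles Z b else carrier (Obj Z i))"

text \<open>A subcomplex as soon as \<open>N\<close> contains the boundaries; the quotient by it is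
  concentrated in degree \<open>b\<close>.\<close>

definition bottom_to :: "int \<Rightarrow> 'm set \<Rightarrow> ('r, 'm) cx \<Rightarrow> ('r, 'm) cx" where
  "bottom_to b N Z = sub_cx Z (\<lambda>i. if i = b then N else carrier (Obj Z i))"

lemma submod_carrier [simp]: "submod M (carrier M) = M"
  by (simp add: submod_def)

lemma submod_submod [simp]: "submod (submod M A) B = submod M B"
  by (simp add: submod_def)

lemma sub_sub_cx [simp]: "sub_cx (sub_cx X S) T = sub_cx X T"
  by (simp add: sub_cx_def)

lemma subcomplex_trunc:
  assumes Z: "cpx Z"
  shows "subcomplex Z (\<lambda>i. if i < b then {\<zero>\<^bsub>Obj Z i\<^esub>} else if i = b then cycles Z b else carrier (Obj Z i))"
  unfolding subcomplex_def
  using Z sub_mod_cycles[OF Z] by (auto simp: mem_cycles)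

lemma cpx_trunc [simp]: "cpx Z \<Longrightarrow> cpx (trunc b Z)"
  unfolding trunc_def by (rule cpx_sub[OF _ subcomplex_trunc])

lemma subcomplex_bottom:
  assumes Z: "cpx Z" and N: "sub_mod (Obj Z b) N" "boundaries Z b \<subseteq> N"
  shows "subcomplex Z (\<lambda>i. if i = b then N else carrier (Obj Z i))"
  unfolding subcomplex_def
proof (intro allI conjI ballI)
  fix n x assume x: "x \<in> (if n = b then N else carrier (Obj Z n))"
  then have "x \<in> carrier (Obj Z n)" using sub_modD(2)[OF N(1)] by (auto split: if_splits)
  moreover from this have "Diff Z n x \<in> N" if "n - 1 = b"
    using N(2) that by (auto simp: mem_boundaries subset_iff intro!: bexI[of _ x])
  ultimately show "Diff Z n x \<in> (if n - 1 = b then N else carrier (Obj Z (n - 1)))" using Z by auto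
qed (use Z N in auto)

lemma cpx_bottom [simp]:
  "cpx Z \<Longrightarrow> sub_mod (Obj Z b) N \<Longrightarrow> boundaries Z b \<subseteq> N \<Longrightarrow> cpx (bottom_to b N Z)"
  unfolding bottom_to_def by (rule cpx_sub[OF _ subcomplex_bottom])

lemma trunc_qis:
  assumes Z: "cpx Z" and ac: "\<And>i. i < b \<Longrightarrow> cycles Z i \<subseteq> boundaries Z i"
  shows "qis (trunc b Z) Z (\<lambda>n x. x)"
  unfolding qis_def
proof (intro conjI allI ballI impI)
  show "cmap (trunc b Z) Z (\<lambda>n x. x)"
    unfolding trunc_def by (rule cmap_sub[OF Z subcomplex_trunc[OF Z]])
  fix n
  show "x \<in> boundaries (trunc b Z) n" if x: "x \<in> cycles (trunc b Z) n" and bx: "x \<in> boundaries Z n" for x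
  proof (cases "n < b")
    case True
    then have "x = \<zero>\<^bsub>Obj (trunc b Z) n\<^esub>" using x by (simp add: mem_cycles trunc_def)
    then show ?thesis using sub_modD(3)[OF sub_mod_boundaries[OF cpx_trunc[OF Z]]] by metis
  next
    case False
    then show ?thesis using bx by (auto simp: mem_boundaries trunc_def)
  qed
  fix z assume z: "z \<in> cycles Z n"
  show "\<exists>x\<in>cycles (trunc b Z) n. \<exists>c\<in>boundaries Z n. z = c \<oplus>\<^bsub>Obj Z n\<^esub> x"
  proof (cases "n < b")
    case True
    have "\<zero>\<^bsub>Obj Z n\<^esub> \<in> cycles (trunc b Z) n" 
      using sub_modD(3)[OF sub_mod_cycles[OF cpx_trunc[OF Z, of b], of n]] by (simp add: trunc_def)
    moreover have "z = z \<oplus>\<^bsub>Obj Z n\<^esub> \<zero>\<^bsub>Obj Z n\<^esub>" using z Z by (simp add: mem_cycles)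
    ultimately show ?thesis using ac[OF True] z by blast
  next
    case False
    have "z \<in> cycles (trunc b Z) n" using z False by (auto simp: mem_cycles trunc_def)
    moreover have "z = \<zero>\<^bsub>Obj Z n\<^esub> \<oplus>\<^bsub>Obj Z n\<^esub> z" using z Z by (simp add: mem_cycles)
    ultimately show ?thesis using sub_modD(3)[OF sub_mod_boundaries[OF Z]] by blast
  qed
qed

end

context cellular
begin

text \<open>For an extension \<open>V\<close> of \<open>Z\<close>, the preimage of \<open>S\<close>
  is an extension of the subcomplex by \<open>B\<close> and thus in \<open>C\<close>. Its inclusion
  into \<open>V\<close> is a quasi-isomorphism since the quotient is the same as that of
  \<open>Z\<close> by \<open>S\<close>; the chase below avoids these quotients.\<close>

lemma absorbed_sub_qis:
  assumes Z: "cpx Z" "small Z" and S: "subcomplex Z S" and q: "qis (sub_cx Z S) Z (\<lambda>n x. x)"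
    and A: "absorbed (sub_cx Z S)"
  shows "absorbed Z"
proof (rule absorbedI[OF Z])
  fix B V :: "('r, 'u) cx" and f p
  assume ses: "ses B V Z f p" and B: "B \<in> C"
  note s = sesD[OF ses] and cp = cmapD[OF sesD(2)[OF ses]] and cf = cmapD[OF sesD(1)[OF ses]]
  note V = cp(1)
  have SM: "sub_mod (Obj Z n) (S n)" and Sd: "x \<in> S n \<Longrightarrow> Diff Z n x \<in> S (n - 1)" for n x
    using S by (auto simp: subcomplex_def)
  note sm = sub_modD[OF SM]
  define P where "P = (\<lambda>n. {v \<in> carrier (Obj V n). p n v \<in> S n})"
  have SP: "subcomplex V P"
    unfolding subcomplex_def
  proof (intro allI conjI ballI)
    show "sub_mod (Obj V n) (P n)" for n
      using V sm by (intro sub_modI) (auto simp: P_def cp)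
    show "Diff V n x \<in> P (n - 1)" if "x \<in> P n" for n x
      using that V Sd by (auto simp: P_def cp)
  qed
  let ?V = "sub_cx V P" and ?Z = "sub_cx Z S"
  have cV: "cpx ?V" using V SP by simp
  have "ses B ?V ?Z f p"
    unfolding ses_def
  proof (intro conjI allI ballI impI)
    have "f n b \<in> P n" if "b \<in> carrier (Obj B n)" for n b
      using cf(3)[OF that] s(5)[OF that] sm(3) by (simp add: P_def)
    then show "cmap B ?V f" using cf(1) cV by (intro cmapI) (auto simp: cf)
    show "cmap ?V ?Z p" using cV cmapD(1)[OF qisD(1)[OF q]] by (intro cmapI) (auto simp: P_def cp)
    show "\<exists>v\<in>carrier (Obj ?V n). y = p n v" if y: "y \<in> carrier (Obj ?Z n)" for n y
    proof -
      have "y \<in> carrier (Obj Z n)" using y sm(2) by simp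
      then obtain v where "v \<in> carrier (Obj V n)" "y = p n v" using s(4) by blast
      then show ?thesis using y by (auto simp: P_def)
    qed
  qed (use s in \<open>auto simp: P_def\<close>)
  then have in_V: "in_cell ?V" by (rule absorbedD[OF A]) (simp add: B in_cell_iff)
  have "qis ?V V (\<lambda>n x. x)"
    unfolding qis_def
  proof (intro conjI allI ballI impI)
    show "cmap ?V V (\<lambda>n x. x)" by (rule cmap_sub[OF V SP])
    fix n
    show "v \<in> boundaries ?V n" if v: "v \<in> cycles ?V n" and bv: "v \<in> boundaries V n" for v
    proof -
      obtain u where u: "u \<in> carrier (Obj V (n + 1))" "v = Diff V (n + 1) u" using bv by (auto simp: mem_boundaries)
      have vP: "v \<in> P n" and vc: "v \<in> carrier (Obj V n)" "Diff V n v = \<zero>\<^bsub>Obj V (n - 1)\<^esub>"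
        using v by (auto simp: mem_cycles P_def)
      have dpu: "Diff Z (n + 1) (p (n + 1) u) = p n v" using u by (simp add: cp)
      have "p n v \<in> cycles ?Z n" using vP vc cmap_cycles[OF s(2), of v n] by (simp add: mem_cycles P_def)
      moreover have "p n v \<in> boundaries Z n" using cmap_boundaries[OF s(2) bv] .
      ultimately have "p n v \<in> boundaries ?Z n" using qisD(2)[OF q] by blast
      then obtain y where y: "y \<in> S (n + 1)" "p n v = Diff Z (n + 1) y" by (auto simp: mem_boundaries)
      have yZ: "y \<in> carrier (Obj Z (n + 1))" using sm(2)[OF y(1)] .
      \<comment> \<open>The images of \<open>u\<close> and \<open>y\<close> have the same boundary,
        so the difference is a cycle, and up to a boundary \<open>c\<close> it belongs to
        \<open>S\<close>. Subtracting a lift of \<open>c\<close> from \<open>u\<close> moves it into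
        the preimage of \<open>S\<close> without changing its boundary.\<close>
      let ?w = "p (n + 1) u \<oplus>\<^bsub>Obj Z (n + 1)\<^esub> \<ominus>\<^bsub>Obj Z (n + 1)\<^esub> y"
      have "?w \<in> cycles Z (n + 1)"
        using Z(1) u yZ cp(3)[OF vc(1)] dpu y(2)[symmetric] by (simp add: mem_cycles cp(3))
      then obtain x c where x: "x \<in> cycles ?Z (n + 1)" "c \<in> boundaries Z (n + 1)" "?w = c \<oplus>\<^bsub>Obj Z (n + 1)\<^esub> x"
        using qisD(3)[OF q] by blast
      obtain e where e: "e \<in> carrier (Obj Z (n + 2))" "c = Diff Z (n + 2) e"
        using x(2) by (auto simp: mem_boundaries add.commute[of 2 n])
      obtain e' where e': "e' \<in> carrier (Obj V (n + 2))" "e = p (n + 2) e'" using s(4)[OF e(1)] by blast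
      have xS: "x \<in> S (n + 1)" "x \<in> carrier (Obj Z (n + 1))" using x(1) sm(2) by (auto simp: mem_cycles)
      have cZ: "c \<in> carrier (Obj Z (n + 1))" using e Z(1) by simp
      have de: "p (n + 1) (Diff V (n + 2) e') = c" using e e' by (simp add: cp(8))
      let ?u = "u \<oplus>\<^bsub>Obj V (n + 1)\<^esub> \<ominus>\<^bsub>Obj V (n + 1)\<^esub> Diff V (n + 2) e'"
      have "p (n + 1) u = ?w \<oplus>\<^bsub>Obj Z (n + 1)\<^esub> y" using Z(1) u yZ cp(3) by simp
      also have "\<dots> = c \<oplus>\<^bsub>Obj Z (n + 1)\<^esub> (x \<oplus>\<^bsub>Obj Z (n + 1)\<^esub> y)"
        unfolding x(3) using Z(1) cZ xS yZ by (simp add: md_ac)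
      finally have "p (n + 1) ?u = x \<oplus>\<^bsub>Obj Z (n + 1)\<^esub> y"
        using V Z(1) u e' cZ xS yZ by (simp add: cp(4) cp(7) de)
      then have "?u \<in> P (n + 1)" using sm(4)[OF xS(1) y(1)] V u e' by (simp add: P_def)
      moreover have "v = Diff V (n + 1) ?u" using V u e' vc by simp
      ultimately show ?thesis by (auto simp: mem_boundaries)
    qed
    fix v assume v: "v \<in> cycles V n"
    then have vc: "v \<in> carrier (Obj V n)" by (simp add: mem_cycles)
    obtain x c where x: "x \<in> cycles ?Z n" "c \<in> boundaries Z n" "p n v = c \<oplus>\<^bsub>Obj Z n\<^esub> x"
      using qisD(3)[OF q cmap_cycles[OF s(2) v]] by blast
    obtain e where e: "e \<in> carrier (Obj Z (n + 1))" "c = Diff Z (n + 1) e" using x(2) by (auto simp: mem_boundaries)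
    obtain e' where e': "e' \<in> carrier (Obj V (n + 1))" "e = p (n + 1) e'" using s(4)[OF e(1)] by blast
    have xS: "x \<in> S n" "x \<in> carrier (Obj Z n)" using x(1) sm(2) by (auto simp: mem_cycles)
    let ?u = "v \<oplus>\<^bsub>Obj V n\<^esub> \<ominus>\<^bsub>Obj V n\<^esub> Diff V (n + 1) e'"
    have "p n (Diff V (n + 1) e') = c" "c \<in> carrier (Obj Z n)" using e e' Z(1) by (simp_all add: cp(8))
    then have "p n ?u = x" using V Z(1) vc e' xS x(3) by (simp add: cp(4) cp(7))
    then have "?u \<in> cycles ?V n" using v vc e' V xS by (simp add: mem_cycles P_def)
    moreover have "v = Diff V (n + 1) e' \<oplus>\<^bsub>Obj V n\<^esub> ?u" using V vc e' by simp
    moreover have "Diff V (n + 1) e' \<in> boundaries V n" using e' by (auto simp: mem_boundaries)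
    ultimately show "\<exists>x\<in>cycles ?V n. \<exists>b\<in>boundaries V n. v = b \<oplus>\<^bsub>Obj V n\<^esub> x" by blast
  qed
  from in_cell_qis[OF this small_UNIV small_UNIV] in_V show "in_cell V" by blast
qed

text \<open>The quotient by \<open>bottom_to b N Z\<close> is generated by the class of
  \<open>g\<close>, hence is R/(N : g) in degree \<open>b\<close>. The map onto it is the functional
  of \<open>hom_to_quot\<close> for \<open>d = 1\<close>.\<close>

lemma absorbed_bottom_quot:
  assumes Z: "cpx Z" and N: "sub_mod (Obj Z b) N" "boundaries Z b \<subseteq> N" and g: "g \<in> carrier (Obj Z b)"
    and ex: "\<And>x. x \<in> carrier (Obj Z b) \<Longrightarrow> \<exists>r\<in>carrier R. \<exists>y\<in>N. x = r \<odot>\<^bsub>Obj Z b\<^esub> g \<oplus>\<^bsub>Obj Z b\<^esub> y"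
    and A: "absorbed (bottom_to b N Z)"
    and K: "absorbed (conc_cx b (quot_ring {r \<in> carrier R. r \<odot>\<^bsub>Obj Z b\<^esub> g \<in> N}))"
  shows "absorbed Z"
proof -
  let ?K = "{r \<in> carrier R. r \<odot>\<^bsub>Obj Z b\<^esub> g \<in> N}"
  note M = cpx_module[OF Z, of b]
  have iK: "ideal ?K R" by (rule colon_ideal[OF M N(1) g])
  note sK = sub_mod_ideal[OF iK]
  note Q = quot_mod_simps[OF module_ring_mod sK] and sN = sub_modD[OF N(1)]
  have ex': "\<exists>r\<in>carrier R. \<exists>y\<in>N. \<one> \<odot>\<^bsub>Obj Z b\<^esub> x = r \<odot>\<^bsub>Obj Z b\<^esub> g \<oplus>\<^bsub>Obj Z b\<^esub> y" if "x \<in> carrier (Obj Z b)" for x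
    using ex[OF that] M that by simp
  obtain h where h: "h \<in> mod_hom R (Obj Z b) (quot_ring ?K)"
    and hx: "\<And>x r y. x \<in> carrier (Obj Z b) \<Longrightarrow> r \<in> carrier R \<Longrightarrow> y \<in> N \<Longrightarrow>
      \<one> \<odot>\<^bsub>Obj Z b\<^esub> x = r \<odot>\<^bsub>Obj Z b\<^esub> g \<oplus>\<^bsub>Obj Z b\<^esub> y \<Longrightarrow> h x = ?K +>\<^bsub>ring_mod\<^esub> r"
    using hom_to_quot[OF M N(1) g one_closed iK ex'] by auto
  note h' = mod_homD[OF h]
  have hz: "h x = \<zero>\<^bsub>quot_ring ?K\<^esub> \<longleftrightarrow> x \<in> N" if x: "x \<in> carrier (Obj Z b)" for x
  proof -
    obtain r y where r: "r \<in> carrier R" "y \<in> N" "x = r \<odot>\<^bsub>Obj Z b\<^esub> g \<oplus>\<^bsub>Obj Z b\<^esub> y" using ex[OF x] by blast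
    have "h x = ?K +>\<^bsub>ring_mod\<^esub> r" using hx[OF x r(1,2)] r(3) M x by simp
    then have "h x = \<zero>\<^bsub>quot_ring ?K\<^esub> \<longleftrightarrow> r \<odot>\<^bsub>Obj Z b\<^esub> g \<in> N" using quot_ring_zero_iff[OF iK r(1)] r(1) by simp
    also have "\<dots> \<longleftrightarrow> x \<in> N"
      using sub_mod_add_cancel[OF M N(1) r(2), of "r \<odot>\<^bsub>Obj Z b\<^esub> g"] M r g sN(2)[OF r(2)] by (simp add: md_ac)
    finally show ?thesis .
  qed
  let ?f = "\<lambda>n x. if n = b then h x else \<zero>\<^bsub>quot_ring ?K\<^esub>"
  have D: "cpx (conc_cx b (quot_ring ?K))" using sK by simp
  have bd: "Diff Z (b + 1) y \<in> N" if "y \<in> carrier (Obj Z (b + 1))" for y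
    using N(2) that by (auto simp: mem_boundaries subset_iff)
  have f: "cmap Z (conc_cx b (quot_ring ?K)) ?f"
  proof (rule cmapI[OF Z D])
    fix n x assume x: "x \<in> carrier (Obj Z n)"
    show "?f (n - 1) (Diff Z n x) = Diff (conc_cx b (quot_ring ?K)) n (?f n x)"
      using x hz[of "Diff Z n x"] bd[of x] Z by (cases "n = b + 1") (auto simp: conc_simps)
  qed (use h' sK in \<open>auto simp: conc_simps\<close>)
  have "ses (bottom_to b N Z) Z (conc_cx b (quot_ring ?K)) (\<lambda>n x. x) ?f"
    unfolding ses_def
  proof (intro conjI allI ballI impI f)
    show "cmap (bottom_to b N Z) Z (\<lambda>n x. x)"
      unfolding bottom_to_def by (rule cmap_sub[OF Z subcomplex_bottom[OF Z N]])
    show "\<exists>x\<in>carrier (Obj Z n). y = ?f n x" if y: "y \<in> carrier (Obj (conc_cx b (quot_ring ?K)) n)" for n y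
    proof (cases "n = b")
      case True
      then obtain r where r: "r \<in> carrier R" "y = ?K +>\<^bsub>ring_mod\<^esub> r" using y by (auto simp: conc_simps Q)
      have "h (r \<odot>\<^bsub>Obj Z b\<^esub> g) = y"
        unfolding r(2) using M r(1) g sN(3) by (intro hx[of _ _ "\<zero>\<^bsub>Obj Z b\<^esub>"]) auto
      then show ?thesis using True M r(1) g by (intro bexI[of _ "r \<odot>\<^bsub>Obj Z b\<^esub> g"]) auto
    next
      case False
      then show ?thesis using y md_closed(2)[OF cpx_module[OF Z]] by (auto simp: conc_simps)
    qed
    show "?f n x = \<zero>\<^bsub>Obj (conc_cx b (quot_ring ?K)) n\<^esub>" if "x \<in> carrier (Obj (bottom_to b N Z) n)" for n x
      using that hz[of x] sN(2)[of x] by (auto simp: bottom_to_def conc_simps)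
    show "\<exists>a\<in>carrier (Obj (bottom_to b N Z) n). x = a"
      if "x \<in> carrier (Obj Z n)" "?f n x = \<zero>\<^bsub>Obj (conc_cx b (quot_ring ?K)) n\<^esub>" for n x
      using that hz[of x] by (auto simp: bottom_to_def conc_simps split: if_splits)
  qed (auto simp: bottom_to_def)
  from absorbed_ext[OF this A K] show ?thesis .
qed

end

context noetherian_cellular
begin

lemma absorbed_trivial:
  assumes M: "module R M" and z: "carrier M = {\<zero>\<^bsub>M\<^esub>}" shows "absorbed (conc_cx c M)"
proof (rule absorbed_acyclic)
  show "cpx (conc_cx c M)" using M by simp
  have "{\<zero>\<^bsub>M\<^esub>} \<lesssim> (UNIV :: 'u set)" by (simp add: lepoll_def)
  then show "small (conc_cx c M)" using z by (auto simp: small_cx_def conc_simps)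
  show "acyclic_cx (conc_cx c M)"
    using z by (auto simp: acyclic_cx_def mem_cycles mem_boundaries conc_simps split: if_splits)
qed

text \<open>An ideal maximal among those for which \<open>R/J\<close> is not absorbed is prime.\<close>

lemma absorbed_cyclic:
  assumes Y: "cpx Y" and shY: "\<And>i :: nat. absorbed (shift (int i) Y)"
    and Y0: "carrier (Obj Y (c - 1)) = {\<zero>\<^bsub>Obj Y (c - 1)\<^esub>}"
    and fg: "fg_over (Obj Y c) (boundaries Y c) (carrier (Obj Y c))"
    and S: "{r \<in> carrier R. \<forall>x\<in>carrier (Obj Y c). r \<odot>\<^bsub>Obj Y c\<^esub> x \<in> boundaries Y c} = Idl S" "S \<subseteq> carrier R"
    and J: "ideal J R" "\<forall>s\<in>S. \<exists>e :: nat. s [^] e \<in> J"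
  shows "absorbed (conc_cx c (quot_ring J))"
proof (rule ccontr)
  note sB = sub_mod_boundaries[OF Y, of c]
  define F where "F = {J. ideal J R \<and> (\<forall>s\<in>S. \<exists>e :: nat. s [^] e \<in> J) \<and> \<not> absorbed (conc_cx c (quot_ring J))}"
  assume "\<not> absorbed (conc_cx c (quot_ring J))"
  then have "F \<noteq> {}" using J by (auto simp: F_def)
  \<comment> \<open>In a Noetherian ring the union of a chain of ideals is a member of the chain, so
    Zorn's lemma yields a maximal counterexample.\<close>
  moreover have "\<Union> D \<in> F" if D: "D \<noteq> {}" "subset.chain F D" for D
  proof -
    have "subset.chain {I. ideal I R} D" using D(2) by (auto simp: F_def subset_chain_def)
    then have "\<Union> D \<in> D" using noetherian_ring.ideal_chain_is_trivial[OF noetherian D(1)] by blast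
    then show ?thesis using D(2) by (auto simp: subset_chain_def)
  qed
  ultimately obtain p where p: "p \<in> F" and max: "\<And>I. I \<in> F \<Longrightarrow> p \<subseteq> I \<Longrightarrow> I = p"
    using subset_Zorn_nonempty[of F] by blast
  have ip: "ideal p R" and Sp: "\<And>s. s \<in> S \<Longrightarrow> \<exists>e :: nat. s [^] e \<in> p"
    and np: "\<not> absorbed (conc_cx c (quot_ring p))" using p by (auto simp: F_def)
  interpret p: ideal p R by (rule ip)
  note sp = sub_mod_ideal[OF ip]
  note Q = quot_mod_simps[OF module_ring_mod sp]
  have bigger: "absorbed (conc_cx c (quot_ring I))" if "ideal I R" "p \<subseteq> I" "I \<noteq> p" for I
  proof (rule ccontr)
    assume n: "\<not> absorbed (conc_cx c (quot_ring I))"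
    have "\<forall>s\<in>S. \<exists>e :: nat. s [^] e \<in> I" using Sp that(2) by fast
    then have "I \<in> F" unfolding F_def using that(1) n by simp
    then show False using max[of I] that(2,3) by simp
  qed
  have one: "\<one> \<notin> p"
  proof
    assume "\<one> \<in> p"
    then have "carrier R = p" by (rule p.one_imp_carrier[symmetric])
    moreover have "p +>\<^bsub>ring_mod\<^esub> r = \<zero>\<^bsub>quot_ring p\<^esub>" if "r \<in> p" for r
      using quot_ring_zero_iff[OF ip p.Icarr[OF that]] that by simp
    ultimately have "carrier (quot_ring p) = {\<zero>\<^bsub>quot_ring p\<^esub>}"
      unfolding Q(1) using p.zero_closed by (simp add: image_constant_conv cong: image_cong_simp) auto
    then show False using np absorbed_trivial[OF module_quot[OF module_ring_mod sp]] by blast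
  qed
  have prime: "x \<in> p \<or> y \<in> p" if xy: "x \<in> carrier R" "y \<in> carrier R" "x \<otimes> y \<in> p" for x y
  proof (rule ccontr)
    assume n: "\<not> (x \<in> p \<or> y \<in> p)"
    let ?M = "quot_ring p"
    let ?Z = "conc_cx c ?M"
    have M: "module R ?M" using sp by simp
    let ?c = "\<lambda>r. p +>\<^bsub>ring_mod\<^esub> r"
    have cM: "?c r \<in> carrier ?M" if "r \<in> carrier R" for r using that by (simp add: Q(1))
    have cz: "?c r = \<zero>\<^bsub>?M\<^esub> \<longleftrightarrow> r \<in> p" if "r \<in> carrier R" for r using quot_ring_zero_iff[OF ip that] .
    \<comment> \<open>The submodule of R/p generated by \<open>x\<close> splits R/p into two cyclic
      modules. Their ideals \<open>(?N : 1)\<close> and \<open>(0 : x)\<close> contain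
      \<open>p\<close> properly, the first because of \<open>x\<close>, the second because of
      \<open>y\<close>, so maximality of \<open>p\<close> makes both modules absorbed.\<close>
    let ?N = "(\<lambda>r. ?c (r \<otimes> x)) ` carrier R"
    have N: "sub_mod ?M ?N"
    proof (rule sub_modI)
      show "?N \<subseteq> carrier ?M" using cM xy by auto
      show "\<zero>\<^bsub>?M\<^esub> \<in> ?N" using xy Q(3) by (intro image_eqI[of _ _ \<zero>]) auto
      show "u \<oplus>\<^bsub>?M\<^esub> v \<in> ?N" if uv: "u \<in> ?N" "v \<in> ?N" for u v
      proof -
        obtain r s where r: "r \<in> carrier R" "u = ?c (r \<otimes> x)" and s: "s \<in> carrier R" "v = ?c (s \<otimes> x)" using uv by blast
        have "u \<oplus>\<^bsub>?M\<^esub> v = ?c ((r \<oplus> s) \<otimes> x)" using Q(2)[of "r \<otimes> x" "s \<otimes> x"] r s xy by (simp add: l_distr)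
        then show ?thesis using r s by blast
      qed
      show "a \<odot>\<^bsub>?M\<^esub> u \<in> ?N" if au: "a \<in> carrier R" "u \<in> ?N" for a u
      proof -
        obtain r where r: "r \<in> carrier R" "u = ?c (r \<otimes> x)" using au by blast
        have "a \<odot>\<^bsub>?M\<^esub> u = ?c ((a \<otimes> r) \<otimes> x)" using Q(4)[of a "r \<otimes> x"] r au xy by (simp add: m_assoc)
        then show ?thesis using r au by blast
      qed
    qed
    have b0: "boundaries (conc_cx c L) c = {\<zero>\<^bsub>L\<^esub>}" for L :: "('r, 'r set) module"
      by (auto simp: boundaries_def conc_simps)
    have "absorbed ?Z"
    proof (rule absorbed_bottom_quot[of ?Z c ?N "?c \<one>"])
      show "cpx ?Z" using M by simp
      show "sub_mod (Obj ?Z c) ?N" using N by (simp add: conc_simps)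
      show "boundaries ?Z c \<subseteq> ?N" using b0 sub_modD(3)[OF N] by simp
      show "?c \<one> \<in> carrier (Obj ?Z c)" using cM by (simp add: conc_simps)
      show "\<exists>r\<in>carrier R. \<exists>v\<in>?N. u = r \<odot>\<^bsub>Obj ?Z c\<^esub> ?c \<one> \<oplus>\<^bsub>Obj ?Z c\<^esub> v" if u: "u \<in> carrier (Obj ?Z c)" for u
      proof -
        obtain r where r: "r \<in> carrier R" "u = ?c r" using u by (auto simp: conc_simps Q(1))
        then have "u = r \<odot>\<^bsub>Obj ?Z c\<^esub> ?c \<one> \<oplus>\<^bsub>Obj ?Z c\<^esub> \<zero>\<^bsub>?M\<^esub>"
          using Q(4)[of r \<one>] M cM by (simp add: conc_simps)
        then show ?thesis using r sub_modD(3)[OF N] by blast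
      qed
      have Kid: "ideal {r \<in> carrier R. r \<odot>\<^bsub>?M\<^esub> ?c \<one> \<in> ?N} R" by (rule colon_ideal[OF M N]) (simp add: cM)
      have Kmem: "r \<odot>\<^bsub>?M\<^esub> ?c \<one> = ?c r" if "r \<in> carrier R" for r using Q(4)[of r \<one>] that by simp
      have pK: "p \<subseteq> {r \<in> carrier R. r \<odot>\<^bsub>?M\<^esub> ?c \<one> \<in> ?N}"
      proof
        fix r assume r: "r \<in> p"
        then have "r \<in> carrier R" "?c r = \<zero>\<^bsub>?M\<^esub>" using p.Icarr cz by auto
        then show "r \<in> {r \<in> carrier R. r \<odot>\<^bsub>?M\<^esub> ?c \<one> \<in> ?N}" using Kmem sub_modD(3)[OF N] by simp
      qed
      have "x \<in> {r \<in> carrier R. r \<odot>\<^bsub>?M\<^esub> ?c \<one> \<in> ?N}"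
        using Kmem xy by (auto intro!: image_eqI[of _ _ \<one>])
      then have "absorbed (conc_cx c (quot_ring {r \<in> carrier R. r \<odot>\<^bsub>?M\<^esub> ?c \<one> \<in> ?N}))"
        using n pK by (intro bigger Kid) auto
      then show "absorbed (conc_cx c (quot_ring {r \<in> carrier R. r \<odot>\<^bsub>Obj ?Z c\<^esub> ?c \<one> \<in> ?N}))"
        by (simp add: conc_simps)
      let ?M' = "submod ?M ?N"
      have M': "module R ?M'" using M N by simp
      have eqZ: "bottom_to c ?N ?Z = conc_cx c ?M'"
        by (auto simp: bottom_to_def sub_cx_def conc_cx_def submod_def fun_eq_iff)
      have "absorbed (conc_cx c ?M')"
      proof (rule absorbed_bottom_quot[of _ c "{\<zero>\<^bsub>?M\<^esub>}" "?c x"])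
        show "cpx (conc_cx c ?M')" using M' by simp
        show "sub_mod (Obj (conc_cx c ?M') c) {\<zero>\<^bsub>?M\<^esub>}" using sub_mod_zero[OF M'] by (simp add: conc_simps)
        show "boundaries (conc_cx c ?M') c \<subseteq> {\<zero>\<^bsub>?M\<^esub>}" using b0[of ?M'] by simp
        show "?c x \<in> carrier (Obj (conc_cx c ?M') c)" using xy by (auto simp: conc_simps intro!: image_eqI[of _ _ \<one>])
        show "\<exists>r\<in>carrier R. \<exists>v\<in>{\<zero>\<^bsub>?M\<^esub>}. u = r \<odot>\<^bsub>Obj (conc_cx c ?M') c\<^esub> ?c x \<oplus>\<^bsub>Obj (conc_cx c ?M') c\<^esub> v"
          if u: "u \<in> carrier (Obj (conc_cx c ?M') c)" for u
        proof -
          obtain r where r: "r \<in> carrier R" "u = ?c (r \<otimes> x)" using u by (auto simp: conc_simps)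
          then have "u = r \<odot>\<^bsub>Obj (conc_cx c ?M') c\<^esub> ?c x \<oplus>\<^bsub>Obj (conc_cx c ?M') c\<^esub> \<zero>\<^bsub>?M\<^esub>"
            using Q(4)[of r x] xy M cM by (simp add: conc_simps)
          then show ?thesis using r by blast
        qed
        have "bottom_to c {\<zero>\<^bsub>?M\<^esub>} (conc_cx c ?M') = conc_cx c (submod ?M {\<zero>\<^bsub>?M\<^esub>})"
          by (auto simp: bottom_to_def sub_cx_def conc_cx_def submod_def fun_eq_iff)
        then show "absorbed (bottom_to c {\<zero>\<^bsub>?M\<^esub>} (conc_cx c ?M'))"
          using absorbed_trivial[of "submod ?M {\<zero>\<^bsub>?M\<^esub>}" c] M by simp
        have iK: "ideal {r \<in> carrier R. r \<odot>\<^bsub>?M\<^esub> ?c x \<in> {\<zero>\<^bsub>?M\<^esub>}} R"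
          by (rule colon_ideal[OF M sub_mod_zero[OF M]]) (simp add: cM xy)
        have eq: "r \<odot>\<^bsub>?M\<^esub> ?c x = \<zero>\<^bsub>?M\<^esub> \<longleftrightarrow> r \<otimes> x \<in> p" if "r \<in> carrier R" for r
          using Q(4)[of r x] cz[of "r \<otimes> x"] that xy by simp
        have "p \<subseteq> {r \<in> carrier R. r \<odot>\<^bsub>?M\<^esub> ?c x \<in> {\<zero>\<^bsub>?M\<^esub>}}"
        proof
          fix r assume r: "r \<in> p"
          then have "r \<otimes> x \<in> p" "r \<in> carrier R" using p.I_r_closed xy p.Icarr by auto
          then show "r \<in> {r \<in> carrier R. r \<odot>\<^bsub>?M\<^esub> ?c x \<in> {\<zero>\<^bsub>?M\<^esub>}}" using eq by simp
        qed
        moreover have "y \<in> {r \<in> carrier R. r \<odot>\<^bsub>?M\<^esub> ?c x \<in> {\<zero>\<^bsub>?M\<^esub>}}" using eq xy by (simp add: m_comm)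
        ultimately have "absorbed (conc_cx c (quot_ring {r \<in> carrier R. r \<odot>\<^bsub>?M\<^esub> ?c x \<in> {\<zero>\<^bsub>?M\<^esub>}}))"
          using n by (intro bigger iK) auto
        then show "absorbed (conc_cx c (quot_ring {r \<in> carrier R. r \<odot>\<^bsub>Obj (conc_cx c ?M') c\<^esub> ?c x \<in> {\<zero>\<^bsub>?M\<^esub>}}))"
          by (simp add: conc_simps)
      qed
      then show "absorbed (bottom_to c ?N ?Z)" unfolding eqZ .
    qed
    then show False using np by blast
  qed
  \<comment> \<open>Powers of the elements of \<open>S\<close> lie in the prime \<open>p\<close>.
    Hence \<open>p\<close> contains the annihilator of the lowest homology, the hypothesis of
    \<open>quotient_witness\<close>.\<close>
  have "S \<subseteq> p"
  proof
    fix s assume s: "s \<in> S"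
    then obtain e :: nat where "s [^] e \<in> p" using Sp by blast
    then show "s \<in> p"
    proof (induction e)
      case 0
      then show ?case using one by simp
    next
      case (Suc e)
      then show ?case using prime[of "s [^] e" s] s S(2) by auto
    qed
  qed
  then have ann: "Idl S \<subseteq> p" by (rule genideal_minimal[OF ip])
  have annp: "r \<in> p" if "r \<in> carrier R" "\<forall>x\<in>carrier (Obj Y c). r \<odot>\<^bsub>Obj Y c\<^esub> x \<in> boundaries Y c" for r
    using ann S(1) that by blast
  obtain N z d where w: "sub_mod (Obj Y c) N" "boundaries Y c \<subseteq> N" "z \<in> carrier (Obj Y c)"
    "d \<in> carrier R" "d \<notin> p"
    "\<forall>x\<in>carrier (Obj Y c). \<exists>r\<in>carrier R. \<exists>y\<in>N. d \<odot>\<^bsub>Obj Y c\<^esub> x = r \<odot>\<^bsub>Obj Y c\<^esub> z \<oplus>\<^bsub>Obj Y c\<^esub> y"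
    "\<forall>r\<in>carrier R. r \<odot>\<^bsub>Obj Y c\<^esub> z \<in> N \<longrightarrow> r \<in> p"
    using quotient_witness[OF cpx_module[OF Y] sB fg ip prime one annp] by blast
  obtain b a where res: "resolves b a p" using resolution_exists[OF noetherian ip] by blast
  \<comment> \<open>The ideal \<open>p + dR\<close>, larger than \<open>p\<close> because
    \<open>d\<close> is outside, so that R/K is absorbed by maximality.\<close>
  let ?K = "{k. \<exists>r\<in>carrier R. \<exists>q\<in>p. k = d \<otimes> r \<oplus> q}"
  have Kid: "ideal ?K R"
  proof (rule sub_mod_ideal'[OF sub_modI])
    show "?K \<subseteq> carrier ring_mod" using w(4) p.Icarr by auto
    show "\<zero>\<^bsub>ring_mod\<^esub> \<in> ?K" using w(4) p.zero_closed by (auto intro!: bexI[of _ \<zero>])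
    show "u \<oplus>\<^bsub>ring_mod\<^esub> v \<in> ?K" if uv: "u \<in> ?K" "v \<in> ?K" for u v
    proof -
      obtain r q r' q' where *: "r \<in> carrier R" "q \<in> p" "u = d \<otimes> r \<oplus> q" "r' \<in> carrier R" "q' \<in> p" "v = d \<otimes> r' \<oplus> q'"
        using uv by blast
      then have "u \<oplus> v = d \<otimes> (r \<oplus> r') \<oplus> (q \<oplus> q')" using w(4) p.Icarr by (simp add: r_distr a_ac)
      then show ?thesis using * p.a_closed by auto
    qed
    show "s \<odot>\<^bsub>ring_mod\<^esub> u \<in> ?K" if s: "s \<in> carrier R" and u: "u \<in> ?K" for s u
    proof -
      obtain r q where *: "r \<in> carrier R" "q \<in> p" "u = d \<otimes> r \<oplus> q" using u by blast
      then have "s \<otimes> u = d \<otimes> (s \<otimes> r) \<oplus> s \<otimes> q" using w(4) s p.Icarr by (simp add: r_distr m_lcomm)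
      then show ?thesis using * s p.I_l_closed by auto
    qed
  qed
  have pK: "p \<subseteq> ?K"
  proof
    fix q assume q: "q \<in> p"
    then have "q = d \<otimes> \<zero> \<oplus> q" using w(4) p.Icarr by simp
    then show "q \<in> ?K" using q by blast
  qed
  have "d = d \<otimes> \<one> \<oplus> \<zero>" using w(4) by simp
  then have dK: "d \<in> ?K" using p.zero_closed by blast
  have "absorbed (conc_cx c (quot_ring ?K))" using bigger[OF Kid pK] dK w(5) by blast
  moreover have "r \<in> p" if "r \<in> carrier R" "d \<otimes> r \<in> p" for r using prime[OF w(4) that] w(5) by blast
  ultimately have "absorbed (conc_cx c (quot_ring p))"
    using w by (intro absorbed_cyclic_step[OF res ip _ w(4) Kid pK dK _ _ Y shY Y0 w(1,2,3)]) blast+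
  then show False using np by blast
qed

end

section \<open>Complexes with finite homology\<close>

context cring_complexes
begin

text \<open>One exponent serves for all degrees and all homology classes, so that exponents can be
  added along exact sequences.\<close>

definition pow_kills :: "'r \<Rightarrow> ('r, 'm) cx \<Rightarrow> bool" where
  "pow_kills s Z \<longleftrightarrow> (\<exists>e :: nat. \<forall>i. \<forall>z\<in>cycles Z i. s [^] e \<odot>\<^bsub>Obj Z i\<^esub> z \<in> boundaries Z i)"

text \<open>The homology is confined to the half-open range from \<open>b\<close> to
  \<open>hi\<close>; the length of this range drives the induction in
  \<open>absorbed_fin_cx\<close>.\<close>

definition fin_cx :: "int \<Rightarrow> int \<Rightarrow> 'r set \<Rightarrow> ('r, 'm) cx \<Rightarrow> bool" where
  "fin_cx b hi S Z \<longleftrightarrow> cpx Z \<and> (\<forall>i. fg_over (Obj Z i) (boundaries Z i) (cycles Z i)) \<and>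
    (\<forall>i. i < b \<or> hi \<le> i \<longrightarrow> cycles Z i \<subseteq> boundaries Z i) \<and> (\<forall>s\<in>S. pow_kills s Z)"

lemma fin_cxD:
  assumes "fin_cx b hi S Z"
  shows "cpx Z" "fg_over (Obj Z i) (boundaries Z i) (cycles Z i)"
    "i < b \<Longrightarrow> cycles Z i \<subseteq> boundaries Z i" "hi \<le> i \<Longrightarrow> cycles Z i \<subseteq> boundaries Z i"
    "s \<in> S \<Longrightarrow> pow_kills s Z"
  using assms by (auto simp: fin_cx_def)

lemma fin_cx_mono:
  "fin_cx b hi S Z \<Longrightarrow> b' \<le> b \<Longrightarrow> hi \<le> hi' \<Longrightarrow> fin_cx b' hi' S Z"
  by (auto simp: fin_cx_def)

lemma fg_over_trivial: "W \<subseteq> N \<Longrightarrow> fg_over M N W"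
  unfolding fg_over_def using spn_superset[of N M] by (intro exI[of _ "{}"]) auto

lemma spn_submod:
  assumes W: "sub_mod M W" and A: "A \<subseteq> W" shows "spn (submod M W) A = spn M A"
proof
  note s = sub_modD[OF W]
  show "spn (submod M W) A \<subseteq> spn M A"
    unfolding spn_def
  proof (intro Inter_greatest)
    fix P assume "P \<in> {P. sub_mod M P \<and> A \<subseteq> P}"
    then have P: "sub_mod M P" "A \<subseteq> P" by auto
    have "sub_mod (submod M W) (P \<inter> W)"
      using s sub_modD[OF P(1)] by (intro sub_modI) auto
    then have "\<Inter> {P. sub_mod (submod M W) P \<and> A \<subseteq> P} \<subseteq> P \<inter> W" using A P(2) by (intro Inter_lower) auto
    then show "\<Inter> {P. sub_mod (submod M W) P \<and> A \<subseteq> P} \<subseteq> P" by blast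
  qed
  show "spn M A \<subseteq> spn (submod M W) A"
    unfolding spn_def
  proof (intro Inter_greatest)
    fix P assume "P \<in> {P. sub_mod (submod M W) P \<and> A \<subseteq> P}"
    then have P: "sub_mod (submod M W) P" "A \<subseteq> P" by auto
    have "sub_mod M P"
      using s(1) sub_modD[OF P(1)] by (intro sub_modI) auto
    then show "\<Inter> {P. sub_mod M P \<and> A \<subseteq> P} \<subseteq> P" using P(2) by (intro Inter_lower) auto
  qed
qed

lemma fg_over_submod:
  assumes "sub_mod M W" "N \<subseteq> W" "V \<subseteq> W" shows "fg_over (submod M W) N V \<longleftrightarrow> fg_over M N V"
proof -
  have "spn (submod M W) (A \<union> N) = spn M (A \<union> N)" if "A \<subseteq> V" for A
    using that assms by (intro spn_submod) auto
  then show ?thesis unfolding fg_over_def by (metis (no_types, lifting))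
qed

lemma cycles_shift: "cpx K \<Longrightarrow> cycles (shift 1 K) n = cycles K (n - 1)"
  by (auto simp: cycles_def)

lemma boundaries_shift:
  assumes K: "cpx K" shows "boundaries (shift 1 K) n = boundaries K (n - 1)"
proof
  show "boundaries (shift 1 K) n \<subseteq> boundaries K (n - 1)"
  proof
    fix x assume "x \<in> boundaries (shift 1 K) n"
    then obtain y where "y \<in> carrier (Obj K n)" "x = \<ominus>\<^bsub>Obj K (n - 1)\<^esub> Diff K n y" by (auto simp: mem_boundaries)
    then show "x \<in> boundaries K (n - 1)"
      using K by (auto simp: mem_boundaries intro!: bexI[of _ "\<ominus>\<^bsub>Obj K n\<^esub> y"])
  qed
  show "boundaries K (n - 1) \<subseteq> boundaries (shift 1 K) n"
  proof
    fix x assume "x \<in> boundaries K (n - 1)"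
    then obtain y where "y \<in> carrier (Obj K n)" "x = Diff K n y" by (auto simp: mem_boundaries)
    then show "x \<in> boundaries (shift 1 K) n"
      using K by (auto simp: mem_boundaries intro!: bexI[of _ "\<ominus>\<^bsub>Obj K n\<^esub> y"])
  qed
qed

lemma fin_cx_shift:
  assumes Z: "fin_cx b hi S Z" shows "fin_cx (b + 1) (hi + 1) S (shift 1 Z)"
proof -
  note f = fin_cxD[OF Z] and eq = cycles_shift[OF fin_cxD(1)[OF Z]] boundaries_shift[OF fin_cxD(1)[OF Z]]
  have "pow_kills s (shift 1 Z)" if sS: "s \<in> S" for s
  proof -
    obtain e :: nat where "\<forall>i. \<forall>z\<in>cycles Z i. s [^] e \<odot>\<^bsub>Obj Z i\<^esub> z \<in> boundaries Z i"
      using f(5)[OF sS] by (auto simp: pow_kills_def)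
    then show ?thesis unfolding pow_kills_def eq by (intro exI[of _ e]) auto
  qed
  moreover have "cycles Z (i - 1) \<subseteq> boundaries Z (i - 1)" if "i < b + 1 \<or> hi + 1 \<le> i" for i
    using f(3,4)[of "i - 1"] that by (cases "i < b + 1") simp_all
  ultimately show ?thesis using f(1,2) unfolding fin_cx_def eq by simp
qed

text \<open>Exactness of the homology sequence at its middle term, in terms of
  representatives.\<close>

lemma ses_cycle_lift:
  assumes S: "ses A B D f g" and b: "b \<in> cycles B n" "g n b \<in> boundaries D n"
  obtains a y where "a \<in> cycles A n" "y \<in> boundaries B n" "b = f n a \<oplus>\<^bsub>Obj B n\<^esub> y"
proof -
  note s = sesD[OF S] and cf = cmapD[OF sesD(1)[OF S]] and cg = cmapD[OF sesD(2)[OF S]]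
  obtain z where z: "z \<in> carrier (Obj D (n + 1))" "g n b = Diff D (n + 1) z" using b(2) by (auto simp: mem_boundaries)
  obtain u where u: "u \<in> carrier (Obj B (n + 1))" "z = g (n + 1) u" using s(4)[OF z(1)] by blast
  have bc: "b \<in> carrier (Obj B n)" "Diff B n b = \<zero>\<^bsub>Obj B (n - 1)\<^esub>" using b(1) by (auto simp: mem_cycles)
  have du: "Diff B (n + 1) u \<in> carrier (Obj B n)" using u cg(1) by simp
  have "g n b = g n (Diff B (n + 1) u)" using z u by (simp add: cg(8))
  then obtain a where a: "a \<in> carrier (Obj A n)" "b = Diff B (n + 1) u \<oplus>\<^bsub>Obj B n\<^esub> f n a"
    using ses_diffD[OF S bc(1) du] by blast
  have "f (n - 1) (Diff A n a) = Diff B n (f n a)" using a by (simp add: cf(8))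
  also have "\<dots> = \<zero>\<^bsub>Obj B (n - 1)\<^esub>" using bc a u cg(1) cf(3) du by simp
  finally have "Diff A n a = \<zero>\<^bsub>Obj A (n - 1)\<^esub>" using s(3)[of "Diff A n a" "n - 1"] a cf(1) by simp
  then have "a \<in> cycles A n" using a by (simp add: mem_cycles)
  moreover have "Diff B (n + 1) u \<in> boundaries B n" using u by (auto simp: mem_boundaries)
  moreover have "b = f n a \<oplus>\<^bsub>Obj B n\<^esub> Diff B (n + 1) u" unfolding a(2) using du a cf(3) cg(1) by (simp add: md_ac)
  ultimately show ?thesis by (rule that)
qed

text \<open>The power for \<open>D\<close> moves a class of \<open>B\<close> into the image of the
  homology of \<open>A\<close>, where the power for \<open>A\<close> kills it; the exponents
  add.\<close>

lemma ses_pow_kills: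
  assumes S: "ses A B D f g" and A: "pow_kills s A" and D: "pow_kills s D" and s: "s \<in> carrier R"
  shows "pow_kills s B"
proof -
  note cf = cmapD[OF sesD(1)[OF S]] and cg = cmapD[OF sesD(2)[OF S]]
  note B = cg(1)
  obtain e e' :: nat where e: "\<forall>i. \<forall>z\<in>cycles A i. s [^] e \<odot>\<^bsub>Obj A i\<^esub> z \<in> boundaries A i"
    "\<forall>i. \<forall>z\<in>cycles D i. s [^] e' \<odot>\<^bsub>Obj D i\<^esub> z \<in> boundaries D i" using A D unfolding pow_kills_def by blast
  have "s [^] (e + e') \<odot>\<^bsub>Obj B i\<^esub> z \<in> boundaries B i" if z: "z \<in> cycles B i" for i z
  proof -
    note sc = sub_modD[OF sub_mod_cycles[OF B, of i]] and sb = sub_modD[OF sub_mod_boundaries[OF B, of i]]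
    have zc: "z \<in> carrier (Obj B i)" using z by (simp add: mem_cycles)
    have "g i (s [^] e' \<odot>\<^bsub>Obj B i\<^esub> z) \<in> boundaries D i"
      using e(2) cmap_cycles[OF sesD(2)[OF S] z] zc s by (simp add: cg(5))
    moreover have "s [^] e' \<odot>\<^bsub>Obj B i\<^esub> z \<in> cycles B i" using sc(5) z s by simp
    ultimately obtain a y where a: "a \<in> cycles A i" "y \<in> boundaries B i"
      "s [^] e' \<odot>\<^bsub>Obj B i\<^esub> z = f i a \<oplus>\<^bsub>Obj B i\<^esub> y" using ses_cycle_lift[OF S] by blast
    have ac: "a \<in> carrier (Obj A i)" using a(1) by (simp add: mem_cycles)
    have "s [^] (e + e') = s [^] e \<otimes> s [^] e'" using s by (simp add: nat_pow_mult)
    then have "s [^] (e + e') \<odot>\<^bsub>Obj B i\<^esub> z = s [^] e \<odot>\<^bsub>Obj B i\<^esub> (s [^] e' \<odot>\<^bsub>Obj B i\<^esub> z)"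
      using B s zc by (simp add: md_smult)
    also have "\<dots> = f i (s [^] e \<odot>\<^bsub>Obj A i\<^esub> a) \<oplus>\<^bsub>Obj B i\<^esub> s [^] e \<odot>\<^bsub>Obj B i\<^esub> y"
      unfolding a(3) using B s ac sb(2)[OF a(2)] cf(3)[OF ac] by (simp add: cf(5))
    also have "\<dots> \<in> boundaries B i"
      using e(1) a(1) cmap_boundaries[OF sesD(1)[OF S]] a(2) sb(4,5) s by simp
    finally show ?thesis .
  qed
  then show ?thesis unfolding pow_kills_def by blast
qed

text \<open>The cycles of \<open>D\<close> that come from \<open>B\<close> form a submodule,
  finitely generated as the ring is Noetherian. Lifts of its generators and the images of the
  generators for \<open>A\<close> generate the homology of \<open>B\<close>.\<close>

lemma ses_fg_over:
  assumes noeth: "noetherian_ring R" and S: "ses A B D f g"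
    and A: "fg_over (Obj A n) (boundaries A n) (cycles A n)"
    and D: "fg_over (Obj D n) (boundaries D n) (cycles D n)"
  shows "fg_over (Obj B n) (boundaries B n) (cycles B n)"
proof -
  note cf = cmapD[OF sesD(1)[OF S]] and cg = cmapD[OF sesD(2)[OF S]]
  note cx [simp] = cf(1) cg(1) cg(2)
  note sB = sub_modD[OF sub_mod_boundaries[OF cg(1), of n]] and sD = sub_modD[OF sub_mod_boundaries[OF cg(2), of n]]
    and zB = sub_modD[OF sub_mod_cycles[OF cg(1), of n]] and zD = sub_modD[OF sub_mod_cycles[OF cg(2), of n]]
    and zA = sub_modD[OF sub_mod_cycles[OF cf(1), of n]]
  \<comment> \<open>The boundaries are added so that the image of a submodule can be compared with
    homology classes.\<close>
  define im where "im = (\<lambda>P. {w \<in> carrier (Obj D n). \<exists>x\<in>P. \<exists>c\<in>boundaries D n. w = g n x \<oplus>\<^bsub>Obj D n\<^esub> c})"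
  have sub_im: "sub_mod (Obj D n) (im P)" if P: "sub_mod (Obj B n) P" for P
  proof (rule sub_modI)
    note sP = sub_modD[OF P]
    show "im P \<subseteq> carrier (Obj D n)" by (auto simp: im_def)
    have "\<zero>\<^bsub>Obj D n\<^esub> = g n \<zero>\<^bsub>Obj B n\<^esub> \<oplus>\<^bsub>Obj D n\<^esub> \<zero>\<^bsub>Obj D n\<^esub>" by (simp add: cg(6))
    then show "\<zero>\<^bsub>Obj D n\<^esub> \<in> im P" unfolding im_def using sP(3) sD(3) by auto
    show "u \<oplus>\<^bsub>Obj D n\<^esub> v \<in> im P" if uv: "u \<in> im P" "v \<in> im P" for u v
    proof -
      obtain x c x' c' where *: "x \<in> P" "c \<in> boundaries D n" "u = g n x \<oplus>\<^bsub>Obj D n\<^esub> c"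
        "x' \<in> P" "c' \<in> boundaries D n" "v = g n x' \<oplus>\<^bsub>Obj D n\<^esub> c'" using uv by (auto simp: im_def)
      have c: "x \<in> carrier (Obj B n)" "x' \<in> carrier (Obj B n)" "c \<in> carrier (Obj D n)" "c' \<in> carrier (Obj D n)"
        using sP(2) sD(2) * by auto
      have "u \<oplus>\<^bsub>Obj D n\<^esub> v = g n (x \<oplus>\<^bsub>Obj B n\<^esub> x') \<oplus>\<^bsub>Obj D n\<^esub> (c \<oplus>\<^bsub>Obj D n\<^esub> c')"
        unfolding * using c cg(3) by (simp add: cg(4) md_ac)
      then show ?thesis
        using sP(4)[OF *(1,4)] sD(4)[OF *(2,5)] c cg(3) unfolding im_def
        by (intro CollectI conjI bexI[of _ "x \<oplus>\<^bsub>Obj B n\<^esub> x'"] bexI[of _ "c \<oplus>\<^bsub>Obj D n\<^esub> c'"]) auto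
    qed
    show "r \<odot>\<^bsub>Obj D n\<^esub> u \<in> im P" if r: "r \<in> carrier R" and u: "u \<in> im P" for r u
    proof -
      obtain x c where *: "x \<in> P" "c \<in> boundaries D n" "u = g n x \<oplus>\<^bsub>Obj D n\<^esub> c" using u by (auto simp: im_def)
      have c: "x \<in> carrier (Obj B n)" "c \<in> carrier (Obj D n)" using sP(2) sD(2) * by auto
      have "r \<odot>\<^bsub>Obj D n\<^esub> u = g n (r \<odot>\<^bsub>Obj B n\<^esub> x) \<oplus>\<^bsub>Obj D n\<^esub> r \<odot>\<^bsub>Obj D n\<^esub> c"
        unfolding * using c r cg(3) by (simp add: cg(5))
      then show ?thesis
        using sP(5)[OF r *(1)] sD(5)[OF r *(2)] c r cg(3) unfolding im_def
        by (intro CollectI conjI bexI[of _ "r \<odot>\<^bsub>Obj B n\<^esub> x"] bexI[of _ "r \<odot>\<^bsub>Obj D n\<^esub> c"]) auto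
    qed
  qed
  have bd_im: "boundaries D n \<subseteq> im P" if "sub_mod (Obj B n) P" for P
  proof
    fix c assume c: "c \<in> boundaries D n"
    then have "c = g n \<zero>\<^bsub>Obj B n\<^esub> \<oplus>\<^bsub>Obj D n\<^esub> c" using sD(2) by (simp add: cg(6))
    then show "c \<in> im P" unfolding im_def using sub_modD(3)[OF that] c sD(2) by auto
  qed
  let ?W = "im (cycles B n)"
  have "?W \<subseteq> cycles D n"
  proof
    fix w assume "w \<in> ?W"
    then obtain x c where "x \<in> cycles B n" "c \<in> boundaries D n" "w = g n x \<oplus>\<^bsub>Obj D n\<^esub> c" by (auto simp: im_def)
    then show "w \<in> cycles D n"
      using zD(4)[OF cmap_cycles[OF sesD(2)[OF S]]] boundaries_subset_cycles[OF cg(2)] by blast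
  qed
  then have "fg_over (Obj D n) (boundaries D n) ?W"
    using fg_over_subset[OF noeth cpx_module[OF cg(2)] sub_mod_boundaries[OF cg(2)] D zD(1)
        sub_im[OF sub_mod_cycles[OF cg(1)]] bd_im[OF sub_mod_cycles[OF cg(1)]]] by blast
  then obtain A2 where A2: "finite A2" "A2 \<subseteq> ?W" "?W \<subseteq> spn (Obj D n) (A2 \<union> boundaries D n)"
    unfolding fg_over_def by (elim exE conjE)
  obtain A1 where A1: "finite A1" "A1 \<subseteq> cycles A n" "cycles A n \<subseteq> spn (Obj A n) (A1 \<union> boundaries A n)"
    using A unfolding fg_over_def by (elim exE conjE)
  have "\<forall>w\<in>A2. \<exists>x. x \<in> cycles B n \<and> (\<exists>c\<in>boundaries D n. w = g n x \<oplus>\<^bsub>Obj D n\<^esub> c)"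
    using A2(2) unfolding im_def by blast
  then obtain X where X: "\<forall>w\<in>A2. X w \<in> cycles B n \<and> (\<exists>c\<in>boundaries D n. w = g n (X w) \<oplus>\<^bsub>Obj D n\<^esub> c)"
    by (rule bchoice[THEN exE])
  let ?A = "f n ` A1 \<union> X ` A2"
  have gen: "?A \<subseteq> cycles B n" using A1(2) cmap_cycles[OF sesD(1)[OF S]] X by blast
  define P where "P = spn (Obj B n) (?A \<union> boundaries B n)"
  have P: "sub_mod (Obj B n) P" unfolding P_def using gen zB(1) sB(1) by (intro sub_mod_spn) auto
  note sP = sub_modD[OF P]
  have AP: "?A \<subseteq> P" "boundaries B n \<subseteq> P"
    unfolding P_def using spn_superset[of "?A \<union> boundaries B n" "Obj B n"] by auto
  have "A2 \<subseteq> im P"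
  proof
    fix w assume w: "w \<in> A2"
    then obtain c where "c \<in> boundaries D n" "w = g n (X w) \<oplus>\<^bsub>Obj D n\<^esub> c" using X by blast
    moreover have "X w \<in> P" using AP(1) w by blast
    moreover have "w \<in> carrier (Obj D n)" using A2(2) w by (auto simp: im_def)
    ultimately show "w \<in> im P" unfolding im_def by blast
  qed
  then have WP: "?W \<subseteq> im P" using A2(3) spn_least[OF sub_im[OF P]] bd_im[OF P] by (meson Un_least order_trans)
  have fP: "f n a \<in> P" if a: "a \<in> cycles A n" for a
  proof -
    have "sub_mod (Obj A n) {x \<in> carrier (Obj A n). f n x \<in> P}"
      using sP by (intro sub_modI) (auto simp: cf)
    then have "spn (Obj A n) (A1 \<union> boundaries A n) \<subseteq> {x \<in> carrier (Obj A n). f n x \<in> P}"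
    proof (rule spn_least)
      show "A1 \<union> boundaries A n \<subseteq> {x \<in> carrier (Obj A n). f n x \<in> P}"
        using A1(2) AP cmap_boundaries[OF sesD(1)[OF S]] zA(1) boundaries_subset_cycles[OF cf(1), of n] by blast
    qed
    then show ?thesis using A1(3) a by blast
  qed
  have "cycles B n \<subseteq> P"
  proof
    fix b assume b: "b \<in> cycles B n"
    then have bc: "b \<in> carrier (Obj B n)" using zB(2) by blast
    have "g n b = g n b \<oplus>\<^bsub>Obj D n\<^esub> \<zero>\<^bsub>Obj D n\<^esub>" "g n b \<in> carrier (Obj D n)" using bc cg(3) by simp_all
    then have "g n b \<in> ?W" unfolding im_def using b sD(3) by blast
    then obtain x c where x: "x \<in> P" "c \<in> boundaries D n" "g n b = g n x \<oplus>\<^bsub>Obj D n\<^esub> c"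
      using WP unfolding im_def by blast
    have "P \<subseteq> cycles B n" unfolding P_def
      using gen boundaries_subset_cycles[OF cg(1)] by (intro spn_least[OF sub_mod_cycles[OF cg(1)]]) auto
    then have xz: "x \<in> cycles B n" "x \<in> carrier (Obj B n)" using x(1) zB(2) by auto
    let ?u = "b \<oplus>\<^bsub>Obj B n\<^esub> \<ominus>\<^bsub>Obj B n\<^esub> x"
    have "?u \<in> cycles B n" using zB(4,6) b xz by simp
    moreover have "g n ?u = c" using bc xz sD(2)[OF x(2)] cg(3) x(3) by (simp add: cg(4) cg(7))
    ultimately obtain a y where a: "a \<in> cycles A n" "y \<in> boundaries B n" "?u = f n a \<oplus>\<^bsub>Obj B n\<^esub> y"
      using ses_cycle_lift[OF S, of ?u n] x(2) by metis
    have "?u \<in> P" unfolding a(3) using fP[OF a(1)] a(2) AP(2) sP(4) by blast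
    then have "?u \<oplus>\<^bsub>Obj B n\<^esub> x \<in> P" using sP(4) x(1) by blast
    then show "b \<in> P" using bc xz by simp
  qed
  then show ?thesis
    unfolding fg_over_def P_def using gen A1(1) A2(1) by (intro exI[of _ ?A]) auto
qed

lemma fin_cx_ses:
  assumes noeth: "noetherian_ring R" and S: "ses A B D f g" and A: "fin_cx b hi T A" and D: "fin_cx b hi T D"
    and T: "T \<subseteq> carrier R"
  shows "fin_cx b hi T B"
proof -
  note fA = fin_cxD[OF A] and fD = fin_cxD[OF D] and cB = cmapD(1)[OF sesD(2)[OF S]]
  have "cycles B i \<subseteq> boundaries B i" if i: "cycles A i \<subseteq> boundaries A i" "cycles D i \<subseteq> boundaries D i" for i
  proof
    fix z assume z: "z \<in> cycles B i"
    have "g i z \<in> boundaries D i" using cmap_cycles[OF sesD(2)[OF S] z] i(2) by blast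
    then obtain a y where "a \<in> cycles A i" "y \<in> boundaries B i" "z = f i a \<oplus>\<^bsub>Obj B i\<^esub> y"
      by (rule ses_cycle_lift[OF S z])
    then show "z \<in> boundaries B i"
      using i(1) cmap_boundaries[OF sesD(1)[OF S]] sub_modD(4)[OF sub_mod_boundaries[OF cB]] by blast
  qed
  then show ?thesis
    using fA(3,4) fD(3,4) ses_fg_over[OF noeth S fA(2) fD(2)] ses_pow_kills[OF S fA(5) fD(5)] T cB
    unfolding fin_cx_def by blast
qed

text \<open>Multiplication by \<open>c\<close> is null-homotopic on its own cone: for a cycle
  \<open>(x, y)\<close> the multiple by \<open>c\<close> is the boundary of \<open>(y, 0)\<close>,
  because \<open>d y = - c x\<close>.\<close>

lemma pow_kills_cone:
  assumes K: "cpx K" and c: "c \<in> carrier R"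
  shows "pow_kills c (cone K K (\<lambda>n k. c \<odot>\<^bsub>Obj K n\<^esub> k))"
  unfolding pow_kills_def
proof (intro exI[of _ "1 :: nat"] allI ballI)
  fix n z assume z: "z \<in> cycles (cone K K (\<lambda>n k. c \<odot>\<^bsub>Obj K n\<^esub> k)) n"
  obtain x y where xy: "z = (x, y)" by (cases z)
  have v: "x \<in> carrier (Obj K (n - 1))" "y \<in> carrier (Obj K n)"
    and e: "c \<odot>\<^bsub>Obj K (n - 1)\<^esub> x \<oplus>\<^bsub>Obj K (n - 1)\<^esub> Diff K n y = \<zero>\<^bsub>Obj K (n - 1)\<^esub>"
    using z by (auto simp: mem_cycles cone_eq_twist xy)
  have "Diff K n y = \<ominus>\<^bsub>Obj K (n - 1)\<^esub> (c \<odot>\<^bsub>Obj K (n - 1)\<^esub> x)"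
    using e md_add_eq_zero[of "Obj K (n - 1)" "c \<odot>\<^bsub>Obj K (n - 1)\<^esub> x" "Diff K n y"] v c K by simp
  then show "c [^] (1 :: nat) \<odot>\<^bsub>Obj (cone K K (\<lambda>n k. c \<odot>\<^bsub>Obj K n\<^esub> k)) n\<^esub> z \<in> boundaries (cone K K (\<lambda>n k. c \<odot>\<^bsub>Obj K n\<^esub> k)) n"
    unfolding mem_boundaries
    by (intro bexI[of _ "(y, \<zero>\<^bsub>Obj K (n + 1)\<^esub>)"]) (use v c K in \<open>auto simp: xy cone_eq_twist\<close>)
qed

lemma pow_kills_iso:
  assumes a: "chain_iso R K K' a" and k: "pow_kills s K" and s: "s \<in> carrier R"
  shows "pow_kills s K'"
proof -
  note c = cmapD[OF chain_isoD(1)[OF a]]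
  obtain e :: nat where e: "\<forall>i. \<forall>z\<in>cycles K i. s [^] e \<odot>\<^bsub>Obj K i\<^esub> z \<in> boundaries K i"
    using k unfolding pow_kills_def by blast
  have "s [^] e \<odot>\<^bsub>Obj K' i\<^esub> z \<in> boundaries K' i" if z: "z \<in> cycles K' i" for i z
  proof -
    have zc: "z \<in> carrier (Obj K' i)" using z by (simp add: mem_cycles)
    have "s [^] e \<odot>\<^bsub>Obj K i\<^esub> iso_inv K a i z \<in> boundaries K i"
      using e cmap_cycles[OF chain_isoD(2)[OF a] z] by blast
    from cmap_boundaries[OF chain_isoD(1)[OF a] this] show ?thesis
      using s chain_iso_inv(3,4)[OF a zc] by (simp add: c(5))
  qed
  then show ?thesis unfolding pow_kills_def by blast
qed

lemma fin_cx_insert: "fin_cx b hi S Z \<Longrightarrow> pow_kills c Z \<Longrightarrow> fin_cx b hi (insert c S) Z"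
  by (auto simp: fin_cx_def)

end

text \<open>The cone is an extension of the suspension of \<open>K\<close> by \<open>K\<close>,
  which accounts for the upper bound \<open>hi + 1\<close>; earlier elements keep acting
  nilpotently, and \<open>c\<close> does so by \<open>pow_kills_cone\<close>.\<close>

lemma (in cellular) fin_cx_cone_copy:
  assumes noeth: "noetherian_ring R" and K: "fin_cx b hi T K" and c: "c \<in> carrier R" and T: "T \<subseteq> carrier R"
    and iso: "chain_iso R (cone K K (\<lambda>n k. c \<odot>\<^bsub>Obj K n\<^esub> k)) K' a"
  shows "fin_cx b (hi + 1) (insert c T) K'"
proof -
  note cK = fin_cxD(1)[OF K]
  from ses_iso[OF ses_cone[OF cmap_smult[OF cK c]] chain_iso_id[OF cK] iso chain_iso_id[OF cpx_shift[OF cK]]]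
  have "fin_cx b (hi + 1) T K'"
    by (rule fin_cx_ses[OF noeth _ _ _ T]) (use fin_cx_mono[OF K] fin_cx_mono[OF fin_cx_shift[OF K]] in auto)
  then show ?thesis
    by (rule fin_cx_insert[OF _ pow_kills_iso[OF iso pow_kills_cone[OF cK c] c]])
qed

section \<open>Truncated complexes and their homology\<close>

context cring_complexes
begin

lemma trunc_simps:
  "n > b \<Longrightarrow> Obj (trunc b Z) n = Obj Z n" "Obj (trunc b Z) b = submod (Obj Z b) (cycles Z b)"
  "n < b \<Longrightarrow> carrier (Obj (trunc b Z) n) = {\<zero>\<^bsub>Obj Z n\<^esub>}" "\<zero>\<^bsub>Obj (trunc b Z) n\<^esub> = \<zero>\<^bsub>Obj Z n\<^esub>"
  "Diff (trunc b Z) = Diff Z"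
  by (simp_all add: trunc_def)

lemma trunc_cycles:
  assumes Z: "cpx Z" and n: "b \<le> n"
  shows "cycles (trunc b Z) n = cycles Z n" "boundaries (trunc b Z) n = boundaries Z n"
proof -
  show "cycles (trunc b Z) n = cycles Z n"
    using n by (cases "n = b") (auto simp: cycles_def trunc_simps)
  show "boundaries (trunc b Z) n = boundaries Z n"
    using n by (simp add: boundaries_def trunc_simps)
qed

lemma trunc_cycles_low:
  assumes Z: "cpx Z" and n: "n < b" shows "cycles (trunc b Z) n \<subseteq> boundaries (trunc b Z) n"
proof
  fix x assume "x \<in> cycles (trunc b Z) n"
  then have "x = \<zero>\<^bsub>Obj (trunc b Z) n\<^esub>" using n by (auto simp: mem_cycles trunc_simps)
  then show "x \<in> boundaries (trunc b Z) n"
    using sub_modD(3)[OF sub_mod_boundaries[OF cpx_trunc[OF Z]]] by simp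
qed

text \<open>The common part of \<open>fin_cx_trunc\<close> and \<open>fin_cx_bottom\<close>:
  homology is compared through cycles and boundaries, while the ambient modules may shrink to a
  submodule containing the cycles.\<close>

lemma fin_cx_agree:
  assumes Z: "fin_cx b hi S Z" and S: "S \<subseteq> carrier R" and W: "cpx W"
    and low: "\<And>i. i < m \<Longrightarrow> cycles W i \<subseteq> boundaries W i"
    and cyc: "\<And>i. m \<le> i \<Longrightarrow> cycles W i = cycles Z i"
    and bd: "\<And>i. m \<le> i \<Longrightarrow> boundaries W i = boundaries Z i"
    and Obj: "\<And>i. m \<le> i \<Longrightarrow> \<exists>P. sub_mod (Obj Z i) P \<and> cycles Z i \<subseteq> P \<and> Obj W i = submod (Obj Z i) P"
  shows "fin_cx m hi S W"
proof -
  note f = fin_cxD[OF Z]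
  have "fg_over (Obj W i) (boundaries W i) (cycles W i)" for i
  proof (cases "i < m")
    case False
    then obtain P where P: "sub_mod (Obj Z i) P" "cycles Z i \<subseteq> P" "Obj W i = submod (Obj Z i) P"
      using Obj[of i] by auto
    show ?thesis
      using False f(2) fg_over_submod[OF P(1) _ P(2)] P(2) boundaries_subset_cycles[OF f(1), of i]
      by (simp add: cyc bd P(3))
  qed (simp add: low fg_over_trivial)
  moreover have "cycles W i \<subseteq> boundaries W i" if i: "i < m \<or> hi \<le> i" for i
  proof (cases "i < m")
    case False
    then show ?thesis using f(4)[of i] i by (simp add: cyc bd)
  qed (rule low)
  moreover have "pow_kills s W" if s: "s \<in> S" for s
  proof -
    obtain e :: nat where e: "\<forall>i. \<forall>z\<in>cycles Z i. s [^] e \<odot>\<^bsub>Obj Z i\<^esub> z \<in> boundaries Z i"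
      using f(5)[OF s] unfolding pow_kills_def by blast
    have "s [^] e \<odot>\<^bsub>Obj W i\<^esub> z \<in> boundaries W i" if z: "z \<in> cycles W i" for i z
    proof (cases "i < m")
      case True
      then have "z \<in> boundaries W i" using low z by blast
      then show ?thesis using sub_modD(5)[OF sub_mod_boundaries[OF W]] s S by auto
    next
      case False
      then obtain P where P: "Obj W i = submod (Obj Z i) P" using Obj[of i] by auto
      show ?thesis using e z False by (simp add: cyc bd P)
    qed
    then show ?thesis unfolding pow_kills_def by blast
  qed
  ultimately show ?thesis using W unfolding fin_cx_def by blast
qed

lemma fin_cx_trunc:
  assumes Z: "fin_cx b hi S Z" and S: "S \<subseteq> carrier R" shows "fin_cx m hi S (trunc m Z)"
proof (rule fin_cx_agree[OF Z S])
  note cZ = fin_cxD(1)[OF Z]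
  show "cpx (trunc m Z)" using cZ by simp
  show "\<exists>P. sub_mod (Obj Z i) P \<and> cycles Z i \<subseteq> P \<and> Obj (trunc m Z) i = submod (Obj Z i) P" if "m \<le> i" for i
  proof (cases "i = m")
    case True
    then show ?thesis using sub_mod_cycles[OF cZ] by (intro exI[of _ "cycles Z i"]) (simp add: trunc_simps)
  next
    case False
    then show ?thesis using that sub_modD(1)[OF sub_mod_cycles[OF cZ]] cZ
      by (intro exI[of _ "carrier (Obj Z i)"]) (simp add: trunc_simps)
  qed
qed (use trunc_cycles_low[OF fin_cxD(1)[OF Z]] trunc_cycles[OF fin_cxD(1)[OF Z]] in auto)

text \<open>The kernel of the map from the truncation at \<open>m\<close> to the homology in degree
  \<open>m\<close>, placed in that degree.\<close>

abbreviation bottom_cx :: "int \<Rightarrow> ('r, 'm) cx \<Rightarrow> ('r, 'm) cx" where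
  "bottom_cx m Z \<equiv> bottom_to m (boundaries Z m) (trunc m Z)"

lemma bottom_simps:
  "n > m \<Longrightarrow> Obj (bottom_cx m Z) n = Obj Z n" "carrier (Obj (bottom_cx m Z) m) = boundaries Z m"
  "n < m \<Longrightarrow> carrier (Obj (bottom_cx m Z) n) = {\<zero>\<^bsub>Obj Z n\<^esub>}" "\<zero>\<^bsub>Obj (bottom_cx m Z) n\<^esub> = \<zero>\<^bsub>Obj Z n\<^esub>"
  "Diff (bottom_cx m Z) = Diff Z"
  by (simp_all add: bottom_to_def trunc_simps)

lemma boundaries_sub_trunc:
  assumes Z: "cpx Z"
  shows "sub_mod (Obj (trunc m Z) m) (boundaries Z m)" "boundaries (trunc m Z) m \<subseteq> boundaries Z m"
  using sub_mod_boundaries[OF cpx_trunc[OF Z], of m m] trunc_cycles(2)[OF Z order_refl] by simp_all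

lemma cpx_bottom': "cpx Z \<Longrightarrow> cpx (bottom_cx m Z)"
  by (rule cpx_bottom[OF cpx_trunc boundaries_sub_trunc])

lemma fin_cx_bottom:
  assumes Z: "fin_cx b hi S Z" and S: "S \<subseteq> carrier R" shows "fin_cx (m + 1) hi S (bottom_cx m Z)"
proof (rule fin_cx_agree[OF Z S])
  note cZ = fin_cxD(1)[OF Z]
  show cV: "cpx (bottom_cx m Z)" by (rule cpx_bottom'[OF cZ])
  show "cycles (bottom_cx m Z) i \<subseteq> boundaries (bottom_cx m Z) i" if "i < m + 1" for i
  proof (cases "i = m")
    case True
    have "boundaries (bottom_cx m Z) m = boundaries Z m"
      by (simp add: boundaries_def[of "bottom_cx m Z"] boundaries_def[of Z m, symmetric] bottom_simps)
    moreover have "cycles (bottom_cx m Z) m \<subseteq> carrier (Obj (bottom_cx m Z) m)" unfolding cycles_def by blast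
    ultimately show ?thesis using True bottom_simps(2)[of m Z] by simp
  next
    case False
    show ?thesis
    proof
      fix x assume "x \<in> cycles (bottom_cx m Z) i"
      then have "x = \<zero>\<^bsub>Obj (bottom_cx m Z) i\<^esub>" using that False by (auto simp: mem_cycles bottom_simps)
      then show "x \<in> boundaries (bottom_cx m Z) i" using sub_modD(3)[OF sub_mod_boundaries[OF cV]] by simp
    qed
  qed
  show "\<exists>P. sub_mod (Obj Z i) P \<and> cycles Z i \<subseteq> P \<and> Obj (bottom_cx m Z) i = submod (Obj Z i) P" if "m + 1 \<le> i" for i
    using that sub_modD(1)[OF sub_mod_cycles[OF cZ]] cZ
    by (intro exI[of _ "carrier (Obj Z i)"]) (simp add: bottom_simps)
  show "boundaries (bottom_cx m Z) i = boundaries Z i" if "m + 1 \<le> i" for i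
    using that by (simp add: boundaries_def[of "bottom_cx m Z"] boundaries_def[of Z i] bottom_simps)
qed (simp add: cycles_def bottom_simps)

text \<open>Truncating one degree higher discards the degree where the boundaries were cut out. This
  is an equality, so the induction over degrees can stay with truncations of one complex.\<close>

lemma trunc_bottom: "trunc (m + 1) (bottom_cx m Z) = trunc (m + 1) Z"
proof -
  let ?T = "\<lambda>V i. if i < m + 1 then {\<zero>\<^bsub>Obj V i\<^esub>} else if i = m + 1 then cycles V (m + 1) else carrier (Obj V i)"
  have T: "?T (bottom_cx m Z) = ?T Z"
    by (simp add: fun_eq_iff cycles_def bottom_simps)
  have "trunc (m + 1) (bottom_cx m Z) = sub_cx (bottom_cx m Z) (?T Z)" unfolding T[symmetric] by (rule trunc_def)
  also have "\<dots> = sub_cx Z (?T Z)" unfolding bottom_to_def trunc_def sub_sub_cx ..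
  also have "\<dots> = trunc (m + 1) Z" by (rule trunc_def[symmetric])
  finally show ?thesis .
qed

lemma conc_shift_iso:
  assumes M: "module R M" shows "chain_iso R (shift 1 (conc_cx c M)) (conc_cx (c + 1) M) (\<lambda>n x. x)"
proof -
  have "\<ominus>\<^bsub>Obj (conc_cx c M) m\<^esub> \<zero>\<^bsub>M\<^esub> = \<zero>\<^bsub>M\<^esub>" for m
    using md_simps(8)[OF cpx_module[OF cpx_conc[OF M, of c], of m]] by (simp add: conc_simps)
  then show ?thesis
    using M by (intro chain_isoI cmapI) (auto simp: conc_simps split: if_splits)
qed

lemma shift_Suc_iso:
  assumes X: "cpx X"
  shows "chain_iso R (shift 1 (shift (int k) X)) (shift (int (Suc k)) X) (\<lambda>n x. x)"
proof -
  have eq: "n - 1 - int k = n - (1 + int k)" "n - 2 - int k = n - (2 + int k)" "n - int k - 2 = n - (2 + int k)" for n by simp_all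
  have "\<ominus>\<^bsub>Obj X (n - 2 - int k)\<^esub> Diff (shift (int k) X) (n - 1) x = Diff (shift (int (Suc k)) X) n x"
    if "x \<in> carrier (Obj X (n - 1 - int k))" for n x
    using that X by (auto simp: shift_def eq)
  then show ?thesis using X by (intro chain_isoI cmapI) (auto simp: eq)
qed

end

context cellular
begin

lemma absorbed_shift_nat:
  assumes X: "absorbed X" shows "absorbed (shift (int i) X)"
proof (induction i)
  case 0
  have "shift 0 X = X" by (simp add: shift_def)
  then show ?case using X by simp
next
  case (Suc i)
  then show ?case
    using absorbed_iso[OF shift_Suc_iso[OF absorbed_cpx[OF X]] absorbed_shift'[OF Suc]] by blast
qed

text \<open>Over a list of generators of the lowest homology the bottom module grows from the
  boundaries to the whole; each generator adds a cyclic quotient, handled by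
  \<open>absorbed_bottom_quot\<close>.\<close>

lemma absorbed_peel:
  assumes Z: "cpx Z" and fg: "fg_over (Obj Z b) (boundaries Z b) (carrier (Obj Z b))"
    and A: "absorbed (bottom_to b (boundaries Z b) Z)"
    and K: "\<And>N g. sub_mod (Obj Z b) N \<Longrightarrow> boundaries Z b \<subseteq> N \<Longrightarrow> g \<in> carrier (Obj Z b) \<Longrightarrow>
      absorbed (conc_cx b (quot_ring {r \<in> carrier R. r \<odot>\<^bsub>Obj Z b\<^esub> g \<in> N}))"
  shows "absorbed Z"
proof -
  let ?B = "boundaries Z b" and ?M = "Obj Z b"
  have M: "module R ?M" using Z by simp
  note sB = sub_mod_boundaries[OF Z, of b]
  let ?F = "\<lambda>xs. spn ?M (set xs \<union> ?B)"
  have F: "sub_mod ?M (?F xs)" "?B \<subseteq> ?F xs" if "set xs \<subseteq> carrier ?M" for xs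
    using that sub_modD(1)[OF sB] sub_mod_spn[OF M, of "set xs \<union> ?B"] spn_superset[of "set xs \<union> ?B" ?M] by auto
  have "absorbed (bottom_to b (?F xs) Z)" if "set xs \<subseteq> carrier ?M" for xs
    using that
  proof (induction xs)
    case Nil
    then show ?case using A spn_sub_mod[OF sB] by simp
  next
    case (Cons g xs)
    then have xs: "set xs \<subseteq> carrier ?M" and g: "g \<in> carrier ?M" and IH: "absorbed (bottom_to b (?F xs) Z)" by auto
    let ?Z = "bottom_to b (?F (g # xs)) Z"
    have cZ: "cpx ?Z" using F[OF Cons.prems] Z by (intro cpx_bottom) auto
    have Ob: "Obj ?Z b = submod ?M (?F (g # xs))" by (simp add: bottom_to_def)
    have sub: "?F xs \<subseteq> ?F (g # xs)" by (rule spn_mono) auto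
    have gF: "g \<in> ?F (g # xs)" using spn_superset[of "set (g # xs) \<union> ?B" ?M] by auto
    show ?case
    proof (rule absorbed_bottom_quot[OF cZ])
      show "sub_mod (Obj ?Z b) (?F xs)"
        unfolding Ob using sub sub_modD[OF F(1)[OF xs]] by (intro sub_modI) auto
      have "boundaries ?Z b = ?B" by (simp add: boundaries_def bottom_to_def)
      then show "boundaries ?Z b \<subseteq> ?F xs" using F(2)[OF xs] by simp
      show "g \<in> carrier (Obj ?Z b)" unfolding Ob using gF by simp
      show "\<exists>r\<in>carrier R. \<exists>y\<in>?F xs. x = r \<odot>\<^bsub>Obj ?Z b\<^esub> g \<oplus>\<^bsub>Obj ?Z b\<^esub> y" if x: "x \<in> carrier (Obj ?Z b)" for x
      proof -
        have "x \<in> spn ?M (insert g (set xs \<union> ?B))" using x unfolding Ob by simp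
        moreover have "set xs \<union> ?B \<subseteq> carrier ?M" using xs sub_modD(1)[OF sB] by simp
        ultimately obtain r q where "r \<in> carrier R" "q \<in> ?F xs" "x = r \<odot>\<^bsub>?M\<^esub> g \<oplus>\<^bsub>?M\<^esub> q"
          using spn_insert[OF M g] by metis
        then show ?thesis unfolding Ob by auto
      qed
      have "(\<lambda>i. if i = b then ?F xs else carrier (Obj ?Z i)) = (\<lambda>i. if i = b then ?F xs else carrier (Obj Z i))"
        by (rule HOL.ext) (simp add: bottom_to_def)
      moreover have "sub_cx ?Z T = sub_cx Z T" for T by (simp only: bottom_to_def sub_sub_cx)
      ultimately have "bottom_to b (?F xs) ?Z = bottom_to b (?F xs) Z"
        unfolding bottom_to_def[of b "?F xs"] by simp
      then show "absorbed (bottom_to b (?F xs) ?Z)" using IH by simp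
      show "absorbed (conc_cx b (quot_ring {r \<in> carrier R. r \<odot>\<^bsub>Obj ?Z b\<^esub> g \<in> ?F xs}))"
        unfolding Ob submod_simps(4) by (rule K[OF F[OF xs] g])
    qed
  qed
  moreover obtain A where A: "finite A" "A \<subseteq> carrier ?M" "carrier ?M \<subseteq> spn ?M (A \<union> ?B)"
    using fg by (auto simp: fg_over_def)
  moreover obtain xs where xs: "set xs = A" using finite_list[OF A(1)] by blast
  moreover have "spn ?M (A \<union> ?B) = carrier ?M"
    using A sub_modD(1)[OF F(1)[of xs]] xs by auto
  moreover have "bottom_to b (carrier ?M) Z = Z"
  proof -
    have "(\<lambda>i. if i = b then carrier ?M else carrier (Obj Z i)) = (\<lambda>i. carrier (Obj Z i))" by (rule HOL.ext) simp
    then show ?thesis by (simp add: bottom_to_def sub_cx_def)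
  qed
  ultimately show ?thesis by metis
qed

text \<open>The induction is on the number of degrees that may carry homology. The lowest homology
  is peeled off into cyclic modules R/J, whose ideals contain powers of the elements of
  \<open>S\<close>; with no degree left the complex is acyclic.\<close>

lemma absorbed_fin_cx:
  assumes S: "S \<subseteq> carrier R"
    and base: "\<And>c J. b \<le> c \<Longrightarrow> ideal J R \<Longrightarrow> \<forall>s\<in>S. \<exists>e :: nat. s [^] e \<in> J \<Longrightarrow> absorbed (conc_cx c (quot_ring J))"
  shows "fin_cx b hi S Z \<Longrightarrow> small Z \<Longrightarrow> hi \<le> b + int k \<Longrightarrow> absorbed Z"
  using base
proof (induction k arbitrary: b Z)
  case 0
  have "cycles Z i \<subseteq> boundaries Z i" for i
    using fin_cxD(3,4)[OF 0(1), of i] 0(3) by (cases "i < b") auto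
  then show ?case using fin_cxD(1)[OF 0(1)] 0(2) by (intro absorbed_acyclic) (auto simp: acyclic_cx_def)
next
  case (Suc k)
  note f = fin_cxD[OF Suc.prems(1)] and base = Suc.prems(4)
  let ?Z = "trunc b Z"
  note ft = fin_cx_trunc[OF Suc.prems(1) S, of b]
  note cZ = fin_cxD(1)[OF ft]
  have smT: "small ?Z" and smB: "small (bottom_cx b Z)"
    using sub_modD(2)[OF sub_mod_cycles[OF f(1)]] sub_modD(2)[OF sub_mod_boundaries[OF f(1)]] f(1)
    by (auto intro!: small_subset[OF Suc.prems(2)] simp: bottom_to_def trunc_def split: if_splits)
  have cb: "carrier (Obj ?Z b) = cycles ?Z b" "boundaries ?Z b = boundaries Z b"
    using trunc_cycles[OF f(1), of b b] by (simp_all add: trunc_simps)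
  have "absorbed (bottom_cx b Z)"
  proof (rule Suc.IH[of "b + 1"])
    show "fin_cx (b + 1) hi S (bottom_cx b Z)" by (rule fin_cx_bottom[OF Suc.prems(1) S])
    show "absorbed (conc_cx c (quot_ring J))"
      if "b + 1 \<le> c" "ideal J R" "\<forall>s\<in>S. \<exists>e :: nat. s [^] e \<in> J" for c J
      using base[OF _ that(2,3)] that(1) by simp
  qed (use Suc.prems(3) smB in auto)
  then have A: "absorbed (bottom_to b (boundaries ?Z b) ?Z)" by (simp add: cb(2))
  have fg: "fg_over (Obj ?Z b) (boundaries ?Z b) (carrier (Obj ?Z b))"
    unfolding cb(1) by (rule fin_cxD(2)[OF ft])
  have K: "absorbed (conc_cx b (quot_ring {r \<in> carrier R. r \<odot>\<^bsub>Obj ?Z b\<^esub> g \<in> N}))"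
    if N: "sub_mod (Obj ?Z b) N" "boundaries ?Z b \<subseteq> N" and g: "g \<in> carrier (Obj ?Z b)" for N g
  proof (rule base[OF order_refl colon_ideal[OF cpx_module[OF cZ] N(1) g]], intro ballI)
    fix s assume s: "s \<in> S"
    obtain e :: nat where "\<forall>i. \<forall>z\<in>cycles ?Z i. s [^] e \<odot>\<^bsub>Obj ?Z i\<^esub> z \<in> boundaries ?Z i"
      using fin_cxD(5)[OF ft s] unfolding pow_kills_def by blast
    then have "s [^] e \<odot>\<^bsub>Obj ?Z b\<^esub> g \<in> N" using g N(2) cb(1) by blast
    then show "\<exists>e :: nat. s [^] e \<in> {r \<in> carrier R. r \<odot>\<^bsub>Obj ?Z b\<^esub> g \<in> N}" using s S by blast
  qed
  have "absorbed ?Z" by (rule absorbed_peel[OF cZ fg A K])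
  then show ?case
    using absorbed_sub_qis[OF f(1) Suc.prems(2) subcomplex_trunc[OF f(1), of b]] trunc_qis[OF f(1) f(3)]
    unfolding trunc_def by blast
qed

end

section \<open>Truncations\<close>

context noetherian_cellular
begin

text \<open>The cones of the elements in \<open>cs\<close> are formed one after another, with a zero
  complex as the initial factor \<open>E\<close>. Both \<open>K\<close> and \<open>E\<close> are
  copied into the universe at each stage, which keeps their types fixed in the induction.\<close>

lemma fin_koszul:
  assumes U: "fin_cx b hi {} (U :: ('r, 'u) cx)" and X: "in_cell X" and \<iota>: "cmap U X \<iota>"
    and r: "\<forall>c\<in>set cs. \<exists>r. cmap X U r \<and>
      (\<forall>n. \<forall>u\<in>carrier (Obj U n). r n (\<iota> n u) = c \<odot>\<^bsub>Obj U n\<^esub> u)"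
    and cs: "set cs \<subseteq> carrier R"
  shows "\<exists>(K :: ('r, 'u) cx) \<kappa> \<rho> (E :: ('r, 'u) cx) h e. factored_retraction U K \<kappa> \<rho> E h e \<and> E \<in> C \<and>
    fin_cx b (hi + int (length cs)) (set cs) K"
  using r cs
proof (induction cs)
  case Nil
  have cU: "cpx U" using fin_cxD(1)[OF U] .
  obtain N where N: "N \<in> C" "\<And>n. carrier (Obj N n) = {\<zero>\<^bsub>Obj N n\<^esub>}" using cell_zero by blast
  have cN: "cpx N" using cell_cpx[OF N(1)] .
  have "factored_retraction U U (\<lambda>n x. x) (\<lambda>n x. x) N (\<lambda>n x. \<zero>\<^bsub>Obj N (n - 1)\<^esub>) (\<lambda>n x. \<zero>\<^bsub>Obj U n\<^esub>)"
    unfolding factored_retraction_def using cU cN cmap_zero[OF cN cU] by auto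
  then show ?case using N(1) U by fastforce
next
  case (Cons c cs)
  then have c: "c \<in> carrier R" and cs: "set cs \<subseteq> carrier R" by auto
  have IH: "\<exists>(K :: ('r, 'u) cx) \<kappa> \<rho> (E :: ('r, 'u) cx) h e. factored_retraction U K \<kappa> \<rho> E h e \<and> E \<in> C \<and>
    fin_cx b (hi + int (length cs)) (set cs) K"
    using Cons.prems(1) by (intro Cons.IH cs) auto
  then obtain K :: "('r, 'u) cx" and \<kappa> \<rho> and E :: "('r, 'u) cx" and h e where
    F: "factored_retraction U K \<kappa> \<rho> E h e" and E: "E \<in> C" and K: "fin_cx b (hi + int (length cs)) (set cs) K"
    by (elim exE conjE)
  obtain r where r: "cmap X U r" "\<forall>n. \<forall>u\<in>carrier (Obj U n). r n (\<iota> n u) = c \<odot>\<^bsub>Obj U n\<^esub> u"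
    using Cons.prems(1) by auto
  note cK = fin_cxD(1)[OF K]
  let ?K = "cone K K (\<lambda>n k. c \<odot>\<^bsub>Obj K n\<^esub> k)" and ?E = "koszul_cell E X c (\<lambda>n x. \<iota> n (e n x))"
  have e: "cmap E X (\<lambda>n x. \<iota> n (e n x))" by (rule cmap_comp[OF factored_retractionD(2)[OF F] \<iota>])
  have "\<exists>\<kappa> \<rho> h e. factored_retraction U ?K \<kappa> \<rho> ?E h e"
    by (intro exI, rule koszul_step[OF F c \<iota> r(1)]) (use r(2) in blast)
  then obtain \<kappa>' \<rho>' h' e' where F1: "factored_retraction U ?K \<kappa>' \<rho>' ?E h' e'" by (elim exE)
  have "in_cell ?E" using e c E X by (intro in_cell_koszul_cell) (simp_all add: in_cell_iff)
  then obtain E' :: "('r, 'u) cx" and \<beta> where E': "chain_iso R ?E E' \<beta>" "E' \<in> C" unfolding in_cell_def by blast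
  have "small ?K" by (rule ses_small[OF ses_cone[OF cmap_smult[OF cK c]] small_UNIV small_UNIV])
  then obtain K' :: "('r, 'u) cx" and \<alpha> where K': "chain_iso R ?K K' \<alpha>"
    by (rule small_copy[OF cpx_cone[OF cmap_smult[OF cK c]]])
  have "fin_cx b (hi + int (length cs) + 1) (insert c (set cs)) K'"
    by (rule fin_cx_cone_copy[OF noetherian K c cs K'])
  then have K'f: "fin_cx b (hi + int (length (c # cs))) (set (c # cs)) K'" by (simp add: algebra_simps)
  note F2 = factored_retraction_iso[OF F1 K' E'(1)]
  show ?case by (rule exI conjI F2 E'(2) K'f)+
qed

text \<open>Multiplication on \<open>bottom_cx m X\<close> by an annihilator of the lowest homology of \<open>trunc m X\<close> factors
  through \<open>trunc m X\<close>, as \<open>fin_koszul\<close> requires.\<close>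

lemma in_cell_bottom:
  assumes W: "in_cell (trunc m X)" and X: "fin_cx b hi {} (X :: ('r, 'u) cx)"
  shows "in_cell (bottom_cx m X)"
proof -
  note cX = fin_cxD(1)[OF X]
  let ?X = "trunc m X" and ?U = "bottom_cx m X"
  have WC: "?X \<in> C" using W by (simp add: in_cell_iff)
  have ft: "fin_cx m hi {} ?X" by (rule fin_cx_trunc[OF X]) simp
  note cW = fin_cxD(1)[OF ft]
  note sub = subcomplex_bottom[OF cW boundaries_sub_trunc[OF cX]]
  have fU: "fin_cx (m + 1) hi {} ?U" by (rule fin_cx_bottom[OF X]) simp
  have cyc: "carrier (Obj ?X m) = cycles ?X m" "boundaries ?X m = boundaries X m"
    using trunc_cycles[OF cX, of m m] by (simp_all add: trunc_simps)
  let ?ann = "{c \<in> carrier R. \<forall>x\<in>carrier (Obj ?X m). c \<odot>\<^bsub>Obj ?X m\<^esub> x \<in> boundaries ?X m}"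
  have ann: "ideal ?ann R" by (rule ann_ideal[OF cpx_module[OF cW] sub_mod_boundaries[OF cW]])
  obtain S where S: "S \<subseteq> carrier R" "finite S" "?ann = Idl S"
    using noetherian_ring.finetely_gen[OF noetherian ann] by (elim exE conjE)
  have Sann: "S \<subseteq> ?ann" unfolding S(3) by (rule genideal_self[OF S(1)])
  obtain cs where cs: "set cs = S" using finite_list[OF S(2)] by blast
  have \<iota>: "cmap ?U ?X (\<lambda>n x. x)" unfolding bottom_to_def by (rule cmap_sub[OF cW sub])
  have r: "\<forall>c\<in>set cs. \<exists>r. cmap ?X ?U r \<and> (\<forall>n. \<forall>u\<in>carrier (Obj ?U n). r n u = c \<odot>\<^bsub>Obj ?U n\<^esub> u)"
  proof (intro ballI exI conjI allI)
    fix c assume c: "c \<in> set cs"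
    have cR: "c \<in> carrier R" using c cs S(1) by blast
    have "c \<odot>\<^bsub>Obj ?X n\<^esub> x \<in> (if n = m then boundaries X m else carrier (Obj ?X n))"
      if "x \<in> carrier (Obj ?X n)" for n x
      using that c cs Sann cR cW cyc(2) by auto
    then show "cmap ?X ?U (\<lambda>n x. c \<odot>\<^bsub>Obj ?X n\<^esub> x)"
      unfolding bottom_to_def by (rule cmap_into_sub[OF cmap_smult[OF cW cR] sub])
  qed (simp add: bottom_to_def)
  have csR: "set cs \<subseteq> carrier R" using cs S(1) by simp
  obtain K :: "('r, 'u) cx" and \<kappa> \<rho> and E :: "('r, 'u) cx" and h e where
    F: "factored_retraction ?U K \<kappa> \<rho> E h e" and E: "E \<in> C" and K: "fin_cx (m + 1) (hi + int (length cs)) (set cs) K"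
    using fin_koszul[OF fU W \<iota> r csR] by (elim exE conjE)
  \<comment> \<open>The suspension is absorbed together with all its suspensions. Its bottom degree
    is \<open>m + 1\<close>, exactly where the homology of \<open>?U\<close> may begin.\<close>
  let ?Y = "shift 1 ?X"
  have cY: "cpx ?Y" using cW by simp
  have aY: "absorbed (shift (int i) ?Y)" for i :: nat by (rule absorbed_shift_nat[OF absorbed_shift[OF W]])
  \<comment> \<open>The bottom degree of \<open>?Y\<close> is the case of
    \<open>absorbed_cyclic\<close>; suspending the result gives all higher degrees.\<close>
  have base: "absorbed (conc_cx c (quot_ring J))"
    if c: "m + 1 \<le> c" and J: "ideal J R" "\<forall>s\<in>set cs. \<exists>e :: nat. s [^] e \<in> J" for c J
    using c
  proof (induction c rule: int_ge_induct)
    case base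
    have bY: "boundaries ?Y (m + 1) = boundaries ?X m" using boundaries_shift[OF cW, of "m + 1"] by simp
    show ?case
    proof (rule absorbed_cyclic[OF cY aY])
      show "carrier (Obj ?Y (m + 1 - 1)) = {\<zero>\<^bsub>Obj ?Y (m + 1 - 1)\<^esub>}" by (simp add: trunc_simps)
      show "fg_over (Obj ?Y (m + 1)) (boundaries ?Y (m + 1)) (carrier (Obj ?Y (m + 1)))"
        using fin_cxD(2)[OF ft, of m] unfolding bY by (simp add: cyc(1))
      show "{r \<in> carrier R. \<forall>x\<in>carrier (Obj ?Y (m + 1)). r \<odot>\<^bsub>Obj ?Y (m + 1)\<^esub> x \<in> boundaries ?Y (m + 1)} = Idl (set cs)"
        unfolding bY cs S(3)[symmetric] by simp
    qed (use J csR in auto)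
  next
    case (step c)
    have "module R (quot_ring J)" using sub_mod_ideal[OF J(1)] by simp
    from absorbed_iso[OF conc_shift_iso[OF this] absorbed_shift'[OF step.IH]] show ?case .
  qed
  have "absorbed K"
    \<comment> \<open>The cut-off at zero by \<open>nat\<close> also covers a degree
      \<open>m\<close> beyond the top of the homology, where the Koszul complex is acyclic.\<close>
    by (rule absorbed_fin_cx[OF csR base K small_UNIV, of "nat (hi + int (length cs) - (m + 1))"]) auto
  then show ?thesis by (rule in_cell_factored_retraction[OF F]) (simp add: in_cell_iff E)
qed

text \<open>At \<open>b\<close> the truncation is quasi-isomorphic to \<open>X\<close>. Each further
  degree passes to the kernel \<open>bottom_cx\<close>, which has no homology in its bottom degree
  and so agrees with the next truncation up to quasi-isomorphism.\<close>

lemma in_cell_trunc: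
  assumes X: "in_cell X" "fin_cx b hi {} (X :: ('r, 'u) cx)"
  shows "in_cell (trunc (b + int i) X)"
proof (induction i)
  case 0
  from in_cell_qis[OF trunc_qis[OF fin_cxD(1,3)[OF X(2)], of b] small_UNIV small_UNIV] show ?case using X(1) by simp
next
  case (Suc i)
  let ?m = "b + int i"
  have fU: "fin_cx (?m + 1) hi {} (bottom_cx ?m X)" by (rule fin_cx_bottom[OF X(2)]) simp
  have "in_cell (bottom_cx ?m X)" by (rule in_cell_bottom[OF Suc X(2)])
  then have "in_cell (trunc (?m + 1) (bottom_cx ?m X))"
    using in_cell_qis[OF trunc_qis[OF fin_cxD(1,3)[OF fU], of "?m + 1"] small_UNIV small_UNIV] by simp
  then show ?case unfolding trunc_bottom by (simp add: algebra_simps)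
qed

text \<open>The homology in degree \<open>k\<close> is the quotient of the truncation at
  \<open>k\<close> by \<open>bottom_cx k X\<close>, both of which are in \<open>C\<close> by now;
  closure under cones suffices for this last step.\<close>

lemma in_cell_homology:
  assumes X: "in_cell X" "fin_cx b hi {} (X :: ('r, 'u) cx)"
  shows "in_cell (conc_cx k (homology k X))"
proof -
  note cX = fin_cxD(1)[OF X(2)]
  note sZ = sub_mod_cycles[OF cX, of k]
  have tr: "in_cell (trunc k X)"
  proof (cases "b \<le> k")
    case True
    then show ?thesis using in_cell_trunc[OF X, of "nat (k - b)"] by simp
  next
    \<comment> \<open>For \<open>k\<close> below \<open>b\<close> the lower bound on the homology is
      weakened to \<open>k\<close>, and the truncation at \<open>k\<close> is the initial
      one.\<close>
    case False
    then have "fin_cx k hi {} X" by (intro fin_cx_mono[OF X(2)]) auto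
    from in_cell_trunc[OF X(1) this, of 0] show ?thesis by simp
  qed
  have cT: "cpx (trunc k X)" using cX by simp
  note bt = in_cell_bottom[OF tr X(2)]
  let ?M = "submod (Obj X k) (cycles X k)" and ?B = "boundaries X k" and ?H = "homology k X"
  let ?D = "conc_cx k ?H"
  have M: "module R ?M" using cX sZ by simp
  note sB = sub_mod_boundaries'[OF cX, of k]
  note Q = quot_mod_simps[OF M sB, folded homology_def]
  have H: "module R ?H" using cX by simp
  let ?c = "\<lambda>x. ?B +>\<^bsub>?M\<^esub> x"
  have cz: "?c x = \<zero>\<^bsub>?H\<^esub> \<longleftrightarrow> x \<in> ?B" if "x \<in> cycles X k" for x
    using coset_eq_N[OF M sB, of x] that by (simp add: homology_def quot_mod_def)
  define f where "f = (\<lambda>n x. if n = k then ?c x else \<zero>\<^bsub>?H\<^esub>)"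
  have fc: "cmap (trunc k X) ?D f"
  proof (rule cmapI[OF cT])
    show "cpx ?D" using H by simp
    show "f n x \<in> carrier (Obj ?D n)" if "x \<in> carrier (Obj (trunc k X) n)" for n x
      using that H Q(1) by (auto simp: f_def conc_simps trunc_simps)
    show "f n (x \<oplus>\<^bsub>Obj (trunc k X) n\<^esub> y) = f n x \<oplus>\<^bsub>Obj ?D n\<^esub> f n y"
      if "x \<in> carrier (Obj (trunc k X) n)" "y \<in> carrier (Obj (trunc k X) n)" for n x y
      using that H Q(2)[of x y] by (auto simp: f_def conc_simps trunc_simps)
    show "f n (r \<odot>\<^bsub>Obj (trunc k X) n\<^esub> x) = r \<odot>\<^bsub>Obj ?D n\<^esub> f n x"
      if "r \<in> carrier R" "x \<in> carrier (Obj (trunc k X) n)" for n r x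
      using that H Q(4)[of r x] by (auto simp: f_def conc_simps trunc_simps)
    show "f (n - 1) (Diff (trunc k X) n x) = Diff ?D n (f n x)" if x: "x \<in> carrier (Obj (trunc k X) n)" for n x
    proof (cases "n = k + 1")
      case True
      then have "Diff X n x \<in> ?B" using x by (auto simp: trunc_simps mem_boundaries)
      then show ?thesis
        using True cz boundaries_subset_cycles[OF cX] by (auto simp: f_def conc_simps trunc_simps)
    qed (simp add: f_def conc_simps)
  qed
  have "ses (bottom_cx k X) (trunc k X) ?D (\<lambda>n x. x) f"
    unfolding ses_def
  proof (intro conjI allI ballI impI fc)
    show "cmap (bottom_cx k X) (trunc k X) (\<lambda>n x. x)"
      unfolding bottom_to_def by (rule cmap_sub[OF cT subcomplex_bottom[OF cT boundaries_sub_trunc[OF cX]]])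
    show "\<exists>x\<in>carrier (Obj (trunc k X) n). y = f n x" if y: "y \<in> carrier (Obj ?D n)" for n y
    proof (cases "n = k")
      case True
      then show ?thesis using y by (auto simp: f_def conc_simps Q(1) trunc_simps)
    next
      case False
      then show ?thesis using y md_closed(2)[OF cpx_module[OF cT]] by (auto simp: f_def conc_simps)
    qed
    show "f n x = \<zero>\<^bsub>Obj ?D n\<^esub>" if x: "x \<in> carrier (Obj (bottom_cx k X) n)" for n x
    proof (cases "n = k")
      case True
      then have "x \<in> ?B" using x bottom_simps(2)[of k X] by simp
      then show ?thesis using True cz boundaries_subset_cycles[OF cX] by (auto simp: f_def conc_simps)
    qed (simp add: f_def conc_simps)
    show "\<exists>a\<in>carrier (Obj (bottom_cx k X) n). x = a"
      if x: "x \<in> carrier (Obj (trunc k X) n)" "f n x = \<zero>\<^bsub>Obj ?D n\<^esub>" for n x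
    proof (cases "n = k")
      case True
      then have "x \<in> ?B" using x cz[of x] by (simp add: f_def conc_simps trunc_simps)
      then show ?thesis using True bottom_simps(2)[of k X] by blast
    next
      case False
      then show ?thesis using x by (simp add: bottom_to_def)
    qed
  qed (auto simp: bottom_to_def)
  from in_cell_ses[OF this bt tr] show ?thesis .
qed

end

section \<open>From finite complexes to bounded finitely generated homology\<close>

context cring_complexes
begin

lemma finsum_sub_mod:
  assumes M: "module R M" and N: "sub_mod M N" and A: "finite A" "\<And>a. a \<in> A \<Longrightarrow> f a \<in> N"
  shows "finsum M f A \<in> N"
proof -
  interpret M: module R M by (rule M)
  show ?thesis
    using A
  proof (induction A rule: finite_induct)
    case empty
    then show ?case using sub_modD(3)[OF N] by simp
  next
    case (insert a A)
    then have "f \<in> A \<rightarrow> carrier M" "f a \<in> carrier M" using sub_modD(2)[OF N] by auto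
    then show ?case using insert sub_modD(4)[OF N] by simp
  qed
qed

text \<open>Each finiteness claim is tested by a submodule of the total homology that contains the
  generators and hence everything. The generators have finite support, which bounds the degrees, and
  their components in one degree generate the homology there.\<close>

lemma finite_cx_fin_cx:
  assumes X: "cpx X" and fin: "finite_cx R X"
  obtains b hi where "fin_cx b hi {} X"
proof -
  let ?H = "\<lambda>i. homology i X"
  let ?D = "dsum_mod UNIV ?H"
  have H: "module R (?H i)" for i using X by simp
  have D: "module R ?D" using H by simp
  obtain A where A: "finite A" "A \<subseteq> carrier ?D"
    "\<forall>x\<in>carrier ?D. \<exists>c\<in>A \<rightarrow> carrier R. x = (\<Oplus>\<^bsub>?D\<^esub>a\<in>A. c a \<odot>\<^bsub>?D\<^esub> a)"
    using fin unfolding finite_cx_def fin_gen_mod_def by (elim exE conjE)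
  have gen: "x \<in> Q" if Q: "sub_mod ?D Q" "A \<subseteq> Q" and x: "x \<in> carrier ?D" for Q x
  proof -
    obtain c where c: "c \<in> A \<rightarrow> carrier R" "x = (\<Oplus>\<^bsub>?D\<^esub>a\<in>A. c a \<odot>\<^bsub>?D\<^esub> a)" using A(3) x by blast
    have "c a \<odot>\<^bsub>?D\<^esub> a \<in> Q" if "a \<in> A" for a
      using sub_modD(5)[OF Q(1)] c(1) Q(2) that by blast
    then show ?thesis unfolding c(2) by (rule finsum_sub_mod[OF D Q(1) A(1)])
  qed
  let ?M = "\<lambda>i. submod (Obj X i) (cycles X i)" and ?B = "\<lambda>i. boundaries X i"
  have M: "module R (?M i)" for i using X sub_mod_cycles[OF X] by simp
  note sB = sub_mod_boundaries'[OF X]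
  note Q = quot_mod_simps[OF M sB, folded homology_def]
  \<comment> \<open>The class of the cycle \<open>z\<close> in degree \<open>i\<close>, included in
    the direct sum.\<close>
  define one where "one = (\<lambda>i z j. if j = i then ?B i +>\<^bsub>?M i\<^esub> z else \<zero>\<^bsub>?H j\<^esub>)"
  have one: "one i z \<in> carrier ?D" if z: "z \<in> cycles X i" for i z
  proof -
    have "{j. one i z j \<noteq> \<zero>\<^bsub>?H j\<^esub>} \<subseteq> {i}" by (auto simp: one_def)
    then have "finite {j. one i z j \<noteq> \<zero>\<^bsub>?H j\<^esub>}" by (rule finite_subset) simp
    moreover have "one i z j \<in> carrier (?H j)" for j
      using z md_closed(2)[OF H, of j] Q(1)[of i] by (cases "j = i") (auto simp: one_def)
    ultimately show ?thesis by (simp add: PiE_def Pi_def)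
  qed
  have fg: "fg_over (Obj X i) (boundaries X i) (cycles X i)" for i
  proof -
    have "\<forall>a\<in>A. \<exists>z. z \<in> cycles X i \<and> a i = ?B i +>\<^bsub>?M i\<^esub> z" 
    proof
      fix a assume "a \<in> A"
      then have "a i \<in> carrier (?H i)" using A(2) by (auto simp: PiE_def Pi_def)
      then show "\<exists>z. z \<in> cycles X i \<and> a i = ?B i +>\<^bsub>?M i\<^esub> z" unfolding Q(1) by auto
    qed
    then obtain z where z: "\<forall>a\<in>A. z a \<in> cycles X i \<and> a i = ?B i +>\<^bsub>?M i\<^esub> z a" by (rule bchoice[THEN exE])
    define P where "P = spn (?M i) (z ` A \<union> ?B i)"
    have P: "sub_mod (?M i) P" unfolding P_def
      using z boundaries_subset_cycles[OF X] by (intro sub_mod_spn[OF M]) auto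
    have zP: "z ` A \<subseteq> P" "?B i \<subseteq> P" unfolding P_def using spn_superset[of "z ` A \<union> ?B i" "?M i"] by auto
    note sP = sub_modD[OF P]
    let ?Q = "{x \<in> carrier ?D. \<exists>q\<in>P. x i = ?B i +>\<^bsub>?M i\<^esub> q}"
    have Pc: "q \<in> cycles X i" if "q \<in> P" for q using sP(2)[OF that] by simp
    have "sub_mod ?D ?Q"
    proof (rule sub_modI)
      show "\<zero>\<^bsub>?D\<^esub> \<in> ?Q" using D Q(3)[of i] sP(3) md_closed(2)[OF D] by auto
      show "x \<oplus>\<^bsub>?D\<^esub> y \<in> ?Q" if xy: "x \<in> ?Q" "y \<in> ?Q" for x y
      proof -
        obtain p q where pq: "p \<in> P" "q \<in> P" "x i = ?B i +>\<^bsub>?M i\<^esub> p" "y i = ?B i +>\<^bsub>?M i\<^esub> q" using xy by blast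
        have "(x \<oplus>\<^bsub>?D\<^esub> y) i = ?B i +>\<^bsub>?M i\<^esub> (p \<oplus>\<^bsub>?M i\<^esub> q)" using Q(2)[of p i q] Pc pq by simp
        then show ?thesis using sP(4)[OF pq(1,2)] xy md_closed(1)[OF D] by blast
      qed
      show "r \<odot>\<^bsub>?D\<^esub> x \<in> ?Q" if r: "r \<in> carrier R" and x: "x \<in> ?Q" for r x
      proof -
        obtain p where p: "p \<in> P" "x i = ?B i +>\<^bsub>?M i\<^esub> p" using x by blast
        have "(r \<odot>\<^bsub>?D\<^esub> x) i = ?B i +>\<^bsub>?M i\<^esub> (r \<odot>\<^bsub>?M i\<^esub> p)" using Q(4)[OF r, of p i] Pc p by simp
        then show ?thesis using sP(5)[OF r p(1)] x r md_closed(4)[OF D] by blast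
      qed
    qed blast
    moreover have "A \<subseteq> ?Q" using A(2) z zP(1) by blast
    ultimately have "cycles X i \<subseteq> P"
    proof (intro subsetI)
      fix y assume Q': "sub_mod ?D ?Q" "A \<subseteq> ?Q" and y: "y \<in> cycles X i"
      have "one i y \<in> ?Q" by (rule gen[OF Q' one[OF y]])
      then obtain q where q: "q \<in> P" "?B i +>\<^bsub>?M i\<^esub> y = ?B i +>\<^bsub>?M i\<^esub> q" by (auto simp: one_def)
      then obtain h where "h \<in> ?B i" "y = h \<oplus>\<^bsub>?M i\<^esub> q"
        using coset_eq_iff[OF M sB, of y i q] y Pc by auto
      then show "y \<in> P" using sP(4) zP(2) q(1) by blast
    qed
    moreover have "P = spn (Obj X i) (z ` A \<union> ?B i)"
      unfolding P_def using z boundaries_subset_cycles[OF X] by (intro spn_submod[OF sub_mod_cycles[OF X]]) auto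
    ultimately show ?thesis
      unfolding fg_over_def using A(1) z by (intro exI[of _ "z ` A"]) auto
  qed
  define F where "F = (\<Union>a\<in>A. {i. a i \<noteq> \<zero>\<^bsub>?H i\<^esub>})"
  have "finite F" unfolding F_def using A(1,2) by auto
  have "cycles X i \<subseteq> boundaries X i" if i: "i \<notin> F" for i
  proof
    fix y assume y: "y \<in> cycles X i"
    let ?Q = "{x \<in> carrier ?D. x i = \<zero>\<^bsub>?H i\<^esub>}"
    have "sub_mod ?D ?Q"
    proof (rule sub_modI)
      show "x \<oplus>\<^bsub>?D\<^esub> y \<in> ?Q" if "x \<in> ?Q" "y \<in> ?Q" for x y using that md_closed(1)[OF D, of x y] H by auto
      show "r \<odot>\<^bsub>?D\<^esub> x \<in> ?Q" if "r \<in> carrier R" "x \<in> ?Q" for r x using that md_closed(4)[OF D, of r x] H by auto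
    qed (use md_closed(2)[OF D] in auto)
    moreover have "A \<subseteq> ?Q" using A(2) i by (auto simp: F_def)
    ultimately have "one i y \<in> ?Q" by (rule gen[OF _ _ one[OF y]])
    then have "?B i +>\<^bsub>?M i\<^esub> y = ?B i" by (simp add: one_def homology_def quot_mod_def)
    then show "y \<in> ?B i" using coset_eq_N[OF M sB, of y i] y by simp
  qed
  moreover have "i \<notin> F" if "i < Min (insert 0 F) \<or> Max (insert 0 F) + 1 \<le> i" for i
  proof
    assume "i \<in> F"
    then have "Min (insert 0 F) \<le> i" "i \<le> Max (insert 0 F)" using \<open>finite F\<close> by (auto intro: Min_le Max_ge)
    then show False using that by auto
  qed
  \<comment> \<open>The inserted \<open>0\<close> gives \<open>Min\<close> and \<open>Max\<close> a
    value when there is no homology; the upper bound is exclusive, hence the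
    \<open>+ 1\<close>.\<close>
  ultimately have "fin_cx (Min (insert 0 F)) (Max (insert 0 F) + 1) {} X"
    using X fg unfolding fin_cx_def by blast
  then show ?thesis by (rule that)
qed

lemma shift_stalk_iso:
  assumes M: "module R M" shows "chain_iso R (shift k (stalk M)) (conc_cx k M) (\<lambda>n x. x)"
proof -
  have s: "cpx (stalk M)" using cpx_conc[OF M, of 0] by (simp add: stalk_def conc_cx_def)
  have z: "\<ominus>\<^bsub>Obj (stalk M) m\<^esub> \<zero>\<^bsub>M\<^esub> = \<zero>\<^bsub>M\<^esub>" for m
    using md_simps(8)[OF cpx_module[OF s, of m]] by (simp add: stalk_def split: if_splits)
  have Ob: "Obj (stalk M) (n - k) = Obj (conc_cx k M) n" for n
    by (simp add: stalk_def conc_cx_def)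
  have ds: "Diff (stalk M) n x = \<zero>\<^bsub>M\<^esub>" for n x by (simp add: stalk_def)
  have d: "Diff (shift k (stalk M)) n x = \<zero>\<^bsub>M\<^esub>" for n x
    using z by (simp add: shift_def ds)
  show ?thesis
    using cpx_shift[OF s] M by (intro chain_isoI cmapI) (auto simp: Ob d conc_simps(3,4))
qed

end

theorem theorem7p2:
  fixes R :: "('r, 's) ring_scheme" and X :: "('r, 'u) cx" and k :: int
  assumes "cring R" and "noetherian_ring R"
    and "infinite (UNIV :: 'u set)" and "\<exists>\<iota> :: 'r \<Rightarrow> 'u. inj_on \<iota> (carrier R)"
    and "chain_cx R X" and "finite_cx R X"
  shows "is_cellular R X (shift k (stalk (homology k X)))"
proof -
  interpret cring_complexes R using assms(1) by (simp add: cring_complexes_def)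
  have H: "module R (homology k X)" using assms(5) by simp
  note iso = shift_stalk_iso[OF H, of k]
  obtain b hi where fin: "fin_cx b hi {} X" by (rule finite_cx_fin_cx[OF assms(5,6)])
  have cell: "noetherian_cellular R C" if "cellular_class R C" for C :: "('r, 'u) cx set"
    using that assms(2,3,4) cring_complexes_axioms
    by (auto intro!: noetherian_cellular.intro cellular.intro cellular_axioms.intro noetherian_cellular_axioms.intro
        simp: lepoll_def)
  have "carrier (homology k X) \<lesssim> (UNIV :: 'u set)"
    unfolding carrier_homology[OF assms(5)] by (rule lepoll_trans[OF image_lepoll subset_imp_lepoll]) simp
  moreover have "{\<zero>\<^bsub>homology k X\<^esub>} \<lesssim> (UNIV :: 'u set)" by (simp add: lepoll_def)
  \<comment> \<open>The copy of the homology is chosen before any cellular class is fixed, since a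
    single copy has to lie in the intersection of all of them. The empty set names the
    universe.\<close>
  ultimately have "small_cx ({} :: ('r, 'u) cx set) (conc_cx k (homology k X))"
    by (auto simp: small_cx_def conc_simps)
  then obtain Y :: "('r, 'u) cx" and g where g: "chain_iso R (conc_cx k (homology k X)) Y g"
    by (rule small_copy[OF cpx_conc[OF H]])
  have "Y \<in> C" if C: "cellular_class R C" "X \<in> C" for C
  proof -
    interpret C: noetherian_cellular R C by (rule cell[OF C(1)])
    have "C.in_cell (conc_cx k (homology k X))"
      using C(2) by (intro C.in_cell_homology[OF _ fin]) (simp add: C.in_cell_iff)
    then show ?thesis using C.in_cell_iso[OF g] by (simp add: C.in_cell_iff)
  qed
  then have "Y \<in> generated_class R X" by (simp add: generated_class_def)
  then show ?thesis unfolding is_cellular_def using chain_iso_trans[OF iso g] by blast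
qed

end
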